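(* For every $c>0$ and $\epsilon>0$ and all positive integers $k\le n$, there is a probability distribution over sparse binary matrices $A$ (with $0/1$ entries) together with a deterministic-or-randomized recovery algorithm $\mathscr{A}$ such that the following holds. For any $x\in\mathbb{R}^n$, any noise vector $\nu$ of the appropriate dimension, and any $S\subseteq[n]$ with $|S|=k$, the output $x'=\mathscr{A}(Ax+\nu,S)\in\mathbb{R}^n$ satisfies $\operatorname{supp}(x')\subseteq S$ and \[ \|x'-x_S\|_2\le \epsilon\left(\|x-x_S\|_2+\|\nu\|_2\right) \] with probability at least $1-1/k^{c}$. The matrix $A$ has $O(\frac{c}{\epsilon^2}k)$ rows and $O(c)$ non-zero entries per column, and $\mathscr{A}$ runs in $O(ck)$ time. Moreover, one can instead achieve $\|x'-x_S\|_1\le\epsilon(\|x-x_S\|_1+\|\nu\|_1)$ under the same conditions, with $A$ having only $O(\frac{c}{\epsilon}k)$ rows.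
   Context: $[n]=\{1,\dots,n\}$. For $S\subseteq[n]$ and $x\in\mathbb{R}^n$, $x_S\in\mathbb{R}^n$ denotes the vector equal to $x$ on coordinates in $S$ and $0$ elsewhere; $\operatorname{supp}(x)$ is the set of nonzero coordinates of $x$. The probability is over the random choice of $A$ (and any randomness of the algorithm); $x,\nu,S$ are fixed before $A$ is drawn. The constants hidden in the $O(\cdot)$ notation are absolute.
   Formalization: In the bounds on rows, non-zeros per column and running time, c is read as max(1,c), and 1/ε² (resp. 1/ε) as max(1,1/ε²) (resp. max(1,1/ε)); with absolute constants the literal bounds are false for small c (A would be zero) and for large ε (too few rows). *)

theory Defs
  imports
    "HOL-Probability.Probability"
    "HOL-Library.More_List"
    "Jordan_Normal_Form.Matrix"
begin

hide_const (open) Finite_Cartesian_Product.vec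
no_notation vec_nth (infixl "$" 90)

text \<open>
  Vectors and matrices are those of \<^theory>\<open>Jordan_Normal_Form.Matrix\<close>, since the dimensions are
  quantified inside the statement; the index set [n] is represented by \<^term>\<open>{..<n::nat}\<close>.
\<close>

definition supp_vec :: "real vec \<Rightarrow> nat set" where
  "supp_vec x = {j. j < dim_vec x \<and> x $ j \<noteq> 0}"

definition restrict_vec :: "real vec \<Rightarrow> nat set \<Rightarrow> real vec" where
  "restrict_vec x S = vec (dim_vec x) (\<lambda>j. if j \<in> S then x $ j else 0)"

definition l2_norm :: "real vec \<Rightarrow> real" where
  "l2_norm x = L2_set (\<lambda>j. x $ j) {..<dim_vec x}"

definition l1_norm :: "real vec \<Rightarrow> real" where
  "l1_norm x = (\<Sum>j<dim_vec x. \<bar>x $ j\<bar>)"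

definition sparse_binary :: "real \<Rightarrow> real mat \<Rightarrow> bool" where
  "sparse_binary s A \<longleftrightarrow>
     elements_mat A \<subseteq> {0, 1} \<and> (\<forall>j<dim_col A. real (card (supp_vec (col A j))) \<le> s)"


section \<open>Model of computation\<close>

text \<open>
  Running time is measured on a real RAM, presented as a while language. The memory consists of
  arrays of natural numbers and arrays of reals; the array named in an access is fixed by the
  program text, the index is computed. All operations, including one array access, cost one step.
  Natural-number arithmetic is limited to addition, truncated subtraction and halving, so that unit
  cost is not abused through rapidly growing integers. On reals the operations are the field
  operations and comparison; there is no rounding of reals to integers.
\<close>

datatype nexp = NConst nat | NGet nat nexp | NAdd nexp nexp | NSub nexp nexp | NHalf nexp

datatype rexp = RNat nexp | RGet nat nexp | RAdd rexp rexp | RSub rexp rexp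
  | RMul rexp rexp | RDiv rexp rexp

datatype bexp = NLess nexp nexp | RLess rexp rexp | BNot bexp | BAnd bexp bexp

datatype com =
    Skip
  | NSet nat nexp nexp  \<comment> \<open>\<open>NSet a i e\<close> stores \<open>e\<close> in cell \<open>i\<close> of array \<open>a\<close>\<close>
  | RSet nat nexp rexp
  | Seq com com
  | If bexp com com
  | While bexp com

type_synonym memory = "(nat \<Rightarrow> nat \<Rightarrow> nat) \<times> (nat \<Rightarrow> nat \<Rightarrow> real)"

primrec nval :: "nexp \<Rightarrow> memory \<Rightarrow> nat" where
  "nval (NConst v) s = v"
| "nval (NGet a e) s = fst s a (nval e s)"
| "nval (NAdd e f) s = nval e s + nval f s"
| "nval (NSub e f) s = nval e s - nval f s"
| "nval (NHalf e) s = nval e s div 2"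

primrec rval :: "rexp \<Rightarrow> memory \<Rightarrow> real" where
  "rval (RNat e) s = real (nval e s)"
| "rval (RGet a e) s = snd s a (nval e s)"
| "rval (RAdd e f) s = rval e s + rval f s"
| "rval (RSub e f) s = rval e s - rval f s"
| "rval (RMul e f) s = rval e s * rval f s"
| "rval (RDiv e f) s = rval e s / rval f s"

primrec bval :: "bexp \<Rightarrow> memory \<Rightarrow> bool" where
  "bval (NLess e f) s = (nval e s < nval f s)"
| "bval (RLess e f) s = (rval e s < rval f s)"
| "bval (BNot b) s = (\<not> bval b s)"
| "bval (BAnd b c) s = (bval b s \<and> bval c s)"

primrec ncost :: "nexp \<Rightarrow> nat" where
  "ncost (NConst v) = 1"
| "ncost (NGet a e) = ncost e + 1"
| "ncost (NAdd e f) = ncost e + ncost f + 1"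
| "ncost (NSub e f) = ncost e + ncost f + 1"
| "ncost (NHalf e) = ncost e + 1"

primrec rcost :: "rexp \<Rightarrow> nat" where
  "rcost (RNat e) = ncost e + 1"
| "rcost (RGet a e) = ncost e + 1"
| "rcost (RAdd e f) = rcost e + rcost f + 1"
| "rcost (RSub e f) = rcost e + rcost f + 1"
| "rcost (RMul e f) = rcost e + rcost f + 1"
| "rcost (RDiv e f) = rcost e + rcost f + 1"

primrec bcost :: "bexp \<Rightarrow> nat" where
  "bcost (NLess e f) = ncost e + ncost f + 1"
| "bcost (RLess e f) = rcost e + rcost f + 1"
| "bcost (BNot b) = bcost b + 1"
| "bcost (BAnd b c) = bcost b + bcost c + 1"

definition upd :: "(nat \<Rightarrow> nat \<Rightarrow> 'a) \<Rightarrow> nat \<Rightarrow> nat \<Rightarrow> 'a \<Rightarrow> nat \<Rightarrow> nat \<Rightarrow> 'a" where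
  "upd M a i v = M(a := (M a)(i := v))"

text \<open>\<open>exec P s t s'\<close>: started in memory \<open>s\<close>, the program \<open>P\<close> halts in memory \<open>s'\<close> after \<open>t\<close> steps.\<close>

inductive exec :: "com \<Rightarrow> memory \<Rightarrow> nat \<Rightarrow> memory \<Rightarrow> bool" where
  Skip: "exec Skip s 1 s"
| NSet: "exec (NSet a i e) s (ncost i + ncost e + 1) (upd (fst s) a (nval i s) (nval e s), snd s)"
| RSet: "exec (RSet a i e) s (ncost i + rcost e + 1) (fst s, upd (snd s) a (nval i s) (rval e s))"
| Seq: "exec P s t s' \<Longrightarrow> exec Q s' u s'' \<Longrightarrow> exec (Seq P Q) s (t + u) s''"
| IfTrue: "bval b s \<Longrightarrow> exec P s t s' \<Longrightarrow> exec (If b P Q) s (bcost b + t) s'"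
| IfFalse: "\<not> bval b s \<Longrightarrow> exec Q s t s' \<Longrightarrow> exec (If b P Q) s (bcost b + t) s'"
| WhileFalse: "\<not> bval b s \<Longrightarrow> exec (While b P) s (bcost b) s"
| WhileTrue: "bval b s \<Longrightarrow> exec P s t s' \<Longrightarrow> exec (While b P) s' u s'' \<Longrightarrow>
    exec (While b P) s (bcost b + t + u) s''"

inductive_cases exec_SkipE: "exec Skip s t s'"
inductive_cases exec_NSetE: "exec (NSet a i e) s t s'"
inductive_cases exec_RSetE: "exec (RSet a i e) s t s'"
inductive_cases exec_SeqE: "exec (Seq P Q) s t s'"
inductive_cases exec_IfE: "exec (If b P Q) s t s'"
inductive_cases exec_WhileE: "exec (While b P) s t s'"

lemma exec_deterministic:
  "exec P s t s' \<Longrightarrow> exec P s u s'' \<Longrightarrow> u = t \<and> s'' = s'"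
proof (induction arbitrary: u s'' rule: exec.induct)
  case (Skip s)
  then show ?case by (rule exec_SkipE) simp
next
  case (NSet a i e s)
  then show ?case by (rule exec_NSetE) simp
next
  case (RSet a i e s)
  then show ?case by (rule exec_RSetE) simp
next
  case (Seq P s t s' Q v s2)
  show ?case
    by (rule exec_SeqE[OF Seq.prems]) (metis Seq.IH)
next
  case (IfTrue b s P t s' Q)
  show ?case
    by (rule exec_IfE[OF IfTrue.prems]) (use IfTrue.hyps in simp_all, metis IfTrue.IH)
next
  case (IfFalse b s Q t s' P)
  show ?case
    by (rule exec_IfE[OF IfFalse.prems]) (use IfFalse.hyps in simp_all, metis IfFalse.IH)
next
  case (WhileFalse b s P)
  show ?case
    by (rule exec_WhileE[OF WhileFalse.prems]) (use WhileFalse.hyps in simp_all)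
next
  case (WhileTrue b s P t s' v s2)
  show ?case
    by (rule exec_WhileE[OF WhileTrue.prems]) (use WhileTrue.hyps in simp_all, metis WhileTrue.IH)
qed

text \<open>
  The matrix is handed to the program in compressed sparse column format: the row indices of the
  nonzero entries of column \<open>j\<close>, in increasing order, are stored in the cells
  \<open>col_ptrs A ! j, \<dots>, col_ptrs A ! (j + 1) - 1\<close> of a single array. For a binary matrix this
  determines the matrix.
\<close>

definition col_rows :: "real mat \<Rightarrow> nat \<Rightarrow> nat list" where
  "col_rows A j = sorted_list_of_set (supp_vec (col A j))"

definition row_inds :: "real mat \<Rightarrow> nat list" where
  "row_inds A = concat (map (col_rows A) [0..<dim_col A])"

definition col_ptrs :: "real mat \<Rightarrow> nat list" where
  "col_ptrs A = map (\<lambda>j. \<Sum>i<j. length (col_rows A i)) [0..<Suc (dim_col A)]"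

text \<open>
  Input of the recovery program: the parameters, the list \<open>ss\<close> of the elements of \<open>S\<close>, the matrix,
  the measurement vector \<open>y\<close> and a tape \<open>\<omega>\<close> of coin flips. All remaining memory is zero.
\<close>

definition input :: "real \<Rightarrow> real \<Rightarrow> real mat \<Rightarrow> real vec \<Rightarrow> nat list \<Rightarrow> nat list \<Rightarrow> memory" where
  "input c \<epsilon> A y ss \<omega> =
     ((\<lambda>_ _. 0)
        (0 := nth_default 0 [dim_col A, length ss, dim_row A],
         1 := nth_default 0 ss,
         2 := nth_default 0 (col_ptrs A),
         3 := nth_default 0 (row_inds A),
         4 := nth_default 0 \<omega>),
      (\<lambda>_ _. 0)
        (0 := nth_default 0 [c, \<epsilon>],
         1 := nth_default 0 (list_of_vec y)))"

text \<open>
  The recovered vector is the content of real array 2 on halting. As the array is initially zero,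
  the program only has to write the coordinates it wants to be nonzero.
\<close>

definition recovered :: "com \<Rightarrow> real \<Rightarrow> real \<Rightarrow> real mat \<Rightarrow> real vec \<Rightarrow> nat list \<Rightarrow> nat list \<Rightarrow> real vec"
  where
  "recovered P c \<epsilon> A y ss \<omega> =
     vec (dim_col A) (snd (THE s. \<exists>t. exec P (input c \<epsilon> A y ss \<omega>) t s) 2)"

definition halts_within ::
    "real \<Rightarrow> com \<Rightarrow> real \<Rightarrow> real \<Rightarrow> real mat \<Rightarrow> real vec \<Rightarrow> nat list \<Rightarrow> nat list \<Rightarrow> bool" where
  "halts_within T P c \<epsilon> A y ss \<omega> \<longleftrightarrow>
     (\<exists>t s. exec P (input c \<epsilon> A y ss \<omega>) t s \<and> real t \<le> T)"

text \<open>The tape holds \<open>R\<close> independent fair bits; a deterministic algorithm is the case \<open>R = 0\<close>.\<close>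

definition coins :: "nat \<Rightarrow> nat list pmf" where
  "coins R = replicate_pmf R (pmf_of_set {0, 1})"


section \<open>Set query schemes\<close>

text \<open>
  Enumerations \<open>ss\<close> of \<open>S\<close> in every order are admitted, so nothing is gained from the way in which
  \<open>S\<close> is presented. The set \<open>S\<close>, its enumeration, \<open>x\<close> and \<open>\<nu>\<close> are fixed before the matrix and the
  coins are drawn.
\<close>

definition solves_set_query ::
    "(real vec \<Rightarrow> real) \<Rightarrow> com \<Rightarrow> real \<Rightarrow> real \<Rightarrow> nat \<Rightarrow> nat \<Rightarrow> nat \<Rightarrow> real mat pmf \<Rightarrow> nat \<Rightarrow> bool" where
  "solves_set_query nrm P c \<epsilon> k n m D R \<longleftrightarrow>
     (\<forall>x\<in>carrier_vec n. \<forall>\<nu>\<in>carrier_vec m. \<forall>S ss.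
        S \<subseteq> {..<n} \<and> card S = k \<and> distinct ss \<and> set ss = S \<longrightarrow>
        measure_pmf.prob (pair_pmf D (coins R))
          {(A, \<omega>). let x' = recovered P c \<epsilon> A (A *\<^sub>v x + \<nu>) ss \<omega> in
             supp_vec x' \<subseteq> S \<and>
             nrm (x' - restrict_vec x S) \<le> \<epsilon> * (nrm (x - restrict_vec x S) + nrm \<nu>)}
        \<ge> 1 - 1 / real k powr c)"

text \<open>Worst case over all inputs, all matrices that can be drawn and all coin flips.\<close>

definition runs_in_time ::
    "real \<Rightarrow> com \<Rightarrow> real \<Rightarrow> real \<Rightarrow> nat \<Rightarrow> nat \<Rightarrow> nat \<Rightarrow> real mat pmf \<Rightarrow> nat \<Rightarrow> bool" where
  "runs_in_time T P c \<epsilon> k n m D R \<longleftrightarrow>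
     (\<forall>A\<in>set_pmf D. \<forall>\<omega>\<in>set_pmf (coins R). \<forall>y\<in>carrier_vec m. \<forall>ss.
        distinct ss \<and> set ss \<subseteq> {..<n} \<and> length ss = k \<longrightarrow> halts_within T P c \<epsilon> A y ss \<omega>)"

text \<open>
  In the asymptotic bounds a factor \<open>c\<close> or \<open>1 / \<epsilon>\<close> below 1 is to be read as 1, as
  \<^term>\<open>max 1 c\<close> and \<^term>\<open>max 1 (1 / \<epsilon>)\<close>. With an absolute constant \<open>C\<close>, the bounds \<open>C * c\<close> on
  the column weight and \<open>C * c * k / \<epsilon>\<^sup>2\<close> on the number of rows fall below 1 for small \<open>c\<close> or large
  \<open>\<epsilon>\<close>, so that only the zero matrix would be left. For \<open>c \<ge> 1\<close> and \<open>\<epsilon> \<le> 1\<close> nothing changes.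
\<close>

end

theory Submission
  imports Defs
begin

text \<open>
  The matrix consists of \<open>r = 64 * 8^L \<ge> 8c\<close> independent copies. A copy hashes every column into 256
  tables of \<open>2w\<close> rows, where \<open>w\<close> is of order \<open>k / \<epsilon>^p\<close>, and rows \<open>2b\<close> and \<open>2b + 1\<close> form a bucket.
  The difference of the two measurements of a bucket is a signed sum over the columns hashed to it,
  the sign being the last bit of the hash value, so a 0/1 matrix provides random signs. By a moment
  bound the noise \<open>N\<close>, which is the \<open>p\<close>-th power of the norms of \<open>\<nu>\<close> and of \<open>x\<close> outside \<open>S\<close>,
  contributes only \<open>N / w\<close> to a typical bucket.

  A copy is decoded by peeling: a column that is alone in at least 224 of its buckets is estimated by
  the median over its tables and subtracted. With high probability every subset of \<open>S\<close> has few
  collisions, hence at least half of the remaining columns can be peeled in every pass, which makes the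
  running time linear. The error of an estimate spreads only inside its component of the collision
  graph. The fourth moment of the component sizes is bounded, so the total error of a copy is
  \<open>O(k N / w)\<close>, except with probability at most \<open>1 / (1024 k)\<close>.

  The output is an approximate coordinatewise median of the copies. It is bad only if an eighth of
  the copies fail, which has probability at most \<open>k powr -c\<close>. This median has to be found in time
  linear in \<open>r\<close>: groups of \<open>G\<close> values are thinned by the factor 4, keeping every fourth rank, and then
  \<open>G\<close> is doubled, until one group is left. Computing ranks costs \<open>O(G)\<close> per value, which is made up for
  by the faster decrease of the number of values.
\<close>

section \<open>Program logic\<close>

text \<open>All probability bounds are union bounds over sets F of u columns of S, and these fix the
  constants. Choosing F costs about (3k/u)^u, and a failure probability of order 1/k needs another
  factor (u/k)^u, so a bad F should have probability about (a (u/k)^2)^u with a tiny. Two collisions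
  per column achieve this; one would not. For the noise, 14 bad tables per column leave 12 in
  distinct buckets once fewer than 2 collisions per column are granted, and a threshold of order
  (k/u)^(1/4) yields (u/k)^3 per column. That fourth root is what a weak-type inequality converts
  into a bound on a sum of squares. Large components force barely one collision per column; there
  the factor 1/k comes from k \<le> u^9, since smaller sets cannot violate the moment bound. The
  second obstacle is peeling itself: an estimate inherits the errors of the columns subtracted
  before it. Charging every error to few tables makes this a contraction with factor 1/2. The number
  of copies is a power of 8 because a thinning round divides the number of groups by exactly
  8.\<close>

definition run :: "com \<Rightarrow> memory \<Rightarrow> (nat \<Rightarrow> memory \<Rightarrow> bool) \<Rightarrow> bool" where
  "run P s Q \<longleftrightarrow> (\<exists>t s'. exec P s t s' \<and> Q t s')"

text \<open>\<open>run\<close> is a weakest precondition whose postcondition also sees the step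
  count. With these equations as simp rules the simplifier executes loop-free code symbolically, and
  only loops need an invariant.\<close>

lemma run_Skip [simp]: "run Skip s Q \<longleftrightarrow> Q 1 s"
  unfolding run_def by (metis exec.Skip exec_SkipE)

lemma run_NSet [simp]:
  "run (NSet a i e) s Q \<longleftrightarrow> Q (ncost i + ncost e + 1) (upd (fst s) a (nval i s) (nval e s), snd s)"
  unfolding run_def by (metis exec.NSet exec_NSetE)

lemma run_RSet [simp]:
  "run (RSet a i e) s Q \<longleftrightarrow> Q (ncost i + rcost e + 1) (fst s, upd (snd s) a (nval i s) (rval e s))"
  unfolding run_def by (metis exec.RSet exec_RSetE)

lemma run_Seq [simp]:
  "run (Seq P1 P2) s Q \<longleftrightarrow> run P1 s (\<lambda>t s'. run P2 s' (\<lambda>u. Q (t + u)))"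
  unfolding run_def by (blast intro: exec.intros elim: exec_SeqE)

lemma run_If [simp]:
  "run (If b P1 P2) s Q \<longleftrightarrow>
     (if bval b s then run P1 s (\<lambda>t. Q (bcost b + t)) else run P2 s (\<lambda>t. Q (bcost b + t)))"
proof (cases "bval b s")
  case True
  then show ?thesis unfolding run_def by (auto elim!: exec_IfE intro: exec.IfTrue)
next
  case False
  then show ?thesis unfolding run_def by (auto elim!: exec_IfE intro: exec.IfFalse)
qed

lemma run_mono: "run P s Q \<Longrightarrow> (\<And>t s'. Q t s' \<Longrightarrow> Q' t s') \<Longrightarrow> run P s Q'"
  unfolding run_def by blast

text \<open>The amortised total-correctness rule: the potential \<open>\<Phi>\<close> pays for all iterations.\<close>

lemma run_While:
  fixes \<Phi> :: "memory \<Rightarrow> nat"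
  assumes "I s"
    and step: "\<And>s. I s \<Longrightarrow> bval b s \<Longrightarrow> run P s (\<lambda>t s'. I s' \<and> t + bcost b + \<Phi> s' \<le> \<Phi> s)"
    and fin: "\<And>t s'. I s' \<Longrightarrow> \<not> bval b s' \<Longrightarrow> t + \<Phi> s' \<le> \<Phi> s + bcost b \<Longrightarrow> Q t s'"
  shows "run (While b P) s Q"
proof -
  \<comment> \<open>Evaluating the guard costs at least one step, so the potential strictly
    decreases and doubles as the termination measure.\<close>
  have pos: "bcost b > 0" by (cases b) auto
  have "\<exists>t s'. exec (While b P) s t s' \<and> I s' \<and> \<not> bval b s' \<and> t + \<Phi> s' \<le> \<Phi> s + bcost b"
    using \<open>I s\<close>
  proof (induction "\<Phi> s" arbitrary: s rule: less_induct)
    case less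
    show ?case
    proof (cases "bval b s")
      case False
        show ?thesis
        by (rule exI[of _ "bcost b"], rule exI[of _ s], intro conjI exec.WhileFalse)
          (rule False less.prems le_refl | simp add: add.commute)+
    next
      case True
      from step[OF less.prems True] obtain t s' where
        e: "exec P s t s'" "I s'" "t + bcost b + \<Phi> s' \<le> \<Phi> s" unfolding run_def by (elim exE conjE) (rule that)
      then have "\<Phi> s' < \<Phi> s" using pos by linarith
      from less.hyps[OF this e(2)] obtain u s'' where
        f: "exec (While b P) s' u s''" "I s''" "\<not> bval b s''" "u + \<Phi> s'' \<le> \<Phi> s' + bcost b" by (elim exE conjE) (rule that)
      have "exec (While b P) s (bcost b + t + u) s''"
        using exec.WhileTrue[OF True e(1) f(1)] .
      moreover have "bcost b + t + u + \<Phi> s'' \<le> \<Phi> s + bcost b" using e(3) f(4) by linarith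
      ultimately show ?thesis using f(2,3) by (intro exI conjI)
    qed
  qed
  then obtain t s' where "exec (While b P) s t s'" "I s'" "\<not> bval b s'" "t + \<Phi> s' \<le> \<Phi> s + bcost b"
    by (elim exE conjE) (rule that)
  then have "exec (While b P) s t s' \<and> Q t s'" by (intro conjI fin)
  then show ?thesis unfolding run_def by (intro exI)
qed

lemma upd_apply [simp]: "upd M a i v b = (if b = a then (M a)(i := v) else M b)"
  by (simp add: upd_def)

definition frame :: "nat set \<Rightarrow> nat set \<Rightarrow> memory \<Rightarrow> memory \<Rightarrow> bool" where
  "frame X Y s s' \<longleftrightarrow> (\<forall>a. a \<notin> X \<longrightarrow> fst s' a = fst s a) \<and> (\<forall>b. b \<notin> Y \<longrightarrow> snd s' b = snd s b)"

lemma frame_refl [simp]: "frame X Y s s"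
  by (simp add: frame_def)

lemma frame_trans: "frame X Y s s' \<Longrightarrow> frame X' Y' s' s'' \<Longrightarrow> X \<subseteq> Z \<Longrightarrow> X' \<subseteq> Z \<Longrightarrow> Y \<subseteq> W \<Longrightarrow> Y' \<subseteq> W \<Longrightarrow> frame Z W s s''"
  unfolding frame_def by (metis subsetD)

lemma upd_frame:
  "a \<in> X \<Longrightarrow> frame X Y s (upd M a i v, R) \<longleftrightarrow> frame X Y s (M, R)"
  "b \<in> Y \<Longrightarrow> frame X Y s (M, upd R b i w) \<longleftrightarrow> frame X Y s (M, R)"
  "frame X Y s (fst s', snd s') \<longleftrightarrow> frame X Y s s'"
  by (auto simp: frame_def)

text \<open>
  Scalars live in cell 0 of their array. Natural-number arrays: 5 holds the number of entries per
  bucket of the columns still to be decoded, 6 the list of these columns with lengths 12 (before the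
  pass) and 13 (after it); 10 and 11 hold \<open>256 * \<rho>\<close> and \<open>n * \<rho>\<close> for copy \<open>\<rho>\<close>; 15 is the offset of the
  current column 21 in array 3, and 16 its current table. Real arrays: 1 is overwritten by the
  residual measurements, 3 is the work space of the selection, 4 holds the estimate of column \<open>j\<close>
  in copy \<open>\<rho>\<close> at \<open>n * \<rho> + j\<close>, and 5 returns the selected value. Arrays 18 to 20 and 22 to 27 belong to
  the selection.
\<close>

abbreviation (input) var :: "nat \<Rightarrow> nexp" where "var a \<equiv> NGet a (NConst 0)"
abbreviation (input) assign :: "nat \<Rightarrow> nexp \<Rightarrow> com" where "assign a e \<equiv> NSet a (NConst 0) e"
abbreviation (input) BOr :: "bexp \<Rightarrow> bexp \<Rightarrow> bexp" where "BOr b c \<equiv> BNot (BAnd (BNot b) (BNot c))"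
abbreviation (input) incr :: "nat \<Rightarrow> com" where "incr a \<equiv> assign a (NAdd (var a) (NConst 1))"

text \<open>The counter loop as an instance of \<open>run_While\<close>: the potential is the number
  of remaining rounds times the worst cost of a round, where \<open>ncost e + 3\<close> is the cost
  of the guard.\<close>

lemma run_for:
  assumes "lo \<le> N" "I lo s" "fst s i 0 = lo"
    and guard: "\<And>z s'. I z s' \<Longrightarrow> nval e s' = N"
    and step: "\<And>z s'. lo \<le> z \<Longrightarrow> z < N \<Longrightarrow> I z s' \<Longrightarrow> fst s' i 0 = z \<Longrightarrow>
      run P s' (\<lambda>t s''. I (Suc z) s'' \<and> fst s'' i 0 = Suc z \<and> t \<le> T)"
    and fin: "\<And>t s'. I N s' \<Longrightarrow> fst s' i 0 = N \<Longrightarrow>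
      t \<le> (N - lo) * (T + ncost e + 3) + ncost e + 3 \<Longrightarrow> Q t s'"
  shows "run (While (NLess (var i) e) P) s Q"
proof (rule run_While[where I = "\<lambda>s'. lo \<le> fst s' i 0 \<and> fst s' i 0 \<le> N \<and> I (fst s' i 0) s'"
      and \<Phi> = "\<lambda>s'. (N - fst s' i 0) * (T + ncost e + 3)"])
  fix s' assume I: "lo \<le> fst s' i 0 \<and> fst s' i 0 \<le> N \<and> I (fst s' i 0) s'"
    and b: "bval (NLess (var i) e) s'"
  have lt: "fst s' i 0 < N" using b guard[of "fst s' i 0" s'] I by simp
  then have m: "N - fst s' i 0 = Suc (N - Suc (fst s' i 0))" by simp
  show "run P s' (\<lambda>t s''. (lo \<le> fst s'' i 0 \<and> fst s'' i 0 \<le> N \<and> I (fst s'' i 0) s'') \<and>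
      t + bcost (NLess (var i) e) + (N - fst s'' i 0) * (T + ncost e + 3) \<le> (N - fst s' i 0) * (T + ncost e + 3))"
    by (rule run_mono[OF step]) (use I lt m in auto)
next
  fix t s' assume I: "lo \<le> fst s' i 0 \<and> fst s' i 0 \<le> N \<and> I (fst s' i 0) s'"
    and b: "\<not> bval (NLess (var i) e) s'"
    and t: "t + (N - fst s' i 0) * (T + ncost e + 3) \<le> (N - fst s i 0) * (T + ncost e + 3) + bcost (NLess (var i) e)"
  have "fst s' i 0 = N" using b guard[of "fst s' i 0" s'] I by simp
  then show "Q t s'" using fin I t assms by simp
qed (use assms in auto)

section \<open>Selection by rank\<close>

text \<open>Ties are broken by position, so the ranks form a permutation even when values
  coincide.\<close>

definition rank_in :: "(nat \<Rightarrow> real) \<Rightarrow> nat \<Rightarrow> nat \<Rightarrow> nat \<Rightarrow> nat" where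
  "rank_in V a b x = card {z \<in> {a..<b}. V z < V x \<or> V z = V x \<and> z < x}"

lemma rank_in_Suc:
  "a \<le> b \<Longrightarrow> rank_in V a (Suc b) x = rank_in V a b x + (if V b < V x \<or> V b = V x \<and> b < x then 1 else 0)"
proof -
  assume ab: "a \<le> b"
  let ?P = "\<lambda>z. V z < V x \<or> V z = V x \<and> z < x"
  have "{z \<in> {a..<Suc b}. ?P z} = {z \<in> {a..<b}. ?P z} \<union> (if ?P b then {b} else {})"
    using ab by (auto simp: less_Suc_eq)
  then show ?thesis
    by (simp add: rank_in_def card_insert_if)
qed

lemma rank_in_empty [simp]: "rank_in V a a x = 0"
  by (simp add: rank_in_def)

definition rank_com :: com where
  "rank_com = Seq (assign 20 (NConst 0)) (Seq (assign 19 (var 22))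
     (While (NLess (var 19) (var 23))
       (Seq (If (BOr (RLess (RGet 3 (var 19)) (RGet 3 (var 18)))
                 (BAnd (BNot (RLess (RGet 3 (var 18)) (RGet 3 (var 19)))) (NLess (var 19) (var 18))))
             (incr 20) Skip)
         (incr 19))))"

lemma run_rank:
  assumes "fst s 22 0 \<le> fst s 23 0"
  shows "run rank_com s (\<lambda>t s'. frame {19,20} {} s s' \<and>
    fst s' 20 0 = rank_in (snd s 3) (fst s 22 0) (fst s 23 0) (fst s 18 0) \<and>
    t \<le> 70 * (fst s 23 0 - fst s 22 0) + 20)"
proof -
  let ?V = "snd s 3" and ?P = "fst s 22 0" and ?E = "fst s 23 0" and ?x = "fst s 18 0"
  show ?thesis
    unfolding rank_com_def
    apply simp
    apply (rule run_for[where lo = ?P and N = ?E and T = 60 and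
       I = "\<lambda>z s'. frame {19,20} {} s s' \<and> fst s' 20 0 = rank_in ?V ?P z ?x"])
    subgoal by (rule assms)
    subgoal by (simp add: frame_def)
    subgoal by simp
    subgoal by (auto simp: frame_def)
    subgoal for z s'
    proof -
      assume z: "?P \<le> z" "fst s' 19 0 = z"
        and I: "frame {19,20} {} s s' \<and> fst s' 20 0 = rank_in ?V ?P z ?x"
      have e: "snd s' 3 = ?V" "fst s' 18 = fst s 18" using I by (auto simp: frame_def)
      have b: "(\<not> (\<not> ?V z < ?V ?x \<and> \<not> (\<not> ?V ?x < ?V z \<and> z < ?x))) \<longleftrightarrow> ?V z < ?V ?x \<or> ?V z = ?V ?x \<and> z < ?x"
        by linarith
      show ?thesis
        using I z by (simp add: e upd_frame rank_in_Suc b del: not_less)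
    qed
    subgoal by simp
    done
qed

lemma rank_in_bij: "bij_betw (rank_in V a b) {a..<b} {0..<b - a}"
proof -
  define lt where "lt z x \<longleftrightarrow> V z < V x \<or> V z = V x \<and> z < x" for z x
  have rank_in: "rank_in V a b x = card {z\<in>{a..<b}. lt z x}" for x by (simp add: rank_in_def lt_def)
  have mono: "rank_in V a b x < rank_in V a b y" if "x \<in> {a..<b}" "lt x y" for x y
    unfolding rank_in
  proof (rule psubset_card_mono)
    show "finite {z\<in>{a..<b}. lt z y}" by simp
    have "lt z y" if "lt z x" for z using that \<open>lt x y\<close> unfolding lt_def by auto
    moreover have "\<not> lt x x" by (simp add: lt_def)
    ultimately show "{z\<in>{a..<b}. lt z x} \<subset> {z\<in>{a..<b}. lt z y}" using that by blast
  qed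
  have inj: "inj_on (rank_in V a b) {a..<b}"
  proof (rule inj_onI)
    fix x y assume "x \<in> {a..<b}" "y \<in> {a..<b}" "rank_in V a b x = rank_in V a b y"
    then have "\<not> lt x y" "\<not> lt y x" using mono[of x y] mono[of y x] by auto
    then show "x = y" unfolding lt_def by linarith
  qed
  have lt: "rank_in V a b x < b - a" if "x \<in> {a..<b}" for x
  proof -
    have "rank_in V a b x < card {a..<b}" unfolding rank_in
      proof (rule psubset_card_mono)
      have "x \<notin> {z\<in>{a..<b}. lt z x}" by (simp add: lt_def)
      then show "{z\<in>{a..<b}. lt z x} \<subset> {a..<b}" using that by blast
    qed simp
    then show ?thesis by simp
  qed
  have "rank_in V a b ` {a..<b} = {0..<b - a}"
  proof (rule card_subset_eq)
    show "rank_in V a b ` {a..<b} \<subseteq> {0..<b - a}" using lt by auto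
  qed (use inj in \<open>simp_all add: card_image\<close>)
  then show ?thesis using inj by (simp add: bij_betw_def)
qed

lemma rank_in_mono: "x \<in> {a..<b} \<Longrightarrow> V x < V y \<Longrightarrow> rank_in V a b x < rank_in V a b y"
  unfolding rank_in_def by (rule psubset_card_mono) auto

text \<open>Q is a lower set for the order of values, so its cells take the smallest ranks: a rank
  below that of a cell in Q belongs to a cell in Q.\<close>

lemma rank_in_image_down:
  assumes down: "\<And>x y. x \<in> {a..<b} \<Longrightarrow> y \<in> {a..<b} \<Longrightarrow> Q y \<Longrightarrow> \<not> Q x \<Longrightarrow> V y < V x"
  shows "rank_in V a b ` {x\<in>{a..<b}. Q x} = {0..<card {x\<in>{a..<b}. Q x}}"
proof -
  let ?A = "{x\<in>{a..<b}. Q x}"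
  have inj: "inj_on (rank_in V a b) {a..<b}" and im: "rank_in V a b ` {a..<b} = {0..<b-a}"
    using rank_in_bij[of V a b] by (auto simp: bij_betw_def)
  have dc: "m \<in> rank_in V a b ` ?A" if "n \<in> rank_in V a b ` ?A" "m < n" for m n
  proof -
    obtain y where y: "y \<in> ?A" "n = rank_in V a b y" using \<open>n \<in> _\<close> by blast
    have "n \<in> rank_in V a b ` {a..<b}" using y by blast
    then have "n < b - a" unfolding im by simp
    have "m \<in> rank_in V a b ` {a..<b}" using \<open>n < b - a\<close> \<open>m < n\<close> unfolding im by simp
    then obtain x where x: "x \<in> {a..<b}" "m = rank_in V a b x" by blast
    have "Q x"
    proof (rule ccontr)
      assume "\<not> Q x"
      then have "rank_in V a b y < rank_in V a b x" using x y down by (intro rank_in_mono) auto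
      then show False using \<open>m < n\<close> x y by simp
    qed
    then show ?thesis using x by auto
  qed
  have fin: "finite (rank_in V a b ` ?A)" by simp
  have sub: "rank_in V a b ` ?A \<subseteq> {0..<card (rank_in V a b ` ?A)}"
  proof
    fix n assume n: "n \<in> rank_in V a b ` ?A"
    have "m \<in> rank_in V a b ` ?A" if "m \<le> n" for m
      using n dc[OF n, of m] that by (cases "m = n") auto
    then have "{0..n} \<subseteq> rank_in V a b ` ?A" by auto
    from card_mono[OF fin this] show "n \<in> {0..<card (rank_in V a b ` ?A)}" by simp
  qed
  have c: "card (rank_in V a b ` ?A) = card ?A"
    by (rule card_image) (rule inj_on_subset[OF inj], auto)
  show ?thesis using card_subset_eq[OF _ sub] c by simp
qed

lemma card_mod4_lessThan: "card {r\<in>{0..<m}. r mod 4 = 3} = m div 4" for m :: nat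
proof (induction m)
  case (Suc m)
  have "{r\<in>{0..<Suc m}. r mod 4 = 3} = {r\<in>{0..<m}. r mod 4 = 3} \<union> (if m mod 4 = 3 then {m} else {})"
    by (auto simp: less_Suc_eq)
  moreover have "Suc m div 4 = m div 4 + (if m mod 4 = 3 then 1 else 0)"
    by (simp add: div_Suc mod_Suc)
  ultimately show ?case using Suc by (auto simp: card_insert_if)
qed simp

text \<open>The ranks of a lower set are an initial segment of the naturals, of which every fourth
  is kept, beginning with 3. Keeping the residue 3 and not 0 makes the count round
  downwards.\<close>

lemma card_kept_down:
  assumes "\<And>x y. x \<in> {a..<b} \<Longrightarrow> y \<in> {a..<b} \<Longrightarrow> Q y \<Longrightarrow> \<not> Q x \<Longrightarrow> V y < V x"
  shows "card {x\<in>{a..<b}. rank_in V a b x mod 4 = 3 \<and> Q x} = card {x\<in>{a..<b}. Q x} div 4"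
proof -
  let ?A = "{x\<in>{a..<b}. Q x}"
  have inj: "inj_on (rank_in V a b) {a..<b}" using rank_in_bij[of V a b] by (auto simp: bij_betw_def)
  have "card {x\<in>{a..<b}. rank_in V a b x mod 4 = 3 \<and> Q x} = card (rank_in V a b ` {x\<in>{a..<b}. rank_in V a b x mod 4 = 3 \<and> Q x})"
    by (rule card_image[symmetric]) (rule inj_on_subset[OF inj], auto)
  also have "rank_in V a b ` {x\<in>{a..<b}. rank_in V a b x mod 4 = 3 \<and> Q x} = {r\<in>rank_in V a b ` ?A. r mod 4 = 3}"
    by auto
  also have "\<dots> = {r\<in>{0..<card ?A}. r mod 4 = 3}"
    using rank_in_image_down[of a b Q V] assms by simp
  finally show ?thesis by (simp only: card_mod4_lessThan)
qed

lemma div4_sum_le: "K + B div 4 = N div 4 \<Longrightarrow> N = A + B \<Longrightarrow> 4 * K \<le> A + 4" for A B K N :: nat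
proof -
  assume "K + B div 4 = N div 4" "N = A + B"
  moreover have "N = 4 * (N div 4) + N mod 4" "B = 4 * (B div 4) + B mod 4" by simp_all
  moreover have "B mod 4 < 4" by simp
  ultimately show ?thesis by linarith
qed

text \<open>An upper set is the complement of a lower set, whose kept part is counted exactly. The
  two roundings together cost at most 4.\<close>

lemma card_kept_up:
  assumes "\<And>x y. x \<in> {a..<b} \<Longrightarrow> y \<in> {a..<b} \<Longrightarrow> Q y \<Longrightarrow> \<not> Q x \<Longrightarrow> V x < V y"
  shows "4 * card {x\<in>{a..<b}. rank_in V a b x mod 4 = 3 \<and> Q x} \<le> card {x\<in>{a..<b}. Q x} + 4"
proof -
  let ?K = "\<lambda>x. rank_in V a b x mod 4 = 3"
  have a: "card {x\<in>{a..<b}. ?K x \<and> True} = card {x\<in>{a..<b}. True} div 4"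
    by (rule card_kept_down) auto
  have b: "card {x\<in>{a..<b}. ?K x \<and> \<not> Q x} = card {x\<in>{a..<b}. \<not> Q x} div 4"
    by (rule card_kept_down) (use assms in auto)
  have "card {x\<in>{a..<b}. ?K x \<and> True} = card ({x\<in>{a..<b}. ?K x \<and> Q x} \<union> {x\<in>{a..<b}. ?K x \<and> \<not> Q x})"
    by (rule arg_cong[where f=card]) auto
  also have "\<dots> = card {x\<in>{a..<b}. ?K x \<and> Q x} + card {x\<in>{a..<b}. ?K x \<and> \<not> Q x}"
    by (rule card_Un_disjoint) auto
  finally have c: "card {x\<in>{a..<b}. ?K x \<and> Q x} + card {x\<in>{a..<b}. \<not> Q x} div 4 = card {x\<in>{a..<b}. True} div 4"
    using a b by simp
  have "card {x\<in>{a..<b}. True} = card ({x\<in>{a..<b}. Q x} \<union> {x\<in>{a..<b}. \<not> Q x})"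
    by (rule arg_cong[where f=card]) auto
  also have "\<dots> = card {x\<in>{a..<b}. Q x} + card {x\<in>{a..<b}. \<not> Q x}"
    by (rule card_Un_disjoint) auto
  finally have d: "card {x\<in>{a..<b}. True} = card {x\<in>{a..<b}. Q x} + card {x\<in>{a..<b}. \<not> Q x}" .
  show ?thesis by (rule div4_sum_le[OF c d])
qed

definition sel_com :: "bexp \<Rightarrow> com \<Rightarrow> com" where
  "sel_com b act = Seq (assign 18 (var 22))
     (While (NLess (var 18) (var 23)) (Seq rank_com (Seq (If b act Skip) (incr 18))))"

text \<open>Writes to cell 5 the element of rank \<open>T\<close> (variable 24) among the cells in \<open>[P, E)\<close>
  (variables 22, 23) of real array 3.\<close>

definition pick_com :: com where
  "pick_com = sel_com (BAnd (BNot (NLess (var 20) (var 24))) (BNot (NLess (var 24) (var 20))))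
     (RSet 5 (NConst 0) (RGet 3 (var 18)))"

lemma frame_mono: "frame X Y s s' \<Longrightarrow> X \<subseteq> X' \<Longrightarrow> Y \<subseteq> Y' \<Longrightarrow> frame X' Y' s s'"
  by (auto simp: frame_def)

lemma run_pick:
  assumes PE: "fst s 22 0 \<le> fst s 23 0"
    and uniq: "\<exists>x\<in>{fst s 22 0..<fst s 23 0}. rank_in (snd s 3) (fst s 22 0) (fst s 23 0) x = fst s 24 0"
  shows "run pick_com s (\<lambda>t s'. frame {18,19,20} {5} s s' \<and>
    (\<exists>x\<in>{fst s 22 0..<fst s 23 0}. rank_in (snd s 3) (fst s 22 0) (fst s 23 0) x = fst s 24 0 \<and>
       snd s' 5 0 = snd s 3 x) \<and>
    t \<le> (fst s 23 0 - fst s 22 0) * (70 * (fst s 23 0 - fst s 22 0) + 75) + 20)"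
proof -
  let ?V = "snd s 3" and ?P = "fst s 22 0" and ?E = "fst s 23 0" and ?T = "fst s 24 0"
  let ?R = "\<lambda>s' x. rank_in ?V ?P ?E x = ?T \<and> snd s' 5 0 = ?V x"
  show ?thesis
    unfolding pick_com_def sel_com_def
    apply simp
    apply (rule run_for[where lo = ?P and N = ?E and T = "70 * (?E - ?P) + 70" and
      I = "\<lambda>z s'. frame {18,19,20} {5} s s' \<and>
         ((\<exists>x\<in>{?P..<?E}. ?R s' x) \<or> (\<forall>x\<in>{?P..<z}. rank_in ?V ?P ?E x \<noteq> ?T))"])
    subgoal by (rule PE)
    subgoal by (simp add: frame_def)
    subgoal by simp
    subgoal by (auto simp: frame_def)
    subgoal for z s'
    proof -
      assume z: "?P \<le> z" "z < ?E" "fst s' 18 0 = z"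
        and I: "frame {18,19,20} {5} s s' \<and> ((\<exists>x\<in>{?P..<?E}. ?R s' x) \<or> (\<forall>x\<in>{?P..<z}. rank_in ?V ?P ?E x \<noteq> ?T))"
      have e: "snd s' 3 = ?V" "fst s' 22 = fst s 22" "fst s' 23 = fst s 23" "fst s' 24 = fst s 24"
        using I by (auto simp: frame_def)
      show ?thesis
        apply simp
        apply (rule run_mono[OF run_rank])
        subgoal using PE by (simp add: e)
        subgoal for t1 s1
        proof -
          assume s1: "frame {19, 20} {} s' s1 \<and>
            fst s1 20 0 = rank_in (snd s' 3) (fst s' 22 0) (fst s' 23 0) (fst s' 18 0) \<and>
            t1 \<le> 70 * (fst s' 23 0 - fst s' 22 0) + 20"
          have fr: "frame {18,19,20} {5} s s1"
            using I s1 by (auto intro: frame_trans)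
          have e1: "fst s1 18 = fst s' 18" "snd s1 3 = ?V" "fst s1 24 = fst s 24" "snd s1 5 = snd s' 5"
            using s1 e by (auto simp: frame_def)
          have r: "fst s1 20 0 = rank_in ?V ?P ?E z" using s1 e z by simp
          have t1: "t1 \<le> 70 * (?E - ?P) + 20" using s1 e by simp
          show ?thesis
          proof (cases "fst s1 20 0 = ?T")
            case True
            then have "\<exists>x\<in>{?P..<?E}. rank_in ?V ?P ?E x = ?T \<and> ?V z = ?V x" using z r by auto
            then show ?thesis using True t1 by (simp add: e1 z upd_frame fr)
          next
            case False
            then have q: "(\<exists>x\<in>{?P..<?E}. ?R s1 x) \<or> (\<forall>x\<in>{?P..<Suc z}. rank_in ?V ?P ?E x \<noteq> ?T)"
              using I r e1 by (auto simp: less_Suc_eq)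
            have "\<not> (\<not> fst s1 20 0 < ?T \<and> \<not> ?T < fst s1 20 0)" using False by linarith
            then show ?thesis using q t1 e1 by (simp add: z upd_frame fr) blast
          qed
        qed
        done
    qed
    subgoal using uniq by (auto simp: add.commute)
    done
qed


text \<open>The test is \<open>rank mod 4 = 3\<close>, as multiplication and remainder are not available.\<close>

definition keep_com :: com where
  "keep_com = sel_com (NLess (NConst 2) (NSub (var 20)
       (NAdd (NAdd (NHalf (NHalf (var 20))) (NHalf (NHalf (var 20))))
             (NAdd (NHalf (NHalf (var 20))) (NHalf (NHalf (var 20)))))))
     (Seq (RSet 3 (var 25) (RGet 3 (var 18))) (incr 25))"

definition count :: "(nat \<Rightarrow> real) \<Rightarrow> nat \<Rightarrow> nat \<Rightarrow> (real \<Rightarrow> bool) \<Rightarrow> nat" where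
  "count V a b Q = card {i \<in> {a..<b}. Q (V i)}"

lemma mod4_test: "2 < (r::nat) - (r div 2 div 2 + r div 2 div 2 + (r div 2 div 2 + r div 2 div 2)) \<longleftrightarrow> r mod 4 = 3"
proof -
  have "r div 2 div 2 = r div 4" using div_mult2_eq[of r 2 2] by simp
  moreover have "r = 4 * (r div 4) + r mod 4" "r mod 4 < 4" by simp_all
  ultimately show ?thesis by linarith
qed

lemma count_Suc: "a \<le> b \<Longrightarrow> count V a (Suc b) Q = count V a b Q + (if Q (V b) then 1 else 0)"
proof -
  assume "a \<le> b"
  then have "{i \<in> {a..<Suc b}. Q (V i)} = {i \<in> {a..<b}. Q (V i)} \<union> (if Q (V b) then {b} else {})"
    by (auto simp: less_Suc_eq)
  then show ?thesis by (simp add: count_def card_insert_if)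
qed

lemma card_filter_Suc:
  "a \<le> b \<Longrightarrow> card {i \<in> {a..<Suc b}. Q i} = card {i \<in> {a..<b}. Q i} + (if Q b then 1 else 0)"
proof -
  assume "a \<le> b"
  then have "{i \<in> {a..<Suc b}. Q i} = {i \<in> {a..<b}. Q i} \<union> (if Q b then {b} else {})"
    by (auto simp: less_Suc_eq)
  then show ?thesis by (simp add: card_insert_if)
qed

definition kept :: "(nat \<Rightarrow> real) \<Rightarrow> nat \<Rightarrow> nat \<Rightarrow> nat \<Rightarrow> (real \<Rightarrow> bool) \<Rightarrow> nat" where
  "kept V a b z Q = card {x \<in> {a..<z}. rank_in V a b x mod 4 = 3 \<and> Q (V x)}"

lemma kept_Suc:
  "a \<le> z \<Longrightarrow> kept V a b (Suc z) Q = kept V a b z Q + (if rank_in V a b z mod 4 = 3 \<and> Q (V z) then 1 else 0)"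
  unfolding kept_def by (rule card_filter_Suc)

lemma count_cong: "(\<And>i. a \<le> i \<Longrightarrow> i < b \<Longrightarrow> V i = V' i) \<Longrightarrow> count V a b Q = count V' a b Q"
  unfolding count_def by (rule arg_cong[where f = card]) auto

text \<open>Survivors are appended at the write pointer in variable 25, which lies at or beyond the
  end of the segment being ranked. Hence reading and writing can share array 3 without disturbing
  the ranks.\<close>

lemma run_keep:
  assumes PE: "fst s 22 0 \<le> fst s 23 0" "fst s 23 0 \<le> fst s 25 0"
  shows "run keep_com s (\<lambda>t s'. frame {18,19,20,25} {3} s s' \<and> fst s 25 0 \<le> fst s' 25 0 \<and>
    (\<forall>i < fst s 25 0. snd s' 3 i = snd s 3 i) \<and>
    (\<forall>Q. count (snd s' 3) (fst s 25 0) (fst s' 25 0) Q =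
       kept (snd s 3) (fst s 22 0) (fst s 23 0) (fst s 23 0) Q) \<and>
    t \<le> (fst s 23 0 - fst s 22 0) * (70 * (fst s 23 0 - fst s 22 0) + 95) + 20)"
proof -
  let ?V = "snd s 3" and ?P = "fst s 22 0" and ?E = "fst s 23 0" and ?W = "fst s 25 0"
  show ?thesis
    unfolding keep_com_def sel_com_def
    apply simp
    apply (rule run_for[where lo = ?P and N = ?E and T = "70 * (?E - ?P) + 90" and
      I = "\<lambda>z s'. frame {18,19,20,25} {3} s s' \<and> ?W \<le> fst s' 25 0 \<and> (\<forall>i < ?W. snd s' 3 i = ?V i) \<and>
        (\<forall>Q. count (snd s' 3) ?W (fst s' 25 0) Q = kept ?V ?P ?E z Q)"])
    subgoal by (rule PE)
    subgoal by (simp add: frame_def count_def kept_def)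
    subgoal by simp
    subgoal by (auto simp: frame_def)
    subgoal for z s'
    proof -
      assume z: "?P \<le> z" "z < ?E" "fst s' 18 0 = z"
        and I: "frame {18,19,20,25} {3} s s' \<and> ?W \<le> fst s' 25 0 \<and> (\<forall>i < ?W. snd s' 3 i = ?V i) \<and>
        (\<forall>Q. count (snd s' 3) ?W (fst s' 25 0) Q = kept ?V ?P ?E z Q)"
      have e: "fst s' 22 = fst s 22" "fst s' 23 = fst s 23"
        using I by (auto simp: frame_def)
      have V: "snd s' 3 i = ?V i" if "i < ?E" for i using I that PE by simp
      have rkV: "rank_in (snd s' 3) ?P ?E z = rank_in ?V ?P ?E z"
        unfolding rank_in_def by (rule arg_cong[where f = card]) (use V z in auto)
      show ?thesis
        apply simp
        apply (rule run_mono[OF run_rank])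
        subgoal using PE by (simp add: e)
        subgoal for t1 s1
        proof -
          assume s1: "frame {19, 20} {} s' s1 \<and>
            fst s1 20 0 = rank_in (snd s' 3) (fst s' 22 0) (fst s' 23 0) (fst s' 18 0) \<and>
            t1 \<le> 70 * (fst s' 23 0 - fst s' 22 0) + 20"
          have fr: "frame {18,19,20,25} {3} s s1"
            using I s1 by (auto intro: frame_trans)
          have e1: "fst s1 18 = fst s' 18" "snd s1 3 = snd s' 3" "fst s1 25 = fst s' 25"
            using s1 e by (auto simp: frame_def)
          have r: "fst s1 20 0 = rank_in ?V ?P ?E z" using s1 e z rkV by simp
          have t1: "t1 \<le> 70 * (?E - ?P) + 20" using s1 e by simp
          show ?thesis
          proof (cases "rank_in ?V ?P ?E z mod 4 = 3")
            case True
            have "count ((snd s' 3)(fst s' 25 0 := snd s' 3 z)) ?W (fst s' 25 0) Q = count (snd s' 3) ?W (fst s' 25 0) Q" for Q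
              by (rule count_cong) simp
            then show ?thesis using True t1 I
              by (simp add: e1 z r upd_frame fr mod4_test count_Suc kept_Suc V)
          next
            case False
            then show ?thesis using t1 I
              by (simp add: e1 z r upd_frame fr mod4_test kept_Suc)
          qed
        qed
        done
    qed
    subgoal by (simp add: add.commute)
    done
qed

lemma count_split: "a \<le> b \<Longrightarrow> b \<le> c \<Longrightarrow> count V a c Q = count V a b Q + count V b c Q"
proof -
  assume "a \<le> b" "b \<le> c"
  then have "{i \<in> {a..<c}. Q (V i)} = {i \<in> {a..<b}. Q (V i)} \<union> {i \<in> {b..<c}. Q (V i)}" by auto
  then have "card {i \<in> {a..<c}. Q (V i)} = card ({i \<in> {a..<b}. Q (V i)} \<union> {i \<in> {b..<c}. Q (V i)})"
    by (rule arg_cong)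
  also have "\<dots> = card {i \<in> {a..<b}. Q (V i)} + card {i \<in> {b..<c}. Q (V i)}"
    by (rule card_Un_disjoint) auto
  finally show ?thesis by (simp only: count_def)
qed

lemma count_True [simp]: "count V a b (\<lambda>_. True) = b - a"
proof -
  have "{i \<in> {a..<b}. True} = {a..<b}" by auto
  then show ?thesis by (simp only: count_def card_atLeastLessThan)
qed

section \<open>Approximate medians in linear time\<close>

text \<open>The half lines in both directions. A median is robust because it avoids every half line
  that contains few of the values, and all guarantees of the selection are phrased through this
  family.\<close>

definition monotone_pred :: "(real \<Rightarrow> bool) \<Rightarrow> bool" where
  "monotone_pred Q \<longleftrightarrow> (\<forall>u v. Q u \<and> v \<le> u \<longrightarrow> Q v) \<or> (\<forall>u v. Q u \<and> u \<le> v \<longrightarrow> Q v)"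

text \<open>Thinning a group turns B bad values into at most B/4 + 1. The additive 1, paid once per
  group, is what the growing group size has to absorb.\<close>

lemma kept_le:
  assumes "monotone_pred Q"
  shows "4 * kept V a b b Q \<le> count V a b Q + 4"
  using assms unfolding monotone_pred_def
proof
  assume Q: "\<forall>u v. Q u \<and> v \<le> u \<longrightarrow> Q v"
  have "card {x\<in>{a..<b}. rank_in V a b x mod 4 = 3 \<and> Q (V x)} = card {x\<in>{a..<b}. Q (V x)} div 4"
    by (rule card_kept_down) (use Q in \<open>meson not_le_imp_less\<close>)
  then show ?thesis by (simp add: kept_def count_def)
next
  assume Q: "\<forall>u v. Q u \<and> u \<le> v \<longrightarrow> Q v"
  have "4 * card {x\<in>{a..<b}. rank_in V a b x mod 4 = 3 \<and> Q (V x)} \<le> card {x\<in>{a..<b}. Q (V x)} + 4"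
    by (rule card_kept_up) (use Q in \<open>meson not_le_imp_less\<close>)
  then show ?thesis by (simp add: kept_def count_def)
qed

lemma kept_all: "kept V a b b (\<lambda>_. True) = (b - a) div 4"
proof -
  have "card {x\<in>{a..<b}. rank_in V a b x mod 4 = 3 \<and> True} = card {x\<in>{a..<b}. True} div 4"
    by (rule card_kept_down) auto
  moreover have "{x\<in>{a..<b}. True} = {a..<b}" by auto
  ultimately show ?thesis by (simp only: kept_def card_atLeastLessThan)
qed

text \<open>A half line with fewer than half of the values occupies only the lowest or only the
  highest ranks, and the middle rank is among neither.\<close>

lemma rank_robust:
  assumes "monotone_pred Q" "2 * count V a b Q < b - a" "x \<in> {a..<b}" "rank_in V a b x = (b - a) div 2"
  shows "\<not> Q (V x)"
proof
  assume qx: "Q (V x)"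
  have bij: "inj_on (rank_in V a b) {a..<b}" "rank_in V a b ` {a..<b} = {0..<b-a}"
    using rank_in_bij[of V a b] by (auto simp: bij_betw_def)
  from assms(1) show False unfolding monotone_pred_def
  proof
    assume Q: "\<forall>u v. Q u \<and> v \<le> u \<longrightarrow> Q v"
    have "rank_in V a b ` {x\<in>{a..<b}. Q (V x)} = {0..<card {x\<in>{a..<b}. Q (V x)}}"
      by (rule rank_in_image_down) (use Q in \<open>meson not_le_imp_less\<close>)
    then have "rank_in V a b x < count V a b Q" using qx assms(3) unfolding count_def by (metis (no_types, lifting) atLeastLessThan_iff image_eqI mem_Collect_eq)
    then show False using assms by linarith
  next
    assume Q: "\<forall>u v. Q u \<and> u \<le> v \<longrightarrow> Q v"
    have "rank_in V a b ` {x\<in>{a..<b}. \<not> Q (V x)} = {0..<card {x\<in>{a..<b}. \<not> Q (V x)}}"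
      by (rule rank_in_image_down) (use Q in \<open>meson not_le_imp_less\<close>)
    moreover have "card {x\<in>{a..<b}. \<not> Q (V x)} + count V a b Q = b - a"
    proof -
      have "{a..<b} = {x\<in>{a..<b}. \<not> Q (V x)} \<union> {x\<in>{a..<b}. Q (V x)}" by auto
      then have "card {a..<b} = card ({x\<in>{a..<b}. \<not> Q (V x)} \<union> {x\<in>{a..<b}. Q (V x)})" by (rule arg_cong)
      also have "\<dots> = card {x\<in>{a..<b}. \<not> Q (V x)} + card {x\<in>{a..<b}. Q (V x)}"
        by (rule card_Un_disjoint) auto
      finally show ?thesis by (simp add: count_def)
    qed
    ultimately have "rank_in V a b x \<in> rank_in V a b ` {x\<in>{a..<b}. \<not> Q (V x)}"
      using assms(2,4) by auto
    then obtain y where "y \<in> {a..<b}" "\<not> Q (V y)" "rank_in V a b x = rank_in V a b y" by auto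
    then have "x = y" using bij(1) assms(3) by (auto dest: inj_onD)
    then show False using qx \<open>\<not> Q (V y)\<close> by simp
  qed
qed

text \<open>Array 3 acts as a queue: variables 22 and 27 delimit the input of the round, 25 is the
  write pointer, and the survivors stored directly behind the input become the input of the next
  round.\<close>

definition groups_com :: com where
  "groups_com = While (NLess (var 22) (var 27))
     (Seq (assign 23 (NAdd (var 22) (var 26))) (Seq keep_com (assign 22 (var 23))))"

lemma run_groups:
  assumes G: "G = fst s 26 0" "G > 0" "4 dvd G"
    and W: "fst s 25 0 = W" "fst s 27 0 = W" "fst s 22 0 = P" "W = P + m * G"
  shows "run groups_com s (\<lambda>t s'. frame {18,19,20,22,23,25} {3} s s' \<and> fst s' 22 0 = W \<and>
    fst s' 25 0 = W + m * (G div 4) \<and>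
    (\<forall>Q. monotone_pred Q \<longrightarrow> 4 * count (snd s' 3) W (fst s' 25 0) Q \<le> count (snd s 3) P W Q + 4 * m) \<and>
    t \<le> (W - P) * (70 * G + 175) + 5)"
proof -
  let ?V = "snd s 3"
  define I where "I s' j \<longleftrightarrow> frame {18,19,20,22,23,25} {3} s s' \<and> j \<le> m \<and> fst s' 22 0 = P + j * G \<and>
    fst s' 25 0 = W + j * (G div 4) \<and> (\<forall>i<W. snd s' 3 i = ?V i) \<and>
    (\<forall>Q. monotone_pred Q \<longrightarrow> 4 * count (snd s' 3) W (fst s' 25 0) Q \<le> count ?V P (P + j * G) Q + 4 * j)" for s' j
  show ?thesis
    unfolding groups_com_def
  proof (rule run_While[where I = "\<lambda>s'. \<exists>j. I s' j" and \<Phi> = "\<lambda>s'. (W - fst s' 22 0) * (70 * G + 175)"])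
    have "I s 0" using W by (simp add: I_def count_def)
    then show "\<exists>j. I s j" by blast
  next
    fix s' assume "\<exists>j. I s' j" and g: "bval (NLess (var 22) (var 27)) s'"
    then obtain j where I: "I s' j" by blast
    have e: "fst s' 26 = fst s 26" "fst s' 27 = fst s 27" using I by (auto simp: I_def frame_def)
    have P': "fst s' 22 0 = P + j * G" and W': "fst s' 25 0 = W + j * (G div 4)" using I by (auto simp: I_def)
    have "P + j * G < W" using g W e P' by simp
    then have "j < m" using W(4) by simp
    then obtain m' where m': "m = Suc j + m'" using less_iff_Suc_add by auto
    have le: "P + j * G + G \<le> W" using W(4) m' by (simp add: algebra_simps)
    have GP: "fst s 26 0 = G" using G by simp
    define s0 where "s0 = (upd (fst s') 23 0 (P + j * G + G), snd s')"
    have s0: "fst s0 22 0 = P + j * G" "fst s0 23 0 = P + j * G + G" "fst s0 25 0 = W + j * (G div 4)" "snd s0 3 = snd s' 3"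
      using P' W' by (simp_all add: s0_def)
    have f0: "frame {18,19,20,22,23,25} {3} s s0" using I by (simp add: s0_def upd_frame I_def)
    have V: "snd s' 3 i = ?V i" if "i < W" for i using I that by (simp add: I_def)
    have k: "4 * kept (snd s0 3) (P + j * G) (P + j * G + G) (P + j * G + G) Q \<le> count ?V (P + j * G) (P + j * G + G) Q + 4"
      if "monotone_pred Q" for Q
    proof -
      have "count (snd s0 3) (P + j * G) (P + j * G + G) Q = count ?V (P + j * G) (P + j * G + G) Q"
        by (rule count_cong) (use V le s0 in auto)
      then show ?thesis using kept_le[OF that, of "snd s0 3" "P + j * G" "P + j * G + G"] by simp
    qed
    show "run (Seq (assign 23 (NAdd (var 22) (var 26))) (Seq keep_com (assign 22 (var 23)))) s'
        (\<lambda>t s''. (\<exists>j. I s'' j) \<and> t + bcost (NLess (var 22) (var 27)) + (W - fst s'' 22 0) * (70 * G + 175)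
          \<le> (W - fst s' 22 0) * (70 * G + 175))"
      apply (simp add: e P' GP s0_def[symmetric])
      apply (rule run_mono[OF run_keep])
      subgoal by (simp add: s0)
      subgoal using le by (simp add: s0)
      subgoal for t s1
      proof -
        assume s1: "frame {18,19,20,25} {3} s0 s1 \<and> fst s0 25 0 \<le> fst s1 25 0 \<and>
          (\<forall>i < fst s0 25 0. snd s1 3 i = snd s0 3 i) \<and>
          (\<forall>Q. count (snd s1 3) (fst s0 25 0) (fst s1 25 0) Q =
             kept (snd s0 3) (fst s0 22 0) (fst s0 23 0) (fst s0 23 0) Q) \<and>
          t \<le> (fst s0 23 0 - fst s0 22 0) * (70 * (fst s0 23 0 - fst s0 22 0) + 95) + 20"
        have f1: "frame {18,19,20,22,23,25} {3} s s1" using f0 s1 by (auto intro: frame_trans)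
        have e1: "fst s1 23 0 = P + j * G + G" using s1 s0 by (auto simp: frame_def)
        have cnt: "count (snd s1 3) (W + j * (G div 4)) (fst s1 25 0) Q = kept (snd s0 3) (P + j * G) (P + j * G + G) (P + j * G + G) Q" for Q
          using s1 s0 by simp
        have W1: "fst s1 25 0 = W + Suc j * (G div 4)"
        proof -
          have "W + j * (G div 4) \<le> fst s1 25 0" using s1 s0 by simp
          moreover have "fst s1 25 0 - (W + j * (G div 4)) = G div 4"
            using cnt[of "\<lambda>_. True"] by (simp add: kept_all)
          ultimately show ?thesis by simp
        qed
        have "I (upd (fst s1) 22 0 (P + j * G + G), snd s1) (Suc j)"
          unfolding I_def
        proof (intro conjI allI impI)
          show "frame {18, 19, 20, 22, 23, 25} {3} s (upd (fst s1) 22 0 (P + j * G + G), snd s1)"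
            using f1 by (simp add: upd_frame)
          show "Suc j \<le> m" using m' by simp
          fix i assume "i < W"
          then show "snd (upd (fst s1) 22 0 (P + j * G + G), snd s1) 3 i = ?V i" using s1 s0 V by simp
        next
          fix Q assume Q: "monotone_pred Q"
          have "count (snd s1 3) W (fst s1 25 0) Q = count (snd s1 3) W (W + j * (G div 4)) Q + count (snd s1 3) (W + j * (G div 4)) (fst s1 25 0) Q"
            by (rule count_split) (simp_all add: W1)
          moreover have "count (snd s1 3) W (W + j * (G div 4)) Q = count (snd s' 3) W (fst s' 25 0) Q"
            unfolding W' by (rule count_cong) (use s1 s0 in auto)
          moreover have "4 * count (snd s' 3) W (fst s' 25 0) Q \<le> count ?V P (P + j * G) Q + 4 * j"
            using I Q unfolding I_def by blast
          moreover have "count ?V P (P + Suc j * G) Q = count ?V P (P + j * G) Q + count ?V (P + j * G) (P + j * G + G) Q"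
            using count_split[of P "P + j * G" "P + j * G + G" ?V Q] by (simp add: algebra_simps)
          ultimately show "4 * count (snd (upd (fst s1) 22 0 (P + j * G + G), snd s1) 3) W
              (fst (upd (fst s1) 22 0 (P + j * G + G), snd s1) 25 0) Q \<le> count ?V P (P + Suc j * G) Q + 4 * Suc j"
            using cnt[of Q] k[OF Q] by simp
        qed (use W1 in \<open>simp_all add: algebra_simps\<close>)
        moreover have "W - (P + j * G) = (W - (P + j * G + G)) + G" using le by simp
        then have "(W - (P + j * G)) * (70 * G + 175) = (W - (P + j * G + G)) * (70 * G + 175) + (G * (70 * G + 95) + 80 * G)"
          by (simp add: algebra_simps)
        moreover have "t \<le> G * (70 * G + 95) + 20" using s1 s0 by simp
        ultimately show ?thesis using e1 \<open>G > 0\<close> by auto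
      qed
      done
  next
    fix t s' assume "\<exists>j. I s' j" and g: "\<not> bval (NLess (var 22) (var 27)) s'"
      and t: "t + (W - fst s' 22 0) * (70 * G + 175) \<le> (W - fst s 22 0) * (70 * G + 175) + bcost (NLess (var 22) (var 27))"
    then obtain j where I: "I s' j" by blast
    have e: "fst s' 27 = fst s 27" using I by (auto simp: I_def frame_def)
    have P': "fst s' 22 0 = P + j * G" "j \<le> m" using I by (auto simp: I_def)
    have "\<not> P + j * G < P + m * G" using g W e P' by simp
    then have "m * G \<le> j * G" by linarith
    then have "m \<le> j" using \<open>G > 0\<close> mult_le_cancel2 by blast
    then have "j = m" using P' by linarith
    then show "frame {18,19,20,22,23,25} {3} s s' \<and> fst s' 22 0 = W \<and>
      fst s' 25 0 = W + m * (G div 4) \<and>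
      (\<forall>Q. monotone_pred Q \<longrightarrow> 4 * count (snd s' 3) W (fst s' 25 0) Q \<le> count ?V P W Q + 4 * m) \<and>
      t \<le> (W - P) * (70 * G + 175) + 5"
    proof (intro conjI)
      have I': "frame {18,19,20,22,23,25} {3} s s'" "fst s' 22 0 = W" "fst s' 25 0 = W + m * (G div 4)"
        "\<forall>Q. monotone_pred Q \<longrightarrow> 4 * count (snd s' 3) W (fst s' 25 0) Q \<le> count ?V P (P + m * G) Q + 4 * m"
        using I \<open>j = m\<close> W(4) by (auto simp: I_def)
      show "frame {18,19,20,22,23,25} {3} s s'" "fst s' 22 0 = W" "fst s' 25 0 = W + m * (G div 4)"
        using I' by blast+
      show "\<forall>Q. monotone_pred Q \<longrightarrow> 4 * count (snd s' 3) W (fst s' 25 0) Q \<le> count ?V P W Q + 4 * m"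
        using I'(4) by (simp only: W(4)[symmetric])
      show "t \<le> (W - P) * (70 * G + 175) + 5" using t W I'(2) by simp
    qed
  qed
qed


definition reduce_com :: com where
  "reduce_com = While (NLess (NAdd (var 22) (var 26)) (var 25))
     (Seq (assign 27 (var 25)) (Seq groups_com (assign 26 (NAdd (var 26) (var 26)))))"

text \<open>Invariant of the selection: the fraction of bad cells is at most \<open>3/8 - 8/G\<close>. Thinning
  groups of size \<open>G\<close> by the factor 4 adds at most \<open>4/G\<close> to it, and \<open>G\<close> doubles.\<close>

lemma run_reduce:
  assumes init: "fst s 26 0 = 64" "fst s 22 0 = 0" "fst s 25 0 = 64 * 8 ^ L"
  shows "run reduce_com s (\<lambda>t s'. frame {18,19,20,22,23,25,26,27} {3} s s' \<and> fst s' 26 0 \<ge> 64 \<and>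
    even (fst s' 26 0) \<and>
    fst s' 25 0 = fst s' 22 0 + fst s' 26 0 \<and>
    (\<forall>Q. monotone_pred Q \<and> 4 * count (snd s 3) 0 (fst s 25 0) Q \<le> fst s 25 0 \<longrightarrow>
      2 * count (snd s' 3) (fst s' 22 0) (fst s' 25 0) Q < fst s' 26 0) \<and>
    t + 150 * fst s' 26 0 * fst s' 26 0 \<le> 9600 * fst s 25 0 + 10)"
proof -
  let ?N = "\<lambda>s'. fst s' 25 0 - fst s' 22 0" and ?G = "\<lambda>s'. fst s' 26 0" and ?W = "fst s 25 0"
  let ?c = "\<lambda>s' Q. count (snd s' 3) (fst s' 22 0) (fst s' 25 0) Q"
  define I where "I s' q \<longleftrightarrow> frame {18,19,20,22,23,25,26,27} {3} s s' \<and> 64 dvd ?G s' \<and> ?G s' > 0 \<and>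
     fst s' 25 0 = fst s' 22 0 + ?G s' * 8 ^ q \<and>
     (\<forall>Q. monotone_pred Q \<and> 4 * count (snd s 3) 0 ?W Q \<le> ?W \<longrightarrow>
        8 * ?G s' * ?c s' Q + 64 * ?N s' \<le> 3 * ?N s' * ?G s')" for s' q
  show ?thesis
    unfolding reduce_com_def
  proof (rule run_While[where I = "\<lambda>s'. \<exists>q. I s' q" and \<Phi> = "\<lambda>s'. 150 * ?N s' * ?G s'"])
    have "I s L" using init by (auto simp: I_def)
    then show "\<exists>q. I s q" by blast
  next
    fix s' assume "\<exists>q. I s' q" and g: "bval (NLess (NAdd (var 22) (var 26)) (var 25)) s'"
    then obtain q where I: "I s' q" by blast
    obtain G P W where GPW: "?G s' = G" "fst s' 22 0 = P" "fst s' 25 0 = W" by blast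
    have G: "64 dvd G" "G > 0" "W = P + G * 8 ^ q" using I GPW by (auto simp: I_def)
    have "q \<noteq> 0" using g G GPW by (cases q) auto
    then obtain q' where q: "q = Suc q'" by (cases q) auto
    obtain g where gG: "G = 64 * g" using G(1) by blast
    have G64: "G \<ge> 64" using gG G(2) by simp
    define m where "m = (8::nat) ^ q"
    have Wm: "W = P + m * G" using G by (simp add: m_def)
    define s0 where "s0 = (upd (fst s') 27 0 W, snd s')"
    have s0: "G = fst s0 26 0" "fst s0 25 0 = W" "fst s0 27 0 = W" "fst s0 22 0 = P" "snd s0 3 = snd s' 3"
      using GPW by (simp_all add: s0_def)
    have f0: "frame {18,19,20,22,23,25,26,27} {3} s s0" using I by (simp add: s0_def upd_frame I_def)
    have d4: "4 dvd G" using gG by simp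
    show "run (Seq (assign 27 (var 25)) (Seq groups_com (assign 26 (NAdd (var 26) (var 26))))) s'
       (\<lambda>t s''. (\<exists>q. I s'' q) \<and> t + bcost (NLess (NAdd (var 22) (var 26)) (var 25)) + 150 * ?N s'' * ?G s''
         \<le> 150 * ?N s' * ?G s')"
      apply (simp add: GPW s0_def[symmetric])
      apply (rule run_mono[OF run_groups[OF s0(1) G(2) d4 s0(2,3,4) Wm]])
      subgoal for t s1
      proof -
        assume s1: "frame {18,19,20,22,23,25} {3} s0 s1 \<and> fst s1 22 0 = W \<and>
          fst s1 25 0 = W + m * (G div 4) \<and>
          (\<forall>Q. monotone_pred Q \<longrightarrow> 4 * count (snd s1 3) W (fst s1 25 0) Q \<le> count (snd s0 3) P W Q + 4 * m) \<and>
          t \<le> (W - P) * (70 * G + 175) + 5"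
        have f1: "frame {18,19,20,22,23,25,26,27} {3} s s1" using f0 s1 by (auto intro: frame_trans)
        have G1: "fst s1 26 0 = G" using s1 s0(1) by (simp add: frame_def)
        let ?s2 = "(upd (fst s1) 26 0 (G + G), snd s1)"
        \<comment> \<open>A quarter of the values in groups of twice the size: the number of groups
          falls from 8^q to 8^(q - 1) without remainder.\<close>
        have N2: "m * (G div 4) = (G + G) * 8 ^ q'" by (simp add: m_def q gG)
        have "I ?s2 q'"
          unfolding I_def
        proof (intro conjI allI impI)
          show "frame {18,19,20,22,23,25,26,27} {3} s ?s2" using f1 by (simp add: upd_frame)
          show "64 dvd fst ?s2 26 0" "0 < fst ?s2 26 0" using G by simp_all
          show "fst ?s2 25 0 = fst ?s2 22 0 + fst ?s2 26 0 * 8 ^ q'" using s1 N2 by simp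
          fix Q assume Q: "monotone_pred Q \<and> 4 * count (snd s 3) 0 ?W Q \<le> ?W"
          define c where "c = count (snd s' 3) P W Q"
          define c1 where "c1 = count (snd s1 3) W (W + m * (G div 4)) Q"
          define h where "h = G div 4"
          have Gh: "G = 4 * h" using d4 by (simp add: h_def)
          have "8 * G * c + 64 * (W - P) \<le> 3 * (W - P) * G"
            using I Q GPW by (auto simp: I_def c_def)
          then have a: "8 * c + 64 * m \<le> 3 * m * G" using Wm \<open>G > 0\<close>
          proof -
            assume "8 * G * c + 64 * (W - P) \<le> 3 * (W - P) * G"
            then have "G * (8 * c + 64 * m) \<le> G * (3 * m * G)" using Wm by (simp add: algebra_simps)
            then show ?thesis using \<open>G > 0\<close> by simp
          qed
          have "4 * count (snd s1 3) W (fst s1 25 0) Q \<le> count (snd s0 3) P W Q + 4 * m" using s1 Q by blast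
          moreover have "fst s1 25 0 = W + m * (G div 4)" using s1 by blast
          ultimately have "4 * c1 \<le> c + 4 * m" by (simp only: c1_def c_def s0)
          moreover have "8 * c + 64 * m \<le> 12 * (m * h)" using a Gh by simp
          ultimately have b: "16 * c1 + 16 * m \<le> 6 * (m * h)" by linarith
          have "G * (16 * c1 + 16 * m) \<le> G * (6 * (m * h))" using b by (rule mult_le_mono2)
          then have "8 * (G + G) * c1 + 64 * (m * h) \<le> 3 * (m * h) * (G + G)"
            using Gh by (simp add: algebra_simps)
          then show "8 * fst ?s2 26 0 * ?c ?s2 Q + 64 * ?N ?s2 \<le> 3 * ?N ?s2 * fst ?s2 26 0"
            using s1 by (simp add: c1_def h_def)
        qed
        \<comment> \<open>With N values left, the potential 150 N G is halved, as N is divided by 4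
          and G doubles. The released 75 N G pays 70 G per value for the ranks and, because G \<ge>
          64, the lower-order terms as well.\<close>
        moreover have "t + 50 + 150 * (m * (G div 4)) * (G + G) \<le> 150 * (W - P) * G"
        proof -
          have "m > 0" by (simp add: m_def)
          then have "64 \<le> m * G" using G64 by (metis One_nat_def Suc_leI mult_le_mono nat_mult_1)
          have "t \<le> m * G * (70 * G + 175) + 5" using s1 Wm by simp
          moreover have "m * G * 240 \<le> m * G * (5 * G)" by (rule mult_le_mono2) (use G64 in simp)
          moreover have "150 * (m * (G div 4)) * (G + G) = 75 * (m * G * G)" using gG by (simp add: algebra_simps)
          moreover have "150 * (W - P) * G = 150 * (m * G * G)" using Wm by simp
          moreover have "m * G * (70 * G + 175) = 70 * (m * G * G) + 175 * (m * G)" "m * G * (5 * G) = 5 * (m * G * G)"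
            by (simp_all add: algebra_simps)
          ultimately show ?thesis using \<open>64 \<le> m * G\<close> by linarith
        qed
        ultimately show ?thesis using s1 G1 by auto
      qed
      done
  next
    fix t s' assume "\<exists>q. I s' q" and g: "\<not> bval (NLess (NAdd (var 22) (var 26)) (var 25)) s'"
      and t: "t + 150 * ?N s' * ?G s' \<le> 150 * ?N s * ?G s + bcost (NLess (NAdd (var 22) (var 26)) (var 25))"
    then obtain q where I: "I s' q" by blast
    have G: "64 dvd ?G s'" "?G s' > 0" "fst s' 25 0 = fst s' 22 0 + ?G s' * 8 ^ q" using I by (auto simp: I_def)
    have "8 ^ q \<le> (1::nat)"
    proof -
      have "?G s' * 8 ^ q \<le> ?G s' * 1" using g G by simp
      then show ?thesis using G(2) by simp
    qed
    then have "q = 0" using one_less_power[of "8::nat" q] by (cases "q = 0") auto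
    then have W: "fst s' 25 0 = fst s' 22 0 + ?G s'" using G by simp
    have G64: "?G s' \<ge> 64" using G(1,2) by (auto dest: dvd_imp_le)
    have "even (?G s')" using G(1) by (meson dvd_trans even_numeral)
    moreover have "2 * ?c s' Q < ?G s'" if "monotone_pred Q \<and> 4 * count (snd s 3) 0 ?W Q \<le> ?W" for Q
    proof -
      have "?G s' * (8 * ?c s' Q + 64) \<le> ?G s' * (3 * ?G s')"
        using I that W by (auto simp: I_def algebra_simps)
      then have "8 * ?c s' Q + 64 \<le> 3 * ?G s'" using G(2) by simp
      then show ?thesis by linarith
    qed
    moreover have "frame {18,19,20,22,23,25,26,27} {3} s s'" using I by (simp add: I_def)
    ultimately show "frame {18,19,20,22,23,25,26,27} {3} s s' \<and> fst s' 26 0 \<ge> 64 \<and> even (fst s' 26 0) \<and>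
      fst s' 25 0 = fst s' 22 0 + fst s' 26 0 \<and>
      (\<forall>Q. monotone_pred Q \<and> 4 * count (snd s 3) 0 ?W Q \<le> ?W \<longrightarrow> 2 * ?c s' Q < fst s' 26 0) \<and>
      t + 150 * fst s' 26 0 * fst s' 26 0 \<le> 9600 * ?W + 10"
      using W G64 t init by simp
  qed
qed

definition robust_com :: com where
  "robust_com = Seq (assign 22 (NConst 0)) (Seq (assign 26 (NConst 64)) (Seq reduce_com
     (Seq (assign 23 (NAdd (var 22) (var 26))) (Seq (assign 24 (NHalf (var 26))) pick_com))))"

lemma ex_rank_in: "i < b - a \<Longrightarrow> \<exists>x\<in>{a..<b}. rank_in V a b x = i"
  using rank_in_bij[of V a b] unfolding bij_betw_def by (metis atLeastLessThan_iff imageE zero_le)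

text \<open>A quarter of bad values can be tolerated at the start since 3/8 - 8/64 = 1/4. The single
  group that remains need not be small, but the potential 150 G^2 left over by
  \<open>reduce_com\<close> pays for the quadratic search in it.\<close>

lemma run_robust:
  assumes "fst s 25 0 = 64 * 8 ^ L"
  shows "run robust_com s (\<lambda>t s'. frame {18,19,20,22,23,24,25,26,27} {3,5} s s' \<and>
    (\<forall>Q. monotone_pred Q \<and> 4 * count (snd s 3) 0 (fst s 25 0) Q \<le> fst s 25 0 \<longrightarrow> \<not> Q (snd s' 5 0)) \<and>
    t \<le> 9600 * fst s 25 0 + 100)"
  unfolding robust_com_def
  apply simp
  apply (rule run_mono[OF run_reduce[where L = L]])
  subgoal by simp
  subgoal by simp
  subgoal using assms by simp
  subgoal premises s1 for t1 s1
  proof -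
    define s0 where "s0 = (upd (upd (fst s) 22 0 0) 26 0 64, snd s)"
    have f: "frame {18,19,20,22,23,24,25,26,27} {3,5} s s1"
      using frame_trans[of "{22,26}" "{}" s s0 _ _ s1] s1[folded s0_def] by (auto simp: s0_def upd_frame)
    obtain P G where PG: "fst s1 22 0 = P" "fst s1 26 0 = G" by blast
    have G: "G \<ge> 64" "even G" "fst s1 25 0 = P + G" using s1 PG by auto
    define s2 where "s2 = (upd (upd (fst s1) 23 0 (P + G)) 24 0 (G div 2), snd s1)"
    have s2: "fst s2 22 0 = P" "fst s2 23 0 = P + G" "fst s2 24 0 = G div 2" "snd s2 3 = snd s1 3"
      using PG by (simp_all add: s2_def)
    have f2: "frame {18,19,20,22,23,24,25,26,27} {3,5} s s2" using f by (simp add: s2_def upd_frame)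
    have ex: "\<exists>x\<in>{P..<P + G}. rank_in (snd s1 3) P (P + G) x = G div 2"
      by (rule ex_rank_in) (use G in simp)
    show ?thesis
      apply (simp add: PG s2_def[symmetric])
      apply (rule run_mono[OF run_pick])
      subgoal by (simp add: s2)
      subgoal using ex by (simp add: s2)
      subgoal premises s3 for t3 s3
      proof -
        have f3: "frame {18,19,20,22,23,24,25,26,27} {3,5} s s3"
          by (rule frame_trans[OF f2 conjunct1[OF s3]]) auto
        obtain x where x: "x \<in> {P..<P + G}" "rank_in (snd s1 3) P (P + G) x = G div 2" "snd s3 5 0 = snd s1 3 x"
          using s3 by (auto simp: s2)
        have "\<not> Q (snd s3 5 0)" if "monotone_pred Q" "4 * count (snd s 3) 0 (fst s 25 0) Q \<le> fst s 25 0" for Q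
        proof -
          have "2 * count (snd s1 3) P (P + G) Q < G" using s1 that PG G by simp
          then show ?thesis using rank_robust[OF that(1), of "snd s1 3" P "P + G" x] x by simp
        qed
        moreover have "t3 \<le> G * (70 * G + 75) + 20" using s3 by (simp add: s2)
        moreover have "G * (70 * G + 75) = 70 * (G * G) + 75 * G" by (simp add: algebra_simps)
        moreover have "64 * G \<le> G * G" using G by simp
        moreover have "t1 + 150 * (G * G) \<le> 9600 * fst s 25 0 + 10" using s1 PG by simp
        ultimately have "(\<forall>Q. monotone_pred Q \<and> 4 * count (snd s 3) 0 (fst s 25 0) Q \<le> fst s 25 0 \<longrightarrow> \<not> Q (snd s3 5 0))"
          "t1 + t3 \<le> 9600 * fst s 25 0 + 40" using G(1) by (blast | linarith)+
        then show ?thesis using f3 by auto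
      qed
      done
  qed
  done

section \<open>Decoding one column\<close>

text \<open>Swaps the two rows \<open>2b\<close> and \<open>2b + 1\<close> of a bucket.\<close>

definition sib :: "nat \<Rightarrow> nat" where
  "sib r = 4 * (r div 2) + 1 - r"

abbreviation (input) cur_row :: nexp where "cur_row \<equiv> NGet 3 (NAdd (var 15) (var 16))"

definition row_of :: "memory \<Rightarrow> nat \<Rightarrow> nat" where
  "row_of s \<tau> = fst s 3 (fst s 15 0 + \<tau>)"

definition count_com :: com where
  "count_com = Seq (assign 17 (NConst 0)) (Seq (assign 16 (NConst 0))
    (While (NLess (var 16) (NConst 256))
      (Seq (If (NLess (NGet 5 (NHalf cur_row)) (NConst 2)) (incr 17) Skip) (incr 16))))"

lemma run_count:
  "run count_com s (\<lambda>t s'. frame {16,17} {} s s' \<and>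
     fst s' 17 0 = card {\<tau> \<in> {0..<256}. fst s 5 (row_of s \<tau> div 2) < 2} \<and> t \<le> 15000)"
  unfolding count_com_def
  apply simp
  apply (rule run_for[where lo = 0 and N = 256 and T = 40 and
     I = "\<lambda>z s'. frame {16,17} {} s s' \<and> fst s' 17 0 = card {\<tau> \<in> {0..<z}. fst s 5 (row_of s \<tau> div 2) < 2}"])
  subgoal by simp
  subgoal by (simp add: frame_def)
  subgoal by simp
  subgoal by simp
  subgoal for z s'
  proof -
    assume z: "fst s' 16 0 = z"
      and I: "frame {16,17} {} s s' \<and> fst s' 17 0 = card {\<tau> \<in> {0..<z}. fst s 5 (row_of s \<tau> div 2) < 2}"
    have e: "fst s' 3 (fst s' 15 0 + z) = row_of s z" "fst s' 5 = fst s 5"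
      using I by (auto simp: row_of_def frame_def)
    have c: "card {\<tau> \<in> {0..<Suc z}. fst s 5 (row_of s \<tau> div 2) < 2} =
      card {\<tau> \<in> {0..<z}. fst s 5 (row_of s \<tau> div 2) < 2} + (if fst s 5 (row_of s z div 2) < 2 then 1 else 0)"
      by (rule card_filter_Suc) simp
    show ?thesis using I z e c by (simp add: upd_frame)
  qed
  subgoal by simp
  done

text \<open>The nested sums compute \<open>sib\<close> of the row, as naturals can only be added,
  subtracted and halved.\<close>

definition vals_com :: com where
  "vals_com = Seq (assign 16 (NConst 0))
    (While (NLess (var 16) (NConst 256))
      (Seq (assign 28 cur_row)
      (Seq (RSet 3 (var 16) (RSub (RGet 1 (var 28))
              (RGet 1 (NSub (NAdd (NAdd (NAdd (NHalf (var 28)) (NHalf (var 28))) (NAdd (NHalf (var 28)) (NHalf (var 28)))) (NConst 1)) (var 28)))))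
        (incr 16))))"

lemma run_vals:
  "run vals_com s (\<lambda>t s'. frame {16,28} {3} s s' \<and>
     (\<forall>\<tau><256. snd s' 3 \<tau> = snd s 1 (row_of s \<tau>) - snd s 1 (sib (row_of s \<tau>))) \<and> t \<le> 20000)"
  unfolding vals_com_def
  apply simp
  apply (rule run_for[where lo = 0 and N = 256 and T = 60 and
     I = "\<lambda>z s'. frame {16,28} {3} s s' \<and>
       (\<forall>\<tau><z. snd s' 3 \<tau> = snd s 1 (row_of s \<tau>) - snd s 1 (sib (row_of s \<tau>)))"])
  subgoal by simp
  subgoal by (simp add: frame_def)
  subgoal by simp
  subgoal by simp
  subgoal for z s'
  proof -
    assume z: "fst s' 16 0 = z"
      and I: "frame {16,28} {3} s s' \<and>
       (\<forall>\<tau><z. snd s' 3 \<tau> = snd s 1 (row_of s \<tau>) - snd s 1 (sib (row_of s \<tau>)))"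
    have e: "fst s' 3 (fst s' 15 0 + z) = row_of s z" "snd s' 1 = snd s 1"
      using I by (auto simp: row_of_def frame_def)
    have e': "snd s' (Suc 0) = snd s (Suc 0)" using I by (auto simp: frame_def)
    have sib: "Suc (r div 2 + r div 2 + (r div 2 + r div 2)) - r = sib r" for r
      by (simp add: sib_def)
    show ?thesis using I by (simp add: z e e' sib upd_frame less_Suc_eq)
  qed
  subgoal by simp
  done

definition update_com :: com where
  "update_com = Seq (assign 16 (NConst 0))
    (While (NLess (var 16) (NConst 256))
      (Seq (assign 28 cur_row)
      (Seq (RSet 1 (var 28) (RSub (RGet 1 (var 28)) (RGet 5 (NConst 0))))
      (Seq (NSet 5 (NHalf (var 28)) (NSub (NGet 5 (NHalf (var 28))) (NConst 1)))
        (incr 16)))))"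

lemma run_update:
  "run update_com s (\<lambda>t s'. frame {5,16,28} {1} s s' \<and>
     (\<forall>r. snd s' 1 r = snd s 1 r - (\<Sum>\<tau><256. if row_of s \<tau> = r then snd s 5 0 else 0)) \<and>
     (\<forall>b. fst s' 5 b = fst s 5 b - (\<Sum>\<tau><256. if row_of s \<tau> div 2 = b then 1 else 0)) \<and> t \<le> 20000)"
  unfolding update_com_def
  apply simp
  apply (rule run_for[where lo = 0 and N = 256 and T = 60 and
     I = "\<lambda>z s'. frame {5,16,28} {1} s s' \<and>
       (\<forall>r. snd s' 1 r = snd s 1 r - (\<Sum>\<tau><z. if row_of s \<tau> = r then snd s 5 0 else 0)) \<and>
       (\<forall>b. fst s' 5 b = fst s 5 b - (\<Sum>\<tau><z. if row_of s \<tau> div 2 = b then 1 else 0))"])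
  subgoal by simp
  subgoal by (simp add: frame_def)
  subgoal by simp
  subgoal by simp
  subgoal for z s'
  proof -
    assume z: "fst s' 16 0 = z"
      and I: "frame {5,16,28} {1} s s' \<and>
       (\<forall>r. snd s' 1 r = snd s 1 r - (\<Sum>\<tau><z. if row_of s \<tau> = r then snd s 5 0 else 0)) \<and>
       (\<forall>b. fst s' 5 b = fst s 5 b - (\<Sum>\<tau><z. if row_of s \<tau> div 2 = b then 1 else 0))"
    have e: "fst s' 3 (fst s' 15 0 + z) = row_of s z" "snd s' 5 = snd s 5"
      using I by (auto simp: row_of_def frame_def)
    show ?thesis using I by (simp add: z e upd_frame)
  qed
  subgoal by simp
  done

definition load_com :: com where
  "load_com = Seq (assign 16 (NConst 0))
    (While (NLess (var 16) (NConst 256))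
      (Seq (assign 28 (NHalf cur_row))
      (Seq (NSet 5 (var 28) (NAdd (NGet 5 (var 28)) (NConst 1)))
        (incr 16))))"

lemma run_load:
  "run load_com s (\<lambda>t s'. frame {5,16,28} {} s s' \<and>
     (\<forall>b. fst s' 5 b = fst s 5 b + (\<Sum>\<tau><256. if row_of s \<tau> div 2 = b then 1 else 0)) \<and> t \<le> 20000)"
  unfolding load_com_def
  apply simp
  apply (rule run_for[where lo = 0 and N = 256 and T = 60 and
     I = "\<lambda>z s'. frame {5,16,28} {} s s' \<and>
       (\<forall>b. fst s' 5 b = fst s 5 b + (\<Sum>\<tau><z. if row_of s \<tau> div 2 = b then 1 else 0))"])
  subgoal by simp
  subgoal by (simp add: frame_def)
  subgoal by simp
  subgoal by simp
  subgoal for z s'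
  proof -
    assume z: "fst s' 16 0 = z"
      and I: "frame {5,16,28} {} s s' \<and>
       (\<forall>b. fst s' 5 b = fst s 5 b + (\<Sum>\<tau><z. if row_of s \<tau> div 2 = b then 1 else 0))"
    have e: "fst s' 3 (fst s' 15 0 + z) = row_of s z"
      using I by (auto simp: row_of_def frame_def)
    show ?thesis using I by (simp add: z e upd_frame)
  qed
  subgoal by simp
  done

text \<open>The consequence of having rank 128 among 256 values that the error analysis relies on.
  Phrased through half lines it is independent of how ties are resolved.\<close>

definition is_median :: "(nat \<Rightarrow> real) \<Rightarrow> real \<Rightarrow> bool" where
  "is_median v z \<longleftrightarrow> (\<forall>Q. monotone_pred Q \<and> card {\<tau> \<in> {0..<256}. Q (v \<tau>)} < 128 \<longrightarrow> \<not> Q z)"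

definition decode_com :: com where
  "decode_com = Seq vals_com (Seq (assign 22 (NConst 0)) (Seq (assign 23 (NConst 256)) (Seq (assign 24 (NConst 128))
     (Seq pick_com (Seq (RSet 4 (NAdd (var 11) (var 21)) (RGet 5 (NConst 0))) update_com)))))"

lemma run_decode:
  "run decode_com s (\<lambda>t s'. frame {5,16,18,19,20,22,23,24,28} {1,3,4,5} s s' \<and>
     (\<exists>z. is_median (\<lambda>\<tau>. snd s 1 (row_of s \<tau>) - snd s 1 (sib (row_of s \<tau>))) z \<and>
        snd s' 4 = (snd s 4)(fst s 11 0 + fst s 21 0 := z) \<and>
        (\<forall>r. snd s' 1 r = snd s 1 r - (\<Sum>\<tau><256. if row_of s \<tau> = r then z else 0)) \<and>
        (\<forall>b. fst s' 5 b = fst s 5 b - (\<Sum>\<tau><256. if row_of s \<tau> div 2 = b then 1 else 0))) \<and>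
     t \<le> 5000000)"
proof -
  let ?X = "{5,16,18,19,20,22,23,24,28} :: nat set" and ?Y = "{1,3,4,5} :: nat set"
  let ?v = "\<lambda>\<tau>. snd s 1 (row_of s \<tau>) - snd s 1 (sib (row_of s \<tau>))"
  show ?thesis
    unfolding decode_com_def
    apply simp
    apply (rule run_mono[OF run_vals])
    subgoal premises s1 for t1 s1
    proof -
      have f1: "frame ?X ?Y s s1" using s1 by (auto intro: frame_mono)
      have v: "snd s1 3 \<tau> = ?v \<tau>" if "\<tau> < 256" for \<tau> using s1 that by blast
      define s2 where "s2 = (upd (upd (upd (fst s1) 22 0 0) 23 0 256) 24 0 128, snd s1)"
      have s2: "fst s2 22 0 = 0" "fst s2 23 0 = 256" "fst s2 24 0 = 128" "snd s2 = snd s1"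
        by (simp_all add: s2_def)
      have f2: "frame ?X ?Y s s2" using f1 by (simp add: s2_def upd_frame)
      show ?thesis
        apply (simp add: s2_def[symmetric])
        apply (rule run_mono[OF run_pick])
        subgoal by (simp add: s2)
        subgoal unfolding s2 by (rule ex_rank_in) simp
        subgoal premises s3 for t3 s3
        proof -
          have f3: "frame ?X ?Y s s3" by (rule frame_trans[OF f2 conjunct1[OF s3]]) auto
          obtain x where x: "x \<in> {0..<256}" "rank_in (snd s1 3) 0 256 x = 128" "snd s3 5 0 = snd s1 3 x"
            using s3 unfolding s2 by blast
          have t3: "t3 \<le> 256 * (70 * 256 + 75) + 20" using s3 by (simp add: s2)
          have med: "is_median ?v (snd s3 5 0)"
            unfolding is_median_def
          proof (intro allI impI)
            fix Q assume Q: "monotone_pred Q \<and> card {\<tau> \<in> {0..<256}. Q (?v \<tau>)} < 128"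
            have "{\<tau> \<in> {0..<256}. Q (?v \<tau>)} = {\<tau> \<in> {0..<256}. Q (snd s1 3 \<tau>)}" using v by auto
            then have "count (snd s1 3) 0 256 Q < 128" using Q by (simp only: count_def)
            then show "\<not> Q (snd s3 5 0)"
              using rank_robust[of Q "snd s1 3" 0 256 x] Q x by simp
          qed
          define s4 where "s4 = (fst s3, upd (snd s3) 4 (fst s3 11 0 + fst s3 21 0) (snd s3 5 0))"
          have f4: "frame ?X ?Y s s4" using f3 by (simp add: s4_def upd_frame)
          have e3: "fst s3 11 = fst s 11" "fst s3 21 = fst s 21" "fst s3 15 = fst s 15" "fst s3 3 = fst s 3"
            using f3 by (auto simp: frame_def)
          have e3': "fst s3 5 = fst s 5" "snd s3 1 = snd s 1" "snd s3 4 = snd s 4"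
          proof -
            have "frame {16,18,19,20,22,23,24,28} {3,5} s s3"
            proof (rule frame_trans[OF _ conjunct1[OF s3]])
              have "frame {16,18,19,20,22,23,24,28} {3,5} s s1" using s1 by (auto intro: frame_mono)
              then show "frame {16,18,19,20,22,23,24,28} {3,5} s s2" by (simp add: s2_def upd_frame)
            qed auto
            then show "fst s3 5 = fst s 5" "snd s3 1 = snd s 1" "snd s3 4 = snd s 4" by (auto simp: frame_def)
          qed
          have ro: "row_of s4 = row_of s" by (rule ext) (simp add: row_of_def s4_def e3)
          show ?thesis
            apply (simp add: s4_def[symmetric])
            apply (rule run_mono[OF run_update])
            subgoal premises s5 for t5 s5
            proof -
              have f5: "frame ?X ?Y s s5" by (rule frame_trans[OF f4 conjunct1[OF s5]]) auto
              have e4: "snd s4 5 = snd s3 5" "snd s4 1 = snd s 1" "fst s4 5 = fst s 5"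
                using e3' by (simp_all add: s4_def)
              have y5: "\<forall>r. snd s5 1 r = snd s 1 r - (\<Sum>\<tau><256. if row_of s \<tau> = r then snd s3 5 0 else 0)"
                and c5: "\<forall>b. fst s5 5 b = fst s 5 b - (\<Sum>\<tau><256. if row_of s \<tau> div 2 = b then 1 else 0)"
                using s5 unfolding ro e4 by blast+
              have "snd s5 4 = snd s4 4" using s5 by (simp add: frame_def)
              also have "\<dots> = (snd s 4)(fst s 11 0 + fst s 21 0 := snd s3 5 0)" by (simp add: s4_def e3 e3')
              finally have "snd s5 4 = (snd s 4)(fst s 11 0 + fst s 21 0 := snd s3 5 0)" .
              then show ?thesis using f5 y5 c5 med s1 t3 s5 by auto
            qed
            done
        qed
        done
    qed
    done
qed

section \<open>Peeling\<close>

definition load :: "(nat \<Rightarrow> nat \<Rightarrow> nat) \<Rightarrow> nat set \<Rightarrow> nat \<Rightarrow> nat" where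
  "load rw R b = (\<Sum>j\<in>R. \<Sum>\<tau><256. if rw j \<tau> div 2 = b then 1 else 0)"

text \<open>The bound 2 includes the column's own entry: for j \<in> R it says that nothing else is
  in the bucket.\<close>

definition lone :: "(nat \<Rightarrow> nat \<Rightarrow> nat) \<Rightarrow> nat set \<Rightarrow> nat \<Rightarrow> nat set" where
  "lone rw R j = {\<tau> \<in> {0..<256}. load rw R (rw j \<tau> div 2) < 2}"

definition resid :: "(nat \<Rightarrow> real) \<Rightarrow> (nat \<Rightarrow> nat \<Rightarrow> nat) \<Rightarrow> (nat \<Rightarrow> real) \<Rightarrow> nat set \<Rightarrow> nat \<Rightarrow> real" where
  "resid y rw X D r = y r - (\<Sum>j\<in>D. \<Sum>\<tau><256. if rw j \<tau> = r then X j else 0)"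

text \<open>The history of a decoder with its memory abstracted away. How the next column is
  selected is left open, so the error analysis holds for any peeling order; success is
  \<open>decodes y rw X J J\<close>.\<close>

inductive decodes :: "(nat \<Rightarrow> real) \<Rightarrow> (nat \<Rightarrow> nat \<Rightarrow> nat) \<Rightarrow> (nat \<Rightarrow> real) \<Rightarrow> nat set \<Rightarrow> nat set \<Rightarrow> bool"
  for y rw X J where
  start: "decodes y rw X J {}"
| step: "decodes y rw X J D \<Longrightarrow> j \<in> J - D \<Longrightarrow> 224 \<le> card (lone rw (J - D) j) \<Longrightarrow>
    is_median (\<lambda>\<tau>. resid y rw X D (rw j \<tau>) - resid y rw X D (sib (rw j \<tau>))) (X j) \<Longrightarrow>
    decodes y rw X J (insert j D)"

lemma resid_cong: "(\<And>j. j \<in> D \<Longrightarrow> X j = X' j) \<Longrightarrow> resid y rw X D = resid y rw X' D"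
  unfolding resid_def by (intro ext arg_cong2[where f = "(-)"] sum.cong) auto

lemma decodes_cong: "decodes y rw X J D \<Longrightarrow> (\<And>j. j \<in> D \<Longrightarrow> X j = X' j) \<Longrightarrow> decodes y rw X' J D"
proof (induction rule: decodes.induct)
  case start
  show ?case by (rule decodes.start)
next
  case (step D j)
  have "resid y rw X D = resid y rw X' D" by (rule resid_cong) (use step.prems in auto)
  then show ?case
    using step by (intro decodes.step) auto
qed

lemma load_mono: "finite R' \<Longrightarrow> R \<subseteq> R' \<Longrightarrow> load rw R b \<le> load rw R' b"
  unfolding load_def by (rule sum_mono2) auto

text \<open>Removing columns only frees buckets. Hence a column rejected in the middle of a pass was
  already bad for the larger set present at the start of that pass.\<close>

lemma lone_antimono: "finite R' \<Longrightarrow> R \<subseteq> R' \<Longrightarrow> lone rw R' j \<subseteq> lone rw R j"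
  unfolding lone_def using load_mono[of R' R rw] by (auto intro: le_less_trans)

text \<open>All subsets are quantified because the set that remains at the start of a pass is not
  known in advance.\<close>

definition peelable :: "(nat \<Rightarrow> nat \<Rightarrow> nat) \<Rightarrow> nat set \<Rightarrow> bool" where
  "peelable rw J \<longleftrightarrow> (\<forall>T\<subseteq>J. 2 * card {j \<in> T. card (lone rw T j) < 224} \<le> card T)"

definition step_com :: com where
  "step_com = Seq (assign 21 (NGet 6 (var 14))) (Seq (assign 15 (NAdd (NGet 2 (var 21)) (var 10)))
    (Seq count_com (Seq
       (If (NLess (NConst 223) (var 17)) decode_com (Seq (NSet 6 (var 13) (var 21)) (incr 13)))
       (incr 14))))"

definition pass_com :: com where
  "pass_com = Seq (assign 13 (NConst 0)) (Seq (assign 14 (NConst 0))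
     (While (NLess (var 14) (var 12)) step_com))"

text \<open>A pass that decodes less than half of the columns gives up, so the total time stays linear for
  every matrix.\<close>

definition peel_com :: com where
  "peel_com = While (NLess (NConst 0) (var 12)) (Seq pass_com
     (If (NLess (var 12) (NAdd (var 13) (var 13))) (assign 12 (NConst 0)) (assign 12 (var 13))))"

definition touched_n :: "nat set" where "touched_n = {5,6,12,13,14,15,16,17,18,19,20,21,22,23,24,28}"
definition touched_r :: "nat set" where "touched_r = {1,3,4,5}"

definition row0 :: "memory \<Rightarrow> nat \<Rightarrow> nat \<Rightarrow> nat" where
  "row0 s j \<tau> = fst s 3 (fst s 2 j + fst s 10 0 + \<tau>)"

text \<open>\<open>copy_inv s J s' D\<close>: in a copy that started in memory \<open>s\<close>, the columns \<open>D\<close> have been decoded.\<close>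

definition copy_inv :: "memory \<Rightarrow> nat set \<Rightarrow> memory \<Rightarrow> nat set \<Rightarrow> bool" where
  "copy_inv s J s' D \<longleftrightarrow> frame touched_n touched_r s s' \<and> D \<subseteq> J \<and>
     decodes (snd s 1) (row0 s) (\<lambda>j. snd s' 4 (fst s 11 0 + j)) J D \<and>
     (\<forall>i. i \<notin> (+) (fst s 11 0) ` D \<longrightarrow> snd s' 4 i = snd s 4 i) \<and>
     (\<forall>r. snd s' 1 r = resid (snd s 1) (row0 s) (\<lambda>j. snd s' 4 (fst s 11 0 + j)) D r) \<and>
     (\<forall>b. fst s' 5 b = fst s 5 b + load (row0 s) (J - D) b)"

lemma copy_inv_cong:
  assumes "copy_inv s J s' D" "frame touched_n touched_r s' s''" "snd s'' 4 = snd s' 4" "snd s'' 1 = snd s' 1" "fst s'' 5 = fst s' 5"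
  shows "copy_inv s J s'' D"
  using assms unfolding copy_inv_def by (auto intro: frame_trans)

lemma load_remove: "finite R \<Longrightarrow> j \<in> R \<Longrightarrow>
  load rw (R - {j}) b = load rw R b - (\<Sum>\<tau><256. if rw j \<tau> div 2 = b then 1 else 0)"
  unfolding load_def by (simp add: sum.remove)

lemma load_ge: "finite R \<Longrightarrow> j \<in> R \<Longrightarrow> (\<Sum>\<tau><256. if rw j \<tau> div 2 = b then 1 else 0) \<le> load rw R b"
  unfolding load_def by (rule member_le_sum) auto

text \<open>By \<open>zero\<close> the buckets of J carry no counts from earlier copies, so the
  counters in array 5 equal \<open>load\<close> there and the test of the program is exactly the
  condition in \<open>decodes\<close>.\<close>

lemma run_step:
  assumes C: "copy_inv s J s1 D" and J: "finite J"
    and zero: "\<And>j \<tau>. j \<in> J \<Longrightarrow> \<tau> < 256 \<Longrightarrow> fst s 5 (row0 s j \<tau> div 2) = 0"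
    and j: "fst s1 6 (fst s1 14 0) = j" "j \<in> J - D"
  shows "run step_com s1 (\<lambda>t s2. frame touched_n touched_r s1 s2 \<and> t \<le> 5100000 \<and>
     fst s2 14 0 = Suc (fst s1 14 0) \<and> fst s2 12 = fst s1 12 \<and>
     (if 224 \<le> card (lone (row0 s) (J - D) j)
      then copy_inv s J s2 (insert j D) \<and> fst s2 13 = fst s1 13 \<and> fst s2 6 = fst s1 6
      else copy_inv s J s2 D \<and> fst s2 13 0 = Suc (fst s1 13 0) \<and> fst s2 6 = (fst s1 6)(fst s1 13 0 := j)))"
proof -
  have f: "frame touched_n touched_r s s1" using C by (simp add: copy_inv_def)
  have e: "fst s1 2 = fst s 2" "fst s1 3 = fst s 3" "fst s1 10 = fst s 10" "fst s1 11 = fst s 11"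
    using f by (auto simp: frame_def touched_n_def)
  define s2 where "s2 = (upd (upd (fst s1) 21 0 j) 15 0 (fst s 2 j + fst s 10 0), snd s1)"
  have f2: "frame touched_n touched_r s1 s2" by (simp add: s2_def frame_def touched_n_def)
  have ro: "row_of s2 = row0 s j" by (rule ext) (simp add: row_of_def row0_def s2_def e)
  have c5: "fst s2 5 (row0 s j \<tau> div 2) = load (row0 s) (J - D) (row0 s j \<tau> div 2)" if "\<tau> < 256" for \<tau>
    using C zero j that by (simp add: copy_inv_def s2_def)
  have cl: "{\<tau> \<in> {0..<256}. fst s2 5 (row_of s2 \<tau> div 2) < 2} = lone (row0 s) (J - D) j"
    unfolding lone_def ro using c5 by auto
  show ?thesis
    unfolding step_com_def
    apply (simp add: j e s2_def[symmetric])
    apply (rule run_mono[OF run_count])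
    subgoal premises s3 for t3 s3
    proof -
      have u: "fst s3 17 0 = card (lone (row0 s) (J - D) j)" using s3 cl by simp
      have e3: "fst s3 14 = fst s1 14" "fst s3 13 = fst s1 13" "fst s3 12 = fst s1 12" "fst s3 6 = fst s1 6"
        "fst s3 21 0 = j" "snd s3 = snd s1" "fst s3 5 = fst s1 5" "fst s3 11 = fst s 11"
        using s3 e by (auto simp: frame_def s2_def)
      have f3: "frame touched_n touched_r s1 s3"
        by (rule frame_trans[OF f2 conjunct1[OF s3]]) (auto simp: touched_n_def)
      have C3: "copy_inv s J s3 D" by (rule copy_inv_cong[OF C f3]) (simp_all add: e3)
      have ro3: "row_of s3 = row0 s j"
        using s3 e by (intro ext) (auto simp: row_of_def row0_def s2_def frame_def)
      show ?thesis
      proof (cases "224 \<le> card (lone (row0 s) (J - D) j)")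
        case False
        let ?s4 = "(upd (upd (upd (fst s3) 6 (fst s1 13 0) j) 13 0 (Suc (fst s1 13 0))) 14 0 (Suc (fst s1 14 0)), snd s3)"
        have f4: "frame touched_n touched_r s1 ?s4" using f3 by (simp add: frame_def touched_n_def)
        have "copy_inv s J ?s4 D"
          by (rule copy_inv_cong[OF C f4]) (simp_all add: e3)
        then show ?thesis using False u f4 s3 by (simp add: e3)
      next
        case True
        have "run decode_com s3 (\<lambda>t s4. t3 + t \<le> 5099900 \<and> frame touched_n touched_r s1 s4 \<and> fst s4 14 = fst s1 14 \<and>
           fst s4 13 = fst s1 13 \<and> fst s4 12 = fst s1 12 \<and> fst s4 6 = fst s1 6 \<and> copy_inv s J s4 (insert j D))"
        proof (rule run_mono[OF run_decode])
          fix t :: nat and s4 :: memory assume s4: "frame {5,16,18,19,20,22,23,24,28} {1,3,4,5} s3 s4 \<and>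
            (\<exists>z. is_median (\<lambda>\<tau>. snd s3 1 (row_of s3 \<tau>) - snd s3 1 (sib (row_of s3 \<tau>))) z \<and>
              snd s4 4 = (snd s3 4)(fst s3 11 0 + fst s3 21 0 := z) \<and>
              (\<forall>r. snd s4 1 r = snd s3 1 r - (\<Sum>\<tau><256. if row_of s3 \<tau> = r then z else 0)) \<and>
              (\<forall>b. fst s4 5 b = fst s3 5 b - (\<Sum>\<tau><256. if row_of s3 \<tau> div 2 = b then 1 else 0))) \<and>
           t \<le> 5000000"
          then obtain z where z: "is_median (\<lambda>\<tau>. snd s3 1 (row0 s j \<tau>) - snd s3 1 (sib (row0 s j \<tau>))) z"
              "snd s4 4 = (snd s3 4)(fst s 11 0 + j := z)"
              "\<And>r. snd s4 1 r = snd s3 1 r - (\<Sum>\<tau><256. if row0 s j \<tau> = r then z else 0)"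
              "\<And>b. fst s4 5 b = fst s3 5 b - (\<Sum>\<tau><256. if row0 s j \<tau> div 2 = b then 1 else 0)"
            unfolding ro3 e3 by blast
          have f4: "frame touched_n touched_r s1 s4"
            by (rule frame_trans[OF f3 conjunct1[OF s4]]) (auto simp: touched_n_def touched_r_def)
          define X where "X = (\<lambda>i. snd s3 4 (fst s 11 0 + i))"
          define X' where "X' = (\<lambda>i. snd s4 4 (fst s 11 0 + i))"
          have X': "X' = X(j := z)" by (auto simp: X'_def X_def z(2))
          have jD: "j \<notin> D" using j by simp
          have Xj: "X' j = z" by (simp add: X')
          have dX: "decodes (snd s 1) (row0 s) X J D" using C3 unfolding copy_inv_def X_def by blast
          have dX': "decodes (snd s 1) (row0 s) X' J D"
            by (rule decodes_cong[OF dX]) (use jD in \<open>auto simp: X'\<close>)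
          have rX: "resid (snd s 1) (row0 s) X' D = snd s3 1"
          proof -
            have "resid (snd s 1) (row0 s) X' D = resid (snd s 1) (row0 s) X D"
              by (rule resid_cong) (use jD in \<open>auto simp: X'\<close>)
            also have "\<dots> = snd s3 1" using C3 unfolding copy_inv_def X_def by (intro ext) simp
            finally show ?thesis .
          qed
          have finD: "finite D" using C J by (auto simp: copy_inv_def intro: finite_subset)
          have "copy_inv s J s4 (insert j D)"
            unfolding copy_inv_def X'_def[symmetric]
          proof (intro conjI allI impI)
            show "frame touched_n touched_r s s4" by (rule frame_trans[OF f f4]) auto
            show "insert j D \<subseteq> J" using j C by (auto simp: copy_inv_def)
            show "decodes (snd s 1) (row0 s) X' J (insert j D)"
              by (rule decodes.step[OF dX' j(2) True]) (use z(1) rX in \<open>simp add: X'\<close>)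
          next
            fix i assume i: "i \<notin> (+) (fst s 11 0) ` insert j D"
            then have "snd s4 4 i = snd s3 4 i" using z(2) by auto
            also have "\<dots> = snd s 4 i" using C3 i by (auto simp: copy_inv_def)
            finally show "snd s4 4 i = snd s 4 i" .
          next
            fix r
            have "resid (snd s 1) (row0 s) X' (insert j D) r = resid (snd s 1) (row0 s) X' D r - (\<Sum>\<tau><256. if row0 s j \<tau> = r then z else 0)"
              unfolding resid_def using finD jD by (simp add: algebra_simps Xj cong: if_cong)
            then show "snd s4 1 r = resid (snd s 1) (row0 s) X' (insert j D) r" using z(3) rX by simp
          next
            fix b
            have R: "J - insert j D = (J - D) - {j}" by auto
            have "fst s3 5 b = fst s 5 b + load (row0 s) (J - D) b" using C3 by (simp add: copy_inv_def)
            \<comment> \<open>\<open>load_ge\<close> ensures that the truncated subtraction on the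
              counters loses nothing.\<close>
            then show "fst s4 5 b = fst s 5 b + load (row0 s) (J - insert j D) b"
              unfolding R using load_remove[of "J - D" j "row0 s" b] load_ge[of "J - D" j "row0 s" b] j J z(4)[of b] by simp
          qed
          moreover have "fst s4 14 = fst s3 14" "fst s4 13 = fst s3 13" "fst s4 12 = fst s3 12" "fst s4 6 = fst s3 6"
            using s4 by (auto simp: frame_def)
          ultimately show "t3 + t \<le> 5099900 \<and> frame touched_n touched_r s1 s4 \<and> fst s4 14 = fst s1 14 \<and>
           fst s4 13 = fst s1 13 \<and> fst s4 12 = fst s1 12 \<and> fst s4 6 = fst s1 6 \<and> copy_inv s J s4 (insert j D)"
            using f4 s3 s4 by (simp add: e3)
        qed
        then have "run decode_com s3 (\<lambda>t s4. frame touched_n touched_r s1 (upd (fst s4) 14 0 (Suc (fst s1 14 0)), snd s4) \<and>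
            t3 + t \<le> 5099900 \<and> fst s4 14 0 = fst s1 14 0 \<and> fst s4 12 = fst s1 12 \<and>
            copy_inv s J (upd (fst s4) 14 0 (Suc (fst s1 14 0)), snd s4) (insert j D) \<and> fst s4 13 = fst s1 13 \<and> fst s4 6 = fst s1 6)"
          apply (rule run_mono)
          subgoal premises p for t s4
          proof -
            have "copy_inv s J (upd (fst s4) 14 0 (Suc (fst s1 14 0)), snd s4) (insert j D)"
              by (rule copy_inv_cong[where s' = s4]) (use p in \<open>auto simp: frame_def touched_n_def\<close>)
            then show ?thesis using p by (simp add: frame_def touched_n_def)
          qed
          done
        moreover have "223 < fst s3 17 0" using True u by simp
        ultimately show ?thesis
          using True
          apply simp
          apply (erule run_mono)
          apply simp
          done
      qed
    qed
    done
qed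

lemma run_pass:
  assumes C: "copy_inv s J s1 D1" and J: "finite J"
    and zero: "\<And>j \<tau>. j \<in> J \<Longrightarrow> \<tau> < 256 \<Longrightarrow> fst s 5 (row0 s j \<tau> div 2) = 0"
    and L: "fst s1 12 0 = length L" "\<And>i. i < length L \<Longrightarrow> fst s1 6 i = L ! i" "distinct L" "set L = J - D1"
  shows "run pass_com s1 (\<lambda>t s2. \<exists>D K. copy_inv s J s2 D \<and> fst s2 12 0 = length L \<and> fst s2 13 0 = length K \<and>
     (\<forall>i < length K. fst s2 6 i = K ! i) \<and> distinct K \<and> set K = J - D \<and>
     set K \<subseteq> {j \<in> set L. card (lone (row0 s) (set L) j) < 224} \<and>
     t \<le> length L * 5100010 + 50)"
proof -
  \<comment> \<open>The list is compacted in place: K holds the rejected columns, rewritten at the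
    front, and \<open>drop p L\<close> is still unread. Writing never overtakes reading because
    \<open>length K \<le> p\<close>.\<close>
  define I where "I p s2 \<longleftrightarrow> (\<exists>D K. copy_inv s J s2 D \<and> fst s2 12 0 = length L \<and> fst s2 13 0 = length K \<and> length K \<le> p \<and>
     (\<forall>i < length K. fst s2 6 i = K ! i) \<and> (\<forall>i. p \<le> i \<and> i < length L \<longrightarrow> fst s2 6 i = L ! i) \<and>
     distinct (K @ drop p L) \<and> set (K @ drop p L) = J - D \<and>
     set K \<subseteq> {j \<in> set L. card (lone (row0 s) (set L) j) < 224})" for p s2
  define s0 where "s0 = (upd (upd (fst s1) 13 0 0) 14 0 0, snd s1)"
  have "copy_inv s J s0 D1"
    by (rule copy_inv_cong[OF C]) (simp_all add: s0_def frame_def touched_n_def)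
  then have I0: "I 0 s0" unfolding I_def
    by (intro exI[of _ D1] exI[of _ "[]"]) (use L in \<open>simp add: s0_def\<close>)
  have finL: "finite (set L)" by simp
  show ?thesis
    unfolding pass_com_def
    apply (simp add: s0_def[symmetric])
    apply (rule run_for[where lo = 0 and N = "length L" and T = 5100000 and I = I])
    subgoal by simp
    subgoal by (rule I0)
    subgoal by (simp add: s0_def)
    subgoal by (auto simp: I_def)
    subgoal premises pr for p s2
    proof -
      note p = pr(2) and pv = pr(4)
      obtain D K where C2: "copy_inv s J s2 D" and len: "fst s2 12 0 = length L" "fst s2 13 0 = length K" "length K \<le> p"
        and K: "\<And>i. i < length K \<Longrightarrow> fst s2 6 i = K ! i" and rest: "\<And>i. p \<le> i \<Longrightarrow> i < length L \<Longrightarrow> fst s2 6 i = L ! i"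
        and dist: "distinct (K @ drop p L)" and set: "set (K @ drop p L) = J - D"
        and sub: "set K \<subseteq> {j \<in> set L. card (lone (row0 s) (set L) j) < 224}"
        using pr(3) unfolding I_def by blast
      define j where "j = L ! p"
      have dr: "drop p L = j # drop (Suc p) L" using p by (simp add: j_def Cons_nth_drop_Suc)
      have jJ: "j \<in> J - D" using set dr by auto
      have j6: "fst s2 6 (fst s2 14 0) = j" using rest[of p] p pv by (simp add: j_def)
      have subL: "J - D \<subseteq> set L"
        using set sub set_drop_subset[of p L] by auto
      show ?thesis
      proof (rule run_mono[OF run_step[OF C2 J zero j6 jJ]], assumption, assumption, goal_cases)
        case (1 t s3)
        show ?case
        proof (cases "224 \<le> card (lone (row0 s) (J - D) j)")
          case True
          have c: "copy_inv s J s3 (insert j D)" "fst s3 13 = fst s2 13" "fst s3 6 = fst s2 6" "fst s3 12 = fst s2 12"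
            using 1 True by auto
          have "I (Suc p) s3"
            unfolding I_def
          proof (intro exI[of _ "insert j D"] exI[of _ K] conjI allI impI)
            show "set (K @ drop (Suc p) L) = J - insert j D" "distinct (K @ drop (Suc p) L)"
              using set dist jJ by (auto simp: dr)
          qed (use c len K rest sub in auto)
          then show ?thesis using 1 pv by simp
        next
          case False
          have c: "copy_inv s J s3 D" "fst s3 13 0 = Suc (length K)" "fst s3 6 = (fst s2 6)(length K := j)" "fst s3 12 = fst s2 12"
            using 1 False len by auto
          have "card (lone (row0 s) (set L) j) \<le> card (lone (row0 s) (J - D) j)"
            by (rule card_mono[OF _ lone_antimono[OF finL subL]]) (simp add: lone_def)
          then have bad: "card (lone (row0 s) (set L) j) < 224" using False by simp
          have "I (Suc p) s3"
            unfolding I_def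
          proof (intro exI[of _ D] exI[of _ "K @ [j]"] conjI allI impI)
            show "set ((K @ [j]) @ drop (Suc p) L) = J - D" "distinct ((K @ [j]) @ drop (Suc p) L)"
              using set dist jJ by (auto simp: dr)
            show "set (K @ [j]) \<subseteq> {j \<in> set L. card (lone (row0 s) (set L) j) < 224}"
              using sub bad subL jJ by auto
            fix i assume "i < length (K @ [j])"
            then show "fst s3 6 i = (K @ [j]) ! i" using c K by (auto simp: nth_append less_Suc_eq)
          qed (use c len rest in auto)
          then show ?thesis using 1 pv by simp
        qed
      qed
    qed
    subgoal premises pr for t s2
      using pr unfolding I_def by (auto simp: algebra_simps)
    done
qed

text \<open>The potential per listed column is twice the cost of a pass per column, since a pass
  after which the loop goes on has at least halved the list. The invariant allows stopping early
  only after a pass that refutes \<open>peelable\<close>.\<close>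

lemma run_peel:
  assumes C: "copy_inv s J s1 {}" and J: "finite J"
    and zero: "\<And>j \<tau>. j \<in> J \<Longrightarrow> \<tau> < 256 \<Longrightarrow> fst s 5 (row0 s j \<tau> div 2) = 0"
    and L: "fst s1 12 0 = length L" "\<And>i. i < length L \<Longrightarrow> fst s1 6 i = L ! i" "distinct L" "set L = J"
  shows "run peel_com s1 (\<lambda>t s2. \<exists>D. copy_inv s J s2 D \<and> (peelable (row0 s) J \<longrightarrow> D = J) \<and>
     t \<le> 10201000 * length L + 10)"
proof -
  define I where "I s2 \<longleftrightarrow> (\<exists>D. copy_inv s J s2 D \<and>
     ((\<exists>L. fst s2 12 0 = length L \<and> (\<forall>i < length L. fst s2 6 i = L ! i) \<and> distinct L \<and> set L = J - D) \<or>
      (fst s2 12 0 = 0 \<and> \<not> peelable (row0 s) J)))" for s2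
  show ?thesis
    unfolding peel_com_def
  proof (rule run_While[where I = I and \<Phi> = "\<lambda>s2. 10201000 * fst s2 12 0"])
    show "I s1" unfolding I_def by (rule exI[of _ "{}"]) (use C L in auto)
  next
    fix s2 assume "I s2" and g: "bval (NLess (NConst 0) (var 12)) s2"
    then obtain D L where C2: "copy_inv s J s2 D" and L: "fst s2 12 0 = length L" "\<And>i. i < length L \<Longrightarrow> fst s2 6 i = L ! i"
        "distinct L" "set L = J - D" unfolding I_def by auto
    have pos: "0 < length L" using g L by simp
    show "run (Seq pass_com (If (NLess (var 12) (NAdd (var 13) (var 13))) (assign 12 (NConst 0)) (assign 12 (var 13)))) s2
        (\<lambda>t s3. I s3 \<and> t + bcost (NLess (NConst 0) (var 12)) + 10201000 * fst s3 12 0 \<le> 10201000 * fst s2 12 0)"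
      apply simp
      apply (rule run_mono[OF run_pass[OF C2 J zero L]])
        apply assumption+
      subgoal premises pr for t s3
      proof -
        obtain D' K where C3: "copy_inv s J s3 D'" and l: "fst s3 12 0 = length L" "fst s3 13 0 = length K"
          and K: "\<And>i. i < length K \<Longrightarrow> fst s3 6 i = K ! i" "distinct K" "set K = J - D'"
          and sub: "set K \<subseteq> {j \<in> set L. card (lone (row0 s) (set L) j) < 224}"
          and t: "t \<le> length L * 5100010 + 50" using pr by blast
        show ?thesis
        proof (cases "length L < length K + length K")
          case True
          have "card (set K) \<le> card {j \<in> set L. card (lone (row0 s) (set L) j) < 224}"
            by (rule card_mono[OF _ sub]) simp
          then have "\<not> 2 * card {j \<in> set L. card (lone (row0 s) (set L) j) < 224} \<le> card (set L)"
            using True L(3) K(2) by (simp add: distinct_card)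
          then have np: "\<not> peelable (row0 s) J" unfolding peelable_def using L(4) by blast
          have "copy_inv s J (upd (fst s3) 12 0 0, snd s3) D'"
            by (rule copy_inv_cong[OF C3]) (simp_all add: frame_def touched_n_def)
          then have "I (upd (fst s3) 12 0 0, snd s3)" unfolding I_def
            by (intro exI[of _ D']) (use np in simp)
          moreover have "t + 20 \<le> 10201000 * length L" using t pos by linarith
          ultimately show ?thesis using True l L by simp
        next
          case False
          have "copy_inv s J (upd (fst s3) 12 0 (length K), snd s3) D'"
            by (rule copy_inv_cong[OF C3]) (simp_all add: frame_def touched_n_def)
          then have "I (upd (fst s3) 12 0 (length K), snd s3)" unfolding I_def
            by (intro exI[of _ D'] conjI disjI1 exI[of _ K]) (use K in simp_all)
          moreover have "2 * length K \<le> length L" using False by simp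
          then have "t + 20 + 10201000 * length K \<le> 10201000 * length L" using t pos by linarith
          ultimately show ?thesis using False l L by simp
        qed
      qed
      done
  next
    fix t s2 assume "I s2" and g: "\<not> bval (NLess (NConst 0) (var 12)) s2"
      and t: "t + 10201000 * fst s2 12 0 \<le> 10201000 * fst s1 12 0 + bcost (NLess (NConst 0) (var 12))"
    then obtain D where D: "copy_inv s J s2 D" "J - D = {} \<or> \<not> peelable (row0 s) J"
      unfolding I_def by auto
    have "D \<subseteq> J" using D by (simp add: copy_inv_def)
    then show "\<exists>D. copy_inv s J s2 D \<and> (peelable (row0 s) J \<longrightarrow> D = J) \<and> t \<le> 10201000 * length L + 10"
      using D t L by (intro exI[of _ D]) auto
  qed
qed

definition init_com :: com where
  "init_com = Seq (assign 14 (NConst 0)) (Seq (While (NLess (var 14) (NGet 0 (NConst 1)))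
     (Seq (assign 21 (NGet 1 (var 14))) (Seq (NSet 6 (var 14) (var 21))
        (Seq (assign 15 (NAdd (NGet 2 (var 21)) (var 10))) (Seq load_com (incr 14))))))
     (assign 12 (NGet 0 (NConst 1))))"

lemma run_init:
  assumes ss: "fst s 0 1 = length ss" "\<And>i. i < length ss \<Longrightarrow> fst s 1 i = ss ! i" "distinct ss" "set ss = J"
  shows "run init_com s (\<lambda>t s1. copy_inv s J s1 {} \<and> fst s1 12 0 = length ss \<and> (\<forall>i < length ss. fst s1 6 i = ss ! i) \<and>
    t \<le> length ss * 20200 + 20)"
proof -
  define I where "I p s1 \<longleftrightarrow> frame touched_n {} s s1 \<and> (\<forall>i < p. fst s1 6 i = ss ! i) \<and>
    (\<forall>b. fst s1 5 b = fst s 5 b + load (row0 s) (set (take p ss)) b)" for p s1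
  show ?thesis
    unfolding init_com_def
    apply simp
    apply (rule run_for[where lo = 0 and N = "length ss" and T = 20100 and I = I])
    subgoal by simp
    subgoal by (simp add: I_def load_def frame_def touched_n_def)
    subgoal by simp
    subgoal using ss(1) by (auto simp: I_def frame_def touched_n_def)
    subgoal premises pr for p s1
    proof -
      note I = pr(3)[unfolded I_def] and p = pr(2) and pv = pr(4)
      have e: "fst s1 1 p = ss ! p" "fst s1 2 = fst s 2" "fst s1 10 = fst s 10" "fst s1 3 = fst s 3"
        using I ss p by (auto simp: frame_def touched_n_def)
      have e': "fst s1 (Suc 0) p = ss ! p" using e(1) by simp
      define s2 where "s2 = (upd (upd (upd (fst s1) 21 0 (ss ! p)) 6 p (ss ! p)) 15 0 (fst s 2 (ss ! p) + fst s 10 0), snd s1)"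
      have f2: "frame touched_n {} s s2" using I by (simp add: s2_def frame_def touched_n_def)
      have ro: "row_of s2 = row0 s (ss ! p)" by (rule ext) (simp add: row_of_def row0_def s2_def e)
      show ?thesis
        apply (simp add: pv e e' s2_def[symmetric])
        apply (rule run_mono[OF run_load])
        subgoal premises s3 for t s3
        proof -
          have f3: "frame touched_n {} s s3"
            by (rule frame_trans[OF f2 conjunct1[OF s3]]) (auto simp: touched_n_def)
          have e3: "fst s3 6 = fst s2 6" "fst s3 14 = fst s2 14" using s3 by (auto simp: frame_def)
          have tk: "set (take (Suc p) ss) = insert (ss ! p) (set (take p ss))"
            using p by (simp add: take_Suc_conv_app_nth)
          have nin: "ss ! p \<notin> set (take p ss)"
          proof -
            have "distinct (take (Suc p) ss)" using ss(3) by simp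
            then show ?thesis using p by (simp add: take_Suc_conv_app_nth)
          qed
          have c: "fst s3 5 b = fst s 5 b + load (row0 s) (set (take (Suc p) ss)) b" for b
          proof -
            have "fst s2 5 b = fst s 5 b + load (row0 s) (set (take p ss)) b" using I by (simp add: s2_def)
            then show ?thesis using s3 nin unfolding tk ro by (simp add: load_def)
          qed
          have "I (Suc p) (upd (fst s3) 14 0 (Suc p), snd s3)"
            unfolding I_def using f3 c e3 I by (auto simp: frame_def touched_n_def s2_def less_Suc_eq)
          then show ?thesis using s3 e3 pv by (simp add: s2_def)
        qed
        done
    qed
    subgoal premises pr for t s1
    proof -
      note I = pr(1)[unfolded I_def]
      let ?s2 = "(upd (fst s1) 12 0 (length ss), snd s1)"
      have n: "fst s1 0 1 = length ss" using I ss by (simp add: frame_def touched_n_def)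
      have n': "fst s1 0 (Suc 0) = length ss" using n by simp
      have r: "snd s1 = snd s" using I by (auto simp: frame_def)
      have "copy_inv s J ?s2 {}"
        unfolding copy_inv_def using I ss(4)
        by (auto simp: r resid_def intro: decodes.start) (auto simp: frame_def touched_n_def)
      then show ?thesis using I pr n' by (simp add: algebra_simps)
    qed
    done
qed

lemma sib_div2: "sib r div 2 = r div 2"
  by (cases "even r") (auto elim!: evenE oddE simp: sib_def)

lemma is_median_cong: "(\<And>\<tau>. \<tau> < 256 \<Longrightarrow> v \<tau> = v' \<tau>) \<Longrightarrow> is_median v z \<longleftrightarrow> is_median v' z"
proof -
  assume a: "\<And>\<tau>. \<tau> < 256 \<Longrightarrow> v \<tau> = v' \<tau>"
  have "{\<tau> \<in> {0..<256}. Q (v \<tau>)} = {\<tau> \<in> {0..<256}. Q (v' \<tau>)}" for Q using a by auto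
  then show ?thesis unfolding is_median_def by (simp only:)
qed

text \<open>The decoder looks at y only in the buckets of J. Copies occupy disjoint blocks of
  buckets, so what earlier copies subtracted from y does no harm.\<close>

lemma decodes_cong_y:
  assumes "decodes y rw X J D"
    and "\<And>j \<tau>. j \<in> J \<Longrightarrow> \<tau> < 256 \<Longrightarrow> y (rw j \<tau>) = y' (rw j \<tau>) \<and> y (sib (rw j \<tau>)) = y' (sib (rw j \<tau>))"
  shows "decodes y' rw X J D"
  using assms(1)
proof (induction rule: decodes.induct)
  case start
  show ?case by (rule decodes.start)
next
  case (step D j)
  have "is_median (\<lambda>\<tau>. resid y' rw X D (rw j \<tau>) - resid y' rw X D (sib (rw j \<tau>))) (X j)"
    by (rule iffD1[OF is_median_cong step.hyps(4)]) (use step.hyps(2) assms(2) in \<open>simp add: resid_def\<close>)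
  then show ?case using step by (intro decodes.step) auto
qed

definition copy_com :: com where "copy_com = Seq init_com peel_com"

lemma run_copy:
  assumes ss: "fst s 0 1 = length ss" "\<And>i. i < length ss \<Longrightarrow> fst s 1 i = ss ! i" "distinct ss" "set ss = J"
    and zero: "\<And>j \<tau>. j \<in> J \<Longrightarrow> \<tau> < 256 \<Longrightarrow> fst s 5 (row0 s j \<tau> div 2) = 0"
  shows "run copy_com s (\<lambda>t s2. \<exists>D. copy_inv s J s2 D \<and> (peelable (row0 s) J \<longrightarrow> D = J) \<and>
     t \<le> 10222000 * length ss + 40)"
proof -
  have J: "finite J" using ss by auto
  show ?thesis
    unfolding copy_com_def
    apply simp
    apply (rule run_mono[OF run_init[OF ss]])
      apply assumption
    subgoal premises s1 for t1 s1
    proof -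
      have a: "copy_inv s J s1 {}" "fst s1 12 0 = length ss" "\<And>i. i < length ss \<Longrightarrow> fst s1 6 i = ss ! i"
        "t1 \<le> length ss * 20200 + 20" using s1 by auto
      show ?thesis
        by (rule run_mono[OF run_peel[OF a(1) J zero a(2,3) ss(3,4)]], assumption, assumption, assumption)
          (use a(4) in fastforce)
    qed
    done
qed

section \<open>All copies\<close>

text \<open>Cell 1 of array 2 is the end of column 0, which is 256 r for the matrices in question:
  the program learns the number of copies from the matrix.\<close>

definition copies_com :: com where
  "copies_com = While (NLess (var 10) (NGet 2 (NConst 1)))
     (Seq copy_com (Seq (assign 10 (NAdd (var 10) (NConst 256))) (assign 11 (NAdd (var 11) (NGet 0 (NConst 0))))))"

definition rows_at :: "memory \<Rightarrow> nat \<Rightarrow> nat \<Rightarrow> nat \<Rightarrow> nat" where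
  "rows_at s \<rho> j \<tau> = fst s 3 (fst s 2 j + 256 * \<rho> + \<tau>)"

text \<open>\<open>H\<close> is the number of buckets per copy. As the blocks are disjoint, array 5
  need not be cleared nor array 1 restored between copies, which keeps the cost of a copy
  proportional to the length of \<open>ss\<close>.\<close>

lemma run_copies:
  assumes ss: "fst s 0 1 = length ss" "\<And>i. i < length ss \<Longrightarrow> fst s 1 i = ss ! i" "distinct ss" "set ss = J"
    and n: "fst s 0 0 = n" "J \<subseteq> {..<n}" and r: "fst s 2 1 = 256 * r"
    and blk: "\<And>\<rho> j \<tau>. \<rho> < r \<Longrightarrow> j \<in> J \<Longrightarrow> \<tau> < 256 \<Longrightarrow>
       \<rho> * H \<le> rows_at s \<rho> j \<tau> div 2 \<and> rows_at s \<rho> j \<tau> div 2 < Suc \<rho> * H"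
    and init: "fst s 10 0 = 0" "fst s 11 0 = 0" "fst s 5 = (\<lambda>_. 0)"
  shows "run copies_com s (\<lambda>t s'. frame (touched_n \<union> {10,11}) touched_r s s' \<and> fst s' 11 0 = n * r \<and>
     (\<forall>\<rho><r. \<exists>D. decodes (snd s 1) (rows_at s \<rho>) (\<lambda>j. snd s' 4 (n * \<rho> + j)) J D \<and>
        (peelable (rows_at s \<rho>) J \<longrightarrow> D = J)) \<and>
     t \<le> r * (10222000 * length ss + 70) + 10)"
proof -
  define I where "I \<rho> s' \<longleftrightarrow> \<rho> \<le> r \<and> frame (touched_n \<union> {10,11}) touched_r s s' \<and> fst s' 10 0 = 256 * \<rho> \<and> fst s' 11 0 = n * \<rho> \<and>
     (\<forall>b \<ge> \<rho> * H. fst s' 5 b = 0) \<and> (\<forall>b. b div 2 \<ge> \<rho> * H \<longrightarrow> snd s' 1 b = snd s 1 b) \<and>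
     (\<forall>\<rho>'<\<rho>. \<exists>D. decodes (snd s 1) (rows_at s \<rho>') (\<lambda>j. snd s' 4 (n * \<rho>' + j)) J D \<and>
        (peelable (rows_at s \<rho>') J \<longrightarrow> D = J))" for \<rho> s'
  show ?thesis
    unfolding copies_com_def
  proof (rule run_While[where I = "\<lambda>s'. \<exists>\<rho>. I \<rho> s'" and \<Phi> = "\<lambda>s'. (r - fst s' 10 0 div 256) * (10222000 * length ss + 70)"])
    have "I 0 s" using init by (simp add: I_def)
    then show "\<exists>\<rho>. I \<rho> s" by blast
  next
    fix s' assume "\<exists>\<rho>. I \<rho> s'" and g: "bval (NLess (var 10) (NGet 2 (NConst 1))) s'"
    then obtain \<rho> where I: "I \<rho> s'" by blast
    have fr: "frame (touched_n \<union> {10,11}) touched_r s s'" and off: "fst s' 10 0 = 256 * \<rho>" "fst s' 11 0 = n * \<rho>"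
      using I by (auto simp: I_def)
    have e: "fst s' 0 = fst s 0" "fst s' 1 = fst s 1" "fst s' 2 = fst s 2" "fst s' 3 = fst s 3"
      using fr by (auto simp: frame_def touched_n_def)
    have ro: "row0 s' = rows_at s \<rho>" by (intro ext) (simp add: row0_def rows_at_def e off)
    have "256 * \<rho> < 256 * r" using g r off e by simp
    then have lt: "\<rho> < r" by simp
    have zero: "fst s' 5 (row0 s' j \<tau> div 2) = 0" if "j \<in> J" "\<tau> < 256" for j \<tau>
      using I blk[OF lt that] by (simp add: I_def ro)
    have ss': "fst s' 0 1 = length ss" "\<And>i. i < length ss \<Longrightarrow> fst s' 1 i = ss ! i"
      using ss e by simp_all
    show "run (Seq copy_com (Seq (assign 10 (NAdd (var 10) (NConst 256))) (assign 11 (NAdd (var 11) (NGet 0 (NConst 0)))))) s'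
      (\<lambda>t s''. (\<exists>\<rho>. I \<rho> s'') \<and> t + bcost (NLess (var 10) (NGet 2 (NConst 1))) + (r - fst s'' 10 0 div 256) * (10222000 * length ss + 70)
        \<le> (r - fst s' 10 0 div 256) * (10222000 * length ss + 70))"
      unfolding run_Seq
    proof (rule run_mono[OF run_copy[OF ss' ss(3,4) zero]])
      fix t s2 assume "\<exists>D. copy_inv s' J s2 D \<and> (peelable (row0 s') J \<longrightarrow> D = J) \<and> t \<le> 10222000 * length ss + 40"
      then obtain D where C: "copy_inv s' J s2 D" and D: "peelable (row0 s') J \<longrightarrow> D = J" and t: "t \<le> 10222000 * length ss + 40"
        by blast
      define s3 where "s3 = (upd (upd (fst s2) 10 0 (256 * \<rho> + 256)) 11 0 (n * \<rho> + n), snd s2)"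
      have f2: "frame touched_n touched_r s' s2" using C by (simp add: copy_inv_def)
      have e2: "fst s2 10 = fst s' 10" "fst s2 11 = fst s' 11" "fst s2 0 = fst s 0"
        using f2 e by (auto simp: frame_def touched_n_def)
      have DJ: "D \<subseteq> J" using C by (simp add: copy_inv_def)
      have "I (Suc \<rho>) s3"
        unfolding I_def
      proof (intro conjI allI impI)
        show "Suc \<rho> \<le> r" using lt by simp
        have "frame (touched_n \<union> {10,11}) touched_r s s2" by (rule frame_trans[OF fr f2]) auto
        then show "frame (touched_n \<union> {10,11}) touched_r s s3" by (simp add: s3_def upd_frame)
        show "fst s3 10 0 = 256 * Suc \<rho>" "fst s3 11 0 = n * Suc \<rho>" by (simp_all add: s3_def)
      next
        fix b assume b: "Suc \<rho> * H \<le> b"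
        have "load (row0 s') (J - D) b = 0"
          unfolding load_def
        proof (intro sum.neutral ballI)
          fix j \<tau> assume "j \<in> J - D" "\<tau> \<in> {..<256::nat}"
          then have "row0 s' j \<tau> div 2 < Suc \<rho> * H" using blk[OF lt, of j \<tau>] by (simp add: ro)
          then show "(if row0 s' j \<tau> div 2 = b then 1 else 0) = (0::nat)" using b by simp
        qed
        moreover have "fst s' 5 b = 0" using I b by (simp add: I_def)
        ultimately show "fst s3 5 b = 0" using C by (simp add: copy_inv_def s3_def)
      next
        fix b assume b: "Suc \<rho> * H \<le> b div 2"
        have "(\<Sum>j\<in>D. \<Sum>\<tau><256. if row0 s' j \<tau> = b then snd s2 4 (fst s' 11 0 + j) else 0) = 0"
        proof (intro sum.neutral ballI)
          fix j \<tau> assume "j \<in> D" "\<tau> \<in> {..<256::nat}"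
          then have "row0 s' j \<tau> div 2 < Suc \<rho> * H" using blk[OF lt, of j \<tau>] DJ by (auto simp: ro)
          then show "(if row0 s' j \<tau> = b then snd s2 4 (fst s' 11 0 + j) else 0) = 0" using b by auto
        qed
        moreover have "snd s2 1 b = resid (snd s' 1) (row0 s') (\<lambda>j. snd s2 4 (fst s' 11 0 + j)) D b"
          using C unfolding copy_inv_def by blast
        moreover have "snd s' 1 b = snd s 1 b" using I b unfolding I_def by simp
        ultimately show "snd s3 1 b = snd s 1 b" by (simp add: resid_def s3_def)
      next
        fix \<rho>' assume "\<rho>' < Suc \<rho>"
        then consider "\<rho>' < \<rho>" | "\<rho>' = \<rho>" by linarith
        then show "\<exists>D. decodes (snd s 1) (rows_at s \<rho>') (\<lambda>j. snd s3 4 (n * \<rho>' + j)) J D \<and>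
           (peelable (rows_at s \<rho>') J \<longrightarrow> D = J)"
        proof cases
          case 1
          then obtain D' where D': "decodes (snd s 1) (rows_at s \<rho>') (\<lambda>j. snd s' 4 (n * \<rho>' + j)) J D'"
            "peelable (rows_at s \<rho>') J \<longrightarrow> D' = J" using I unfolding I_def by blast
          have D'J: "D' \<subseteq> J" using D'(1) by (induction rule: decodes.induct) auto
          have "decodes (snd s 1) (rows_at s \<rho>') (\<lambda>j. snd s3 4 (n * \<rho>' + j)) J D'"
          proof (rule decodes_cong[OF D'(1)])
            fix j assume "j \<in> D'"
            then have "j < n" using D'J n by auto
            \<comment> \<open>Copy \<rho>' keeps its estimates in the n cells from n \<rho>' on,
              below all cells that the current copy writes.\<close>
            moreover have "n * Suc \<rho>' \<le> n * \<rho>" using 1 by (intro mult_le_mono2) simp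
            ultimately have "n * \<rho>' + j < n * \<rho>" by simp
            then have "n * \<rho>' + j \<notin> (+) (fst s' 11 0) ` D" using off by auto
            then show "snd s' 4 (n * \<rho>' + j) = snd s3 4 (n * \<rho>' + j)" using C by (simp add: copy_inv_def s3_def)
          qed
          then show ?thesis using D' by blast
        next
          case 2
          have "decodes (snd s' 1) (rows_at s \<rho>) (\<lambda>j. snd s2 4 (n * \<rho> + j)) J D"
            using C unfolding copy_inv_def ro off by blast
          then have "decodes (snd s 1) (rows_at s \<rho>) (\<lambda>j. snd s2 4 (n * \<rho> + j)) J D"
            by (rule decodes_cong_y) (use I blk[OF lt] in \<open>auto simp: I_def sib_div2\<close>)
          then show ?thesis using D 2 by (auto simp: s3_def ro)
        qed
      qed
      moreover have "r - \<rho> = Suc (r - Suc \<rho>)" using lt by simp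
      moreover have "(upd (upd (fst s2) 10 0 (fst s2 10 0 + 256)) 11 0 (fst s2 11 0 + fst s2 0 0), snd s2) = s3"
        by (simp only: s3_def e2 off n)
      moreover have "fst s3 10 0 = 256 * Suc \<rho>" by (simp add: s3_def)
      ultimately show "run (assign 10 (NAdd (var 10) (NConst 256))) s2 (\<lambda>u s''. run (assign 11 (NAdd (var 11) (NGet 0 (NConst 0)))) s'' (\<lambda>ua s''.
         (\<exists>\<rho>. I \<rho> s'') \<and> t + (u + ua) + bcost (NLess (var 10) (NGet 2 (NConst 1))) + (r - fst s'' 10 0 div 256) * (10222000 * length ss + 70)
        \<le> (r - fst s' 10 0 div 256) * (10222000 * length ss + 70)))"
        using t off by auto
    qed
  next
    fix t s' assume "\<exists>\<rho>. I \<rho> s'" and g: "\<not> bval (NLess (var 10) (NGet 2 (NConst 1))) s'"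
      and t: "t + (r - fst s' 10 0 div 256) * (10222000 * length ss + 70) \<le>
        (r - fst s 10 0 div 256) * (10222000 * length ss + 70) + bcost (NLess (var 10) (NGet 2 (NConst 1)))"
    then obtain \<rho> where I: "I \<rho> s'" by blast
    have "fst s' 2 = fst s 2" using I by (auto simp: I_def frame_def touched_n_def)
    then have "\<rho> = r" using g r I by (simp add: I_def)
    then show "frame (touched_n \<union> {10,11}) touched_r s s' \<and> fst s' 11 0 = n * r \<and>
     (\<forall>\<rho><r. \<exists>D. decodes (snd s 1) (rows_at s \<rho>) (\<lambda>j. snd s' 4 (n * \<rho> + j)) J D \<and>
        (peelable (rows_at s \<rho>) J \<longrightarrow> D = J)) \<and>
     t \<le> r * (10222000 * length ss + 70) + 10"
      using I t init unfolding I_def by simp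
  qed
qed


text \<open>After the last copy variable 11 holds n r, so stepping by n from j visits exactly the r
  estimates of column j.\<close>

definition collect_com :: com where
  "collect_com = Seq (assign 18 (var 21)) (Seq (assign 25 (NConst 0)) (While (NLess (var 18) (var 11))
     (Seq (RSet 3 (var 25) (RGet 4 (var 18))) (Seq (incr 25) (assign 18 (NAdd (var 18) (NGet 0 (NConst 0))))))))"

lemma run_collect:
  assumes "fst s 21 0 = j" "fst s 0 0 = n" "fst s 11 0 = n * r" "j < n"
  shows "run collect_com s (\<lambda>t s'. frame {18,25} {3} s s' \<and> fst s' 25 0 = r \<and>
    (\<forall>\<rho><r. snd s' 3 \<rho> = snd s 4 (n * \<rho> + j)) \<and> t \<le> r * 40 + 20)"
proof -
  define I where "I s' W \<longleftrightarrow> frame {18,25} {3} s s' \<and> W \<le> r \<and> fst s' 25 0 = W \<and> fst s' 18 0 = n * W + j \<and>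
    (\<forall>\<rho><W. snd s' 3 \<rho> = snd s 4 (n * \<rho> + j))" for s' W
  have guard: "n * W + j < n * r \<longleftrightarrow> W < r" for W
  proof
    assume "n * W + j < n * r"
    then have "n * W < n * r" by linarith
    then show "W < r" by simp
  next
    assume "W < r"
    then have "n * Suc W \<le> n * r" by (intro mult_le_mono2) simp
    then show "n * W + j < n * r" using assms(4) by simp
  qed
  show ?thesis
    unfolding collect_com_def
    apply simp
    apply (rule run_While[where I = "\<lambda>s'. \<exists>W. I s' W" and \<Phi> = "\<lambda>s'. (r - fst s' 25 0) * 40"])
    subgoal by (rule exI[of _ 0]) (use assms in \<open>simp add: I_def frame_def\<close>)
    subgoal premises pr for s'
    proof -
      obtain W where I: "I s' W" using pr by blast
      have e: "fst s' 11 = fst s 11" "fst s' 0 = fst s 0" "snd s' 4 = snd s 4" using I by (auto simp: I_def frame_def)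
      have lt: "W < r" using pr(2) I e assms guard by (simp add: I_def)
      let ?s3 = "(upd (upd (fst s') 25 0 (Suc W)) 18 0 (n * W + j + n), upd (snd s') 3 W (snd s 4 (n * W + j)))"
      have "I ?s3 (Suc W)"
        unfolding I_def using I lt by (auto simp: I_def upd_frame less_Suc_eq)
      then have ex: "\<exists>W. I ?s3 W" by blast
      moreover have "r - W = Suc (r - Suc W)" using lt by simp
      ultimately show ?thesis using I by (simp add: I_def[of s'] e assms)
    qed
    subgoal premises pr for t s'
    proof -
      obtain W where I: "I s' W" using pr by blast
      have e: "fst s' 11 = fst s 11" using I by (auto simp: I_def frame_def)
      have "W = r" using pr(2) I e assms guard[of W] by (simp add: I_def)
      then show ?thesis using I pr(3) by (simp add: I_def)
    qed
    done
qed

definition output_com :: com where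
  "output_com = Seq (assign 14 (NConst 0)) (While (NLess (var 14) (NGet 0 (NConst 1)))
     (Seq (assign 21 (NGet 1 (var 14))) (Seq collect_com (Seq robust_com (Seq (RSet 2 (var 21) (RGet 5 (NConst 0))) (incr 14))))))"

definition touched_o :: "nat set" where "touched_o = {14,18,19,20,21,22,23,24,25,26,27}"

lemma run_output:
  assumes ss: "fst s 0 1 = length ss" "\<And>i. i < length ss \<Longrightarrow> fst s 1 i = ss ! i" "distinct ss"
    and n: "fst s 0 0 = n" "set ss \<subseteq> {..<n}" and r: "fst s 11 0 = n * r" "r = 64 * 8 ^ L"
    and out: "snd s 2 = (\<lambda>_. 0)"
  shows "run output_com s (\<lambda>t s'. (\<forall>j. j \<notin> set ss \<longrightarrow> snd s' 2 j = 0) \<and>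
    (\<forall>j\<in>set ss. \<forall>Q. monotone_pred Q \<and> 4 * card {\<rho>\<in>{0..<r}. Q (snd s 4 (n * \<rho> + j))} \<le> r \<longrightarrow> \<not> Q (snd s' 2 j)) \<and>
    t \<le> length ss * (9640 * r + 180) + 20)"
proof -
  define ok where "ok j v \<longleftrightarrow> (\<forall>Q. monotone_pred Q \<and> 4 * card {\<rho>\<in>{0..<r}. Q (snd s 4 (n * \<rho> + j))} \<le> r \<longrightarrow> \<not> Q v)" for j v
  define I where "I p s' \<longleftrightarrow> frame touched_o {2,3,5} s s' \<and> (\<forall>j. j \<notin> set (take p ss) \<longrightarrow> snd s' 2 j = 0) \<and>
    (\<forall>j\<in>set (take p ss). ok j (snd s' 2 j))" for p s'
  show ?thesis
    unfolding output_com_def ok_def[symmetric]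
    apply simp
    apply (rule run_for[where lo = 0 and N = "length ss" and T = "9640 * r + 170" and I = I])
    subgoal by simp
    subgoal by (simp add: I_def frame_def touched_o_def out)
    subgoal by simp
    subgoal using ss(1) by (auto simp: I_def frame_def touched_o_def)
    subgoal premises pr for p s1
    proof -
      note I = pr(3)[unfolded I_def] and p = pr(2) and pv = pr(4)
      define j where "j = ss ! p"
      have "j \<in> set ss" using p by (simp add: j_def)
      then have jn: "j < n" using n by auto
      have e: "fst s1 1 p = j" "fst s1 11 = fst s 11" "fst s1 0 = fst s 0" "snd s1 4 = snd s 4"
        using I ss p by (auto simp: frame_def touched_o_def j_def)
      have e': "fst s1 (Suc 0) p = j" using e(1) by simp
      define s2 where "s2 = (upd (fst s1) 21 0 j, snd s1)"
      have f2: "frame touched_o {2,3,5} s s2" using I by (simp add: s2_def frame_def touched_o_def)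
      have s2: "fst s2 21 0 = j" "fst s2 0 0 = n" "fst s2 11 0 = n * r" "snd s2 4 = snd s 4" "fst s2 14 0 = p" "snd s2 2 = snd s1 2"
        using e n r pv by (simp_all add: s2_def)
      show ?thesis
        apply (simp add: pv e e' s2_def[symmetric])
        apply (rule run_mono[OF run_collect[OF s2(1-3) jn]])
        subgoal premises s3 for t3 s3
        proof -
          have f3: "frame touched_o {2,3,5} s s3"
            by (rule frame_trans[OF f2 conjunct1[OF s3]]) (auto simp: touched_o_def)
          have W: "fst s3 25 0 = 64 * 8 ^ L" using s3 r by simp
          show ?thesis
            apply (rule run_mono[OF run_robust[OF W]])
            subgoal premises s4 for t4 s4
            proof -
              have f4: "frame touched_o {2,3,5} s s4"
                by (rule frame_trans[OF f3 conjunct1[OF s4]]) (auto simp: touched_o_def)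
              have e4: "fst s4 21 0 = j" "fst s4 14 0 = p" "snd s4 2 = snd s1 2"
                using s3 s4 s2 by (auto simp: frame_def)
              have "ok j (snd s4 5 0)"
                unfolding ok_def
              proof (intro allI impI)
                fix Q assume Q: "monotone_pred Q \<and> 4 * card {\<rho>\<in>{0..<r}. Q (snd s 4 (n * \<rho> + j))} \<le> r"
                have "{\<rho>\<in>{0..<r}. Q (snd s 4 (n * \<rho> + j))} = {\<rho>\<in>{0..<r}. Q (snd s3 3 \<rho>)}"
                  using s3 s2 by auto
                then have "4 * count (snd s3 3) 0 (fst s3 25 0) Q \<le> fst s3 25 0"
                  using Q W r by (simp only: count_def)
                then show "\<not> Q (snd s4 5 0)" using s4 Q by blast
              qed
              then have "I (Suc p) (upd (fst s4) 14 0 (Suc p), upd (snd s4) 2 j (snd s4 5 0))"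
                unfolding I_def using f4 I p e4
                by (auto simp: frame_def touched_o_def take_Suc_conv_app_nth j_def[symmetric])
              then show ?thesis using s3 s4 W r by (auto simp: e4)
            qed
            done
        qed
        done
    qed
    subgoal premises pr for t s1
      using pr by (auto simp: I_def algebra_simps)
    done
qed

definition recover_com :: com where "recover_com = Seq copies_com output_com"

section \<open>Error propagation\<close>

text \<open>Turns the inductive history into an explicit time \<rho> of decoding, because the
  charging argument compares two arbitrary columns and not only the last one with its
  predecessors.\<close>

lemma decodes_order:
  assumes "decodes y rw X J D"
  obtains \<rho> :: "nat \<Rightarrow> nat" where "inj_on \<rho> D" "D \<subseteq> J" "finite D"
    "\<And>j. j \<in> D \<Longrightarrow> 224 \<le> card (lone rw (J - {i \<in> D. \<rho> i < \<rho> j}) j) \<and>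
      is_median (\<lambda>\<tau>. resid y rw X {i \<in> D. \<rho> i < \<rho> j} (rw j \<tau>) - resid y rw X {i \<in> D. \<rho> i < \<rho> j} (sib (rw j \<tau>))) (X j)"
  using assms
proof (induction arbitrary: thesis rule: decodes.induct)
  case start
  show ?case by (rule start) auto
next
  case (step D j)
  obtain \<rho> :: "nat \<Rightarrow> nat" where \<rho>: "inj_on \<rho> D" "D \<subseteq> J" "finite D"
    "\<And>j. j \<in> D \<Longrightarrow> 224 \<le> card (lone rw (J - {i \<in> D. \<rho> i < \<rho> j}) j) \<and>
      is_median (\<lambda>\<tau>. resid y rw X {i \<in> D. \<rho> i < \<rho> j} (rw j \<tau>) - resid y rw X {i \<in> D. \<rho> i < \<rho> j} (sib (rw j \<tau>))) (X j)"
    using step.IH by blast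
  obtain N where N: "\<And>i. i \<in> D \<Longrightarrow> \<rho> i < N"
    using finite_nat_set_iff_bounded[of "\<rho> ` D"] \<rho>(3) by auto
  let ?\<rho> = "\<rho>(j := N)"
  have jD: "j \<notin> D" using step by simp
  have a: "{i \<in> insert j D. ?\<rho> i < ?\<rho> j} = D" using N jD by auto
  have b: "{i \<in> insert j D. ?\<rho> i < ?\<rho> i'} = {i \<in> D. \<rho> i < \<rho> i'}" if "i' \<in> D" for i'
  proof -
    have "i' \<noteq> j" "\<not> N < \<rho> i'" using that jD N[OF that] by auto
    then show ?thesis using jD by auto
  qed
  show ?case
  proof (rule step.prems)
    show "inj_on ?\<rho> (insert j D)"
      using \<rho>(1) N jD by (auto simp: inj_on_def)
    show "insert j D \<subseteq> J" "finite (insert j D)" using step \<rho> by auto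
    fix i assume i: "i \<in> insert j D"
    show "224 \<le> card (lone rw (J - {i' \<in> insert j D. ?\<rho> i' < ?\<rho> i}) i) \<and>
      is_median (\<lambda>\<tau>. resid y rw X {i' \<in> insert j D. ?\<rho> i' < ?\<rho> i} (rw i \<tau>) - resid y rw X {i' \<in> insert j D. ?\<rho> i' < ?\<rho> i} (sib (rw i \<tau>))) (X i)"
    proof (cases "i = j")
      case True
      show ?thesis unfolding True a using step by blast
    next
      case False
      then have "i \<in> D" using i by simp
      then show ?thesis using b \<rho>(4) by simp
    qed
  qed
qed

lemma load_card:
  assumes "finite R"
  shows "load rw R b = card {(j, \<tau>) \<in> R \<times> {..<256}. rw j \<tau> div 2 = b}"
proof -
  have fin: "finite (R \<times> {..<256::nat})" using assms by simp
  have "load rw R b = (\<Sum>p \<in> R \<times> {..<256}. if rw (fst p) (snd p) div 2 = b then 1 else 0)"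
    by (simp add: load_def sum.cartesian_product case_prod_beta')
  also have "\<dots> = card {p \<in> R \<times> {..<256}. rw (fst p) (snd p) div 2 = b}"
    by (simp only: card_eq_sum sum.inter_filter[OF fin])
  also have "{p \<in> R \<times> {..<256}. rw (fst p) (snd p) div 2 = b} = {(j, \<tau>) \<in> R \<times> {..<256}. rw j \<tau> div 2 = b}"
    by auto
  finally show ?thesis .
qed

lemma two_le_load:
  assumes "finite R" "(i, \<sigma>) \<noteq> (j, \<tau>)" "i \<in> R" "j \<in> R" "\<sigma> < 256" "\<tau> < 256"
    "rw i \<sigma> div 2 = b" "rw j \<tau> div 2 = b"
  shows "2 \<le> load rw R b"
proof -
  have "card {(i, \<sigma>), (j, \<tau>)} \<le> load rw R b"
    unfolding load_card[OF assms(1)]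
  proof (rule card_mono)
    show "finite {(j, \<tau>) \<in> R \<times> {..<256}. rw j \<tau> div 2 = b}"
      by (rule finite_subset[of _ "R \<times> {..<256}"]) (use assms in auto)
  qed (use assms in auto)
  then show ?thesis using assms(2) by simp
qed

lemma sib_neq: "sib r \<noteq> r"
  by (cases "even r") (auto elim!: evenE oddE simp: sib_def)

lemma resid_split:
  assumes "finite J" "D \<subseteq> J"
  shows "resid y rw x J r = resid y rw x D r - (\<Sum>j\<in>J - D. \<Sum>\<tau><256. if rw j \<tau> = r then x j else 0)"
  unfolding resid_def using assms by (subst sum.subset_diff[of D J]) auto

definition noise :: "(nat \<Rightarrow> real) \<Rightarrow> (nat \<Rightarrow> nat \<Rightarrow> nat) \<Rightarrow> (nat \<Rightarrow> real) \<Rightarrow> nat set \<Rightarrow> nat \<Rightarrow> nat \<Rightarrow> real" where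
  "noise y rw x J j \<tau> = resid y rw x J (rw j \<tau>) - resid y rw x J (sib (rw j \<tau>))"

text \<open>With j the only column left in the bucket, the difference of its two rows is x j, plus
  the noise from outside J, plus signed errors of those columns of D that were subtracted from this
  bucket before.\<close>

lemma lone_value:
  assumes J: "finite J" "D \<subseteq> J" "j \<in> J - D" "\<tau> \<in> lone rw (J - D) j"
  shows "\<bar>resid y rw X D (rw j \<tau>) - resid y rw X D (sib (rw j \<tau>)) - x j\<bar> \<le> \<bar>noise y rw x J j \<tau>\<bar> +
    (\<Sum>(i, \<sigma>) \<in> D \<times> {..<256}. if rw i \<sigma> div 2 = rw j \<tau> div 2 then \<bar>X i - x i\<bar> else 0)"
proof -
  let ?r = "rw j \<tau>"
  have \<tau>: "\<tau> < 256" "\<not> 2 \<le> load rw (J - D) (?r div 2)" using J(4) by (auto simp: lone_def)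
  have single: "i = j \<and> \<sigma> = \<tau>" if "i \<in> J - D" "\<sigma> < 256" "rw i \<sigma> div 2 = ?r div 2" for i \<sigma>
  proof (rule ccontr)
    assume "\<not> (i = j \<and> \<sigma> = \<tau>)"
    then have "2 \<le> load rw (J - D) (?r div 2)"
      using two_le_load[of "J - D" i \<sigma> j \<tau> rw "?r div 2"] that J \<tau> by auto
    then show False using \<tau> by simp
  qed
  have s1: "(\<Sum>i\<in>J - D. \<Sum>\<sigma><256. if rw i \<sigma> = ?r then x i else 0) = x j"
  proof -
    have "(\<Sum>i\<in>J - D. \<Sum>\<sigma><256. if rw i \<sigma> = ?r then x i else 0) =
        (\<Sum>i\<in>J - D. \<Sum>\<sigma><256. if i = j then (if \<sigma> = \<tau> then x j else 0) else 0)"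
    proof (intro sum.cong refl)
      fix i \<sigma> assume "i \<in> J - D" "\<sigma> \<in> {..<256::nat}"
      then show "(if rw i \<sigma> = ?r then x i else 0) = (if i = j then (if \<sigma> = \<tau> then x j else 0) else 0)"
        using single[of i \<sigma>] by (cases "rw i \<sigma> = ?r") auto
    qed
    also have "\<dots> = (\<Sum>i\<in>J - D. if i = j then x j else 0)"
    proof (intro sum.cong refl)
      fix i
      show "(\<Sum>\<sigma><256. if i = j then (if \<sigma> = \<tau> then x j else 0) else 0) = (if i = j then x j else 0)"
        using \<tau> by (cases "i = j") auto
    qed
    also have "\<dots> = x j" using J by simp
    finally show ?thesis .
  qed
  have s2: "(\<Sum>i\<in>J - D. \<Sum>\<sigma><256. if rw i \<sigma> = sib ?r then x i else 0) = 0"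
  proof (intro sum.neutral ballI)
    fix i \<sigma> assume "i \<in> J - D" "\<sigma> \<in> {..<256::nat}"
    then show "(if rw i \<sigma> = sib ?r then x i else 0) = 0"
      using single[of i \<sigma>] sib_div2[of ?r] sib_neq[of ?r] by (cases "rw i \<sigma> = sib ?r") auto
  qed
  let ?d = "\<lambda>r. \<Sum>(i, \<sigma>) \<in> D \<times> {..<256}. if rw i \<sigma> = r then X i - x i else 0"
  have dd: "resid y rw X D r = resid y rw x D r - ?d r" for r
  proof -
    have "(\<Sum>i\<in>D. \<Sum>\<sigma><256. if rw i \<sigma> = r then X i else 0) =
      (\<Sum>i\<in>D. \<Sum>\<sigma><256. (if rw i \<sigma> = r then x i else 0) + (if rw i \<sigma> = r then X i - x i else 0))"
      by (intro sum.cong refl) auto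
    then show ?thesis by (simp add: resid_def sum.distrib sum.cartesian_product)
  qed
  have "resid y rw X D ?r - resid y rw X D (sib ?r) - x j = noise y rw x J j \<tau> - (?d ?r - ?d (sib ?r))"
    unfolding noise_def resid_split[OF J(1,2)] s1 s2 dd by simp
  moreover have "\<bar>?d ?r - ?d (sib ?r)\<bar> \<le> (\<Sum>(i, \<sigma>) \<in> D \<times> {..<256}. if rw i \<sigma> div 2 = ?r div 2 then \<bar>X i - x i\<bar> else 0)"
  proof -
    define f where "f p = (if rw (fst p) (snd p) = ?r then X (fst p) - x (fst p) else 0) -
      (if rw (fst p) (snd p) = sib ?r then X (fst p) - x (fst p) else 0)" for p
    have "?d ?r - ?d (sib ?r) = sum f (D \<times> {..<256})"
      unfolding f_def sum_subtractf case_prod_beta' ..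
    also have "\<bar>\<dots>\<bar> \<le> (\<Sum>p \<in> D \<times> {..<256}. \<bar>f p\<bar>)"
      by (rule sum_abs)
    also have "\<dots> \<le> (\<Sum>(i, \<sigma>) \<in> D \<times> {..<256}. if rw i \<sigma> div 2 = ?r div 2 then \<bar>X i - x i\<bar> else 0)"
    proof (rule sum_mono, clarify)
      fix i \<sigma>
      consider "rw i \<sigma> = ?r" | "rw i \<sigma> = sib ?r" | "rw i \<sigma> \<noteq> ?r" "rw i \<sigma> \<noteq> sib ?r" by blast
      then show "\<bar>f (i, \<sigma>)\<bar> \<le> (if rw i \<sigma> div 2 = ?r div 2 then \<bar>X i - x i\<bar> else 0)"
      proof cases
        case 1
        then show ?thesis using sib_neq[of ?r] by (simp add: f_def)
      next
        case 2
        then show ?thesis using sib_neq[of ?r] sib_div2[of ?r] by (simp add: f_def)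
      next
        case 3
        then show ?thesis by (simp add: f_def)
      qed
    qed
    finally show ?thesis .
  qed
  ultimately show ?thesis by linarith
qed

text \<open>The half line from z pointing away from a contains z, so by robustness at least half of
  the values lie in it.\<close>

lemma median_far:
  assumes "is_median v z" "z \<noteq> (a::real)"
  shows "128 \<le> card {\<tau> \<in> {0..<256}. \<bar>z - a\<bar> \<le> \<bar>v \<tau> - a\<bar>}"
proof -
  have "\<exists>Q. monotone_pred Q \<and> Q z \<and> (\<forall>u. Q u \<longrightarrow> \<bar>z - a\<bar> \<le> \<bar>u - a\<bar>)"
  proof (cases "a < z")
    case True
    then show ?thesis by (intro exI[of _ "\<lambda>u. z \<le> u"]) (auto simp: monotone_pred_def)
  next
    case False
    then show ?thesis by (intro exI[of _ "\<lambda>u. u \<le> z"]) (auto simp: monotone_pred_def)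
  qed
  then obtain Q where Q: "monotone_pred Q" "Q z" "\<And>u. Q u \<Longrightarrow> \<bar>z - a\<bar> \<le> \<bar>u - a\<bar>" by blast
  then have "128 \<le> card {\<tau> \<in> {0..<256}. Q (v \<tau>)}"
    using assms unfolding is_median_def by (metis not_le)
  also have "\<dots> \<le> card {\<tau> \<in> {0..<256}. \<bar>z - a\<bar> \<le> \<bar>v \<tau> - a\<bar>}"
    by (rule card_mono) (use Q in auto)
  finally show ?thesis .
qed

text \<open>A closed set of columns is a union of components of the collision graph. Every bucket has at
  most one owner, the last column decoded from it, so an error is charged only by the at most 32
  tables in which its column is not the owner, while a wrong median needs 64 witnesses.\<close>

lemma decode_error:
  assumes dec: "decodes y rw X J J" and q: "\<And>j. j \<in> J \<Longrightarrow> q j \<ge> 0 \<and> card {\<tau> \<in> {0..<256}. q j < \<bar>noise y rw x J j \<tau>\<bar>} \<le> 32"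
    and C: "C \<subseteq> J" "\<And>i j \<sigma> \<tau>. i \<in> J \<Longrightarrow> j \<in> C \<Longrightarrow> \<sigma> < 256 \<Longrightarrow> \<tau> < 256 \<Longrightarrow> rw i \<sigma> div 2 = rw j \<tau> div 2 \<Longrightarrow> i \<in> C"
  shows "(\<Sum>j\<in>C. \<bar>X j - x j\<bar>) \<le> 2 * (\<Sum>j\<in>C. q j)"
proof -
  obtain \<rho> :: "nat \<Rightarrow> nat" where \<rho>: "inj_on \<rho> J" "J \<subseteq> J" "finite J"
    "\<And>j. j \<in> J \<Longrightarrow> 224 \<le> card (lone rw (J - {i \<in> J. \<rho> i < \<rho> j}) j) \<and>
      is_median (\<lambda>\<tau>. resid y rw X {i \<in> J. \<rho> i < \<rho> j} (rw j \<tau>) - resid y rw X {i \<in> J. \<rho> i < \<rho> j} (sib (rw j \<tau>))) (X j)"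
    by (rule decodes_order[OF dec]) (rule that, assumption+)
  define E where "E j = \<bar>X j - x j\<bar>" for j
  define B where "B j = {i \<in> J. \<rho> i < \<rho> j}" for j
  define U where "U j = lone rw (J - B j) j" for j
  define W where "W i \<sigma> j \<tau> \<longleftrightarrow> i \<in> B j \<and> rw i \<sigma> div 2 = rw j \<tau> div 2" for i \<sigma> j \<tau>
  have finC: "finite C" using C \<rho> finite_subset by blast
  have Usub: "U j \<subseteq> {..<256}" "finite (U j)" for j by (auto simp: U_def lone_def)
  have E0: "E j \<ge> 0" for j by (simp add: E_def)
  have each: "64 * (E j - q j) \<le> (\<Sum>\<tau>\<in>U j. \<Sum>(i, \<sigma>) \<in> C \<times> {..<256}. if W i \<sigma> j \<tau> then E i else 0)"
    if "j \<in> C" for j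
  proof (cases "E j \<le> q j")
    case True
    have "0 \<le> (\<Sum>\<tau>\<in>U j. \<Sum>(i, \<sigma>) \<in> C \<times> {..<256}. if W i \<sigma> j \<tau> then E i else 0)"
      by (intro sum_nonneg) (auto simp: E0)
    moreover have "64 * (E j - q j) \<le> 0" using True by simp
    ultimately show ?thesis by (rule order_trans[rotated])
  next
    case False
    have jJ: "j \<in> J" using that C by auto
    let ?v = "\<lambda>\<tau>. resid y rw X (B j) (rw j \<tau>) - resid y rw X (B j) (sib (rw j \<tau>))"
    let ?S = "\<lambda>\<tau>. \<Sum>(i, \<sigma>) \<in> C \<times> {..<256}. if W i \<sigma> j \<tau> then E i else 0"
    have "X j \<noteq> x j" using False q[OF jJ] by (auto simp: E_def)
    then have far: "128 \<le> card {\<tau> \<in> {0..<256}. E j \<le> \<bar>?v \<tau> - x j\<bar>}"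
      using median_far[of ?v "X j" "x j"] \<rho>(4)[OF jJ] by (simp add: E_def B_def)
    have U224: "224 \<le> card (U j)" using \<rho>(4)[OF jJ] by (simp add: U_def B_def)
    define G where "G = {\<tau> \<in> U j. E j \<le> \<bar>?v \<tau> - x j\<bar> \<and> \<bar>noise y rw x J j \<tau>\<bar> \<le> q j}"
    have "{\<tau> \<in> {0..<256}. E j \<le> \<bar>?v \<tau> - x j\<bar>} \<subseteq> G \<union> ({0..<256} - U j) \<union> {\<tau> \<in> {0..<256}. q j < \<bar>noise y rw x J j \<tau>\<bar>}"
      by (auto simp: G_def)
    then have "card {\<tau> \<in> {0..<256}. E j \<le> \<bar>?v \<tau> - x j\<bar>} \<le> card (G \<union> ({0..<256} - U j) \<union> {\<tau> \<in> {0..<256}. q j < \<bar>noise y rw x J j \<tau>\<bar>})"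
      by (intro card_mono) (auto simp: G_def Usub)
    also have "\<dots> \<le> card G + card ({0..<256} - U j) + card {\<tau> \<in> {0..<256}. q j < \<bar>noise y rw x J j \<tau>\<bar>}"
      by (meson add_le_mono1 card_Un_le order_trans)
    also have "card ({0..<256} - U j) = 256 - card (U j)"
      using Usub by (subst card_Diff_subset) (auto simp: atLeast0LessThan)
    \<comment> \<open>Of the 128 values at least as far off as the estimate, at most 256 - 224 = 32
      stem from shared buckets and at most 32 from noisy ones.\<close>
    finally have G64: "64 \<le> card G" using far U224 q[OF jJ] by linarith
    have gs: "E j - q j \<le> ?S \<tau>" if \<tau>: "\<tau> \<in> G" for \<tau>
    proof -
      have "\<tau> < 256" using \<tau> by (auto simp: G_def U_def lone_def)
      have "E j \<le> \<bar>noise y rw x J j \<tau>\<bar> + (\<Sum>(i, \<sigma>) \<in> B j \<times> {..<256}. if rw i \<sigma> div 2 = rw j \<tau> div 2 then \<bar>X i - x i\<bar> else 0)"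
        using lone_value[of J "B j" j \<tau> rw y X x] \<tau> \<rho>(3) jJ by (force simp: G_def U_def B_def)
      moreover have "(\<Sum>(i, \<sigma>) \<in> B j \<times> {..<256}. if rw i \<sigma> div 2 = rw j \<tau> div 2 then \<bar>X i - x i\<bar> else 0) \<le> ?S \<tau>"
      proof -
        have "(\<Sum>(i, \<sigma>) \<in> B j \<times> {..<256}. if rw i \<sigma> div 2 = rw j \<tau> div 2 then \<bar>X i - x i\<bar> else 0)
          = (\<Sum>(i, \<sigma>) \<in> {p \<in> B j \<times> {..<256}. rw (fst p) (snd p) div 2 = rw j \<tau> div 2}. \<bar>X i - x i\<bar>)"
          using \<rho>(3) by (simp add: sum.inter_filter case_prod_beta' B_def)
        also have "\<dots> = (\<Sum>(i, \<sigma>) \<in> {p \<in> B j \<times> {..<256}. rw (fst p) (snd p) div 2 = rw j \<tau> div 2}. if W i \<sigma> j \<tau> then E i else 0)"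
          by (rule sum.cong) (auto simp: W_def E_def)
        also have "\<dots> \<le> ?S \<tau>"
        proof (rule sum_mono2)
          show "{p \<in> B j \<times> {..<256}. rw (fst p) (snd p) div 2 = rw j \<tau> div 2} \<subseteq> C \<times> {..<256}"
            using C(2)[OF _ \<open>j \<in> C\<close> _ \<open>\<tau> < 256\<close>] by (auto simp: B_def)
          show "0 \<le> (case p of (i, \<sigma>) \<Rightarrow> if W i \<sigma> j \<tau> then E i else 0)" for p
            using E0[of "fst p"] by (cases p) simp
          show "finite (C \<times> {..<256::nat})" using finC by simp
        qed
        finally show ?thesis .
      qed
      ultimately show ?thesis using \<tau> by (auto simp: G_def)
    qed
    have "64 * (E j - q j) \<le> card G * (E j - q j)" using G64 False by (intro mult_right_mono) auto
    also have "\<dots> = (\<Sum>\<tau>\<in>G. E j - q j)" by simp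
    also have "\<dots> \<le> (\<Sum>\<tau>\<in>G. ?S \<tau>)" by (rule sum_mono) (rule gs)
    also have "\<dots> \<le> (\<Sum>\<tau>\<in>U j. ?S \<tau>)"
      by (rule sum_mono2) (auto simp: Usub G_def E0 intro!: sum_nonneg)
    finally show ?thesis .
  qed
  define Pr where "Pr = (SIGMA j:C. U j)"
  have finP: "finite Pr" using finC Usub by (auto simp: Pr_def)
  have owner: "card {p \<in> Pr. W i \<sigma> (fst p) (snd p)} \<le> (if \<sigma> \<in> U i then 0 else 1)"
    if i: "i \<in> C" and \<sigma>: "\<sigma> < 256" for i \<sigma>
  proof -
    have Uload: "\<not> 2 \<le> load rw (J - B j) (rw j \<tau> div 2)" "\<tau> < 256" if "\<tau> \<in> U j" for j \<tau>
      using that by (auto simp: U_def lone_def)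
    \<comment> \<open>In this claim and the next one, the column decoded first would still have seen
      the other one in the bucket, so it was not lone there.\<close>
    have notU: False if "\<sigma> \<in> U i" "W i \<sigma> j \<tau>" "j \<in> C" "\<tau> \<in> U j" for j \<tau>
    proof -
      have "2 \<le> load rw (J - B i) (rw i \<sigma> div 2)"
        using two_le_load[of "J - B i" i \<sigma> j \<tau> rw "rw i \<sigma> div 2"] that i \<sigma> \<rho>(3) C Uload(2)[OF that(4)]
        by (auto simp: W_def B_def)
      then show False using Uload that by blast
    qed
    have uniq: "(j, \<tau>) = (j', \<tau>')"
      if p: "W i \<sigma> j \<tau>" "j \<in> C" "\<tau> \<in> U j" and p': "W i \<sigma> j' \<tau>'" "j' \<in> C" "\<tau>' \<in> U j'" for j \<tau> j' \<tau>'
    proof (rule ccontr)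
      assume ne: "(j, \<tau>) \<noteq> (j', \<tau>')"
      have b: "rw j \<tau> div 2 = rw j' \<tau>' div 2" using p p' by (simp add: W_def)
      have \<tau>: "\<tau> < 256" "\<tau>' < 256" using Uload(2) p(3) p'(3) by blast+
      have jJ: "j \<in> J" "j' \<in> J" using p(2) p'(2) C(1) by blast+
      have ge: "2 \<le> load rw (J - B l) (rw j \<tau> div 2)" if "\<rho> l \<le> \<rho> j" "\<rho> l \<le> \<rho> j'" for l
      proof (rule two_le_load[OF _ ne])
        show "finite (J - B l)" using \<rho>(3) by simp
        show "j \<in> J - B l" "j' \<in> J - B l" using jJ that by (simp_all add: B_def)
        show "rw j' \<tau>' div 2 = rw j \<tau> div 2" by (rule b[symmetric])
      qed (rule \<tau> refl)+
      show False
      proof (cases "\<rho> j \<le> \<rho> j'")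
        case True
        then show False using ge[of j] Uload(1)[OF p(3)] by blast
      next
        case False
        then have "2 \<le> load rw (J - B j') (rw j \<tau> div 2)" by (intro ge) simp_all
        then show False using Uload(1)[OF p'(3)] b by simp
      qed
    qed
    show ?thesis
    proof (cases "\<sigma> \<in> U i")
      case True
      then have e: "{p \<in> Pr. W i \<sigma> (fst p) (snd p)} = {}" using notU by (auto simp: Pr_def)
      show ?thesis unfolding e by simp
    next
      case False
      have "card {p \<in> Pr. W i \<sigma> (fst p) (snd p)} \<le> 1"
        unfolding One_nat_def by (rule card_le_Suc0_iff_eq[THEN iffD2]) (use uniq finP in \<open>auto simp: Pr_def\<close>)
      then show ?thesis using False by simp
    qed
  qed
  \<comment> \<open>Double counting of pairs consisting of a cause (i, \<sigma>) and a lone entry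
    (j, \<tau>) that it disturbs.\<close>
  have "64 * (\<Sum>j\<in>C. E j - q j) \<le> (\<Sum>j\<in>C. \<Sum>\<tau>\<in>U j. \<Sum>(i, \<sigma>) \<in> C \<times> {..<256}. if W i \<sigma> j \<tau> then E i else 0)"
    unfolding sum_distrib_left by (rule sum_mono) (rule each)
  also have "\<dots> = (\<Sum>p\<in>Pr. \<Sum>(i, \<sigma>) \<in> C \<times> {..<256}. if W i \<sigma> (fst p) (snd p) then E i else 0)"
    unfolding Pr_def using finC Usub by (subst sum.Sigma) (auto simp: case_prod_beta')
  also have "\<dots> = (\<Sum>(i, \<sigma>) \<in> C \<times> {..<256}. \<Sum>p\<in>Pr. if W i \<sigma> (fst p) (snd p) then E i else 0)"
    by (subst sum.swap) (simp add: case_prod_beta')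
  also have "\<dots> = (\<Sum>(i, \<sigma>) \<in> C \<times> {..<256}. E i * card {p \<in> Pr. W i \<sigma> (fst p) (snd p)})"
  proof (rule sum.cong[OF refl], clarify)
    fix i \<sigma>
    have "(\<Sum>p\<in>Pr. if W i \<sigma> (fst p) (snd p) then E i else 0) = (\<Sum>p\<in>{p \<in> Pr. W i \<sigma> (fst p) (snd p)}. E i)"
      by (rule sum.inter_filter[OF finP, symmetric])
    then show "(\<Sum>p\<in>Pr. if W i \<sigma> (fst p) (snd p) then E i else 0) = E i * card {p \<in> Pr. W i \<sigma> (fst p) (snd p)}"
      by simp
  qed
  also have "\<dots> \<le> (\<Sum>(i, \<sigma>) \<in> C \<times> {..<256}. E i * (if \<sigma> \<in> U i then 0 else 1))"
  proof (rule sum_mono)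
    fix p assume "p \<in> C \<times> {..<256::nat}"
    then obtain i \<sigma> where p: "p = (i, \<sigma>)" "i \<in> C" "\<sigma> < 256" by auto
    have "real (card {p \<in> Pr. W i \<sigma> (fst p) (snd p)}) \<le> (if \<sigma> \<in> U i then 0 else 1)"
      using owner[OF p(2,3)] by (auto split: if_splits)
    from mult_left_mono[OF this E0]
    show "(case p of (i, \<sigma>) \<Rightarrow> E i * card {p \<in> Pr. W i \<sigma> (fst p) (snd p)})
      \<le> (case p of (i, \<sigma>) \<Rightarrow> E i * (if \<sigma> \<in> U i then 0 else 1))"
      unfolding p(1) prod.case .
  qed
  also have "\<dots> = (\<Sum>i\<in>C. \<Sum>\<sigma><256. E i * (if \<sigma> \<in> U i then 0 else 1))"
    by (simp add: sum.cartesian_product)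
  also have "\<dots> \<le> (\<Sum>i\<in>C. E i * 32)"
  proof (rule sum_mono)
    fix i assume "i \<in> C"
    then have U224: "224 \<le> card (U i)" using \<rho>(4)[of i] C by (auto simp: U_def B_def)
    have "(\<Sum>\<sigma><256. (if \<sigma> \<in> U i then 0 else 1 :: real)) = (\<Sum>\<sigma>\<in>{..<256} - U i. 1)"
      by (rule sum.mono_neutral_cong_right) auto
    also have "\<dots> = real (256 - card (U i))" using Usub by (simp add: card_Diff_subset)
    also have "\<dots> \<le> 32" using U224 by simp
    finally have "E i * (\<Sum>\<sigma><256. (if \<sigma> \<in> U i then 0 else 1 :: real)) \<le> E i * 32" using E0 by (rule mult_left_mono)
    then show "(\<Sum>\<sigma><256. E i * (if \<sigma> \<in> U i then 0 else 1)) \<le> E i * 32" by (simp only: sum_distrib_left)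
  qed
  also have "(\<Sum>i\<in>C. E i * 32) = sum E C * 32" by (rule sum_distrib_right[symmetric])
  \<comment> \<open>In total 64 (E - q) \<le> 32 E, hence the factor 2.\<close>
  finally have "sum E C \<le> 2 * sum q C" by (simp add: sum_subtractf)
  then show ?thesis by (simp add: E_def)
qed


section \<open>Components of the collision graph and the total error of a copy\<close>

definition touching :: "(nat \<Rightarrow> nat \<Rightarrow> nat) \<Rightarrow> nat set \<Rightarrow> (nat \<times> nat) set" where
  "touching rw J = {(i, j). i \<in> J \<and> j \<in> J \<and> (\<exists>\<sigma><256. \<exists>\<tau><256. rw i \<sigma> div 2 = rw j \<tau> div 2)}"

definition component :: "(nat \<Rightarrow> nat \<Rightarrow> nat) \<Rightarrow> nat set \<Rightarrow> nat \<Rightarrow> nat set" where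
  "component rw J i = {j \<in> J. (i, j) \<in> (touching rw J)\<^sup>*}"

lemma sym_touching: "sym (touching rw J)"
  unfolding touching_def by (rule symI) (auto, metis)

lemma component_sym: "i \<in> J \<Longrightarrow> j \<in> component rw J i \<Longrightarrow> i \<in> component rw J j"
  using sym_rtrancl[OF sym_touching[of rw J]] unfolding component_def by (auto dest: symD)

lemma component_refl: "i \<in> J \<Longrightarrow> i \<in> component rw J i"
  by (simp add: component_def)

lemma component_eq: "i \<in> J \<Longrightarrow> j \<in> component rw J i \<Longrightarrow> component rw J j = component rw J i"
  using component_sym[of i J j rw] unfolding component_def by (auto intro: rtrancl_trans)

lemma component_closed:
  assumes "i \<in> J" "j \<in> component rw J j'" "\<sigma> < 256" "\<tau> < 256" "rw i \<sigma> div 2 = rw j \<tau> div 2"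
  shows "i \<in> component rw J j'"
proof -
  have "j \<in> J" using assms(2) by (simp add: component_def)
  then have "(j, i) \<in> touching rw J" unfolding touching_def
    by (intro CollectI case_prodI conjI exI[of _ \<tau>] exI[of _ \<sigma>]) (use assms in simp_all)
  then show ?thesis using assms unfolding component_def by (auto intro: rtrancl_into_rtrancl)
qed

text \<open>Inside a component with V columns, Cauchy-Schwarz bounds each squared error by 4 V times
  the sum of the squares of q, and adding up its V columns gives the factor V^2. For absolute values
  the errors merely add, so component sizes do not appear there.\<close>

lemma decode_error_sq:
  assumes dec: "decodes y rw X J J" and "finite J"
    and q: "\<And>j. j \<in> J \<Longrightarrow> q j \<ge> 0 \<and> card {\<tau> \<in> {0..<256}. q j < \<bar>noise y rw x J j \<tau>\<bar>} \<le> 32"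
  shows "(\<Sum>j\<in>J. (X j - x j)\<^sup>2) \<le> 4 * (\<Sum>j\<in>J. (q j)\<^sup>2 * (real (card (component rw J j)))\<^sup>2)"
proof -
  let ?c = "component rw J"
  let ?V = "\<lambda>j. real (card (?c j))"
  have fin: "finite (?c j)" for j using assms(2) by (simp add: component_def)
  have sub: "?c j \<subseteq> J" for j by (auto simp: component_def)
  have each: "(X j - x j)\<^sup>2 \<le> 4 * (\<Sum>i\<in>?c j. (q i)\<^sup>2 * ?V i)" if j: "j \<in> J" for j
  proof -
    have "\<bar>X j - x j\<bar> \<le> (\<Sum>i\<in>?c j. \<bar>X i - x i\<bar>)"
      by (rule member_le_sum) (use fin component_refl[OF j] in auto)
    also have "\<dots> \<le> 2 * (\<Sum>i\<in>?c j. q i)"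
    proof (rule decode_error[OF dec])
      show "q i \<ge> 0 \<and> card {\<tau> \<in> {0..<256}. q i < \<bar>noise y rw x J i \<tau>\<bar>} \<le> 32" if "i \<in> J" for i
        using q[OF that] .
      show "?c j \<subseteq> J" by (rule sub)
      show "i \<in> ?c j" if "i \<in> J" "i' \<in> ?c j" "\<sigma> < 256" "\<tau> < 256" "rw i \<sigma> div 2 = rw i' \<tau> div 2" for i i' \<sigma> \<tau>
        by (rule component_closed[OF that])
    qed
    finally have "\<bar>X j - x j\<bar>\<^sup>2 \<le> (2 * (\<Sum>i\<in>?c j. q i))\<^sup>2" by (rule power_mono) simp
    also have "\<dots> = 4 * (\<Sum>i\<in>?c j. 1 * q i)\<^sup>2" by (simp add: power_mult_distrib)
    also have "(\<Sum>i\<in>?c j. 1 * q i)\<^sup>2 \<le> (\<Sum>i\<in>?c j. 1\<^sup>2) * (\<Sum>i\<in>?c j. (q i)\<^sup>2)"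
      by (rule Cauchy_Schwarz_ineq_sum)
    also have "\<dots> = (\<Sum>i\<in>?c j. (q i)\<^sup>2 * ?V j)" by (simp add: sum_distrib_left mult.commute)
    also have "\<dots> = (\<Sum>i\<in>?c j. (q i)\<^sup>2 * ?V i)"
      by (rule sum.cong) (use component_eq[OF j] in auto)
    finally show ?thesis by simp
  qed
  have "(\<Sum>j\<in>J. (X j - x j)\<^sup>2) \<le> (\<Sum>j\<in>J. 4 * (\<Sum>i\<in>?c j. (q i)\<^sup>2 * ?V i))"
    by (rule sum_mono) (rule each)
  also have "\<dots> = 4 * (\<Sum>j\<in>J. \<Sum>i\<in>?c j. (q i)\<^sup>2 * ?V i)"
    by (rule sum_distrib_left[symmetric])
  also have "\<dots> = 4 * (\<Sum>j\<in>J. \<Sum>i\<in>J. if i \<in> ?c j then (q i)\<^sup>2 * ?V i else 0)"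
  proof (intro arg_cong[where f = "(*) 4"] sum.cong[OF refl])
    fix j
    have "(\<Sum>i\<in>J. if i \<in> ?c j then (q i)\<^sup>2 * ?V i else 0) = (\<Sum>i\<in>J \<inter> ?c j. (q i)\<^sup>2 * ?V i)"
      by (rule sum.inter_restrict[symmetric]) (rule assms(2))
    then show "(\<Sum>i\<in>?c j. (q i)\<^sup>2 * ?V i) = (\<Sum>i\<in>J. if i \<in> ?c j then (q i)\<^sup>2 * ?V i else 0)"
      using sub[of j] by (simp add: Int_absorb1)
  qed
  also have "\<dots> = 4 * (\<Sum>i\<in>J. \<Sum>j\<in>J. if i \<in> ?c j then (q i)\<^sup>2 * ?V i else 0)"
    by (subst sum.swap) (rule refl)
  also have "\<dots> = 4 * (\<Sum>i\<in>J. (q i)\<^sup>2 * (?V i)\<^sup>2)"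
  proof (intro arg_cong[where f = "(*) 4"] sum.cong refl)
    fix i assume i: "i \<in> J"
    have "(\<Sum>j\<in>J. if i \<in> ?c j then (q i)\<^sup>2 * ?V i else 0) = (\<Sum>j\<in>J. if j \<in> ?c i then (q i)\<^sup>2 * ?V i else 0)"
    proof (rule sum.cong[OF refl])
      fix j assume "j \<in> J"
      then have "i \<in> ?c j \<longleftrightarrow> j \<in> ?c i" using component_sym i by blast
      then show "(if i \<in> ?c j then (q i)\<^sup>2 * ?V i else 0) = (if j \<in> ?c i then (q i)\<^sup>2 * ?V i else 0)" by simp
    qed
    also have "\<dots> = (\<Sum>j\<in>J \<inter> ?c i. (q i)\<^sup>2 * ?V i)"
      by (rule sum.inter_restrict[symmetric]) (rule assms(2))
    also have "\<dots> = (q i)\<^sup>2 * (?V i)\<^sup>2" using sub[of i] by (simp add: Int_absorb1 power2_eq_square)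
    finally show "(\<Sum>j\<in>J. if i \<in> ?c j then (q i)\<^sup>2 * ?V i else 0) = (q i)\<^sup>2 * (?V i)\<^sup>2" .
  qed
  finally show ?thesis .
qed

lemma decode_error_abs:
  assumes dec: "decodes y rw X J J"
    and q: "\<And>j. j \<in> J \<Longrightarrow> q j \<ge> 0 \<and> card {\<tau> \<in> {0..<256}. q j < \<bar>noise y rw x J j \<tau>\<bar>} \<le> 32"
  shows "(\<Sum>j\<in>J. \<bar>X j - x j\<bar>) \<le> 2 * (\<Sum>j\<in>J. q j)"
proof (rule decode_error[OF dec])
  show "q j \<ge> 0 \<and> card {\<tau> \<in> {0..<256}. q j < \<bar>noise y rw x J j \<tau>\<bar>} \<le> 32" if "j \<in> J" for j
    using q[OF that] .
qed auto

section \<open>A weak-type inequality: from tail bounds to sums of squares\<close>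

lemma sum_inverse_sqrt_rank:
  fixes f :: "'a \<Rightarrow> real"
  assumes "finite S"
  shows "(\<Sum>i\<in>S. 1 / sqrt (card {j\<in>S. f i \<le> f j})) \<le> 2 * sqrt (card S)"
  using assms
proof (induction "card S" arbitrary: S)
  case 0
  then show ?case by simp
next
  case (Suc m)
  then have "S \<noteq> {}" by auto
  \<comment> \<open>The smallest value has the denominator sqrt (card S), and taking it away can
    only enlarge the remaining terms.\<close>
  then obtain a where a: "a \<in> S" "\<And>j. j \<in> S \<Longrightarrow> f a \<le> f j"
    using Suc(3) ex_min_if_finite[of "f ` S"] by (metis (no_types, lifting) finite_imageI image_iff image_is_empty linorder_not_le)
  let ?S = "S - {a}"
  have m: "card ?S = m" using Suc a by simp
  have "(\<Sum>i\<in>?S. 1 / sqrt (card {j\<in>S. f i \<le> f j})) \<le> (\<Sum>i\<in>?S. 1 / sqrt (card {j\<in>?S. f i \<le> f j}))"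
  proof (rule sum_mono)
    fix i assume i: "i \<in> ?S"
    have "card {j\<in>?S. f i \<le> f j} \<le> card {j\<in>S. f i \<le> f j}" by (rule card_mono) (use Suc in auto)
    moreover have "0 < card {j\<in>?S. f i \<le> f j}" using i Suc by (auto simp: card_gt_0_iff)
    ultimately show "1 / sqrt (card {j\<in>S. f i \<le> f j}) \<le> 1 / sqrt (card {j\<in>?S. f i \<le> f j})"
      by (intro divide_left_mono) auto
  qed
  also have "\<dots> \<le> 2 * sqrt m" using Suc(1)[of ?S] m Suc(3) by simp
  finally have 1: "(\<Sum>i\<in>?S. 1 / sqrt (card {j\<in>S. f i \<le> f j})) \<le> 2 * sqrt m" .
  have "{j\<in>S. f a \<le> f j} = S" using a by auto
  then have 2: "1 / sqrt (card {j\<in>S. f a \<le> f j}) = 1 / sqrt (Suc m)" using Suc by simp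
  have "(\<Sum>i\<in>S. 1 / sqrt (card {j\<in>S. f i \<le> f j})) = 1 / sqrt (Suc m) + (\<Sum>i\<in>?S. 1 / sqrt (card {j\<in>S. f i \<le> f j}))"
    using 2 a Suc(3) by (simp add: sum.remove)
  also have "\<dots> \<le> 1 / sqrt (Suc m) + 2 * sqrt m" using 1 by simp
  also have "\<dots> \<le> 2 * sqrt (Suc m)"
  proof -
    let ?s = "sqrt (Suc m)" and ?t = "sqrt m"
    have s: "?s > 0" "?s\<^sup>2 = ?t\<^sup>2 + 1" by simp_all
    have "0 \<le> (?s - ?t)\<^sup>2" by simp
    then have "1 + 2 * ?t * ?s \<le> 2 * ?s * ?s" using s(2) by (simp add: power2_eq_square algebra_simps)
    then show ?thesis using s(1) by (simp add: field_simps)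
  qed
  finally show ?case using Suc by simp
qed

text \<open>The hypothesis is a weak l4 bound: the value of rank m is at most B (card S / m)^(1/4).
  Its square can be summed because 1 / sqrt m adds up to at most 2 sqrt n. This form suits union
  bounds, which control how many values are large, not their sum.\<close>

lemma weak_type_sum:
  fixes f :: "'a \<Rightarrow> real"
  assumes S: "finite S" and nn: "\<And>i. i \<in> S \<Longrightarrow> f i \<ge> 0" "B \<ge> 0"
    and weak: "\<And>i. i \<in> S \<Longrightarrow> f i ^ 4 * card {j\<in>S. f i \<le> f j} \<le> B ^ 4 * card S"
  shows "(\<Sum>i\<in>S. (f i)\<^sup>2) \<le> 2 * B\<^sup>2 * card S"
proof -
  have "(\<Sum>i\<in>S. (f i)\<^sup>2) \<le> (\<Sum>i\<in>S. B\<^sup>2 * sqrt (card S) * (1 / sqrt (card {j\<in>S. f i \<le> f j})))"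
  proof (rule sum_mono)
    fix i assume i: "i \<in> S"
    let ?u = "real (card {j\<in>S. f i \<le> f j})"
    have u: "?u > 0" using i S by (auto simp: card_gt_0_iff)
    have "((f i)\<^sup>2 * sqrt ?u)\<^sup>2 = f i ^ 4 * ?u" using u by (simp add: power_mult_distrib)
    also have "\<dots> \<le> B ^ 4 * card S" by (rule weak[OF i])
    also have "\<dots> = (B\<^sup>2 * sqrt (card S))\<^sup>2" by (simp add: power_mult_distrib)
    finally have "(f i)\<^sup>2 * sqrt ?u \<le> B\<^sup>2 * sqrt (card S)" by (rule power2_le_imp_le) simp
    then show "(f i)\<^sup>2 \<le> B\<^sup>2 * sqrt (card S) * (1 / sqrt ?u)" using u by (simp add: field_simps)
  qed
  also have "\<dots> = B\<^sup>2 * sqrt (card S) * (\<Sum>i\<in>S. 1 / sqrt (card {j\<in>S. f i \<le> f j}))"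
    by (simp only: sum_distrib_left)
  also have "\<dots> \<le> B\<^sup>2 * sqrt (card S) * (2 * sqrt (card S))"
    by (rule mult_left_mono[OF sum_inverse_sqrt_rank[OF S]]) simp
  also have "\<dots> = 2 * B\<^sup>2 * card S" by simp
  finally show ?thesis .
qed

section \<open>Collisions and components\<close>

definition buckets :: "(nat \<Rightarrow> nat \<Rightarrow> nat) \<Rightarrow> nat set \<Rightarrow> nat set" where
  "buckets rw F = (\<lambda>p. rw (fst p) (snd p) div 2) ` (F \<times> {..<256})"

text \<open>The number of collisions, counted so that each further entry adds at most one. The
  number of colliding pairs would not have this property.\<close>

definition excess :: "(nat \<Rightarrow> nat \<Rightarrow> nat) \<Rightarrow> nat set \<Rightarrow> nat" where
  "excess rw F = 256 * card F - card (buckets rw F)"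

lemma card_buckets_le: "finite F \<Longrightarrow> card (buckets rw F) \<le> 256 * card F"
  unfolding buckets_def using card_image_le[of "F \<times> {..<256::nat}" "\<lambda>p. rw (fst p) (snd p) div 2"]
  by (simp add: card_cartesian_product mult.commute)

text \<open>Each entry outside P accounts for at most one further bucket, so the collisions within P
  are already present in F.\<close>

lemma excess_subset:
  assumes "finite F" "P \<subseteq> F \<times> {..<256}"
  shows "card P \<le> card ((\<lambda>p. rw (fst p) (snd p) div 2) ` P) + excess rw F"
proof -
  let ?g = "\<lambda>p. rw (fst p) (snd p) div 2" and ?A = "F \<times> {..<256::nat}"
  have fin: "finite ?A" using assms by simp
  have "buckets rw F \<subseteq> ?g ` P \<union> ?g ` (?A - P)" by (auto simp: buckets_def)
  then have "card (buckets rw F) \<le> card (?g ` P \<union> ?g ` (?A - P))"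
    using fin finite_subset[OF assms(2)] by (intro card_mono) auto
  also have "\<dots> \<le> card (?g ` P) + card (?A - P)"
    using card_Un_le[of "?g ` P" "?g ` (?A - P)"] card_image_le[OF finite_Diff[OF fin], of ?g P] by linarith
  also have "card (?A - P) = 256 * card F - card P"
    using assms fin by (subst card_Diff_subset) (auto simp: card_cartesian_product intro: finite_subset)
  finally show ?thesis
    using card_mono[OF fin assms(2)] by (simp add: excess_def card_cartesian_product)
qed

text \<open>Shared entries sit at least two to a bucket, so there are at most twice as many as
  collisions, on average fewer than 4 per column. A bad column has at least 33 of them, so fewer
  than 4/33 of the columns are bad.\<close>

lemma peelable_of_excess:
  assumes J: "finite J" and ex: "\<And>F. F \<subseteq> J \<Longrightarrow> F \<noteq> {} \<Longrightarrow> excess rw F < 2 * card F"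
  shows "peelable rw J"
  unfolding peelable_def
proof (intro allI impI)
  fix T assume T: "T \<subseteq> J"
  show "2 * card {j \<in> T. card (lone rw T j) < 224} \<le> card T"
  proof (cases "T = {}")
    case False
    have finT: "finite T" using T J finite_subset by blast
    let ?g = "\<lambda>p. rw (fst p) (snd p) div 2" and ?A = "T \<times> {..<256::nat}"
    define NL where "NL = {p \<in> ?A. 2 \<le> load rw T (?g p)}"
    have finA: "finite ?A" using finT by simp
    have finN: "finite NL" using finA by (simp add: NL_def)
    have fiber: "card {p \<in> NL. ?g p = b} \<ge> 2" if "b \<in> ?g ` NL" for b
    proof -
      have b: "2 \<le> load rw T b" using that by (auto simp: NL_def)
      have "{(j, \<tau>) \<in> T \<times> {..<256}. rw j \<tau> div 2 = b} = {p \<in> NL. ?g p = b}"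
        using b by (auto simp: NL_def)
      then show ?thesis using b load_card[OF finT, of rw b] by simp
    qed
    have "2 * card (?g ` NL) = (\<Sum>b\<in>?g ` NL. 2)" by simp
    also have "\<dots> \<le> (\<Sum>b\<in>?g ` NL. card {p \<in> NL. ?g p = b})" by (rule sum_mono) (rule fiber)
    also have "\<dots> = card NL" using sum.image_gen[OF finN, of "\<lambda>_. 1::nat" ?g] by simp
    finally have "2 * card (?g ` NL) \<le> card NL" .
    moreover have "card NL \<le> card (?g ` NL) + excess rw T"
      by (rule excess_subset[OF finT]) (auto simp: NL_def)
    ultimately have NL4: "card NL < 4 * card T" using ex[OF T False] by linarith
    let ?bad = "{j \<in> T. card (lone rw T j) < 224}"
    have "33 * card ?bad \<le> (\<Sum>j\<in>?bad. card ({0..<256} - lone rw T j))"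
    proof -
      have "33 \<le> card ({0..<256} - lone rw T j)" if "j \<in> ?bad" for j
      proof -
        have "card ({0..<256} - lone rw T j) = 256 - card (lone rw T j)"
          by (subst card_Diff_subset) (auto simp: lone_def)
        moreover have "card (lone rw T j) < 224" using that by blast
        ultimately show ?thesis by linarith
      qed
      then have "(\<Sum>j\<in>?bad. 33) \<le> (\<Sum>j\<in>?bad. card ({0..<256} - lone rw T j))" by (rule sum_mono)
      then show ?thesis by simp
    qed
    also have "\<dots> = card (SIGMA j:?bad. {0..<256} - lone rw T j)"
      using finT by (simp add: card_SigmaI)
    also have "\<dots> \<le> card NL"
      by (rule card_mono[OF finN]) (auto simp: NL_def lone_def)
    finally show ?thesis using NL4 by linarith
  qed simp
qed

text \<open>The 256 entries of i occupy at most 255 new buckets, as one of them falls into a bucket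
  of F.\<close>

lemma excess_insert:
  assumes "finite F" "i \<notin> F" "\<sigma> < 256" "j \<in> F" "\<tau> < 256" "rw i \<sigma> div 2 = rw j \<tau> div 2"
  shows "Suc (excess rw F) \<le> excess rw (insert i F)"
proof -
  have fb: "finite (buckets rw F)" using assms(1) by (simp add: buckets_def)
  have "buckets rw (insert i F) \<subseteq> buckets rw F \<union> (\<lambda>\<tau>. rw i \<tau> div 2) ` ({..<256} - {\<sigma>})"
  proof
    fix b assume "b \<in> buckets rw (insert i F)"
    then obtain p where p: "p \<in> insert i F \<times> {..<256}" "b = rw (fst p) (snd p) div 2"
      unfolding buckets_def by blast
    obtain l \<rho> where "p = (l, \<rho>)" by (cases p)
    with p have b: "l \<in> insert i F" "\<rho> < 256" "b = rw l \<rho> div 2" by auto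
    show "b \<in> buckets rw F \<union> (\<lambda>\<tau>. rw i \<tau> div 2) ` ({..<256} - {\<sigma>})"
    proof (cases "l \<in> F \<or> \<rho> = \<sigma>")
      case True
      have in_buckets: "rw l' \<rho>' div 2 \<in> buckets rw F" if "l' \<in> F" "\<rho>' < 256" for l' \<rho>'
        unfolding buckets_def by (rule rev_image_eqI[of "(l', \<rho>')"]) (use that in auto)
      show ?thesis
      proof (cases "l \<in> F")
        case True
        then show ?thesis using in_buckets b by simp
      next
        case False
        then have "b = rw j \<tau> div 2" using b \<open>l \<in> F \<or> \<rho> = \<sigma>\<close> assms(6) by simp
        then show ?thesis using in_buckets assms by simp
      qed
    next
      case False
      then show ?thesis using b by auto
    qed
  qed
  then have "card (buckets rw (insert i F)) \<le> card (buckets rw F \<union> (\<lambda>\<tau>. rw i \<tau> div 2) ` ({..<256} - {\<sigma>}))"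
    using fb by (intro card_mono) auto
  also have "\<dots> \<le> card (buckets rw F) + card ({..<256} - {\<sigma>})"
    using card_Un_le[of "buckets rw F"] card_image_le[of "{..<256} - {\<sigma>}" "\<lambda>\<tau>. rw i \<tau> div 2"]
    by (meson add_left_mono finite_Diff finite_lessThan order_trans)
  also have "card ({..<256::nat} - {\<sigma>}) = 255" using assms by simp
  finally show ?thesis
    using assms(1,2) card_buckets_le[OF assms(1), of rw] by (simp add: excess_def)
qed

text \<open>A spanning forest argument: starting from one root per component, every further column
  can be attached through an occupied bucket and costs a collision. So \<open>excess\<close> is at
  least \<open>card F\<close> minus the number of components, and there are at most
  \<open>card F\<close> / v of these.\<close>

lemma excess_components:
  assumes J: "finite J" and F: "F \<subseteq> J" "\<And>i. i \<in> F \<Longrightarrow> component rw J i \<subseteq> F" "\<And>i. i \<in> F \<Longrightarrow> v \<le> card (component rw J i)"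
  shows "card F * v \<le> excess rw F * v + card F"
proof -
  have finF: "finite F" using F J finite_subset by blast
  \<comment> \<open>The minimum is a canonical root, the same for all columns of a
    component.\<close>
  define Rt where "Rt = (\<lambda>i. Min (component rw J i)) ` F"
  have fc: "finite (component rw J i)" for i using J by (simp add: component_def)
  have root: "Min (component rw J i) \<in> component rw J i" if "i \<in> F" for i
    by (rule Min_in[OF fc]) (use component_refl[of i J rw] F that in auto)
  have RtF: "Rt \<subseteq> F" using root F(2) by (auto simp: Rt_def)
  have grow: "\<exists>D. Rt \<subseteq> D \<and> D \<subseteq> F \<and> card D = card Rt + m \<and> m \<le> excess rw D" if "card Rt + m \<le> card F" for m
    using that
  proof (induction m)
    case 0
    show ?case by (rule exI[of _ Rt]) (use RtF in simp)
  next
    case (Suc m)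
    then obtain D where D: "Rt \<subseteq> D" "D \<subseteq> F" "card D = card Rt + m" "m \<le> excess rw D" by auto
    have "D \<noteq> F" using D Suc by auto
    then obtain i where i: "i \<in> F" "i \<notin> D" using D by auto
    let ?r = "Min (component rw J i)"
    have rD: "?r \<in> D" using D(1) i by (auto simp: Rt_def)
    have "i \<in> component rw J ?r" by (rule component_sym[OF _ root]) (use i F in auto)
    then have "(?r, i) \<in> (touching rw J)\<^sup>*" by (simp add: component_def)
    \<comment> \<open>A path from the root in D to i outside D must cross the boundary of D along
      some edge.\<close>
    then have "\<exists>a b. a \<in> D \<and> b \<in> F \<and> b \<notin> D \<and> (a, b) \<in> touching rw J"
      using i
    proof (induction rule: rtrancl_induct)
      case base
      then show ?case using rD by simp
    next
      case (step b c)
      show ?case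
      proof (cases "b \<in> D")
        case True
        then show ?thesis using step by blast
      next
        case False
        have "(c, b) \<in> touching rw J" using step(2) sym_touching by (meson symD)
        then have "b \<in> component rw J c" unfolding component_def by (auto simp: touching_def)
        then have "b \<in> F" using F(2)[of c] step by auto
        then show ?thesis using step False by blast
      qed
    qed
    then obtain a b where ab: "a \<in> D" "b \<in> F" "b \<notin> D" "(a, b) \<in> touching rw J" by blast
    then obtain \<sigma> \<tau> where "\<sigma> < 256" "\<tau> < 256" "rw a \<sigma> div 2 = rw b \<tau> div 2" by (auto simp: touching_def)
    then have "Suc (excess rw D) \<le> excess rw (insert b D)"
      using excess_insert[of D b \<tau> a \<sigma> rw] ab D finF finite_subset by metis
    then show ?case
      using D ab finF finite_subset[OF D(2) finF] by (intro exI[of _ "insert b D"]) auto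
  qed
  have le: "card Rt \<le> card F" by (rule card_mono[OF finF RtF])
  obtain D where D: "D \<subseteq> F" "card D = card F" "card F - card Rt \<le> excess rw D"
    using grow[of "card F - card Rt"] le by auto
  have "D = F" by (rule card_subset_eq[OF finF D(1,2)])
  then have 1: "card F \<le> excess rw F + card Rt" using D by simp
  have disj: "component rw J a \<inter> component rw J b = {}" if "a \<in> Rt" "b \<in> Rt" "a \<noteq> b" for a b
  proof (rule ccontr)
    assume "component rw J a \<inter> component rw J b \<noteq> {}"
    then obtain c where c: "c \<in> component rw J a" "c \<in> component rw J b" by blast
    have m: "Min (component rw J l) = l" if l: "l \<in> Rt" for l
    proof -
      obtain i where i: "i \<in> F" "l = Min (component rw J i)" using l by (auto simp: Rt_def)
      then have "component rw J l = component rw J i" using component_eq[of i J l rw] root[of i] F by auto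
      then show ?thesis using i by simp
    qed
    have "component rw J c = component rw J a" "component rw J c = component rw J b"
      using component_eq[OF _ c(1)] component_eq[OF _ c(2)] that RtF F by auto
    then show False using m that by metis
  qed
  have "card Rt * v = (\<Sum>l\<in>Rt. v)" by simp
  also have "\<dots> \<le> (\<Sum>l\<in>Rt. card (component rw J l))" by (rule sum_mono) (use F RtF in auto)
  also have "\<dots> = card (\<Union>l\<in>Rt. component rw J l)"
    by (rule card_UN_disjoint[symmetric]) (use finite_subset[OF RtF finF] fc disj in auto)
  also have "\<dots> \<le> card F" by (rule card_mono[OF finF]) (use F RtF in auto)
  finally have 2: "card Rt * v \<le> card F" .
  have "card F * v \<le> (excess rw F + card Rt) * v" using 1 by (rule mult_le_mono1)
  then show ?thesis using 2 by (simp add: algebra_simps)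
qed

section \<open>Random hashing\<close>

abbreviation E :: "'a pmf \<Rightarrow> ('a \<Rightarrow> real) \<Rightarrow> real" where
  "E p h \<equiv> measure_pmf.expectation p h"

text \<open>The distributions involved have finite support; working with finite sums avoids
  integrability conditions.\<close>

lemma E_eq_sum: "finite (set_pmf p) \<Longrightarrow> E p h = (\<Sum>a\<in>set_pmf p. pmf p a * h a)"
  by (subst integral_measure_pmf[of "set_pmf p"]) auto

lemma E_mono: "finite (set_pmf p) \<Longrightarrow> (\<And>a. a \<in> set_pmf p \<Longrightarrow> g a \<le> h a) \<Longrightarrow> E p g \<le> E p h"
  by (simp add: E_eq_sum sum_mono mult_left_mono)

lemma E_add: "finite (set_pmf p) \<Longrightarrow> E p (\<lambda>a. g a + h a) = E p g + E p h"
  by (simp add: E_eq_sum sum.distrib distrib_left)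

lemma E_cmult: "finite (set_pmf p) \<Longrightarrow> E p (\<lambda>a. c * h a) = c * E p h"
  by (simp add: E_eq_sum sum_distrib_left mult.left_commute)

lemma E_sum: "finite (set_pmf p) \<Longrightarrow> E p (\<lambda>a. \<Sum>i\<in>I. h i a) = (\<Sum>i\<in>I. E p (h i))"
  by (simp add: E_eq_sum sum_distrib_left) (rule sum.swap)

lemma prob_eq_E: "measure_pmf.prob p {a. Q a} = E p (\<lambda>a. of_bool (Q a))"
proof -
  have "(\<lambda>a. of_bool (Q a)) = (indicator {a. Q a} :: _ \<Rightarrow> real)" by (auto simp: indicator_def fun_eq_iff)
  then show ?thesis by simp
qed

lemma E_pair:
  assumes "finite (set_pmf p)" "finite (set_pmf q)"
  shows "E (pair_pmf p q) h = E p (\<lambda>a. E q (\<lambda>b. h (a, b)))"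
proof -
  have pp: "pmf (pair_pmf p q) z = pmf p (fst z) * pmf q (snd z)" for z
    by (cases z) (simp add: pmf_pair)
  have "E (pair_pmf p q) h = (\<Sum>z\<in>set_pmf p \<times> set_pmf q. pmf p (fst z) * pmf q (snd z) * h z)"
    using assms by (subst integral_measure_pmf[of "set_pmf p \<times> set_pmf q"]) (auto simp: pp)
  also have "\<dots> = (\<Sum>a\<in>set_pmf p. \<Sum>b\<in>set_pmf q. pmf p a * pmf q b * h (a, b))"
    by (simp add: sum.cartesian_product case_prod_beta')
  also have "\<dots> = E p (\<lambda>a. E q (\<lambda>b. h (a, b)))"
    using assms by (simp add: E_eq_sum sum_distrib_left mult.assoc)
  finally show ?thesis .
qed

lemma finite_set_Pi_pmf:
  assumes "finite A" "\<And>a. a \<in> A \<Longrightarrow> finite (set_pmf (q a))"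
  shows "finite (set_pmf (Pi_pmf A d q))"
  using assms by (simp add: set_Pi_pmf finite_PiE_dflt)

lemma E_Pi_insert:
  assumes "finite A" "a \<notin> A" "\<And>b. b \<in> insert a A \<Longrightarrow> finite (set_pmf (q b))"
  shows "E (Pi_pmf (insert a A) d q) h = E (Pi_pmf A d q) (\<lambda>f. E (q a) (\<lambda>v. h (f(a := v))))"
proof -
  have "E (Pi_pmf (insert a A) d q) h = E (pair_pmf (q a) (Pi_pmf A d q)) (\<lambda>(v, f). h (f(a := v)))"
    using assms by (simp add: Pi_pmf_insert case_prod_beta')
  also have "\<dots> = E (pair_pmf (Pi_pmf A d q) (q a)) (\<lambda>(f, v). h (f(a := v)))"
    by (subst pair_commute_pmf) (simp add: case_prod_beta')
  also have "\<dots> = E (Pi_pmf A d q) (\<lambda>f. E (q a) (\<lambda>v. h (f(a := v))))"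
    using assms by (subst E_pair) (auto intro: finite_set_Pi_pmf)
  finally show ?thesis .
qed

lemma E_Pi_remove:
  assumes "finite A" "a \<in> A" "\<And>b. b \<in> A \<Longrightarrow> finite (set_pmf (q b))"
  shows "E (Pi_pmf A d q) h = E (Pi_pmf (A - {a}) d q) (\<lambda>f. E (q a) (\<lambda>v. h (f(a := v))))"
  using E_Pi_insert[of "A - {a}" a q d h] assms by (simp add: insert_absorb)

lemma E_Pi_union:
  assumes "finite A" "finite B" "A \<inter> B = {}" "\<And>b. b \<in> A \<union> B \<Longrightarrow> finite (set_pmf (q b))"
  shows "E (Pi_pmf (A \<union> B) d q) h = E (Pi_pmf A d q) (\<lambda>f. E (Pi_pmf B d q) (\<lambda>g. h (\<lambda>x. if x \<in> A then f x else g x)))"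
proof -
  have "E (Pi_pmf (A \<union> B) d q) h = E (pair_pmf (Pi_pmf A d q) (Pi_pmf B d q)) (\<lambda>(f, g). h (\<lambda>x. if x \<in> A then f x else g x))"
    using assms by (simp add: Pi_pmf_union case_prod_beta')
  also have "\<dots> = E (Pi_pmf A d q) (\<lambda>f. E (Pi_pmf B d q) (\<lambda>g. h (\<lambda>x. if x \<in> A then f x else g x)))"
    using assms by (subst E_pair) (auto intro: finite_set_Pi_pmf)
  finally show ?thesis .
qed

lemma E_uniform: "w > 0 \<Longrightarrow> E (pmf_of_set {..<w}) h = (\<Sum>v<w. h v) / real w" for w :: nat
  by (subst integral_pmf_of_set) auto

text \<open>Integrate out the coordinate a first: Q does not see it, and Q' has conditional
  probability at most c.\<close>

lemma prob_Pi_conditional: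
  assumes A: "finite A" "a \<in> A" "\<And>b. b \<in> A \<Longrightarrow> finite (set_pmf (q b))"
    and indep: "\<And>f v. Q (f(a := v)) \<longleftrightarrow> Q f"
    and c: "\<And>f. measure_pmf.prob (q a) {v. Q' (f(a := v))} \<le> c" "c \<ge> 0"
  shows "measure_pmf.prob (Pi_pmf A d q) {f. Q f \<and> Q' f} \<le> c * measure_pmf.prob (Pi_pmf A d q) {f. Q f}"
proof -
  let ?p = "Pi_pmf (A - {a}) d q"
  have fin: "finite (set_pmf ?p)" using A by (intro finite_set_Pi_pmf) auto
  have "measure_pmf.prob (Pi_pmf A d q) {f. Q f \<and> Q' f} =
      E ?p (\<lambda>f. E (q a) (\<lambda>v. of_bool (Q f) * of_bool (Q' (f(a := v)))))"
    unfolding prob_eq_E by (subst E_Pi_remove[OF A]) (simp_all add: indep of_bool_conj)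
  also have "\<dots> = E ?p (\<lambda>f. of_bool (Q f) * measure_pmf.prob (q a) {v. Q' (f(a := v))})"
    using A by (simp add: E_cmult prob_eq_E)
  also have "\<dots> \<le> E ?p (\<lambda>f. c * of_bool (Q f))"
    by (rule E_mono[OF fin]) (use c in auto)
  also have "\<dots> = c * E ?p (\<lambda>f. of_bool (Q f))" by (rule E_cmult[OF fin])
  also have "E ?p (\<lambda>f. of_bool (Q f)) = E (Pi_pmf A d q) (\<lambda>f. of_bool (Q f))"
    by (subst E_Pi_remove[OF A]) (simp_all add: indep)
  finally show ?thesis by (simp add: prob_eq_E)
qed

text \<open>The value at (j, \<tau>) selects one of the 2 w rows of table \<tau>: its half is the
  bucket, its parity the sign. All entries are fully independent.\<close>

definition hash_pmf :: "nat set \<Rightarrow> nat \<Rightarrow> (nat \<times> nat \<Rightarrow> nat) pmf" where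
  "hash_pmf U w = Pi_pmf (U \<times> {..<256}) 0 (\<lambda>_. pmf_of_set {..<2 * w})"

lemma finite_uniform: "w > 0 \<Longrightarrow> finite (set_pmf (pmf_of_set {..<2 * w}))" for w :: nat
  by (subst set_pmf_of_set) (auto simp: lessThan_empty_iff)

lemma finite_hash: "finite U \<Longrightarrow> w > 0 \<Longrightarrow> finite (set_pmf (hash_pmf U w))"
  unfolding hash_pmf_def by (intro finite_set_Pi_pmf finite_uniform) auto

lemma set_hash: "finite U \<Longrightarrow> w > 0 \<Longrightarrow> f \<in> set_pmf (hash_pmf U w) \<Longrightarrow> j \<in> U \<Longrightarrow> \<tau> < 256 \<Longrightarrow> f (j, \<tau>) < 2 * w"
  unfolding hash_pmf_def by (auto simp: set_Pi_pmf PiE_dflt_def lessThan_empty_iff)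

lemma prob_bucket:
  assumes "finite H" "w > 0"
  shows "measure_pmf.prob (pmf_of_set {..<2 * w}) {v. v div 2 \<in> H} \<le> card H / real w"
proof -
  have "{..<2 * w} \<inter> {v. v div 2 \<in> H} \<subseteq> (\<lambda>h. 2 * h) ` H \<union> (\<lambda>h. 2 * h + 1) ` H"
  proof
    fix v assume "v \<in> {..<2 * w} \<inter> {v. v div 2 \<in> H}"
    then show "v \<in> (\<lambda>h. 2 * h) ` H \<union> (\<lambda>h. 2 * h + 1) ` H"
      by (cases "even v") (auto elim!: evenE oddE)
  qed
  then have "card ({..<2 * w} \<inter> {v. v div 2 \<in> H}) \<le> card ((\<lambda>h. 2 * h) ` H \<union> (\<lambda>h. 2 * h + 1) ` H)"
    using assms by (intro card_mono) auto
  also have "\<dots> \<le> card H + card H"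
    by (rule order_trans[OF card_Un_le add_mono[OF card_image_le card_image_le]]) (use assms in auto)
  finally have "real (card ({..<2 * w} \<inter> {v. v div 2 \<in> H})) \<le> 2 * card H" by simp
  then show ?thesis using assms(2)
    by (subst measure_pmf_of_set) (auto simp: field_simps lessThan_empty_iff)
qed

text \<open>Revealing the entries by increasing column, each entry of X falls into one of at most
  \<open>card F\<close> buckets fixed before. Demanding j < i makes the events sequential, although
  colliding is a symmetric relation.\<close>

lemma prob_collisions:
  assumes U: "finite U" "w > 0" and F: "finite F" "F \<subseteq> U" and X: "finite X" "X \<subseteq> F \<times> {..<256}"
  shows "measure_pmf.prob (hash_pmf U w)
     {f. \<forall>(i, \<tau>)\<in>X. \<exists>j\<in>F. j < i \<and> f (j, \<tau>) div 2 = f (i, \<tau>) div 2} \<le> (card F / real w) ^ card X"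
  using X
proof (induction "card X" arbitrary: X)
  case 0
  then show ?case by simp
next
  case (Suc m)
  define hit where "hit f = (\<lambda>(i, \<tau>). \<exists>j\<in>F. j < i \<and> f (j, \<tau>) div 2 = f (i, \<tau>) div 2)" for f :: "nat \<times> nat \<Rightarrow> nat"
  have hit_cong: "hit g b \<longleftrightarrow> hit f b"
    if "\<And>j. j < fst b \<Longrightarrow> g (j, snd b) = f (j, snd b)" "g b = f b" for f g b
    using that by (cases b) (auto simp: hit_def)
  have "X \<noteq> {}" using Suc by auto
  \<comment> \<open>Take an entry of maximal column: the other entries of X test only their own
    value and values of smaller columns, so they do not see its value.\<close>
  then have "Max (fst ` X) \<in> fst ` X" using Suc by (intro Max_in) auto
  then obtain a where a: "a \<in> X" "fst a = Max (fst ` X)" by auto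
  have amax: "fst b \<le> fst a" if "b \<in> X" for b
    unfolding a(2) by (rule Max_ge) (use that Suc in auto)
  have aU: "a \<in> U \<times> {..<256}" using a Suc(4) F by auto
  have "measure_pmf.prob (hash_pmf U w) {f. (\<forall>b\<in>X - {a}. hit f b) \<and> hit f a}
     \<le> card F / real w * measure_pmf.prob (hash_pmf U w) {f. \<forall>b\<in>X - {a}. hit f b}"
    unfolding hash_pmf_def
  proof (rule prob_Pi_conditional[OF _ aU])
    fix f :: "nat \<times> nat \<Rightarrow> nat" and v :: nat
    have "hit (f(a := v)) b \<longleftrightarrow> hit f b" if "b \<in> X - {a}" for b
    proof -
      have "(f(a := v)) (j, snd b) = f (j, snd b)" if "j < fst b" for j
        using amax[of b] \<open>b \<in> X - {a}\<close> that by auto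
      moreover have "(f(a := v)) b = f b" using that by simp
      ultimately show ?thesis by (rule hit_cong)
    qed
    then show "(\<forall>b\<in>X - {a}. hit (f(a := v)) b) \<longleftrightarrow> (\<forall>b\<in>X - {a}. hit f b)" by blast
  next
    fix f :: "nat \<times> nat \<Rightarrow> nat"
    let ?H = "(\<lambda>j. f (j, snd a) div 2) ` {j \<in> F. j < fst a}"
    have "measure_pmf.prob (pmf_of_set {..<2 * w}) {v. hit (f(a := v)) a}
        \<le> measure_pmf.prob (pmf_of_set {..<2 * w}) {v. v div 2 \<in> ?H}"
    proof (rule measure_pmf.finite_measure_mono)
      show "{v. hit (f(a := v)) a} \<subseteq> {v. v div 2 \<in> ?H}"
      proof clarify
        fix v assume "hit (f(a := v)) a"
        then obtain j where "j \<in> F" "j < fst a" "(f(a := v)) (j, snd a) div 2 = (f(a := v)) a div 2"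
          by (cases a) (auto simp only: hit_def prod.case fst_conv snd_conv)
        moreover from this(2) have "(j, snd a) \<noteq> a" by (metis fst_conv less_irrefl)
        ultimately have "v div 2 = f (j, snd a) div 2" "j \<in> {j \<in> F. j < fst a}" by auto
        then show "v div 2 \<in> ?H" by (rule image_eqI)
      qed
    qed simp
    also have "\<dots> \<le> card ?H / real w" by (rule prob_bucket) (use F U in auto)
    also have "\<dots> \<le> card F / real w"
    proof -
      have "card ?H \<le> card {j \<in> F. j < fst a}" by (rule card_image_le) (use F in simp)
      also have "\<dots> \<le> card F" by (rule card_mono) (use F in auto)
      finally show ?thesis by (simp add: divide_right_mono)
    qed
    finally show "measure_pmf.prob (pmf_of_set {..<2 * w}) {v. hit (f(a := v)) a} \<le> card F / real w" .
  qed (use U in \<open>auto simp: lessThan_empty_iff\<close>)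
  also have "\<dots> \<le> card F / real w * (card F / real w) ^ m"
  proof (rule mult_left_mono)
    have cm: "card (X - {a}) = m" unfolding card_Diff_singleton[OF a(1)] Suc(2)[symmetric] by simp
    have "measure_pmf.prob (hash_pmf U w)
     {f. \<forall>(i, \<tau>)\<in>X - {a}. \<exists>j\<in>F. j < i \<and> f (j, \<tau>) div 2 = f (i, \<tau>) div 2} \<le> (card F / real w) ^ card (X - {a})"
      by (rule Suc(1)) (use Suc a in auto)
    then show "measure_pmf.prob (hash_pmf U w) {f. \<forall>b\<in>X - {a}. hit f b} \<le> (card F / real w) ^ m"
      unfolding cm hit_def .
  qed simp
  finally have "measure_pmf.prob (hash_pmf U w) {f. (\<forall>b\<in>X - {a}. hit f b) \<and> hit f a} \<le> (card F / real w) ^ Suc m" by simp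
  moreover have "{f. (\<forall>b\<in>X - {a}. hit f b) \<and> hit f a} = {f. \<forall>b\<in>X. hit f b}" using a by auto
  ultimately show ?case using Suc(2) by (simp add: hit_def)
qed


section \<open>Moments of the signed noise in distinct buckets\<close>

definition sgn_of :: "nat \<Rightarrow> real" where
  "sgn_of v = (if even v then 1 else -1)"

lemma sum_uniform_pairs: "(\<Sum>v<2 * w. h v) = (\<Sum>b<w. h (2 * b) + h (2 * b + 1))" for h :: "nat \<Rightarrow> real" and w :: nat
  by (induction w) simp_all

text \<open>Expanding the product on the right, the left side consists of the terms with at most one
  factor c, and all other terms are nonnegative.\<close>

lemma prod_add_ge:
  fixes M c :: "'b \<Rightarrow> real"
  assumes "finite K" "\<And>b. b \<in> K \<Longrightarrow> M b \<ge> 0" "\<And>b. b \<in> K \<Longrightarrow> c b \<ge> 0"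
  shows "(\<Prod>b\<in>K. M b) + (\<Sum>b\<in>K. c b * (\<Prod>b'\<in>K - {b}. M b')) \<le> (\<Prod>b\<in>K. M b + c b)"
  using assms
proof (induction K rule: finite_induct)
  case (insert a K)
  have IH: "prod M K + (\<Sum>b\<in>K. c b * prod M (K - {b})) \<le> (\<Prod>b\<in>K. M b + c b)" using insert by auto
  have e: "prod M (insert a K - {b}) = M a * prod M (K - {b})" if "b \<in> K" for b
  proof -
    have "insert a K - {b} = insert a (K - {b})" using that insert by auto
    then show ?thesis using insert by simp
  qed
  have nn: "prod M K \<ge> 0" "M a \<ge> 0" "c a \<ge> 0" using insert by (auto intro: prod_nonneg)
  have nn2: "(\<Sum>b\<in>K. c b * prod M (K - {b})) \<ge> 0"
    using insert by (intro sum_nonneg mult_nonneg_nonneg prod_nonneg) auto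
  have "prod M (insert a K) + (\<Sum>b\<in>insert a K. c b * prod M (insert a K - {b}))
     = M a * prod M K + (c a * prod M K + (\<Sum>b\<in>K. c b * (M a * prod M (K - {b}))))"
    using insert e by simp
  also have "(\<Sum>b\<in>K. c b * (M a * prod M (K - {b}))) = M a * (\<Sum>b\<in>K. c b * prod M (K - {b}))"
    by (simp add: sum_distrib_left mult.left_commute)
  also have "M a * prod M K + (c a * prod M K + M a * (\<Sum>b\<in>K. c b * prod M (K - {b})))
     \<le> (M a + c a) * (prod M K + (\<Sum>b\<in>K. c b * prod M (K - {b})))"
    using nn nn2 by (simp add: algebra_simps)
  also have "\<dots> \<le> (M a + c a) * (\<Prod>b\<in>K. M b + c b)"
    using IH nn by (intro mult_left_mono) auto
  also have "\<dots> = (\<Prod>b\<in>insert a K. M b + c b)" using insert by simp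
  finally show ?case .
qed simp

text \<open>The average over a random sign: the triangle inequality for p = 1 and the parallelogram
  identity for p = 2.\<close>

lemma pow_add_sub_le: "p = 1 \<or> p = 2 \<Longrightarrow> \<bar>e + x\<bar> ^ p + \<bar>e - x\<bar> ^ p \<le> 2 * (\<bar>e\<bar> ^ p + \<bar>x\<bar> ^ p)" for e x :: real
  by (auto simp: power2_eq_square algebra_simps)

text \<open>The pair b names a table and a bucket in it. With Y the entries outside S, this is, up
  to a sign, what the tail of x contributes to the difference of the two rows of the bucket.\<close>

definition leak :: "(nat \<Rightarrow> real) \<Rightarrow> (nat \<times> nat) set \<Rightarrow> (nat \<times> nat \<Rightarrow> nat) \<Rightarrow> nat \<times> nat \<Rightarrow> real" where
  "leak x Y g b = (\<Sum>a\<in>Y. if snd a = fst b \<and> g a div 2 = snd b then sgn_of (g a) * x (fst a) else 0)"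

text \<open>Adding one coordinate changes one bucket, so products over distinct buckets behave as if the
  buckets were independent; for exponent 2 the random sign removes the cross term.\<close>

lemma E_prod_leak:
  assumes p: "p = 1 \<or> p = 2" and Y: "finite Y" and w: "w > 0" and K: "finite K" "K \<subseteq> UNIV \<times> {..<w}"
  shows "E (Pi_pmf Y 0 (\<lambda>_. pmf_of_set {..<2 * w})) (\<lambda>g. \<Prod>b\<in>K. \<bar>leak x Y g b\<bar> ^ p)
    \<le> (\<Prod>b\<in>K. (\<Sum>a\<in>{a\<in>Y. snd a = fst b}. \<bar>x (fst a)\<bar> ^ p) / w)"
  using Y K
proof (induction Y arbitrary: K rule: finite_induct)
  case empty
  show ?case using p by (elim disjE) (simp_all add: leak_def)
next
  case (insert a Y)
  let ?q = "\<lambda>_::nat \<times> nat. pmf_of_set {..<2 * w}" and ?M = "\<lambda>b. (\<Sum>a\<in>{a\<in>Y. snd a = fst b}. \<bar>x (fst a)\<bar> ^ p) / w"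
  let ?c = "\<lambda>b. if fst b = snd a then \<bar>x (fst a)\<bar> ^ p / w else 0"
  let ?L = "\<lambda>g b. \<bar>leak x Y g b\<bar> ^ p"
  have fin: "finite (set_pmf (Pi_pmf Y 0 ?q))"
    using insert w by (intro finite_set_Pi_pmf finite_uniform) auto
  have step: "leak x (insert a Y) (g(a := v)) b = leak x Y g b + (if b = (snd a, v div 2) then sgn_of v * x (fst a) else 0)" for g v b
  proof -
    have "(\<Sum>a'\<in>Y. if snd a' = fst b \<and> (g(a := v)) a' div 2 = snd b then sgn_of ((g(a := v)) a') * x (fst a') else 0) = leak x Y g b"
      unfolding leak_def by (rule sum.cong) (use insert in auto)
    then show ?thesis unfolding leak_def[of x "insert a Y"] using insert by (auto simp: prod_eq_iff)
  qed
  have one: "E (pmf_of_set {..<2 * w}) (\<lambda>v. \<Prod>b\<in>K. \<bar>leak x (insert a Y) (g(a := v)) b\<bar> ^ p)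
      \<le> (\<Prod>b\<in>K. ?L g b) + (\<Sum>b\<in>K. ?c b * (\<Prod>b'\<in>K - {b}. ?L g b'))" for g
  proof -
    define P where "P v = (\<Prod>b\<in>K. \<bar>leak x (insert a Y) (g(a := v)) b\<bar> ^ p)" for v
    \<comment> \<open>The hash values 2 h and 2 h + 1 select the same bucket with opposite signs, so
      averaging over the two is enough.\<close>
    have pair: "P (2 * h) + P (2 * h + 1) \<le> 2 * (\<Prod>b\<in>K. ?L g b) +
        (if (snd a, h) \<in> K then 2 * \<bar>x (fst a)\<bar> ^ p * (\<Prod>b'\<in>K - {(snd a, h)}. ?L g b') else 0)" for h
    proof (cases "(snd a, h) \<in> K")
      case False
      have "P v = (\<Prod>b\<in>K. ?L g b)" if "v div 2 = h" for v
        unfolding P_def step by (rule prod.cong) (use that False in auto)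
      then show ?thesis using False by simp
    next
      case True
      let ?b = "(snd a, h)" and ?R = "\<Prod>b'\<in>K - {(snd a, h)}. ?L g b'"
      have Pv: "P v = \<bar>leak x Y g ?b + sgn_of v * x (fst a)\<bar> ^ p * ?R" if "v div 2 = h" for v
      proof -
        have "P v = \<bar>leak x (insert a Y) (g(a := v)) ?b\<bar> ^ p * (\<Prod>b\<in>K - {?b}. \<bar>leak x (insert a Y) (g(a := v)) b\<bar> ^ p)"
          unfolding P_def using True insert.prems(1) by (rule prod.remove[rotated])
        also have "(\<Prod>b\<in>K - {?b}. \<bar>leak x (insert a Y) (g(a := v)) b\<bar> ^ p) = ?R"
          unfolding step by (rule prod.cong) (use that in auto)
        also have "leak x (insert a Y) (g(a := v)) ?b = leak x Y g ?b + sgn_of v * x (fst a)"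
          unfolding step using that by simp
        finally show ?thesis .
      qed
      have "P (2 * h) + P (2 * h + 1) = (\<bar>leak x Y g ?b + x (fst a)\<bar> ^ p + \<bar>leak x Y g ?b - x (fst a)\<bar> ^ p) * ?R"
        using Pv[of "2 * h"] Pv[of "2 * h + 1"] by (simp add: sgn_of_def algebra_simps)
      also have "\<dots> \<le> (2 * (?L g ?b + \<bar>x (fst a)\<bar> ^ p)) * ?R"
        by (rule mult_right_mono[OF pow_add_sub_le[OF p]]) (intro prod_nonneg, simp)
      also have "\<dots> = 2 * (?L g ?b * ?R) + 2 * \<bar>x (fst a)\<bar> ^ p * ?R" by (simp add: algebra_simps)
      also have "?L g ?b * ?R = (\<Prod>b\<in>K. ?L g b)" using True insert.prems(1) by (rule prod.remove[rotated, symmetric])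
      finally show ?thesis using True by simp
    qed
    have "E (pmf_of_set {..<2 * w}) P = (\<Sum>h<w. P (2 * h) + P (2 * h + 1)) / (2 * w)"
      using w by (subst E_uniform) (simp_all add: sum_uniform_pairs)
    also have "\<dots> \<le> (\<Sum>h<w. 2 * (\<Prod>b\<in>K. ?L g b) +
        (if (snd a, h) \<in> K then 2 * \<bar>x (fst a)\<bar> ^ p * (\<Prod>b'\<in>K - {(snd a, h)}. ?L g b') else 0)) / (2 * w)"
      by (intro divide_right_mono sum_mono pair) simp
    also have "\<dots> = (\<Prod>b\<in>K. ?L g b) + (\<Sum>h<w. if (snd a, h) \<in> K then \<bar>x (fst a)\<bar> ^ p / w * (\<Prod>b'\<in>K - {(snd a, h)}. ?L g b') else 0)"
    proof -
      have "(\<Sum>h<w. if (snd a, h) \<in> K then 2 * \<bar>x (fst a)\<bar> ^ p * (\<Prod>b'\<in>K - {(snd a, h)}. ?L g b') else 0) / (2 * w)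
        = (\<Sum>h<w. if (snd a, h) \<in> K then \<bar>x (fst a)\<bar> ^ p / w * (\<Prod>b'\<in>K - {(snd a, h)}. ?L g b') else 0)"
        unfolding sum_divide_distrib by (rule sum.cong) auto
      then show ?thesis using w by (simp add: sum.distrib add_divide_distrib)
    qed
    also have "(\<Sum>h<w. if (snd a, h) \<in> K then \<bar>x (fst a)\<bar> ^ p / w * (\<Prod>b'\<in>K - {(snd a, h)}. ?L g b') else 0)
      = (\<Sum>b\<in>K. ?c b * (\<Prod>b'\<in>K - {b}. ?L g b'))"
    proof -
      let ?F = "\<lambda>b. \<bar>x (fst a)\<bar> ^ p / w * (\<Prod>b'\<in>K - {b}. ?L g b')"
      have "(\<Sum>h<w. if (snd a, h) \<in> K then ?F (snd a, h) else 0) = (\<Sum>h\<in>{h\<in>{..<w}. (snd a, h) \<in> K}. ?F (snd a, h))"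
        by (rule sum.inter_filter[symmetric]) simp
      also have "\<dots> = (\<Sum>b\<in>(Pair (snd a)) ` {h\<in>{..<w}. (snd a, h) \<in> K}. ?F b)"
        by (subst sum.reindex) (auto simp: inj_on_def)
      also have "(Pair (snd a)) ` {h\<in>{..<w}. (snd a, h) \<in> K} = {b\<in>K. fst b = snd a}"
        using insert.prems(2) by force
      also have "(\<Sum>b\<in>{b\<in>K. fst b = snd a}. ?F b) = (\<Sum>b\<in>K. if fst b = snd a then ?F b else 0)"
        by (rule sum.inter_filter) (rule insert.prems(1))
      also have "\<dots> = (\<Sum>b\<in>K. ?c b * (\<Prod>b'\<in>K - {b}. ?L g b'))" by (rule sum.cong) auto
      finally show ?thesis .
    qed
    finally show ?thesis by (simp only: P_def)
  qed
  have "E (Pi_pmf (insert a Y) 0 ?q) (\<lambda>g. \<Prod>b\<in>K. \<bar>leak x (insert a Y) g b\<bar> ^ p)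
      = E (Pi_pmf Y 0 ?q) (\<lambda>g. E (pmf_of_set {..<2 * w}) (\<lambda>v. \<Prod>b\<in>K. \<bar>leak x (insert a Y) (g(a := v)) b\<bar> ^ p))"
    using insert w by (intro E_Pi_insert finite_uniform) auto
  also have "\<dots> \<le> E (Pi_pmf Y 0 ?q) (\<lambda>g. (\<Prod>b\<in>K. ?L g b) + (\<Sum>b\<in>K. ?c b * (\<Prod>b'\<in>K - {b}. ?L g b')))"
    by (rule E_mono[OF fin one])
  also have "\<dots> = E (Pi_pmf Y 0 ?q) (\<lambda>g. \<Prod>b\<in>K. ?L g b) + (\<Sum>b\<in>K. ?c b * E (Pi_pmf Y 0 ?q) (\<lambda>g. \<Prod>b'\<in>K - {b}. ?L g b'))"
    by (simp only: E_add[OF fin] E_sum[OF fin] E_cmult[OF fin])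
  also have "\<dots> \<le> (\<Prod>b\<in>K. ?M b) + (\<Sum>b\<in>K. ?c b * (\<Prod>b'\<in>K - {b}. ?M b'))"
  proof (intro add_mono sum_mono mult_left_mono)
    show "E (Pi_pmf Y 0 ?q) (\<lambda>g. \<Prod>b\<in>K. ?L g b) \<le> (\<Prod>b\<in>K. ?M b)" by (rule insert.IH[OF insert.prems])
    show "E (Pi_pmf Y 0 ?q) (\<lambda>g. \<Prod>b'\<in>K - {b}. ?L g b') \<le> (\<Prod>b'\<in>K - {b}. ?M b')" for b
      by (rule insert.IH) (use insert.prems in auto)
  qed auto
  also have "\<dots> \<le> (\<Prod>b\<in>K. ?M b + ?c b)"
    by (rule prod_add_ge[OF insert.prems(1)]) (auto intro!: divide_nonneg_nonneg sum_nonneg)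
  also have "\<dots> = (\<Prod>b\<in>K. (\<Sum>a'\<in>{a'\<in>insert a Y. snd a' = fst b}. \<bar>x (fst a')\<bar> ^ p) / w)"
  proof (rule prod.cong[OF refl])
    fix b
    have "{a'\<in>insert a Y. snd a' = fst b} = (if fst b = snd a then insert a {a'\<in>Y. snd a' = fst b} else {a'\<in>Y. snd a' = fst b})"
      by auto
    then show "?M b + ?c b = (\<Sum>a'\<in>{a'\<in>insert a Y. snd a' = fst b}. \<bar>x (fst a')\<bar> ^ p) / w"
      using insert by (auto simp: add_divide_distrib)
  qed
  finally show ?case .
qed

section \<open>Union bounds and tail bounds for hashing\<close>

lemma prob_mono_supp:
  assumes "\<And>f. f \<in> set_pmf p \<Longrightarrow> Q f \<Longrightarrow> Q' f"
  shows "measure_pmf.prob p {f. Q f} \<le> measure_pmf.prob p {f. Q' f}"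
proof -
  have "measure_pmf.prob p {f. Q f} = measure_pmf.prob p ({f. Q f} \<inter> set_pmf p)"
    by (rule measure_Int_set_pmf[symmetric])
  also have "\<dots> \<le> measure_pmf.prob p {f. Q' f}"
    by (rule measure_pmf.finite_measure_mono) (use assms in auto)
  finally show ?thesis .
qed

lemma prob_Ex_le:
  assumes "finite I" "\<And>i. i \<in> I \<Longrightarrow> measure_pmf.prob p {f. Q i f} \<le> c i"
  shows "measure_pmf.prob p {f. \<exists>i\<in>I. Q i f} \<le> (\<Sum>i\<in>I. c i)"
proof -
  have "{f. \<exists>i\<in>I. Q i f} = (\<Union>i\<in>I. {f. Q i f})" by auto
  then have "measure_pmf.prob p {f. \<exists>i\<in>I. Q i f} \<le> (\<Sum>i\<in>I. measure_pmf.prob p {f. Q i f})"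
    using measure_pmf.finite_measure_subadditive_finite[OF assms(1), of "\<lambda>i. {f. Q i f}" p] by simp
  also have "\<dots> \<le> (\<Sum>i\<in>I. c i)" by (rule sum_mono) (rule assms(2))
  finally show ?thesis .
qed

lemma prob_Ex_subsets:
  assumes "finite A" "\<And>X. X \<subseteq> A \<Longrightarrow> card X = m \<Longrightarrow> measure_pmf.prob p {f. Q X f} \<le> c" "c \<ge> 0"
  shows "measure_pmf.prob p {f. \<exists>X\<subseteq>A. card X = m \<and> Q X f} \<le> real (card A choose m) * c"
proof -
  have "{f. \<exists>X\<subseteq>A. card X = m \<and> Q X f} = {f. \<exists>X\<in>{X. X \<subseteq> A \<and> card X = m}. Q X f}" by auto
  then have "measure_pmf.prob p {f. \<exists>X\<subseteq>A. card X = m \<and> Q X f} \<le> (\<Sum>X\<in>{X. X \<subseteq> A \<and> card X = m}. c)"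
    using prob_Ex_le[of "{X. X \<subseteq> A \<and> card X = m}" p Q "\<lambda>_. c"] assms by simp
  then show ?thesis using n_subsets[OF assms(1)] by simp
qed

text \<open>Markov's inequality for the product, which reaches s^\<open>card K\<close> when all
  factors reach s. A bound on the mixed moment thus takes the place of independence.\<close>

lemma markov_prod:
  assumes "finite (set_pmf p)" "s > 0" "\<And>f b. f \<in> set_pmf p \<Longrightarrow> b \<in> K \<Longrightarrow> h b f \<ge> 0" "finite K"
  shows "measure_pmf.prob p {f. \<forall>b\<in>K. s \<le> h b f} \<le> E p (\<lambda>f. \<Prod>b\<in>K. h b f) / s ^ card K"
proof -
  have "measure_pmf.prob p {f. \<forall>b\<in>K. s \<le> h b f} \<le> E p (\<lambda>f. (1 / s ^ card K) * (\<Prod>b\<in>K. h b f))"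
    unfolding prob_eq_E
  proof (rule E_mono[OF assms(1)])
    fix f assume f: "f \<in> set_pmf p"
    show "of_bool (\<forall>b\<in>K. s \<le> h b f) \<le> (1 / s ^ card K) * (\<Prod>b\<in>K. h b f)"
    proof (cases "\<forall>b\<in>K. s \<le> h b f")
      case True
      have "(\<Prod>b\<in>K. s) \<le> (\<Prod>b\<in>K. h b f)" by (rule prod_mono) (use True assms in auto)
      then show ?thesis using True assms(2) by (simp add: field_simps)
    next
      case False
      have "(\<Prod>b\<in>K. h b f) \<ge> 0" by (rule prod_nonneg) (use assms f in auto)
      then show ?thesis using False assms(2) by auto
    qed
  qed
  then show ?thesis using E_cmult[OF assms(1)] by simp
qed

text \<open>Row numbers in mixed radix: copy, table, hash value. As 2 w is even, halving a row
  number keeps the buckets of different tables apart.\<close>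

definition hash_row :: "nat \<Rightarrow> nat \<Rightarrow> (nat \<times> nat \<Rightarrow> nat) \<Rightarrow> nat \<Rightarrow> nat \<Rightarrow> nat" where
  "hash_row w \<rho> f j \<tau> = (256 * \<rho> + \<tau>) * (2 * w) + f (j, \<tau>)"

lemma hash_row_div2: "hash_row w \<rho> f j \<tau> div 2 = (256 * \<rho> + \<tau>) * w + f (j, \<tau>) div 2"
  by (simp add: hash_row_def)

lemma mult_add_eq: "a * w + b = a' * w + b' \<Longrightarrow> b < w \<Longrightarrow> b' < w \<Longrightarrow> a = a' \<and> b = (b'::nat)"
proof -
  assume e: "a * w + b = a' * w + b'" and b: "b < w" "b' < w"
  have "(a * w + b) div w = a" "(a' * w + b') div w = a'" using b by simp_all
  then have "a = a'" using e by metis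
  then show ?thesis using e by simp
qed

lemma same_bucket:
  assumes "f (i, \<sigma>) < 2 * w" "f (j, \<tau>) < 2 * w"
  shows "hash_row w \<rho> f i \<sigma> div 2 = hash_row w \<rho> f j \<tau> div 2 \<longleftrightarrow> \<sigma> = \<tau> \<and> f (i, \<sigma>) div 2 = f (j, \<tau>) div 2"
proof
  assume "hash_row w \<rho> f i \<sigma> div 2 = hash_row w \<rho> f j \<tau> div 2"
  then have c: "256 * \<rho> + \<sigma> = 256 * \<rho> + \<tau> \<and> f (i, \<sigma>) div 2 = f (j, \<tau>) div 2"
    unfolding hash_row_div2 by (rule mult_add_eq) (use assms in auto)
  have "\<sigma> = \<tau>" using conjunct1[OF c] by (simp only: add_left_cancel)
  then show "\<sigma> = \<tau> \<and> f (i, \<sigma>) div 2 = f (j, \<tau>) div 2" using conjunct2[OF c] by (rule conjI)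
next
  assume "\<sigma> = \<tau> \<and> f (i, \<sigma>) div 2 = f (j, \<tau>) div 2"
  then have "\<sigma> = \<tau>" "f (i, \<sigma>) div 2 = f (j, \<tau>) div 2" by blast+
  then show "hash_row w \<rho> f i \<sigma> div 2 = hash_row w \<rho> f j \<tau> div 2" by (simp only: hash_row_div2)
qed

abbreviation bucket :: "(nat \<Rightarrow> nat \<Rightarrow> nat) \<Rightarrow> nat \<times> nat \<Rightarrow> nat" where
  "bucket rw p \<equiv> rw (fst p) (snd p) div 2"

text \<open>Entries without a colliding entry of smaller column occupy distinct buckets, so at least
  \<open>excess\<close> many entries do have one. The number of choices of x such entries is
  estimated crudely by 2^(256 \<open>card F\<close>).\<close>

lemma prob_excess:
  assumes U: "finite U" "w > 0" and F: "F \<subseteq> U"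
  shows "measure_pmf.prob (hash_pmf U w) {f. x \<le> excess (hash_row w \<rho> f) F} \<le> 2 ^ (256 * card F) * (card F / real w) ^ x"
proof -
  have finF: "finite F" using F U finite_subset by blast
  let ?A = "F \<times> {..<256::nat}"
  have finA: "finite ?A" using finF by simp
  have "measure_pmf.prob (hash_pmf U w) {f. x \<le> excess (hash_row w \<rho> f) F}
    \<le> measure_pmf.prob (hash_pmf U w) {f. \<exists>X\<subseteq>?A. card X = x \<and> (\<forall>(i, \<tau>)\<in>X. \<exists>j\<in>F. j < i \<and> f (j, \<tau>) div 2 = f (i, \<tau>) div 2)}"
  proof (rule prob_mono_supp)
    fix f assume f: "f \<in> set_pmf (hash_pmf U w)" and x: "x \<le> excess (hash_row w \<rho> f) F"
    let ?hit = "\<lambda>(i, \<tau>). \<exists>j\<in>F. j < i \<and> f (j, \<tau>) div 2 = f (i, \<tau>) div 2"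
    let ?C = "{p\<in>?A. \<not> ?hit p}"
    have lt: "f (j, \<tau>) < 2 * w" if "j \<in> F" "\<tau> < 256" for j \<tau> using set_hash[OF U f] that F by auto
    have "inj_on (bucket (hash_row w \<rho> f)) ?C"
    proof (rule inj_onI)
      fix p q assume p: "p \<in> ?C" and q: "q \<in> ?C" and eq: "bucket (hash_row w \<rho> f) p = bucket (hash_row w \<rho> f) q"
      obtain i \<sigma> j \<tau> where pq: "p = (i, \<sigma>)" "q = (j, \<tau>)" by (cases p; cases q)
      have a: "i \<in> F" "\<sigma> < 256" "j \<in> F" "\<tau> < 256" using p q pq by auto
      have e: "\<sigma> = \<tau>" "f (i, \<sigma>) div 2 = f (j, \<tau>) div 2"
        using eq same_bucket[of f i \<sigma> w j \<tau> \<rho>] lt a pq by auto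
      have "\<not> i < j" using q a(1) e by (auto simp: pq)
      moreover have "\<not> j < i" using p a(3) e by (auto simp: pq)
      ultimately show "p = q" using e pq by simp
    qed
    then have "card ?C = card (bucket (hash_row w \<rho> f) ` ?C)" by (rule card_image[symmetric])
    also have "\<dots> \<le> card (buckets (hash_row w \<rho> f) F)"
      unfolding buckets_def by (rule card_mono) (use finF in auto)
    finally have C: "card ?C \<le> card (buckets (hash_row w \<rho> f) F)" .
    have "{p\<in>?A. ?hit p} = ?A - ?C" by auto
    then have "card {p\<in>?A. ?hit p} = card ?A - card ?C"
      using finA by (simp only:) (rule card_Diff_subset, auto)
    moreover have "card ?A = 256 * card F" by (simp add: card_cartesian_product)
    ultimately have "x \<le> card {p\<in>?A. ?hit p}"
      using C x unfolding excess_def by linarith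
    then obtain X where "X \<subseteq> {p\<in>?A. ?hit p}" "card X = x" by (rule obtain_subset_with_card_n)
    then show "\<exists>X\<subseteq>?A. card X = x \<and> (\<forall>(i, \<tau>)\<in>X. \<exists>j\<in>F. j < i \<and> f (j, \<tau>) div 2 = f (i, \<tau>) div 2)"
      by (intro exI[of _ X]) auto
  qed
  also have "\<dots> \<le> real (card ?A choose x) * (card F / real w) ^ x"
  proof (rule prob_Ex_subsets[OF finA])
    fix X assume X: "X \<subseteq> ?A" "card X = x"
    show "measure_pmf.prob (hash_pmf U w) {f. \<forall>(i, \<tau>)\<in>X. \<exists>j\<in>F. j < i \<and> f (j, \<tau>) div 2 = f (i, \<tau>) div 2}
      \<le> (card F / real w) ^ x"
      using prob_collisions[OF U finF F finite_subset[OF X(1) finA] X(1)] X(2) by simp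
  qed simp
  also have "\<dots> \<le> 2 ^ (256 * card F) * (card F / real w) ^ x"
  proof (rule mult_right_mono)
    have "(card ?A choose x) \<le> 2 ^ card ?A" by (rule binomial_le_pow2)
    then have "real (card ?A choose x) \<le> real (2 ^ card ?A)" by (simp only: of_nat_le_iff)
    then show "real (card ?A choose x) \<le> 2 ^ (256 * card F)" by (simp add: card_cartesian_product mult.commute)
  qed simp
  finally show ?thesis .
qed

text \<open>The 14th largest of 256 values. Two noise sources exceed their quantiles in at most 26 tables,
  less than the 32 admitted in the error analysis.\<close>

definition upper_quantile :: "(nat \<Rightarrow> real) \<Rightarrow> real" where
  "upper_quantile a = Max (a ` {\<tau> \<in> {0..<256}. 14 \<le> card {\<sigma> \<in> {0..<256}. a \<tau> \<le> a \<sigma>}})"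

lemma upper_quantile:
  shows upper_quantile_ge: "14 \<le> card {\<sigma> \<in> {0..<256}. upper_quantile a \<le> a \<sigma>}"
    and upper_quantile_less: "card {\<sigma> \<in> {0..<256}. upper_quantile a < a \<sigma>} \<le> 13"
    and upper_quantile_in: "\<exists>\<tau><256. upper_quantile a = a \<tau>"
proof -
  let ?T = "{\<tau> \<in> {0..<256}. 14 \<le> card {\<sigma> \<in> {0..<256}. a \<tau> \<le> a \<sigma>}}"
  have "Min (a ` {0..<256}) \<in> a ` {0..<256}" by (rule Min_in) auto
  then obtain \<tau> where t: "\<tau> \<in> {0..<256}" "Min (a ` {0..<256}) = a \<tau>" by (elim imageE)
  have "{\<sigma> \<in> {0..<256}. a \<tau> \<le> a \<sigma>} = {0..<256}" unfolding t(2)[symmetric] by auto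
  then have "\<tau> \<in> ?T" using t(1) by simp
  then have "upper_quantile a \<in> a ` ?T" unfolding upper_quantile_def by (intro Max_in) auto
  then obtain \<tau>0 where t0: "\<tau>0 \<in> ?T" "upper_quantile a = a \<tau>0" by auto
  show "14 \<le> card {\<sigma> \<in> {0..<256}. upper_quantile a \<le> a \<sigma>}" using t0 by simp
  show "\<exists>\<tau><256. upper_quantile a = a \<tau>" using t0 by auto
  show "card {\<sigma> \<in> {0..<256}. upper_quantile a < a \<sigma>} \<le> 13"
  proof (rule ccontr)
    let ?H = "{\<sigma> \<in> {0..<256}. upper_quantile a < a \<sigma>}"
    assume "\<not> card ?H \<le> 13"
    then have c: "14 \<le> card ?H" by simp
    then have "?H \<noteq> {}" by (metis card.empty not_numeral_le_zero)
    then have "Min (a ` ?H) \<in> a ` ?H" by (intro Min_in) auto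
    then obtain \<tau>1 where t1: "\<tau>1 \<in> ?H" "Min (a ` ?H) = a \<tau>1" by (elim imageE)
    have "card ?H \<le> card {\<sigma> \<in> {0..<256}. a \<tau>1 \<le> a \<sigma>}" unfolding t1(2)[symmetric] by (rule card_mono) auto
    then have "\<tau>1 \<in> ?T" using c t1(1) by simp
    then have "a \<tau>1 \<le> upper_quantile a" unfolding upper_quantile_def by (intro Max_ge) auto
    then show False using t1(1) by auto
  qed
qed

text \<open>The hash values inside and outside S are independent. Once those of S are fixed, P marks
  distinct buckets, to which the moment bound over the outside applies. Injectivity matters, since
  entries in one bucket see the same leak.\<close>

lemma prob_leak:
  assumes p: "p = 1 \<or> p = 2" and U: "finite U" "w > 0" and S: "S \<subseteq> U" and P: "P \<subseteq> S \<times> {..<256}"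
    and N: "(\<Sum>j\<in>U - S. \<bar>x j\<bar> ^ p) \<le> N" and s: "s > 0"
  shows "measure_pmf.prob (hash_pmf U w) {f. inj_on (\<lambda>a. (snd a, f a div 2)) P \<and>
      (\<forall>a\<in>P. s \<le> \<bar>leak x ((U - S) \<times> {..<256}) f (snd a, f a div 2)\<bar> ^ p)} \<le> (N / w / s) ^ card P"
proof -
  let ?A = "S \<times> {..<256::nat}" and ?B = "(U - S) \<times> {..<256::nat}" and ?q = "\<lambda>_::nat \<times> nat. pmf_of_set {..<2 * w}"
  have finS: "finite S" using S U finite_subset by blast
  have finP: "finite P" using P finS finite_subset[OF P] by simp
  have AB: "U \<times> {..<256} = ?A \<union> ?B" using S by auto
  have fA: "finite (set_pmf (Pi_pmf ?A 0 ?q))" "finite (set_pmf (Pi_pmf ?B 0 ?q))"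
    using finS U by (auto intro!: finite_set_Pi_pmf finite_uniform)
  have N0: "N \<ge> 0" using N by (rule order_trans[rotated]) (simp add: sum_nonneg)
  let ?ev = "\<lambda>f. inj_on (\<lambda>a. (snd a, f a div 2)) P \<and> (\<forall>a\<in>P. s \<le> \<bar>leak x ?B f (snd a, f a div 2)\<bar> ^ p)"
  have "measure_pmf.prob (hash_pmf U w) {f. ?ev f} =
    E (Pi_pmf ?A 0 ?q) (\<lambda>f. E (Pi_pmf ?B 0 ?q) (\<lambda>g. of_bool (?ev (\<lambda>x. if x \<in> ?A then f x else g x))))"
    unfolding prob_eq_E hash_pmf_def AB using finS U by (intro E_Pi_union finite_uniform) auto
  also have "\<dots> \<le> E (Pi_pmf ?A 0 ?q) (\<lambda>f. (N / w / s) ^ card P)"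
  proof (rule E_mono[OF fA(1)])
    fix f assume f: "f \<in> set_pmf (Pi_pmf ?A 0 ?q)"
    define K where "K = (\<lambda>a. (snd a, f a div 2)) ` P"
    have lt: "f a < 2 * w" if "a \<in> P" for a
      using f finS U(2) P that by (auto simp: set_Pi_pmf PiE_dflt_def lessThan_empty_iff)
    have K: "finite K" "K \<subseteq> UNIV \<times> {..<w}" using finP lt less_mult_imp_div_less[of _ w 2] by (auto simp: K_def mult.commute)
    have ev: "?ev (\<lambda>x. if x \<in> ?A then f x else g x) \<longleftrightarrow>
        inj_on (\<lambda>a. (snd a, f a div 2)) P \<and> (\<forall>b\<in>K. s \<le> \<bar>leak x ?B g b\<bar> ^ p)" for g
    proof -
      let ?h = "\<lambda>x. if x \<in> ?A then f x else g x"
      have 1: "leak x ?B ?h b = leak x ?B g b" for b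
        unfolding leak_def by (rule sum.cong) auto
      have 2: "?h a = f a" if "a \<in> P" for a using that P by auto
      have "inj_on (\<lambda>a. (snd a, ?h a div 2)) P \<longleftrightarrow> inj_on (\<lambda>a. (snd a, f a div 2)) P"
        by (rule inj_on_cong) (simp add: 2)
      moreover have "(\<forall>a\<in>P. s \<le> \<bar>leak x ?B ?h (snd a, ?h a div 2)\<bar> ^ p) \<longleftrightarrow> (\<forall>b\<in>K. s \<le> \<bar>leak x ?B g b\<bar> ^ p)"
        unfolding K_def 1 by (simp add: 2)
      ultimately show ?thesis by blast
    qed
    show "E (Pi_pmf ?B 0 ?q) (\<lambda>g. of_bool (?ev (\<lambda>x. if x \<in> ?A then f x else g x))) \<le> (N / w / s) ^ card P"
    proof (cases "inj_on (\<lambda>a. (snd a, f a div 2)) P")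
      case False
      then show ?thesis unfolding ev using N0 s by simp
    next
      case True
      have cK: "card K = card P" unfolding K_def by (rule card_image[OF True])
      have "E (Pi_pmf ?B 0 ?q) (\<lambda>g. of_bool (?ev (\<lambda>x. if x \<in> ?A then f x else g x)))
        = measure_pmf.prob (Pi_pmf ?B 0 ?q) {g. \<forall>b\<in>K. s \<le> \<bar>leak x ?B g b\<bar> ^ p}"
        unfolding ev prob_eq_E using True by simp
      also have "\<dots> \<le> E (Pi_pmf ?B 0 ?q) (\<lambda>g. \<Prod>b\<in>K. \<bar>leak x ?B g b\<bar> ^ p) / s ^ card K"
        by (rule markov_prod[OF fA(2) s]) (use K in auto)
      also have "\<dots> \<le> (\<Prod>b\<in>K. (\<Sum>a\<in>{a\<in>?B. snd a = fst b}. \<bar>x (fst a)\<bar> ^ p) / w) / s ^ card K"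
        by (rule divide_right_mono[OF E_prod_leak[OF p _ U(2) K]]) (use U s in auto)
      also have "\<dots> \<le> (\<Prod>b\<in>K. N / w) / s ^ card K"
      proof (intro divide_right_mono prod_mono conjI)
        fix b
        have "(\<Sum>a\<in>{a\<in>?B. snd a = fst b}. \<bar>x (fst a)\<bar> ^ p) \<le> (\<Sum>a\<in>(\<lambda>j. (j, fst b)) ` (U - S). \<bar>x (fst a)\<bar> ^ p)"
          by (rule sum_mono2) (use U in auto)
        also have "\<dots> = (\<Sum>j\<in>U - S. \<bar>x j\<bar> ^ p)" by (subst sum.reindex) (auto simp: inj_on_def)
        finally show "(\<Sum>a\<in>{a\<in>?B. snd a = fst b}. \<bar>x (fst a)\<bar> ^ p) \<le> N" using N by linarith
      qed (use s in \<open>auto intro!: divide_nonneg_nonneg sum_nonneg\<close>)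
      also have "\<dots> = (N / w / s) ^ card P" by (simp add: cK power_divide power_mult_distrib)
      finally show ?thesis .
    qed
  qed
  also have "\<dots> = (N / w / s) ^ card P" by simp
  finally show ?thesis .
qed

text \<open>Here the noise is fixed and distinct entries have independent hash values, so the
  expectation of the product factorises even when entries share a bucket.\<close>

lemma prob_fixed_noise:
  assumes U: "finite U" "w > 0" and P: "P \<subseteq> U \<times> {..<256}"
    and nn: "\<And>\<tau> v. \<nu> \<tau> v \<ge> 0" and N: "\<And>\<tau>. \<tau> < 256 \<Longrightarrow> (\<Sum>v<2 * w. \<nu> \<tau> v) / (2 * w) \<le> N / w" and s: "s > 0"
  shows "measure_pmf.prob (hash_pmf U w) {f. \<forall>a\<in>P. s \<le> \<nu> (snd a) (f a)} \<le> (N / w / s) ^ card P"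
proof -
  let ?A = "U \<times> {..<256::nat}"
  have finP: "finite P" using finite_subset[OF P] U by simp
  have "measure_pmf.prob (hash_pmf U w) {f. \<forall>a\<in>P. s \<le> \<nu> (snd a) (f a)}
    \<le> E (hash_pmf U w) (\<lambda>f. \<Prod>a\<in>P. \<nu> (snd a) (f a)) / s ^ card P"
    by (rule markov_prod[OF finite_hash[OF U] s]) (use nn finP in auto)
  also have "E (hash_pmf U w) (\<lambda>f. \<Prod>a\<in>P. \<nu> (snd a) (f a)) = E (hash_pmf U w) (\<lambda>f. \<Prod>a\<in>?A. if a \<in> P then \<nu> (snd a) (f a) else 1)"
  proof (rule arg_cong[where f = "E (hash_pmf U w)"], rule ext)
    fix f
    have "(\<Prod>a\<in>?A. if a \<in> P then \<nu> (snd a) (f a) else 1) = (\<Prod>a\<in>?A \<inter> P. \<nu> (snd a) (f a))"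
      by (rule prod.inter_restrict[symmetric]) (use U in simp)
    then show "(\<Prod>a\<in>P. \<nu> (snd a) (f a)) = (\<Prod>a\<in>?A. if a \<in> P then \<nu> (snd a) (f a) else 1)"
      using P by (simp add: Int_absorb1)
  qed
  also have "\<dots> = (\<Prod>a\<in>?A. E (pmf_of_set {..<2 * w}) (\<lambda>v. if a \<in> P then \<nu> (snd a) v else 1))"
    unfolding hash_pmf_def
    by (rule expectation_prod_Pi_pmf) (use U nn in \<open>auto intro!: integrable_measure_pmf_finite finite_uniform\<close>)
  also have "\<dots> \<le> (\<Prod>a\<in>?A. if a \<in> P then N / w else 1)"
  proof (rule prod_mono)
    fix a assume a: "a \<in> ?A"
    have "E (pmf_of_set {..<2 * w}) (\<lambda>v. \<nu> (snd a) v) = (\<Sum>v<2 * w. \<nu> (snd a) v) / (2 * w)"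
      using U by (subst E_uniform) auto
    moreover have "0 \<le> (\<Sum>v<2 * w. \<nu> (snd a) v)" by (simp add: sum_nonneg nn)
    ultimately show "0 \<le> E (pmf_of_set {..<2 * w}) (\<lambda>v. if a \<in> P then \<nu> (snd a) v else 1) \<and>
       E (pmf_of_set {..<2 * w}) (\<lambda>v. if a \<in> P then \<nu> (snd a) v else 1) \<le> (if a \<in> P then N / w else 1)"
      using N[of "snd a"] a by auto
  qed
  also have "\<dots> = (\<Prod>a\<in>?A \<inter> P. N / w)" by (rule prod.inter_restrict[symmetric]) (use U in simp)
  also have "\<dots> = (N / w) ^ card P" using P by (simp add: Int_absorb1)
  finally show ?thesis using s by (simp add: power_divide power_mult_distrib divide_right_mono)
qed

text \<open>From 14 u large entries, fewer than 2 u collisions leave 12 u in distinct buckets, where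
  \<open>tail\<close> applies. The combinatorial factors count the choices of F and of these
  entries.\<close>

lemma prob_quantile:
  assumes U: "finite U" "w > 0" and S: "S \<subseteq> U" and t: "t > 0" "M > 0"
    and tail: "\<And>P s. P \<subseteq> S \<times> {..<256} \<Longrightarrow> s > 0 \<Longrightarrow> measure_pmf.prob (hash_pmf U w)
      {f. inj_on (\<lambda>a. (snd a, f a div 2)) P \<and> (\<forall>a\<in>P. s \<le> q f a)} \<le> (M / s) ^ card P"
  shows "measure_pmf.prob (hash_pmf U w) {f. \<exists>F\<subseteq>S. card F = u \<and> (excess (hash_row w \<rho> f) F < 2 * card F \<and>
      (\<forall>i\<in>F. 14 \<le> card {\<tau>\<in>{0..<256}. t * M \<le> q f (i, \<tau>)}))} \<le> real (card S choose u) * (2 ^ (256 * u) * (1 / t) ^ (12 * u))"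
proof (rule prob_Ex_subsets)
  show "finite S" by (rule finite_subset[OF S U(1)])
  show "0 \<le> 2 ^ (256 * u) * (1 / t) ^ (12 * u)" using t by simp
  fix F assume F: "F \<subseteq> S" "card F = u"
  have finF: "finite F" by (rule finite_subset[OF order_trans[OF F(1) S] U(1)])
  let ?A = "F \<times> {..<256::nat}"
  have finA: "finite ?A" using finF by simp
  let ?p = "measure_pmf.prob (hash_pmf U w)"
  have "?p {f. excess (hash_row w \<rho> f) F < 2 * card F \<and> (\<forall>i\<in>F. 14 \<le> card {\<tau>\<in>{0..<256}. t * M \<le> q f (i, \<tau>)})}
    \<le> ?p {f. \<exists>P\<subseteq>?A. card P = 12 * u \<and> (inj_on (\<lambda>a. (snd a, f a div 2)) P \<and> (\<forall>a\<in>P. t * M \<le> q f a))}"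
  proof (rule prob_mono_supp)
    fix f assume f: "f \<in> set_pmf (hash_pmf U w)"
      and ev: "excess (hash_row w \<rho> f) F < 2 * card F \<and> (\<forall>i\<in>F. 14 \<le> card {\<tau>\<in>{0..<256}. t * M \<le> q f (i, \<tau>)})"
    have lt: "f (j, \<tau>) < 2 * w" if "j \<in> F" "\<tau> < 256" for j \<tau> using set_hash[OF U f] that F S by auto
    define H where "H = {a\<in>?A. t * M \<le> q f a}"
    have "14 * card F = (\<Sum>i\<in>F. 14)" by simp
    also have "\<dots> \<le> (\<Sum>i\<in>F. card {\<tau>\<in>{0..<256}. t * M \<le> q f (i, \<tau>)})" by (rule sum_mono) (use ev in blast)
    also have "\<dots> = card (SIGMA i:F. {\<tau>\<in>{0..<256}. t * M \<le> q f (i, \<tau>)})" using finF by (simp add: card_SigmaI)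
    also have "(SIGMA i:F. {\<tau>\<in>{0..<256}. t * M \<le> q f (i, \<tau>)}) = H" by (auto simp: H_def)
    finally have "14 * u \<le> card H" using F by simp
    moreover have "card H \<le> card (bucket (hash_row w \<rho> f) ` H) + excess (hash_row w \<rho> f) F"
      by (rule excess_subset[OF finF]) (auto simp: H_def)
    ultimately have "12 * u \<le> card (bucket (hash_row w \<rho> f) ` H)" using ev F by linarith
    then obtain G where G: "G \<subseteq> bucket (hash_row w \<rho> f) ` H" "card G = 12 * u" by (rule obtain_subset_with_card_n)
    then obtain P where P: "P \<subseteq> H" "inj_on (bucket (hash_row w \<rho> f)) P" "G = bucket (hash_row w \<rho> f) ` P"
      by (auto simp: subset_image_inj)
    have PA: "P \<subseteq> ?A" using P(1) by (auto simp: H_def)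
    have "inj_on (\<lambda>a. (snd a, f a div 2)) P"
    proof (rule inj_onI)
      fix a b assume a: "a \<in> P" "b \<in> P" and e: "(snd a, f a div 2) = (snd b, f b div 2)"
      have m: "fst a \<in> F" "snd a < 256" "fst b \<in> F" "snd b < 256" using PA a by auto
      have l: "f (fst a, snd a) < 2 * w" "f (fst b, snd b) < 2 * w"
        by (rule lt[OF m(1,2)] lt[OF m(3,4)])+
      have "snd a = snd b \<and> f (fst a, snd a) div 2 = f (fst b, snd b) div 2"
        unfolding prod.collapse using e by (rule iffD1[OF prod.inject])
      then have "bucket (hash_row w \<rho> f) a = bucket (hash_row w \<rho> f) b" by (rule iffD2[OF same_bucket[OF l]])
      then show "a = b" using P(2) a by (auto dest: inj_onD)
    qed
    moreover have "card P = 12 * u" using card_image[OF P(2)] P(3) G by simp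
    ultimately show "\<exists>P\<subseteq>?A. card P = 12 * u \<and> (inj_on (\<lambda>a. (snd a, f a div 2)) P \<and> (\<forall>a\<in>P. t * M \<le> q f a))"
      using PA P(1) by (intro exI[of _ P]) (auto simp: H_def)
  qed
  also have "\<dots> \<le> real (card ?A choose (12 * u)) * (1 / t) ^ (12 * u)"
  proof (rule prob_Ex_subsets[OF finA])
    fix P assume P: "P \<subseteq> ?A" "card P = 12 * u"
    have "P \<subseteq> S \<times> {..<256}" using P F by auto
    from tail[OF this, of "t * M"] show "?p {f. inj_on (\<lambda>a. (snd a, f a div 2)) P \<and> (\<forall>a\<in>P. t * M \<le> q f a)} \<le> (1 / t) ^ (12 * u)"
      using t P by simp
  qed (use t in simp)
  also have "\<dots> \<le> 2 ^ (256 * u) * (1 / t) ^ (12 * u)"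
  proof (rule mult_right_mono)
    have "(card ?A choose (12 * u)) \<le> 2 ^ card ?A" by (rule binomial_le_pow2)
    then have "real (card ?A choose (12 * u)) \<le> real (2 ^ card ?A)" by (simp only: of_nat_le_iff)
    then show "real (card ?A choose (12 * u)) \<le> 2 ^ (256 * u)" using F by (simp add: card_cartesian_product mult.commute)
  qed (use t in simp)
  finally show "?p {f. excess (hash_row w \<rho> f) F < 2 * card F \<and> (\<forall>i\<in>F. 14 \<le> card {\<tau>\<in>{0..<256}. t * M \<le> q f (i, \<tau>)})}
    \<le> 2 ^ (256 * u) * (1 / t) ^ (12 * u)" .
qed

section \<open>Binomial estimates behind the union bounds\<close>

lemma choose_mult_pow_le:
  assumes "k > 0"
  shows "real (k choose u) * (real u / real k) ^ u \<le> 3 ^ u"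
proof -
  have "real (k choose u) \<le> real k ^ u / fact u"
  proof -
    have "real ((k choose u) * fact u) \<le> real (k ^ u)" by (simp only: of_nat_le_iff binomial_fact_pow)
    then show ?thesis by (simp add: pos_le_divide_eq)
  qed
  then have "real (k choose u) * (real u / real k) ^ u \<le> (real k ^ u / fact u) * (real u / real k) ^ u"
    by (rule mult_right_mono) simp
  also have "\<dots> = real u ^ u / fact u" using assms by (simp add: power_divide)
  \<comment> \<open>The quotient is a single term of the exponential series at u.\<close>
  also have "\<dots> \<le> exp (real u)"
  proof -
    have "summable (\<lambda>n. real u ^ n /\<^sub>R fact n)" by (rule summable_exp_generic)
    then have "(\<Sum>n\<in>{u}. real u ^ n /\<^sub>R fact n) \<le> (\<Sum>n. real u ^ n /\<^sub>R fact n)"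
      by (rule sum_le_suminf) auto
    then have "real u ^ u /\<^sub>R fact u \<le> exp (real u)" by (simp add: exp_def)
    then show ?thesis by (simp add: divide_inverse mult.commute)
  qed
  also have "\<dots> = exp 1 ^ u" by (simp add: exp_of_nat_mult[symmetric])
  also have "\<dots> \<le> 3 ^ u" by (rule power_mono) (use exp_le in auto)
  finally show ?thesis .
qed

text \<open>One factor u / k supplies 1 / k at the cost of u \<le> 2^u; the other factors are at
  most 1.\<close>

lemma pow_self_le:
  assumes "1 \<le> u" "u \<le> k"
  shows "(real u / real k) ^ u \<le> 2 ^ u / real k"
proof -
  obtain m where m: "u = Suc m" using assms by (cases u) auto
  have k: "real k > 0" using assms by simp
  have "real u ^ m \<le> real k ^ m" using assms by (intro power_mono) auto
  then have "real k * real u ^ u \<le> real u * real k ^ u"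
  proof -
    have "real u ^ u = real u * real u ^ m" "real k ^ u = real k * real k ^ m" using m by simp_all
    moreover have "real k * real u * real u ^ m \<le> real k * real u * real k ^ m"
      using \<open>real u ^ m \<le> real k ^ m\<close> by (rule mult_left_mono) simp
    ultimately show ?thesis by (simp only: ac_simps)
  qed
  also have "\<dots> \<le> 2 ^ u * real k ^ u"
  proof (rule mult_right_mono)
    have "u \<le> 2 ^ u" by (simp add: less_imp_le)
    then have "real u \<le> real (2 ^ u)" by (simp only: of_nat_le_iff)
    then show "real u \<le> 2 ^ u" by simp
  qed simp
  finally show ?thesis using k by (simp add: power_divide field_simps)
qed

text \<open>Of the two powers (u / k)^u, one cancels the binomial coefficient up to 3^u and the
  other supplies 1 / k. The constant 4096 leaves room for four bad events of total probability 1 /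
  (1024 k).\<close>

lemma choose_pow_small:
  fixes a :: real
  assumes u: "1 \<le> u" "u \<le> k" and a: "0 \<le> a" "a \<le> 1 / 2 ^ 100"
  shows "real (k choose u) * (a * (real u / real k)\<^sup>2) ^ u \<le> (1 / 2) ^ u / (4096 * real k)"
proof -
  have k: "real k > 0" using u by simp
  let ?z = "(real u / real k) ^ u"
  have "real (k choose u) * (a * (real u / real k)\<^sup>2) ^ u = (real (k choose u) * ?z) * a ^ u * ?z"
  proof -
    have "(a * y\<^sup>2) ^ u = a ^ u * y ^ u * y ^ u" for y by (simp add: power_mult_distrib power2_eq_square)
    then show ?thesis by (simp only: ac_simps)
  qed
  also have "\<dots> \<le> 3 ^ u * a ^ u * (2 ^ u / real k)"
    using choose_mult_pow_le[of k u] pow_self_le[OF u] k a by (intro mult_mono) auto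
  also have "\<dots> = (6 * a) ^ u / real k"
  proof -
    have "(6 * a) ^ u = (3 * 2 * a) ^ u" by simp
    also have "\<dots> = 3 ^ u * 2 ^ u * a ^ u" by (simp only: power_mult_distrib)
    finally have e: "(6 * a) ^ u = 3 ^ u * 2 ^ u * a ^ u" .
    show ?thesis unfolding e by (simp only: times_divide_eq_right mult_ac)
  qed
  also have "\<dots> \<le> (1 / 2 * (1 / 4096)) ^ u / real k"
  proof (intro divide_right_mono power_mono)
    have "6 * a \<le> 6 * (1 / 2 ^ 100)" using a by (intro mult_left_mono) auto
    then show "6 * a \<le> 1 / 2 * (1 / 4096)" by simp
  qed (use a k in auto)
  also have "\<dots> = (1 / 2) ^ u * (1 / 4096) ^ u / real k" by (simp only: power_mult_distrib)
  also have "\<dots> \<le> (1 / 2) ^ u * (1 / 4096) / real k"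
  proof (intro divide_right_mono mult_left_mono)
    show "(1 / 4096 :: real) ^ u \<le> 1 / 4096" using power_decreasing[of 1 u "1 / 4096 :: real"] u by simp
  qed (use k in auto)
  finally show ?thesis by (simp add: mult.commute)
qed

section \<open>Bad events of a copy\<close>

definition tail_sum :: "nat \<Rightarrow> real" where
  "tail_sum k = (\<Sum>u\<in>{1..k}. (1 / 2) ^ u / (4096 * real k))"

lemma tail_sum_le: "k > 0 \<Longrightarrow> tail_sum k \<le> 1 / (4096 * real k)"
proof -
  assume k: "k > 0"
  have "(\<Sum>u\<in>{1..k}. (1 / 2 :: real) ^ u) = 1 - (1 / 2) ^ k"
    by (induction k) (auto simp: field_simps)
  then have "(\<Sum>u\<in>{1..k}. (1 / 2 :: real) ^ u) \<le> 1" by simp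
  then have "(\<Sum>u\<in>{1..k}. (1 / 2 :: real) ^ u) / (4096 * real k) \<le> 1 / (4096 * real k)"
    by (rule divide_right_mono) simp
  then show ?thesis by (simp add: tail_sum_def sum_divide_distrib)
qed

text \<open>If the sum of squares is large, the hypothesis of \<open>weak_type_sum\<close> fails at
  some column, and the columns at least as large form a set whose quantiles all exceed a threshold
  depending on its size u. The conjunct on \<open>excess\<close> provides the few collisions that
  \<open>prob_quantile\<close> demands.\<close>

lemma prob_quantile_sum:
  assumes U: "finite U" "w > 0" and S: "S \<subseteq> U" "card S = k" "k > 0" and M: "M \<ge> 0" and nn: "\<And>f a. q f a \<ge> 0"
    and tail: "\<And>P s. P \<subseteq> S \<times> {..<256} \<Longrightarrow> s > 0 \<Longrightarrow> measure_pmf.prob (hash_pmf U w)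
      {f. inj_on (\<lambda>a. (snd a, f a div 2)) P \<and> (\<forall>a\<in>P. s \<le> q f a)} \<le> (M / s) ^ card P"
  shows "measure_pmf.prob (hash_pmf U w) {f. (\<forall>F\<subseteq>S. F \<noteq> {} \<longrightarrow> excess (hash_row w \<rho> f) F < 2 * card F) \<and>
      \<not> (\<Sum>i\<in>S. (upper_quantile (\<lambda>\<tau>. q f (i, \<tau>)) / M)\<^sup>2) \<le> 2 * (2 ^ 30)\<^sup>2 * real k} \<le> tail_sum k"
proof (cases "M = 0")
  \<comment> \<open>Division by zero yields 0, so the sum vanishes and the event is empty.\<close>
  case True
  then show ?thesis by (simp add: tail_sum_def sum_nonneg)
next
  case False
  then have M0: "M > 0" using M by simp
  have finS: "finite S" by (rule finite_subset[OF S(1) U(1)])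
  \<comment> \<open>A failure of the weak-type hypothesis with B = 2^30 at a column of rank u means
    a value above B (k / u)^(1/4).\<close>
  define T where "T u = root 4 ((2 ^ 30) ^ 4 * real k / real u)" for u :: nat
  have Tpos: "T u > 0" if "u > 0" for u using that S(3) by (simp add: T_def)
  have T4: "T u ^ 4 = (2 ^ 30) ^ 4 * real k / real u" for u unfolding T_def by (rule real_root_pow_pos2) simp_all
  let ?Q = "\<lambda>u f. \<exists>F\<subseteq>S. card F = u \<and> (excess (hash_row w \<rho> f) F < 2 * card F \<and>
      (\<forall>i\<in>F. 14 \<le> card {\<tau>\<in>{0..<256}. T u * M \<le> q f (i, \<tau>)}))"
  have "measure_pmf.prob (hash_pmf U w) {f. (\<forall>F\<subseteq>S. F \<noteq> {} \<longrightarrow> excess (hash_row w \<rho> f) F < 2 * card F) \<and>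
      \<not> (\<Sum>i\<in>S. (upper_quantile (\<lambda>\<tau>. q f (i, \<tau>)) / M)\<^sup>2) \<le> 2 * (2 ^ 30)\<^sup>2 * real k}
    \<le> measure_pmf.prob (hash_pmf U w) {f. \<exists>u\<in>{1..k}. ?Q u f}"
  proof (rule prob_mono_supp)
    fix f assume ev: "(\<forall>F\<subseteq>S. F \<noteq> {} \<longrightarrow> excess (hash_row w \<rho> f) F < 2 * card F) \<and>
      \<not> (\<Sum>i\<in>S. (upper_quantile (\<lambda>\<tau>. q f (i, \<tau>)) / M)\<^sup>2) \<le> 2 * (2 ^ 30)\<^sup>2 * real k"
    define g where "g i = upper_quantile (\<lambda>\<tau>. q f (i, \<tau>)) / M" for i
    have g0: "g i \<ge> 0" for i
    proof -
      obtain \<tau> where "upper_quantile (\<lambda>\<tau>. q f (i, \<tau>)) = q f (i, \<tau>)" using upper_quantile_in[of "\<lambda>\<tau>. q f (i, \<tau>)"] by blast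
      then show ?thesis using nn M0 by (simp add: g_def)
    qed
    have "\<exists>i\<in>S. \<not> g i ^ 4 * card {j\<in>S. g i \<le> g j} \<le> (2 ^ 30) ^ 4 * card S"
    proof (rule ccontr)
      assume "\<not> (\<exists>i\<in>S. \<not> g i ^ 4 * card {j\<in>S. g i \<le> g j} \<le> (2 ^ 30) ^ 4 * card S)"
      then have "(\<Sum>i\<in>S. (g i)\<^sup>2) \<le> 2 * (2 ^ 30)\<^sup>2 * card S"
        by (intro weak_type_sum finS g0) auto
      then show False using ev S by (simp add: g_def)
    qed
    then obtain i where i: "i \<in> S" "\<not> g i ^ 4 * card {j\<in>S. g i \<le> g j} \<le> (2 ^ 30) ^ 4 * card S" by blast
    define F where "F = {j\<in>S. g i \<le> g j}"
    define u where "u = card F"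
    have F: "F \<subseteq> S" "F \<noteq> {}" using i by (auto simp: F_def)
    have finF: "finite F" by (rule finite_subset[OF F(1) finS])
    have u: "1 \<le> u" "u \<le> k" using F finF card_mono[OF finS F(1)] S(2) by (auto simp: u_def Suc_le_eq card_gt_0_iff)
    have "(2 ^ 30) ^ 4 * real k < g i ^ 4 * real u" using i S unfolding F_def[symmetric] u_def by simp
    then have "T u ^ 4 \<le> g i ^ 4" unfolding T4 using u by (simp add: field_simps)
    then have Tg: "T u \<le> g i" using g0 by (rule power_le_imp_le_base[of _ 3, simplified])
    have "14 \<le> card {\<tau>\<in>{0..<256}. T u * M \<le> q f (j, \<tau>)}" if j: "j \<in> F" for j
    proof -
      have "T u \<le> g j" using Tg j by (auto simp: F_def)
      then have "T u * M \<le> upper_quantile (\<lambda>\<tau>. q f (j, \<tau>))" using M0 by (simp add: g_def pos_le_divide_eq)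
      then have "card {\<sigma>\<in>{0..<256}. upper_quantile (\<lambda>\<tau>. q f (j, \<tau>)) \<le> q f (j, \<sigma>)} \<le> card {\<tau>\<in>{0..<256}. T u * M \<le> q f (j, \<tau>)}"
        by (intro card_mono) auto
      then show ?thesis using upper_quantile_ge[of "\<lambda>\<tau>. q f (j, \<tau>)"] by simp
    qed
    then have "?Q u f" using F ev u_def by blast
    then show "\<exists>u\<in>{1..k}. ?Q u f" using u by (intro bexI[of _ u]) auto
  qed
  also have "\<dots> \<le> (\<Sum>u\<in>{1..k}. (1 / 2) ^ u / (4096 * real k))"
  proof (rule prob_Ex_le)
    fix u assume "u \<in> {1..k}"
    then have u: "1 \<le> u" "u \<le> k" by auto
    have "measure_pmf.prob (hash_pmf U w) {f. ?Q u f} \<le> real (card S choose u) * (2 ^ (256 * u) * (1 / T u) ^ (12 * u))"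
      by (rule prob_quantile[OF U S(1) Tpos M0 tail]) (use u in auto)
    \<comment> \<open>As 12 = 3 * 4, the fourth power of T enters three times: (u / k)^3 / 2^360 per
      column. So 2^30 is chosen for 2^360 to beat the 2^256 choices of entries, and (u / k)^2
      already suffices.\<close>
    also have "2 ^ (256 * u) * (1 / T u) ^ (12 * u) \<le> (2 ^ 256 / 2 ^ 360 * (real u / real k)\<^sup>2) ^ u"
    proof -
      have "(1 / T u) ^ (12 * u) = ((1 / T u ^ 4) ^ 3) ^ u" by (simp add: power_mult[symmetric] power_divide)
      also have "1 / T u ^ 4 = real u / real k / 2 ^ 120" unfolding T4 using u by (simp add: field_simps)
      finally have "2 ^ (256 * u) * (1 / T u) ^ (12 * u) = (2 ^ 256 * (real u / real k / 2 ^ 120) ^ 3) ^ u"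
        by (simp add: power_mult power_mult_distrib)
      also have "\<dots> \<le> (2 ^ 256 / 2 ^ 360 * (real u / real k)\<^sup>2) ^ u"
      proof (rule power_mono)
        have "real u / real k \<le> 1" using u by simp
        then have "(real u / real k) ^ 3 \<le> (real u / real k) ^ 2" by (intro power_decreasing) auto
        then show "2 ^ 256 * (real u / real k / 2 ^ 120) ^ 3 \<le> 2 ^ 256 / 2 ^ 360 * (real u / real k)\<^sup>2"
          by (simp add: power_divide)
      qed simp
      finally show ?thesis .
    qed
    also have "real (card S choose u) * (2 ^ 256 / 2 ^ 360 * (real u / real k)\<^sup>2) ^ u \<le> (1 / 2) ^ u / (4096 * real k)"
      unfolding S(2) by (rule choose_pow_small[OF u]) simp_all
    finally show "measure_pmf.prob (hash_pmf U w) {f. ?Q u f} \<le> (1 / 2) ^ u / (4096 * real k)"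
      by (simp add: mult_left_mono)
  qed simp
  finally show ?thesis by (simp add: tail_sum_def)
qed

text \<open>Two collisions per column give the power (u / w)^(2 u), just the exponent that
  \<open>choose_pow_small\<close> asks for.\<close>

lemma prob_not_expanding:
  assumes U: "finite U" "w > 0" and S: "S \<subseteq> U" "card S = k" "k > 0" and w: "2 ^ 700 * real k \<le> real w"
  shows "measure_pmf.prob (hash_pmf U w) {f. \<not> (\<forall>F\<subseteq>S. F \<noteq> {} \<longrightarrow> excess (hash_row w \<rho> f) F < 2 * card F)} \<le> tail_sum k"
proof -
  have finS: "finite S" by (rule finite_subset[OF S(1) U(1)])
  let ?Q = "\<lambda>u f. \<exists>F\<subseteq>S. card F = u \<and> 2 * u \<le> excess (hash_row w \<rho> f) F"
  have "measure_pmf.prob (hash_pmf U w) {f. \<not> (\<forall>F\<subseteq>S. F \<noteq> {} \<longrightarrow> excess (hash_row w \<rho> f) F < 2 * card F)}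
    \<le> measure_pmf.prob (hash_pmf U w) {f. \<exists>u\<in>{1..k}. ?Q u f}"
  proof (rule prob_mono_supp)
    fix f assume "\<not> (\<forall>F\<subseteq>S. F \<noteq> {} \<longrightarrow> excess (hash_row w \<rho> f) F < 2 * card F)"
    then obtain F where F: "F \<subseteq> S" "F \<noteq> {}" "2 * card F \<le> excess (hash_row w \<rho> f) F" by (auto simp: not_less)
    have "finite F" by (rule finite_subset[OF F(1) finS])
    then have "card F \<in> {1..k}" using F card_mono[OF finS F(1)] S(2) by (auto simp: Suc_le_eq card_gt_0_iff)
    then show "\<exists>u\<in>{1..k}. ?Q u f" using F by blast
  qed
  also have "\<dots> \<le> (\<Sum>u\<in>{1..k}. (1 / 2) ^ u / (4096 * real k))"
  proof (rule prob_Ex_le)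
    fix u assume "u \<in> {1..k}"
    then have u: "1 \<le> u" "u \<le> k" by auto
    have "measure_pmf.prob (hash_pmf U w) {f. ?Q u f} \<le> real (card S choose u) * (2 ^ (256 * u) * (real u / real w) ^ (2 * u))"
    proof (rule prob_Ex_subsets[OF finS])
      fix F assume F: "F \<subseteq> S" "card F = u"
      show "measure_pmf.prob (hash_pmf U w) {f. 2 * u \<le> excess (hash_row w \<rho> f) F} \<le> 2 ^ (256 * u) * (real u / real w) ^ (2 * u)"
        using prob_excess[OF U order_trans[OF F(1) S(1)], of "2 * u" \<rho>] F by simp
    qed simp
    also have "2 ^ (256 * u) * (real u / real w) ^ (2 * u) \<le> (2 ^ 256 / 2 ^ 1400 * (real u / real k)\<^sup>2) ^ u"
    proof -
      have "real u / real w \<le> real u / (2 ^ 700 * real k)"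
        by (rule divide_left_mono[OF w]) (use u S U in auto)
      then have "(real u / real w)\<^sup>2 \<le> (real u / (2 ^ 700 * real k))\<^sup>2" by (rule power_mono) simp
      also have "\<dots> = (real u / real k)\<^sup>2 / 2 ^ 1400" by (simp add: power_divide power_mult_distrib)
      finally have "2 ^ 256 * (real u / real w)\<^sup>2 \<le> 2 ^ 256 / 2 ^ 1400 * (real u / real k)\<^sup>2" by simp
      then have "(2 ^ 256 * (real u / real w)\<^sup>2) ^ u \<le> (2 ^ 256 / 2 ^ 1400 * (real u / real k)\<^sup>2) ^ u"
        by (rule power_mono) simp
      then show ?thesis by (simp add: power_mult power_mult_distrib)
    qed
    also have "real (card S choose u) * (2 ^ 256 / 2 ^ 1400 * (real u / real k)\<^sup>2) ^ u \<le> (1 / 2) ^ u / (4096 * real k)"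
      unfolding S(2) by (rule choose_pow_small[OF u]) simp_all
    finally show "measure_pmf.prob (hash_pmf U w) {f. ?Q u f} \<le> (1 / 2) ^ u / (4096 * real k)"
      by (simp add: mult_left_mono)
  qed simp
  finally show ?thesis by (simp add: tail_sum_def)
qed

text \<open>Only u - u div v collisions are available. Compared with (u / k)^u the loss is (k /
  u)^(u div v), at most v^(8 (u div v)) \<le> 2^(8 u), so the binomial coefficient is still
  cancelled. Nothing is left for 1 / k, which is recovered from k \<le> u^9 and the geometric decay.
  Since the exponent may drop to u / 2, w has to exceed k by a factor as large as 2^700.\<close>

lemma component_tail_bound:
  assumes u: "1 \<le> u" "u \<le> k" and v: "2 \<le> v" "v \<le> u" "k \<le> v ^ 8 * u" and w: "2 ^ 700 * real k \<le> real w"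
  shows "real (k choose u) * (2 ^ (256 * u) * (real u / real w) ^ (u - u div v)) \<le> (1 / 2) ^ u / (4096 * real k) / real u"
proof -
  let ?x = "u - u div v" and ?z = "real u / real k"
  have k: "real k > 0" "real u > 0" using u by auto
  have dv: "u div v \<le> u" "2 * (u div v) \<le> u"
  proof -
    show "u div v \<le> u" by simp
    have "u div v * v \<le> u" by simp
    moreover have "u div v * 2 \<le> u div v * v" using v by (intro mult_le_mono2) simp
    ultimately show "2 * (u div v) \<le> u" by linarith
  qed
  have "real u / real w \<le> ?z / 2 ^ 700"
  proof -
    have "real u / real w \<le> real u / (2 ^ 700 * real k)"
    proof (rule divide_left_mono[OF w])
      have "0 < real w" using w k by (meson less_le_trans mult_pos_pos zero_less_numeral zero_less_power)
      then show "0 < real w * (2 ^ 700 * real k)" using k by simp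
    qed simp
    then show ?thesis by (simp add: mult.commute)
  qed
  then have "(real u / real w) ^ ?x \<le> (?z / 2 ^ 700) ^ ?x" by (rule power_mono) simp
  also have "\<dots> = ?z ^ ?x * (1 / 2 ^ 700) ^ ?x" by (simp add: power_divide)
  also have "\<dots> \<le> (?z ^ u * 2 ^ (8 * u)) * (1 / 2 ^ 350) ^ u"
  proof (rule mult_mono)
    have "?z ^ u = ?z ^ ?x * ?z ^ (u div v)" using dv by (simp flip: power_add)
    moreover have "1 \<le> ?z ^ (u div v) * 2 ^ (8 * u)"
    proof -
      have gen: "(y * a ^ 8) ^ m = y ^ m * (a ^ m) ^ 8" for y a :: real and m :: nat
        by (simp add: power_mult_distrib power_mult[symmetric] mult.commute)
      have "real k \<le> real (v ^ 8 * u)" using v by (simp only: of_nat_le_iff)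
      then have "1 \<le> ?z * real v ^ 8" using k by (simp add: field_simps)
      then have "1 \<le> (?z * real v ^ 8) ^ (u div v)" by simp
      also have "\<dots> = ?z ^ (u div v) * (real v ^ (u div v)) ^ 8" by (rule gen)
      also have "\<dots> \<le> ?z ^ (u div v) * 2 ^ (8 * u)"
      proof (rule mult_left_mono)
        have "v \<le> 2 ^ v" by (simp add: less_imp_le)
        then have "real v \<le> 2 ^ v" by (metis of_nat_le_iff of_nat_numeral of_nat_power)
        then have "real v ^ (u div v) \<le> (2 ^ v) ^ (u div v)" by (rule power_mono) simp
        also have "\<dots> = 2 ^ (v * (u div v))" by (simp add: power_mult)
        also have "\<dots> \<le> (2 :: real) ^ u" by (rule power_increasing) auto
        finally have "(real v ^ (u div v)) ^ 8 \<le> (2 ^ u) ^ 8" by (rule power_mono) simp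
        then show "(real v ^ (u div v)) ^ 8 \<le> 2 ^ (8 * u)" by (simp add: power_mult[symmetric] mult.commute)
      qed simp
      finally show ?thesis .
    qed
    ultimately have "?z ^ ?x * 1 \<le> ?z ^ ?x * (?z ^ (u div v) * 2 ^ (8 * u))" by (intro mult_left_mono) auto
    then show "?z ^ ?x \<le> ?z ^ u * 2 ^ (8 * u)" using \<open>?z ^ u = ?z ^ ?x * ?z ^ (u div v)\<close> by (simp add: mult.assoc)
    have "(1 / 2 ^ 700 :: real) ^ ?x = (1 / 2 ^ 350) ^ (2 * ?x)" by (simp add: power_mult power_divide)
    also have "\<dots> \<le> (1 / 2 ^ 350) ^ u" by (rule power_decreasing) (use dv in auto)
    finally show "(1 / 2 ^ 700 :: real) ^ ?x \<le> (1 / 2 ^ 350) ^ u" .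
  qed auto
  finally have "real (k choose u) * (2 ^ (256 * u) * (real u / real w) ^ ?x)
     \<le> real (k choose u) * (2 ^ (256 * u) * ((?z ^ u * 2 ^ (8 * u)) * (1 / 2 ^ 350) ^ u))"
    by (intro mult_left_mono) auto
  also have "\<dots> = (real (k choose u) * ?z ^ u) * (2 ^ 264 / 2 ^ 350) ^ u"
  proof -
    have "(2 ^ 264 / 2 ^ 350 :: real) = 2 ^ 256 * 2 ^ 8 * (1 / 2 ^ 350)" by simp
    then have "(2 ^ 264 / 2 ^ 350 :: real) ^ u = (2 ^ 256) ^ u * (2 ^ 8) ^ u * (1 / 2 ^ 350) ^ u"
      by (simp only: power_mult_distrib)
    moreover have "(2::real) ^ (256 * u) = (2 ^ 256) ^ u" "(2::real) ^ (8 * u) = (2 ^ 8) ^ u"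
      by (simp_all only: power_mult)
    ultimately show ?thesis by (simp only: mult_ac)
  qed
  also have "\<dots> \<le> 3 ^ u * (2 ^ 264 / 2 ^ 350) ^ u"
    using choose_mult_pow_le[of k u] u by (intro mult_right_mono) auto
  also have "\<dots> = (3 * (2 ^ 264 / 2 ^ 350)) ^ u" by (rule power_mult_distrib[symmetric])
  also have "\<dots> \<le> (1 / 2 * (1 / 2 ^ 22)) ^ u" by (rule power_mono) simp_all
  also have "\<dots> = (1 / 2) ^ u / 2 ^ (22 * u)"
  proof -
    have "(1 / 2 ^ 22 :: real) ^ u = 1 / 2 ^ (22 * u)" by (simp only: power_divide power_one power_mult)
    then show ?thesis by (simp only: power_mult_distrib) simp
  qed
  also have "\<dots> \<le> (1 / 2) ^ u / (4096 * real k * real u)"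
  proof (rule divide_left_mono)
    have "k * u \<le> v ^ 8 * u * u" using v by simp
    also have "\<dots> \<le> u ^ 8 * u * u" using v by (intro mult_le_mono1 power_mono) auto
    also have "\<dots> = u ^ 10" by (simp add: eval_nat_numeral)
    also have "\<dots> \<le> (2 ^ u) ^ 10" by (intro power_mono) (auto simp: less_imp_le)
    finally have "4096 * (k * u) \<le> 2 ^ 12 * (2 ^ u) ^ 10" by simp
    also have "\<dots> \<le> 2 ^ (12 * u) * (2 ^ u) ^ 10" using u by (intro mult_le_mono1 power_increasing) auto
    also have "\<dots> = 2 ^ (22 * u)" by (simp add: power_mult[symmetric] power_add[symmetric])
    finally have "real (4096 * (k * u)) \<le> real (2 ^ (22 * u))" by (simp only: of_nat_le_iff)
    then show "4096 * real k * real u \<le> 2 ^ (22 * u)" by simp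
  qed (use k in auto)
  finally show ?thesis by simp
qed

text \<open>Applying the weak-type inequality to squared sizes leads to v^8. The columns in
  components of size at least v form a union of components, which forces u - u div v
  collisions.\<close>

lemma prob_large_components:
  assumes U: "finite U" "w > 0" and S: "S \<subseteq> U" "card S = k" "k > 0" and w: "2 ^ 700 * real k \<le> real w"
  shows "measure_pmf.prob (hash_pmf U w) {f. \<not> (\<Sum>i\<in>S. ((real (card (component (hash_row w \<rho> f) S i)))\<^sup>2)\<^sup>2) \<le> 2 * (2 ^ 30)\<^sup>2 * real k} \<le> tail_sum k"
proof -
  have finS: "finite S" by (rule finite_subset[OF S(1) U(1)])
  let ?R = "\<lambda>u v f. \<exists>F\<subseteq>S. card F = u \<and> (k \<le> v ^ 8 * u \<and> u - u div v \<le> excess (hash_row w \<rho> f) F)"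
  have "measure_pmf.prob (hash_pmf U w) {f. \<not> (\<Sum>i\<in>S. ((real (card (component (hash_row w \<rho> f) S i)))\<^sup>2)\<^sup>2) \<le> 2 * (2 ^ 30)\<^sup>2 * real k}
    \<le> measure_pmf.prob (hash_pmf U w) {f. \<exists>u\<in>{1..k}. \<exists>v\<in>{2..u}. ?R u v f}"
  proof (rule prob_mono_supp)
    fix f assume ev: "\<not> (\<Sum>i\<in>S. ((real (card (component (hash_row w \<rho> f) S i)))\<^sup>2)\<^sup>2) \<le> 2 * (2 ^ 30)\<^sup>2 * real k"
    let ?rw = "hash_row w \<rho> f"
    let ?V = "\<lambda>i. card (component ?rw S i)"
    define g where "g i = (real (?V i))\<^sup>2" for i
    have gle: "g i \<le> g j \<longleftrightarrow> ?V i \<le> ?V j" for i j by (simp add: g_def)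
    have "\<exists>i\<in>S. \<not> g i ^ 4 * card {j\<in>S. g i \<le> g j} \<le> (2 ^ 30) ^ 4 * card S"
    proof (rule ccontr)
      assume "\<not> (\<exists>i\<in>S. \<not> g i ^ 4 * card {j\<in>S. g i \<le> g j} \<le> (2 ^ 30) ^ 4 * card S)"
      then have "(\<Sum>i\<in>S. (g i)\<^sup>2) \<le> 2 * (2 ^ 30)\<^sup>2 * card S"
        by (intro weak_type_sum finS) (auto simp: g_def)
      then show False using ev S by (simp add: g_def)
    qed
    then obtain i where i: "i \<in> S" "\<not> g i ^ 4 * card {j\<in>S. g i \<le> g j} \<le> (2 ^ 30) ^ 4 * card S" by blast
    define F where "F = {j\<in>S. ?V i \<le> ?V j}"
    define u where "u = card F"
    define v where "v = ?V i"
    have F: "F \<subseteq> S" "i \<in> F" using i by (auto simp: F_def)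
    have finF: "finite F" by (rule finite_subset[OF F(1) finS])
    have u: "1 \<le> u" "u \<le> k" using F finF card_mono[OF finS F(1)] S(2) by (auto simp: u_def Suc_le_eq card_gt_0_iff)
    have big: "(2 ^ 30) ^ 4 * real k < real v ^ 8 * real u"
      using i S unfolding gle F_def[symmetric] u_def[symmetric] by (simp add: g_def v_def power_mult[symmetric])
    have closed: "component ?rw S j \<subseteq> F" if "j \<in> F" for j
    proof
      fix l assume l: "l \<in> component ?rw S j"
      then have "component ?rw S l = component ?rw S j" using component_eq[of j S l ?rw] that F by auto
      then show "l \<in> F" using l that by (auto simp: F_def component_def)
    qed
    have "u * v \<le> excess ?rw F * v + u"
      unfolding u_def by (rule excess_components[OF finS F(1) closed]) (auto simp: F_def v_def)
    have v2: "2 \<le> v"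
    proof (rule ccontr)
      assume "\<not> 2 \<le> v"
      then have "real v ^ 8 \<le> 1" by (intro power_le_one) auto
      then have "real v ^ 8 * real u \<le> 1 * real k" using u by (intro mult_mono) auto
      moreover have "real k \<le> (2 ^ 30) ^ 4 * real k" by simp
      ultimately show False using big by linarith
    qed
    have vu: "v \<le> u" unfolding v_def u_def by (rule card_mono[OF finF closed[OF F(2)]])
    have "real k \<le> (2 ^ 30) ^ 4 * real k" by simp
    then have "real k \<le> real (v ^ 8 * u)" using big by simp
    then have kv: "k \<le> v ^ 8 * u" by (simp only: of_nat_le_iff)
    have "u - u div v \<le> excess ?rw F"
    proof (rule ccontr)
      assume "\<not> u - u div v \<le> excess ?rw F"
      then have "excess ?rw F + u div v + 1 \<le> u" by linarith
      then have "(excess ?rw F + u div v + 1) * v \<le> u * v" by (rule mult_le_mono1)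
      then have "excess ?rw F * v + (u div v * v + v) \<le> excess ?rw F * v + u"
        using \<open>u * v \<le> excess ?rw F * v + u\<close> by (simp add: algebra_simps)
      moreover have "u < u div v * v + v" using v2 by (metis add.commute add_less_cancel_left div_mult_mod_eq less_le_trans mod_less_divisor zero_less_numeral)
      ultimately show False by linarith
    qed
    then show "\<exists>u\<in>{1..k}. \<exists>v\<in>{2..u}. ?R u v f"
      using u v2 vu kv F(1) by (intro bexI[of _ u] bexI[of _ v] exI[of _ F]) (auto simp: u_def)
  qed
  also have "\<dots> \<le> (\<Sum>u\<in>{1..k}. (1 / 2) ^ u / (4096 * real k))"
  proof (rule prob_Ex_le)
    fix u assume "u \<in> {1..k}"
    then have u: "1 \<le> u" "u \<le> k" by auto
    \<comment> \<open>For a given u fewer than u values of v are possible, which consumes the factor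
      1 / u of the tail bound.\<close>
    have "measure_pmf.prob (hash_pmf U w) {f. \<exists>v\<in>{2..u}. ?R u v f} \<le> (\<Sum>v\<in>{2..u}. (1 / 2) ^ u / (4096 * real k) / real u)"
    proof (rule prob_Ex_le)
      fix v assume "v \<in> {2..u}"
      then have v: "2 \<le> v" "v \<le> u" by auto
      show "measure_pmf.prob (hash_pmf U w) {f. ?R u v f} \<le> (1 / 2) ^ u / (4096 * real k) / real u"
      proof (cases "k \<le> v ^ 8 * u")
        case False
        then show ?thesis using u by simp
      next
        case True
        have "measure_pmf.prob (hash_pmf U w) {f. ?R u v f} \<le> real (card S choose u) * (2 ^ (256 * u) * (real u / real w) ^ (u - u div v))"
        proof (rule prob_Ex_subsets[OF finS])
          fix F assume F: "F \<subseteq> S" "card F = u"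
          show "measure_pmf.prob (hash_pmf U w) {f. k \<le> v ^ 8 * u \<and> u - u div v \<le> excess (hash_row w \<rho> f) F}
             \<le> 2 ^ (256 * u) * (real u / real w) ^ (u - u div v)"
            using prob_excess[OF U order_trans[OF F(1) S(1)], of "u - u div v" \<rho>] F True by simp
        qed simp
        also have "\<dots> \<le> (1 / 2) ^ u / (4096 * real k) / real u"
          unfolding S(2) by (rule component_tail_bound[OF u v True w])
        finally show ?thesis .
      qed
    qed simp
    also have "\<dots> \<le> real u * ((1 / 2) ^ u / (4096 * real k) / real u)"
    proof -
      have "real (u - 1) * ((1 / 2) ^ u / (4096 * real k) / real u) \<le> real u * ((1 / 2) ^ u / (4096 * real k) / real u)"
        by (rule mult_right_mono) auto
      then show ?thesis by simp
    qed
    also have "\<dots> = (1 / 2) ^ u / (4096 * real k)" using u by simp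
    finally show "measure_pmf.prob (hash_pmf U w) {f. \<exists>v\<in>{2..u}. ?R u v f} \<le> (1 / 2) ^ u / (4096 * real k)" .
  qed simp
  finally show ?thesis by (simp add: tail_sum_def)
qed

section \<open>The good event of one copy and the error it guarantees\<close>

definition leak_pow :: "nat \<Rightarrow> (nat \<Rightarrow> real) \<Rightarrow> nat set \<Rightarrow> nat set \<Rightarrow> (nat \<times> nat \<Rightarrow> nat) \<Rightarrow> nat \<times> nat \<Rightarrow> real" where
  "leak_pow p x U S f a = \<bar>leak x ((U - S) \<times> {..<256}) f (snd a, f a div 2)\<bar> ^ p"

definition gap :: "nat \<Rightarrow> nat \<Rightarrow> (nat \<Rightarrow> real) \<Rightarrow> nat \<Rightarrow> nat \<Rightarrow> real" where
  "gap w \<rho> \<nu> \<tau> v = \<nu> ((256 * \<rho> + \<tau>) * (2 * w) + v) - \<nu> (sib ((256 * \<rho> + \<tau>) * (2 * w) + v))"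

text \<open>The exponents are matched: the l2 analysis has to sum products of a quantile and a
  squared component size, and splits them into the squares of both. M is the typical noise of a
  bucket, measured as a p-th power.\<close>

definition nice :: "nat \<Rightarrow> (nat \<Rightarrow> real) \<Rightarrow> (nat \<Rightarrow> real) \<Rightarrow> nat set \<Rightarrow> nat set \<Rightarrow> nat \<Rightarrow> real \<Rightarrow> nat \<Rightarrow> (nat \<times> nat \<Rightarrow> nat) \<Rightarrow> bool" where
  "nice p x \<nu> U S w M \<rho> f \<longleftrightarrow> (\<forall>F\<subseteq>S. F \<noteq> {} \<longrightarrow> excess (hash_row w \<rho> f) F < 2 * card F) \<and>
     (\<Sum>i\<in>S. ((real (card (component (hash_row w \<rho> f) S i)))\<^sup>2)\<^sup>2) \<le> 2 * (2 ^ 30)\<^sup>2 * real (card S) \<and>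
     (\<Sum>i\<in>S. (upper_quantile (\<lambda>\<tau>. leak_pow p x U S f (i, \<tau>)) / M)\<^sup>2) \<le> 2 * (2 ^ 30)\<^sup>2 * real (card S) \<and>
     (\<Sum>i\<in>S. (upper_quantile (\<lambda>\<tau>. \<bar>gap w \<rho> \<nu> \<tau> (f (i, \<tau>))\<bar> ^ p) / M)\<^sup>2) \<le> 2 * (2 ^ 30)\<^sup>2 * real (card S)"

lemma prob_Un4_le:
  assumes "measure_pmf.prob q A \<le> t" "measure_pmf.prob q B \<le> t" "measure_pmf.prob q C \<le> t" "measure_pmf.prob q D \<le> t"
  shows "measure_pmf.prob q (A \<union> B \<union> C \<union> D) \<le> 4 * t"
  using assms measure_Un_le[of A "measure_pmf q" B] measure_Un_le[of "A \<union> B" "measure_pmf q" C]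
    measure_Un_le[of "A \<union> B \<union> C" "measure_pmf q" D] by simp

text \<open>The two noise events are intersected with the event of few collisions, because their
  tail bounds rely on it; together with its complement they still cover all failures.\<close>

lemma prob_not_nice:
  assumes p: "p = 1 \<or> p = 2" and U: "finite U" "w > 0" and S: "S \<subseteq> U" "card S = k" "k > 0" and w: "2 ^ 700 * real k \<le> real w"
    and N: "(\<Sum>j\<in>U - S. \<bar>x j\<bar> ^ p) \<le> N" "\<And>\<tau>. \<tau> < 256 \<Longrightarrow> (\<Sum>v<2 * w. \<bar>gap w \<rho> \<nu> \<tau> v\<bar> ^ p) / (2 * w) \<le> N / w"
  shows "measure_pmf.prob (hash_pmf U w) {f. \<not> nice p x \<nu> U S w (N / w) \<rho> f} \<le> 1 / (1024 * real k)"
proof -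
  have N0: "N \<ge> 0" using N(1) by (rule order_trans[rotated]) (simp add: sum_nonneg)
  then have M0: "N / w \<ge> 0" by simp
  let ?P = "measure_pmf.prob (hash_pmf U w)"
  let ?ex = "\<lambda>f. \<forall>F\<subseteq>S. F \<noteq> {} \<longrightarrow> excess (hash_row w \<rho> f) F < 2 * card F"
  let ?v = "\<lambda>f. (\<Sum>i\<in>S. ((real (card (component (hash_row w \<rho> f) S i)))\<^sup>2)\<^sup>2) \<le> 2 * (2 ^ 30)\<^sup>2 * real k"
  let ?x = "\<lambda>f. (\<Sum>i\<in>S. (upper_quantile (\<lambda>\<tau>. leak_pow p x U S f (i, \<tau>)) / (N / w))\<^sup>2) \<le> 2 * (2 ^ 30)\<^sup>2 * real k"
  let ?n = "\<lambda>f. (\<Sum>i\<in>S. (upper_quantile (\<lambda>\<tau>. \<bar>gap w \<rho> \<nu> \<tau> (f (i, \<tau>))\<bar> ^ p) / (N / w))\<^sup>2) \<le> 2 * (2 ^ 30)\<^sup>2 * real k"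
  have 1: "?P {f. \<not> ?ex f} \<le> tail_sum k" by (rule prob_not_expanding[OF U S w])
  have 2: "?P {f. \<not> ?v f} \<le> tail_sum k" by (rule prob_large_components[OF U S w])
  have 3: "?P {f. ?ex f \<and> \<not> ?x f} \<le> tail_sum k"
  proof (rule prob_quantile_sum[OF U S M0])
    show "0 \<le> leak_pow p x U S f a" for f a by (simp add: leak_pow_def)
    fix P :: "(nat \<times> nat) set" and s :: real assume P: "P \<subseteq> S \<times> {..<256}" "s > 0"
    show "?P {f. inj_on (\<lambda>a. (snd a, f a div 2)) P \<and> (\<forall>a\<in>P. s \<le> leak_pow p x U S f a)} \<le> (N / w / s) ^ card P"
      unfolding leak_pow_def by (rule prob_leak[OF p U S(1) P(1) N(1) P(2)])
  qed
  have 4: "?P {f. ?ex f \<and> \<not> ?n f} \<le> tail_sum k"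
  proof (rule prob_quantile_sum[OF U S M0, where q = "\<lambda>f a. \<bar>gap w \<rho> \<nu> (snd a) (f a)\<bar> ^ p" and \<rho> = \<rho>, unfolded snd_conv])
    show "0 \<le> \<bar>gap w \<rho> \<nu> (snd a) (f a)\<bar> ^ p" for f a by simp
    fix P :: "(nat \<times> nat) set" and s :: real assume P: "P \<subseteq> S \<times> {..<256}" "s > 0"
    have "?P {f. inj_on (\<lambda>a. (snd a, f a div 2)) P \<and> (\<forall>a\<in>P. s \<le> \<bar>gap w \<rho> \<nu> (snd a) (f a)\<bar> ^ p)}
       \<le> ?P {f. \<forall>a\<in>P. s \<le> \<bar>gap w \<rho> \<nu> (snd a) (f a)\<bar> ^ p}"
      by (rule prob_mono_supp) simp
    also have "\<dots> \<le> (N / w / s) ^ card P"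
    proof (rule prob_fixed_noise[OF U, where \<nu> = "\<lambda>\<tau> v. \<bar>gap w \<rho> \<nu> \<tau> v\<bar> ^ p"])
      show "P \<subseteq> U \<times> {..<256}" using P S by auto
    qed (use N P in simp_all)
    finally show "?P {f. inj_on (\<lambda>a. (snd a, f a div 2)) P \<and> (\<forall>a\<in>P. s \<le> \<bar>gap w \<rho> \<nu> (snd a) (f a)\<bar> ^ p)} \<le> (N / real w / s) ^ card P" .
  qed
  have eq: "{f. \<not> nice p x \<nu> U S w (N / w) \<rho> f} = {f. \<not> ?ex f} \<union> {f. \<not> ?v f} \<union> {f. ?ex f \<and> \<not> ?x f} \<union> {f. ?ex f \<and> \<not> ?n f}"
    unfolding nice_def S(2) by blast
  have "?P {f. \<not> nice p x \<nu> U S w (N / w) \<rho> f} \<le> 4 * tail_sum k"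
    unfolding eq by (rule prob_Un4_le[OF 1 2 3 4])
  then show ?thesis using tail_sum_le[OF S(3)] by simp
qed

text \<open>The measurements without reference to a matrix: i is split into copy, table and hash
  value in the radix of \<open>hash_row\<close>.\<close>

definition measure_at :: "nat \<Rightarrow> nat \<Rightarrow> (nat \<Rightarrow> nat \<times> nat \<Rightarrow> nat) \<Rightarrow> (nat \<Rightarrow> real) \<Rightarrow> (nat \<Rightarrow> real) \<Rightarrow> nat \<Rightarrow> real" where
  "measure_at n w h x \<nu> i =
     (\<Sum>j<n. if i mod (2 * w) = h (i div (2 * w) div 256) (j, i div (2 * w) mod 256) then x j else 0) + \<nu> i"

lemma sib_add: "even a \<Longrightarrow> sib (a + v) = a + sib v" for a v :: nat
proof -
  assume "even a"
  then obtain b where b: "a = 2 * b" by (elim evenE)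
  have "v \<le> 2 * (v div 2) + 1" by presburger
  then show ?thesis by (simp add: sib_def b)
qed

lemma sib_lt: "v < 2 * w \<Longrightarrow> sib v < 2 * w" for w :: nat
  by (cases "even v") (auto elim!: evenE oddE simp: sib_def)

text \<open>Subtracting the sibling row turns 0/1 entries into signs. The sign of v is common to the
  whole bucket and disappears in absolute values.\<close>

lemma sgn_of_eq:
  "(if u = v then 1 else 0) - (if u = sib v then 1 else 0) = (if u div 2 = v div 2 then sgn_of v * sgn_of u else (0::real))"
proof (cases "u div 2 = v div 2")
  case False
  then show ?thesis using sib_div2[of v] by auto
next
  case True
  show ?thesis
  proof (cases "even u = even v")
    case e: True
    then have "u = v" using True by (metis even_two_times_div_two odd_two_times_div_two_succ)
    then show ?thesis using sib_neq[of v] by (simp add: sgn_of_def)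
  next
    case e: False
    then have "u \<noteq> v" by auto
    moreover have "u = sib v" using True e
      by (cases "even v") (auto elim!: evenE oddE simp: sib_def)
    ultimately show ?thesis using True e by (simp add: sgn_of_def)
  qed
qed

lemma noise_bound:
  assumes w: "w > 0" and S: "S \<subseteq> {..<n}" and f: "\<And>j \<tau>. j < n \<Longrightarrow> \<tau> < 256 \<Longrightarrow> h \<rho> (j, \<tau>) < 2 * w"
    and j: "j \<in> S" "\<tau> < 256"
  shows "\<bar>noise (measure_at n w h x \<nu>) (hash_row w \<rho> (h \<rho>)) x S j \<tau>\<bar>
    \<le> \<bar>leak x (({..<n} - S) \<times> {..<256}) (h \<rho>) (\<tau>, h \<rho> (j, \<tau>) div 2)\<bar> + \<bar>gap w \<rho> \<nu> \<tau> (h \<rho> (j, \<tau>))\<bar>"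
proof -
  let ?f = "h \<rho>" and ?off = "(256 * \<rho> + \<tau>) * (2 * w)" and ?v = "h \<rho> (j, \<tau>)"
  have finS: "finite S" using S finite_subset by blast
  have v: "?v < 2 * w" using f j S by auto
  have div: "(?off + u) div (2 * w) = 256 * \<rho> + \<tau>" "(?off + u) mod (2 * w) = u" if "u < 2 * w" for u
    using that by simp_all
  have rwi: "hash_row w \<rho> ?f i \<sigma> = ?off + u \<longleftrightarrow> \<sigma> = \<tau> \<and> ?f (i, \<sigma>) = u" if "i < n" "\<sigma> < 256" "u < 2 * w" for i \<sigma> u
  proof
    assume "hash_row w \<rho> ?f i \<sigma> = ?off + u"
    then have c: "256 * \<rho> + \<sigma> = 256 * \<rho> + \<tau> \<and> ?f (i, \<sigma>) = u"
      unfolding hash_row_def by (rule mult_add_eq) (use f[OF that(1,2)] that in auto)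
    then have "\<sigma> = \<tau>" by (simp only: add_left_cancel)
    then show "\<sigma> = \<tau> \<and> ?f (i, \<sigma>) = u" using conjunct2[OF c] by (rule conjI)
  qed (auto simp: hash_row_def)
  have res: "resid (measure_at n w h x \<nu>) (hash_row w \<rho> ?f) x S (?off + u) =
      (\<Sum>i\<in>{..<n} - S. if ?f (i, \<tau>) = u then x i else 0) + \<nu> (?off + u)" if u: "u < 2 * w" for u
  proof -
    have "measure_at n w h x \<nu> (?off + u) = (\<Sum>i<n. if ?f (i, \<tau>) = u then x i else 0) + \<nu> (?off + u)"
      unfolding measure_at_def div[OF u] using j by (simp add: eq_commute)
    moreover have "(\<Sum>i\<in>S. \<Sum>\<sigma><256. if hash_row w \<rho> ?f i \<sigma> = ?off + u then x i else 0) = (\<Sum>i\<in>S. if ?f (i, \<tau>) = u then x i else 0)"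
    proof (rule sum.cong[OF refl])
      fix i assume "i \<in> S"
      then have "i < n" using S by auto
      have "(\<Sum>\<sigma><256. if hash_row w \<rho> ?f i \<sigma> = ?off + u then x i else 0) = (\<Sum>\<sigma><256. if \<sigma> = \<tau> then (if ?f (i, \<tau>) = u then x i else 0) else 0)"
        by (rule sum.cong[OF refl]) (use rwi[OF \<open>i < n\<close> _ u] in auto)
      then show "(\<Sum>\<sigma><256. if hash_row w \<rho> ?f i \<sigma> = ?off + u then x i else 0) = (if ?f (i, \<tau>) = u then x i else 0)"
        using j by simp
    qed
    moreover have "(\<Sum>i<n. if ?f (i, \<tau>) = u then x i else 0) =
        (\<Sum>i\<in>{..<n} - S. if ?f (i, \<tau>) = u then x i else 0) + (\<Sum>i\<in>S. if ?f (i, \<tau>) = u then x i else 0)"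
      by (rule sum.subset_diff[OF S]) simp
    ultimately show ?thesis by (simp add: resid_def)
  qed
  have r: "hash_row w \<rho> ?f j \<tau> = ?off + ?v" by (simp add: hash_row_def)
  have s: "sib (hash_row w \<rho> ?f j \<tau>) = ?off + sib ?v" unfolding r by (rule sib_add) simp
  have "noise (measure_at n w h x \<nu>) (hash_row w \<rho> ?f) x S j \<tau> =
      ((\<Sum>i\<in>{..<n} - S. if ?f (i, \<tau>) = ?v then x i else 0) - (\<Sum>i\<in>{..<n} - S. if ?f (i, \<tau>) = sib ?v then x i else 0)) + gap w \<rho> \<nu> \<tau> ?v"
    unfolding noise_def s unfolding r res[OF v] res[OF sib_lt[OF v]] gap_def sib_add[of ?off ?v, simplified] by simp
  also have "(\<Sum>i\<in>{..<n} - S. if ?f (i, \<tau>) = ?v then x i else 0) - (\<Sum>i\<in>{..<n} - S. if ?f (i, \<tau>) = sib ?v then x i else 0)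
     = (\<Sum>i\<in>{..<n} - S. ((if ?f (i, \<tau>) = ?v then 1 else 0) - (if ?f (i, \<tau>) = sib ?v then 1 else 0)) * x i)"
    unfolding sum_subtractf[symmetric] by (rule sum.cong) auto
  also have "\<dots> = sgn_of ?v * (\<Sum>i\<in>{..<n} - S. if ?f (i, \<tau>) div 2 = ?v div 2 then sgn_of (?f (i, \<tau>)) * x i else 0)"
    unfolding sgn_of_eq sum_distrib_left by (rule sum.cong) auto
  also have "(\<Sum>i\<in>{..<n} - S. if ?f (i, \<tau>) div 2 = ?v div 2 then sgn_of (?f (i, \<tau>)) * x i else 0)
     = leak x (({..<n} - S) \<times> {..<256}) ?f (\<tau>, ?v div 2)"
  proof -
    have "leak x (({..<n} - S) \<times> {..<256}) ?f (\<tau>, ?v div 2) =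
      (\<Sum>i\<in>{..<n} - S. \<Sum>\<sigma><256. if \<sigma> = \<tau> then (if ?f (i, \<tau>) div 2 = ?v div 2 then sgn_of (?f (i, \<tau>)) * x i else 0) else 0)"
      unfolding leak_def sum.cartesian_product by (rule sum.cong) auto
    then show ?thesis using j by simp
  qed
  finally have "noise (measure_at n w h x \<nu>) (hash_row w \<rho> ?f) x S j \<tau> =
    sgn_of ?v * leak x (({..<n} - S) \<times> {..<256}) ?f (\<tau>, ?v div 2) + gap w \<rho> \<nu> \<tau> ?v" .
  moreover have "\<bar>sgn_of ?v\<bar> = 1" by (simp add: sgn_of_def)
  ultimately show ?thesis by (simp add: abs_mult order_trans[OF abs_triangle_ineq])
qed

text \<open>The quantiles A and B are p-th powers, comparable to M, and their roots bound the noise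
  itself. For p = 1 first moments suffice and follow from z \<le> 1 + z^2; for p = 2 the component
  sizes enter.\<close>

lemma nice_copy_error:
  assumes p: "p = 1 \<or> p = 2" and w: "w > 0" and S: "S \<subseteq> {..<n}" and f: "\<And>j \<tau>. j < n \<Longrightarrow> \<tau> < 256 \<Longrightarrow> h \<rho> (j, \<tau>) < 2 * w"
    and nice: "nice p x \<nu> {..<n} S w M \<rho> (h \<rho>)" and M: "M \<ge> 0"
    and M0: "M = 0 \<Longrightarrow> (\<forall>j\<in>{..<n} - S. x j = 0) \<and> (\<forall>\<tau><256. \<forall>v<2 * w. gap w \<rho> \<nu> \<tau> v = 0)"
    and dec: "decodes (measure_at n w h x \<nu>) (hash_row w \<rho> (h \<rho>)) X S S"
  shows "(\<Sum>j\<in>S. \<bar>X j - x j\<bar> ^ p) \<le> 48 * 2 ^ 60 * real (card S) * M"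
proof -
  let ?f = "h \<rho>" and ?rw = "hash_row w \<rho> (h \<rho>)"
  define a where "a j \<tau> = leak_pow p x {..<n} S ?f (j, \<tau>)" for j \<tau>
  define b where "b j \<tau> = \<bar>gap w \<rho> \<nu> \<tau> (?f (j, \<tau>))\<bar> ^ p" for j \<tau>
  define A where "A j = upper_quantile (a j)" for j
  define B where "B j = upper_quantile (b j)" for j
  define V where "V j = real (card (component ?rw S j))" for j
  let ?k = "real (card S)"
  have finS: "finite S" using S finite_subset by blast
  have p0: "p > 0" using p by auto
  have nn: "a j \<tau> \<ge> 0" "b j \<tau> \<ge> 0" for j \<tau> by (simp_all add: a_def b_def leak_pow_def)
  have AB0: "A j \<ge> 0" "B j \<ge> 0" for j
    using upper_quantile_in[of "a j"] upper_quantile_in[of "b j"] nn by (auto simp: A_def B_def)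
  \<comment> \<open>For M = 0 the quotient is 0 by convention, so A and B themselves have to vanish;
    this is the purpose of \<open>M0\<close>.\<close>
  have AM: "A j = A j / M * M" "B j = B j / M * M" if "j \<in> S" for j
  proof -
    have "A j = 0 \<and> B j = 0" if "M = 0"
    proof -
      have "leak x (({..<n} - S) \<times> {..<256}) ?f c = 0" for c
        unfolding leak_def by (rule sum.neutral) (use M0[OF that] in auto)
      then have "a j \<tau> = 0" for \<tau> using p0 by (simp add: a_def leak_pow_def)
      moreover have "b j \<tau> = 0" if "\<tau> < 256" for \<tau>
        using M0[OF \<open>M = 0\<close>] f[of j \<tau>] that \<open>j \<in> S\<close> S p0 by (auto simp: b_def)
      ultimately show ?thesis using upper_quantile_in[of "a j"] upper_quantile_in[of "b j"] by (auto simp: A_def B_def)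
    qed
    then show "A j = A j / M * M" "B j = B j / M * M" by (cases "M = 0"; simp)+
  qed
  define q where "q j = root p (A j) + root p (B j)" for j
  have q: "q j \<ge> 0 \<and> card {\<tau> \<in> {0..<256}. q j < \<bar>noise (measure_at n w h x \<nu>) ?rw x S j \<tau>\<bar>} \<le> 32" if j: "j \<in> S" for j
  proof
    show "q j \<ge> 0" using AB0 by (simp add: q_def p0)
    have rt: "z \<le> root p c" if "z ^ p \<le> c" "z \<ge> 0" for z c
    proof -
      have "z = root p (z ^ p)" using that p0 by (simp add: real_root_power_cancel)
      also have "\<dots> \<le> root p c" using that p0 by simp
      finally show ?thesis .
    qed
    have "{\<tau> \<in> {0..<256}. q j < \<bar>noise (measure_at n w h x \<nu>) ?rw x S j \<tau>\<bar>}
      \<subseteq> {\<tau> \<in> {0..<256}. A j < a j \<tau>} \<union> {\<tau> \<in> {0..<256}. B j < b j \<tau>}"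
    proof
      fix \<tau> assume t: "\<tau> \<in> {\<tau> \<in> {0..<256}. q j < \<bar>noise (measure_at n w h x \<nu>) ?rw x S j \<tau>\<bar>}"
      show "\<tau> \<in> {\<tau> \<in> {0..<256}. A j < a j \<tau>} \<union> {\<tau> \<in> {0..<256}. B j < b j \<tau>}"
      proof (rule ccontr)
        assume "\<not> ?thesis"
        then have "a j \<tau> \<le> A j" "b j \<tau> \<le> B j" using t by auto
        then have "\<bar>leak x (({..<n} - S) \<times> {..<256}) ?f (\<tau>, ?f (j, \<tau>) div 2)\<bar> \<le> root p (A j)"
          "\<bar>gap w \<rho> \<nu> \<tau> (?f (j, \<tau>))\<bar> \<le> root p (B j)"
          by (auto intro!: rt simp: a_def b_def leak_pow_def)
        then show False using noise_bound[where h = h and \<rho> = \<rho> and \<tau> = \<tau> and x = x and \<nu> = \<nu>, OF w S f j] t by (auto simp: q_def)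
      qed
    qed
    then have "card {\<tau> \<in> {0..<256}. q j < \<bar>noise (measure_at n w h x \<nu>) ?rw x S j \<tau>\<bar>}
      \<le> card ({\<tau> \<in> {0..<256}. A j < a j \<tau>} \<union> {\<tau> \<in> {0..<256}. B j < b j \<tau>})"
      by (intro card_mono) auto
    also have "\<dots> \<le> 13 + 13"
      unfolding A_def B_def by (intro order_trans[OF card_Un_le] add_mono upper_quantile_less)
    finally show "card {\<tau> \<in> {0..<256}. q j < \<bar>noise (measure_at n w h x \<nu>) ?rw x S j \<tau>\<bar>} \<le> 32" by simp
  qed
  have sV: "(\<Sum>j\<in>S. ((V j)\<^sup>2)\<^sup>2) \<le> 2 * 2 ^ 60 * ?k" and sA: "(\<Sum>j\<in>S. (A j / M)\<^sup>2) \<le> 2 * 2 ^ 60 * ?k"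
    and sB: "(\<Sum>j\<in>S. (B j / M)\<^sup>2) \<le> 2 * 2 ^ 60 * ?k"
    using nice unfolding nice_def V_def A_def B_def a_def b_def by simp_all
  show ?thesis
    using p
  proof
    assume p: "p = 1"
    have "(\<Sum>j\<in>S. \<bar>X j - x j\<bar> ^ p) = (\<Sum>j\<in>S. \<bar>X j - x j\<bar>)" by (simp add: p)
    also have "\<dots> \<le> 2 * (\<Sum>j\<in>S. q j)" by (rule decode_error_abs[OF dec q])
    also have "(\<Sum>j\<in>S. q j) \<le> (\<Sum>j\<in>S. M * (2 + (A j / M)\<^sup>2 + (B j / M)\<^sup>2))"
    proof (rule sum_mono)
      fix j assume j: "j \<in> S"
      have le: "z \<le> 1 + z\<^sup>2" for z :: real using zero_le_power2[of "z - 1 / 2"] by (simp add: power2_eq_square algebra_simps)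
      have "q j = M * (A j / M + B j / M)" using AM[OF j] by (simp add: q_def p distrib_left mult.commute)
      also have "\<dots> \<le> M * (2 + (A j / M)\<^sup>2 + (B j / M)\<^sup>2)"
        using le[of "A j / M"] le[of "B j / M"] by (intro mult_left_mono M) linarith
      finally show "q j \<le> M * (2 + (A j / M)\<^sup>2 + (B j / M)\<^sup>2)" .
    qed
    also have "\<dots> = M * (2 * ?k + (\<Sum>j\<in>S. (A j / M)\<^sup>2) + (\<Sum>j\<in>S. (B j / M)\<^sup>2))"
      by (simp add: sum_distrib_left[symmetric] sum.distrib)
    also have "\<dots> \<le> M * (2 * ?k + 2 * 2 ^ 60 * ?k + 2 * 2 ^ 60 * ?k)"
      using sA sB by (intro mult_left_mono M) linarith
    also have "2 * (M * (2 * ?k + 2 * 2 ^ 60 * ?k + 2 * 2 ^ 60 * ?k)) \<le> 48 * 2 ^ 60 * ?k * M"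
      using M by (simp add: algebra_simps mult_right_mono)
    finally show ?thesis by simp
  next
    assume p: "p = 2"
    have "(\<Sum>j\<in>S. \<bar>X j - x j\<bar> ^ p) = (\<Sum>j\<in>S. (X j - x j)\<^sup>2)" by (simp add: p)
    also have "\<dots> \<le> 4 * (\<Sum>j\<in>S. (q j)\<^sup>2 * (V j)\<^sup>2)" unfolding V_def by (rule decode_error_sq[OF dec finS q])
    also have "(\<Sum>j\<in>S. (q j)\<^sup>2 * (V j)\<^sup>2) \<le> (\<Sum>j\<in>S. 2 * M * ((A j / M)\<^sup>2 + (B j / M)\<^sup>2 + ((V j)\<^sup>2)\<^sup>2))"
    proof (rule sum_mono)
      fix j assume j: "j \<in> S"
      have "(y + z)\<^sup>2 \<le> 2 * (y\<^sup>2 + z\<^sup>2)" for y z :: real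
        using zero_le_power2[of "y - z"] by (simp add: power2_eq_square algebra_simps)
      from this[of "root p (A j)" "root p (B j)"] have "(q j)\<^sup>2 \<le> 2 * (A j + B j)"
        using AB0 by (simp add: q_def p sqrt_def[symmetric])
      also have "\<dots> = 2 * M * (A j / M + B j / M)" using AM[OF j] by (cases "M = 0") (simp_all add: field_simps)
      finally have "(q j)\<^sup>2 * (V j)\<^sup>2 \<le> 2 * M * (A j / M + B j / M) * (V j)\<^sup>2" by (rule mult_right_mono) simp
      also have "\<dots> = 2 * M * ((A j / M + B j / M) * (V j)\<^sup>2)" by simp
      \<comment> \<open>No joint bound for quantiles and component sizes is available; 2 y v \<le>
        y^2 + v^2 separates them.\<close>
      also have "\<dots> \<le> 2 * M * ((A j / M)\<^sup>2 + (B j / M)\<^sup>2 + ((V j)\<^sup>2)\<^sup>2)"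
      proof (intro mult_left_mono)
        have "(y + z) * v \<le> y\<^sup>2 + z\<^sup>2 + v\<^sup>2" for y z v :: real
          using sum_squares_bound[of y v] sum_squares_bound[of z v] zero_le_power2[of y] zero_le_power2[of z]
          unfolding distrib_right by linarith
        then show "(A j / M + B j / M) * (V j)\<^sup>2 \<le> (A j / M)\<^sup>2 + (B j / M)\<^sup>2 + ((V j)\<^sup>2)\<^sup>2" .
      qed (use M in simp)
      finally show "(q j)\<^sup>2 * (V j)\<^sup>2 \<le> 2 * M * ((A j / M)\<^sup>2 + (B j / M)\<^sup>2 + ((V j)\<^sup>2)\<^sup>2)" .
    qed
    also have "\<dots> = 2 * M * ((\<Sum>j\<in>S. (A j / M)\<^sup>2) + (\<Sum>j\<in>S. (B j / M)\<^sup>2) + (\<Sum>j\<in>S. ((V j)\<^sup>2)\<^sup>2))"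
      by (simp add: sum_distrib_left[symmetric] sum.distrib)
    also have "\<dots> \<le> 2 * M * (2 * 2 ^ 60 * ?k + 2 * 2 ^ 60 * ?k + 2 * 2 ^ 60 * ?k)"
      using sA sB sV M by (intro mult_left_mono) linarith+
    also have "4 * (2 * M * (2 * 2 ^ 60 * ?k + 2 * 2 ^ 60 * ?k + 2 * 2 ^ 60 * ?k)) = 48 * 2 ^ 60 * ?k * M"
      by simp
    finally show ?thesis by simp
  qed
qed

text \<open>If Z j is off by E, more than r/4 copies are off by at least E, and at least r/8 of
  these are good. So (r/8) E^p is at most the sum of the errors of the good copies at j; summing
  over j and exchanging the sums yields the factor 8.\<close>

lemma median_amplification:
  fixes X :: "nat \<Rightarrow> 'a \<Rightarrow> real"
  assumes r: "r > 0" and S: "finite S" and bad: "8 * card {\<rho>\<in>{0..<r}. \<not> ok \<rho>} \<le> r" and p: "p > 0"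
    and err: "\<And>\<rho>. \<rho> < r \<Longrightarrow> ok \<rho> \<Longrightarrow> (\<Sum>j\<in>S. \<bar>X \<rho> j - x j\<bar> ^ p) \<le> K"
    and Z: "\<And>j Q. j \<in> S \<Longrightarrow> monotone_pred Q \<Longrightarrow> 4 * card {\<rho>\<in>{0..<r}. Q (X \<rho> j)} \<le> r \<Longrightarrow> \<not> Q (Z j)"
  shows "(\<Sum>j\<in>S. \<bar>Z j - x j\<bar> ^ p) \<le> 8 * K"
proof -
  let ?G = "{\<rho>\<in>{0..<r}. ok \<rho>}"
  have K0: "0 \<le> K"
  proof -
    have "?G \<noteq> {}"
    proof
      assume "?G = {}"
      then have "{\<rho>\<in>{0..<r}. \<not> ok \<rho>} = {0..<r}" by auto
      then have "card {\<rho>\<in>{0..<r}. \<not> ok \<rho>} = r" by simp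
      then show False using bad r by simp
    qed
    then obtain \<rho> where "\<rho> < r" "ok \<rho>" by auto
    from err[OF this] show ?thesis by (rule order_trans[rotated]) (simp add: sum_nonneg)
  qed
  have each: "real r / 8 * \<bar>Z j - x j\<bar> ^ p \<le> (\<Sum>\<rho>\<in>?G. \<bar>X \<rho> j - x j\<bar> ^ p)" if j: "j \<in> S" for j
  proof (cases "Z j = x j")
    case True
    then have "real r / 8 * \<bar>Z j - x j\<bar> ^ p = 0" using p by (simp add: zero_power)
    also have "0 \<le> (\<Sum>\<rho>\<in>?G. \<bar>X \<rho> j - x j\<bar> ^ p)" by (simp add: sum_nonneg)
    finally show ?thesis .
  next
    case False
    let ?E = "\<bar>Z j - x j\<bar>"
    have "\<exists>Q. monotone_pred Q \<and> Q (Z j) \<and> (\<forall>u. Q u \<longrightarrow> ?E \<le> \<bar>u - x j\<bar>)"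
    proof (cases "x j < Z j")
      case True
      then show ?thesis by (intro exI[of _ "\<lambda>u. Z j \<le> u"]) (auto simp: monotone_pred_def)
    next
      case False
      then show ?thesis by (intro exI[of _ "\<lambda>u. u \<le> Z j"]) (auto simp: monotone_pred_def)
    qed
    then obtain Q where Q: "monotone_pred Q" "Q (Z j)" "\<And>u. Q u \<Longrightarrow> ?E \<le> \<bar>u - x j\<bar>" by blast
    let ?H = "{\<rho>\<in>{0..<r}. Q (X \<rho> j)}"
    have "r < 4 * card ?H" using Z[OF j Q(1)] Q(2) by (meson not_le)
    moreover have "card ?H \<le> card (?H \<inter> ?G) + card {\<rho>\<in>{0..<r}. \<not> ok \<rho>}"
      by (rule order_trans[OF card_mono card_Un_le]) auto
    ultimately have "r \<le> 8 * card (?H \<inter> ?G)" using bad by linarith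
    then have "real r \<le> real (8 * card (?H \<inter> ?G))" by (simp only: of_nat_le_iff)
    then have "real r / 8 * ?E ^ p \<le> card (?H \<inter> ?G) * ?E ^ p" by (intro mult_right_mono) auto
    also have "\<dots> = (\<Sum>\<rho>\<in>?H \<inter> ?G. ?E ^ p)" by simp
    also have "\<dots> \<le> (\<Sum>\<rho>\<in>?H \<inter> ?G. \<bar>X \<rho> j - x j\<bar> ^ p)" by (intro sum_mono power_mono) (use Q in auto)
    also have "\<dots> \<le> (\<Sum>\<rho>\<in>?G. \<bar>X \<rho> j - x j\<bar> ^ p)" by (rule sum_mono2) auto
    finally show ?thesis .
  qed
  have "real r / 8 * (\<Sum>j\<in>S. \<bar>Z j - x j\<bar> ^ p) \<le> (\<Sum>j\<in>S. \<Sum>\<rho>\<in>?G. \<bar>X \<rho> j - x j\<bar> ^ p)"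
    unfolding sum_distrib_left by (rule sum_mono) (rule each)
  also have "\<dots> = (\<Sum>\<rho>\<in>?G. \<Sum>j\<in>S. \<bar>X \<rho> j - x j\<bar> ^ p)" by (rule sum.swap)
  also have "\<dots> \<le> (\<Sum>\<rho>\<in>?G. K)" by (rule sum_mono) (use err in auto)
  also have "\<dots> = card ?G * K" by simp
  also have "\<dots> \<le> real r * K"
  proof (rule mult_right_mono[OF _ K0])
    have "card ?G \<le> card {0..<r}" by (rule card_mono) auto
    then show "real (card ?G) \<le> real r" by simp
  qed
  finally show ?thesis using r by (simp add: field_simps)
qed

section \<open>The matrix\<close>

definition hash_mat :: "nat \<Rightarrow> nat \<Rightarrow> nat \<Rightarrow> (nat \<Rightarrow> nat \<times> nat \<Rightarrow> nat) \<Rightarrow> real mat" where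
  "hash_mat n w r h = mat (256 * r * (2 * w)) n
     (\<lambda>(i, j). if i mod (2 * w) = h (i div (2 * w) div 256) (j, i div (2 * w) mod 256) then 1 else 0)"

lemma hash_mat_dim [simp]: "dim_row (hash_mat n w r h) = 256 * r * (2 * w)" "dim_col (hash_mat n w r h) = n"
  by (simp_all add: hash_mat_def)

lemma load_cong_rows: "(\<And>j \<tau>. j \<in> T \<Longrightarrow> \<tau> < 256 \<Longrightarrow> rw j \<tau> = rw' j \<tau>) \<Longrightarrow> load rw T b = load rw' T b"
  unfolding load_def by (intro sum.cong refl) simp

lemma lone_cong_rows:
  assumes "\<And>j \<tau>. j \<in> T \<Longrightarrow> \<tau> < 256 \<Longrightarrow> rw j \<tau> = rw' j \<tau>" "j \<in> T"
  shows "lone rw T j = lone rw' T j"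
proof -
  have "load rw T b = load rw' T b" for b by (rule load_cong_rows[OF assms(1)])
  then show ?thesis unfolding lone_def using assms by (intro Collect_cong) auto
qed

lemma peelable_cong_rows:
  assumes "\<And>j \<tau>. j \<in> J \<Longrightarrow> \<tau> < 256 \<Longrightarrow> rw j \<tau> = rw' j \<tau>" "peelable rw' J"
  shows "peelable rw J"
  unfolding peelable_def
proof (intro allI impI)
  fix T assume T: "T \<subseteq> J"
  have "lone rw T j = lone rw' T j" if "j \<in> T" for j
    by (rule lone_cong_rows) (use T assms(1) that in auto)
  then have "{j \<in> T. card (lone rw T j) < 224} = {j \<in> T. card (lone rw' T j) < 224}" by auto
  then show "2 * card {j \<in> T. card (lone rw T j) < 224} \<le> card T" using assms(2) T by (simp add: peelable_def)
qed

lemma decodes_subset: "decodes y rw X J D \<Longrightarrow> D \<subseteq> J"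
  by (induction rule: decodes.induct) auto

lemma decodes_cong_rows:
  assumes "decodes y rw X J D" "\<And>j \<tau>. j \<in> J \<Longrightarrow> \<tau> < 256 \<Longrightarrow> rw j \<tau> = rw' j \<tau>"
  shows "decodes y rw' X J D"
  using assms(1)
proof (induction rule: decodes.induct)
  case start
  show ?case by (rule decodes.start)
next
  case (step D j)
  have "D \<subseteq> J" by (rule decodes_subset[OF step.hyps(1)])
  then have r: "resid y rw X D = resid y rw' X D"
    unfolding resid_def using assms(2) by (intro ext arg_cong2[where f = "(-)"] sum.cong refl) auto
  have "is_median (\<lambda>\<tau>. resid y rw' X D (rw' j \<tau>) - resid y rw' X D (sib (rw' j \<tau>))) (X j)"
    by (rule iffD1[OF is_median_cong step.hyps(4)]) (use step.hyps(2) assms(2) r in simp)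
  moreover have "lone rw (J - D) j = lone rw' (J - D) j"
    by (rule lone_cong_rows) (use assms(2) step.hyps in auto)
  ultimately show ?case using step by (intro decodes.step) auto
qed

lemma length_concat_uniform: "(\<And>j. j < n \<Longrightarrow> length (f j) = T) \<Longrightarrow> length (concat (map f [0..<n])) = n * T"
  by (induction n) auto

lemma nth_concat_uniform:
  "(\<And>j. j < n \<Longrightarrow> length (f j) = T) \<Longrightarrow> j < n \<Longrightarrow> t < T \<Longrightarrow> concat (map f [0..<n]) ! (j * T + t) = f j ! t"
proof (induction n)
  case (Suc n)
  have l: "length (concat (map f [0..<n])) = n * T" by (rule length_concat_uniform) (use Suc in auto)
  show ?case
  proof (cases "j = n")
    case True
    then show ?thesis using l by (simp add: nth_append)
  next
    case False
    then have "Suc j \<le> n" using Suc by simp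
    then have "Suc j * T \<le> n * T" by (rule mult_le_mono1)
    then have "j * T + t < n * T" using Suc by simp
    moreover have "concat (map f [0..<n]) ! (j * T + t) = f j ! t" using Suc False by simp
    ultimately show ?thesis using l by (simp add: nth_append)
  qed
qed simp

text \<open>All that the deterministic analysis of the program knows about the hash functions; what
  holds only with high probability enters later through \<open>nice\<close>.\<close>

locale hashing =
  fixes n w r :: nat and h :: "nat \<Rightarrow> nat \<times> nat \<Rightarrow> nat"
  assumes w: "w > 0" and h: "\<And>\<rho> j \<tau>. \<rho> < r \<Longrightarrow> j < n \<Longrightarrow> \<tau> < 256 \<Longrightarrow> h \<rho> (j, \<tau>) < 2 * w"
begin

abbreviation entry :: "nat \<Rightarrow> nat \<Rightarrow> nat" where
  "entry j t \<equiv> t * (2 * w) + h (t div 256) (j, t mod 256)"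

lemma hash_less: "j < n \<Longrightarrow> t < 256 * r \<Longrightarrow> h (t div 256) (j, t mod 256) < 2 * w"
  by (rule h) auto

lemma block_less: "t < b \<Longrightarrow> u < 2 * w \<Longrightarrow> t * (2 * w) + u < b * (2 * w)"
proof -
  assume "t < b" "u < 2 * w"
  then have "t * (2 * w) + u < Suc t * (2 * w)" by simp
  also have "\<dots> \<le> b * (2 * w)" using \<open>t < b\<close> by (intro mult_le_mono1) simp
  finally show ?thesis .
qed

lemma supp_col:
  assumes j: "j < n"
  shows "supp_vec (col (hash_mat n w r h) j) = entry j ` {..<256 * r}"
proof (intro Set.set_eqI iffI)
  fix i assume "i \<in> supp_vec (col (hash_mat n w r h) j)"
  then have i: "i < 256 * r * (2 * w)" "i mod (2 * w) = h (i div (2 * w) div 256) (j, i div (2 * w) mod 256)"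
    using j by (auto simp: supp_vec_def hash_mat_def split: if_splits)
  have "i = entry j (i div (2 * w))" unfolding i(2)[symmetric] by (rule div_mult_mod_eq[symmetric])
  moreover have "i div (2 * w) \<in> {..<256 * r}" using i(1) by (simp add: less_mult_imp_div_less)
  ultimately show "i \<in> entry j ` {..<256 * r}" by (rule image_eqI)
next
  fix i assume "i \<in> entry j ` {..<256 * r}"
  then obtain t where t: "t < 256 * r" "i = entry j t" by auto
  have "i div (2 * w) = t" "i mod (2 * w) = h (t div 256) (j, t mod 256)"
    unfolding t(2) using hash_less[OF j t(1)] by simp_all
  moreover have "i < 256 * r * (2 * w)" unfolding t(2) by (rule block_less[OF t(1) hash_less[OF j t(1)]])
  ultimately show "i \<in> supp_vec (col (hash_mat n w r h) j)" using j by (simp add: supp_vec_def hash_mat_def)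
qed

text \<open>Each table owns a block of 2 w consecutive rows, so within a column increasing row order
  is table order. Hence the entry with index 256 \<rho> + \<tau> belongs to table \<tau> of copy
  \<rho>.\<close>

lemma col_rows_hash: "j < n \<Longrightarrow> col_rows (hash_mat n w r h) j = map (entry j) [0..<256 * r]"
proof -
  assume j: "j < n"
  have lt: "entry j t < entry j u" if "t < u" "u < 256 * r" for t u
    using block_less[OF that(1) hash_less[OF j, of t]] that by linarith
  have "sorted_wrt (<) (map (entry j) [0..<256 * r])"
    unfolding sorted_wrt_iff_nth_less using lt by simp
  then have "sorted_list_of_set (set (map (entry j) [0..<256 * r])) = map (entry j) [0..<256 * r]"
    by (intro sorted_list_of_set.idem_if_sorted_distinct) (auto simp: strict_sorted_iff)
  then show ?thesis unfolding col_rows_def supp_col[OF j] by (simp add: atLeast0LessThan)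
qed

lemma sparse_hash: "sparse_binary (256 * real r) (hash_mat n w r h)"
  unfolding sparse_binary_def
proof (intro conjI allI impI)
  show "elements_mat (hash_mat n w r h) \<subseteq> {0, 1}" by (auto simp: elements_mat_def hash_mat_def)
  fix j assume "j < dim_col (hash_mat n w r h)"
  then have "j < n" by simp
  then have "card (supp_vec (col (hash_mat n w r h) j)) \<le> card {..<256 * r}"
    unfolding supp_col[OF \<open>j < n\<close>] by (intro card_image_le) simp
  then have "real (card (supp_vec (col (hash_mat n w r h) j))) \<le> real (256 * r)"
    by (simp only: card_lessThan of_nat_le_iff)
  then show "real (card (supp_vec (col (hash_mat n w r h) j))) \<le> 256 * real r" by simp
qed

lemma col_ptrs_hash: "j \<le> n \<Longrightarrow> nth_default 0 (col_ptrs (hash_mat n w r h)) j = j * (256 * r)"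
proof -
  assume j: "j \<le> n"
  have "(\<Sum>i<j. length (col_rows (hash_mat n w r h) i)) = (\<Sum>i<j. 256 * r)"
    by (rule sum.cong[OF refl]) (use j in \<open>simp add: col_rows_hash\<close>)
  moreover have "[0..<Suc n] ! j = j" using j by (subst nth_upt) auto
  ultimately show ?thesis using j unfolding col_ptrs_def by (simp add: nth_default_def del: upt_Suc)
qed

lemma row_inds_hash: "j < n \<Longrightarrow> t < 256 * r \<Longrightarrow> nth_default 0 (row_inds (hash_mat n w r h)) (j * (256 * r) + t) = entry j t"
proof -
  assume j: "j < n" and t: "t < 256 * r"
  let ?f = "col_rows (hash_mat n w r h)"
  have l: "length (?f i) = 256 * r" if "i < n" for i using that by (simp add: col_rows_hash)
  have "Suc j * (256 * r) \<le> n * (256 * r)" using j by (intro mult_le_mono1) simp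
  then have "j * (256 * r) + t < n * (256 * r)" using t by simp
  then show ?thesis
    unfolding row_inds_def
    using nth_concat_uniform[of n ?f, OF l j t] length_concat_uniform[of n ?f, OF l] j t
    by (simp add: nth_default_def col_rows_hash)
qed

lemma hash_row_less: "\<rho> < r \<Longrightarrow> j < n \<Longrightarrow> \<tau> < 256 \<Longrightarrow> hash_row w \<rho> (h \<rho>) j \<tau> < 256 * r * (2 * w)"
  unfolding hash_row_def by (rule block_less[OF _ h]) auto

text \<open>The guarantee of the program with its memory hidden: X \<rho> are the estimates of copy
  \<rho> and z their approximate median. A copy that gave up may contribute arbitrary
  values.\<close>

definition decoded :: "(nat \<Rightarrow> real) \<Rightarrow> nat set \<Rightarrow> (nat \<Rightarrow> real) \<Rightarrow> bool" where
  "decoded y J z \<longleftrightarrow> (\<exists>X. (\<forall>\<rho><r. \<exists>D. decodes y (hash_row w \<rho> (h \<rho>)) (X \<rho>) J D \<and>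
       (peelable (hash_row w \<rho> (h \<rho>)) J \<longrightarrow> D = J)) \<and>
     (\<forall>j\<in>J. \<forall>Q. monotone_pred Q \<and> 4 * card {\<rho>\<in>{0..<r}. Q (X \<rho> j)} \<le> r \<longrightarrow> \<not> Q (z j)))"

lemma run_recover:
  assumes r: "r = 64 * 8 ^ L" and ss: "distinct ss" "set ss \<subseteq> {..<n}" "ss \<noteq> []"
  shows "run recover_com (input c \<epsilon> (hash_mat n w r h) y ss \<omega>) (\<lambda>t s. t \<le> 10240000 * (r * length ss) \<and>
     (\<forall>j. j \<notin> set ss \<longrightarrow> snd s 2 j = 0) \<and> decoded (nth_default 0 (list_of_vec y)) (set ss) (snd s 2))"
proof -
  let ?s = "input c \<epsilon> (hash_mat n w r h) y ss \<omega>"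
  \<comment> \<open>Column 0 must exist, as its end pointer tells the program r.\<close>
  have n: "n \<ge> 1" using ss(2,3) by (cases ss) auto
  have s: "fst ?s 0 1 = length ss" "\<And>i. i < length ss \<Longrightarrow> fst ?s 1 i = ss ! i" "fst ?s 0 0 = n" "fst ?s 2 1 = 256 * r"
    "fst ?s 10 0 = 0" "fst ?s 11 0 = 0" "fst ?s 5 = (\<lambda>_. 0)" "snd ?s 2 = (\<lambda>_. 0)" "snd ?s 1 = nth_default 0 (list_of_vec y)"
    using col_ptrs_hash[OF n] by (simp_all add: input_def nth_default_def)
  have rows: "rows_at ?s \<rho> j \<tau> = hash_row w \<rho> (h \<rho>) j \<tau>" if "\<rho> < r" "j < n" "\<tau> < 256" for \<rho> j \<tau>
  proof -
    have lt: "256 * \<rho> + \<tau> < 256 * r" using that by simp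
    have "rows_at ?s \<rho> j \<tau> = nth_default 0 (row_inds (hash_mat n w r h)) (j * (256 * r) + (256 * \<rho> + \<tau>))"
      using col_ptrs_hash[of j] that by (simp add: rows_at_def input_def add.assoc)
    also have "\<dots> = hash_row w \<rho> (h \<rho>) j \<tau>" unfolding row_inds_hash[OF that(2) lt] using that by (simp add: hash_row_def)
    finally show ?thesis .
  qed
  have blk: "\<rho> * (256 * w) \<le> rows_at ?s \<rho> j \<tau> div 2 \<and> rows_at ?s \<rho> j \<tau> div 2 < Suc \<rho> * (256 * w)"
    if "\<rho> < r" "j \<in> set ss" "\<tau> < 256" for \<rho> j \<tau>
  proof -
    have j: "j < n" using ss that by auto
    have e: "rows_at ?s \<rho> j \<tau> div 2 = (256 * \<rho> + \<tau>) * w + h \<rho> (j, \<tau>) div 2"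
      unfolding rows[OF that(1) j that(3)] hash_row_def by simp
    have "h \<rho> (j, \<tau>) div 2 < w" using h[OF that(1) j that(3)] by simp
    moreover have "(256 * \<rho> + \<tau>) * w + w \<le> Suc \<rho> * (256 * w)"
    proof -
      have "(256 * \<rho> + \<tau> + 1) * w \<le> (Suc \<rho> * 256) * w" using that by (intro mult_le_mono1) simp
      then show ?thesis by (simp only: distrib_right mult.assoc mult_1)
    qed
    moreover have "\<rho> * (256 * w) \<le> (256 * \<rho> + \<tau>) * w" by (simp add: distrib_right)
    ultimately show ?thesis unfolding e by linarith
  qed
  show ?thesis
    unfolding recover_com_def run_Seq
  proof (rule run_mono[OF run_copies[OF s(1,2) ss(1) refl s(3) ss(2) s(4) blk s(5-7)]])
    fix t s1 assume a: "frame (touched_n \<union> {10,11}) touched_r ?s s1 \<and> fst s1 11 0 = n * r \<and>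
     (\<forall>\<rho><r. \<exists>D. decodes (snd ?s 1) (rows_at ?s \<rho>) (\<lambda>j. snd s1 4 (n * \<rho> + j)) (set ss) D \<and>
        (peelable (rows_at ?s \<rho>) (set ss) \<longrightarrow> D = set ss)) \<and>
     t \<le> r * (10222000 * length ss + 70) + 10"
    then have e: "fst s1 0 = fst ?s 0" "fst s1 1 = fst ?s 1" "snd s1 2 = snd ?s 2"
      by (auto simp: frame_def touched_n_def touched_r_def)
    let ?X = "\<lambda>\<rho> j. snd s1 4 (n * \<rho> + j)"
    have X: "\<exists>D. decodes (nth_default 0 (list_of_vec y)) (hash_row w \<rho> (h \<rho>)) (?X \<rho>) (set ss) D \<and>
            (peelable (hash_row w \<rho> (h \<rho>)) (set ss) \<longrightarrow> D = set ss)" if "\<rho> < r" for \<rho>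
    proof -
      have ro: "rows_at ?s \<rho> j \<tau> = hash_row w \<rho> (h \<rho>) j \<tau>" if "j \<in> set ss" "\<tau> < 256" for j \<tau>
        using rows[OF \<open>\<rho> < r\<close>] ss(2) that by auto
      obtain D where D: "decodes (snd ?s 1) (rows_at ?s \<rho>) (?X \<rho>) (set ss) D"
        "peelable (rows_at ?s \<rho>) (set ss) \<longrightarrow> D = set ss" using a \<open>\<rho> < r\<close> by blast
      have "decodes (nth_default 0 (list_of_vec y)) (hash_row w \<rho> (h \<rho>)) (?X \<rho>) (set ss) D"
        using decodes_cong_rows[OF D(1) ro] unfolding s(9) .
      moreover have "peelable (hash_row w \<rho> (h \<rho>)) (set ss) \<longrightarrow> D = set ss"
        using D(2) peelable_cong_rows[of "set ss" "rows_at ?s \<rho>" "hash_row w \<rho> (h \<rho>)", OF ro] by simp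
      ultimately show ?thesis by blast
    qed
    have "run output_com s1 (\<lambda>t s'. (\<forall>j. j \<notin> set ss \<longrightarrow> snd s' 2 j = 0) \<and>
      (\<forall>j\<in>set ss. \<forall>Q. monotone_pred Q \<and> 4 * card {\<rho>\<in>{0..<r}. Q (?X \<rho> j)} \<le> r \<longrightarrow> \<not> Q (snd s' 2 j)) \<and>
      t \<le> length ss * (9640 * r + 180) + 20)"
    proof (rule run_output[OF _ _ ss(1) _ ss(2) _ r])
      show "fst s1 0 1 = length ss" "\<And>i. i < length ss \<Longrightarrow> fst s1 1 i = ss ! i" "fst s1 0 0 = n" "snd s1 2 = (\<lambda>_. 0)"
        unfolding e by (fact s)+
      show "fst s1 11 0 = n * r" using a by (elim conjE)
    qed
    then show "run output_com s1 (\<lambda>u s. t + u \<le> 10240000 * (r * length ss) \<and>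
     (\<forall>j. j \<notin> set ss \<longrightarrow> snd s 2 j = 0) \<and> decoded (nth_default 0 (list_of_vec y)) (set ss) (snd s 2))"
    proof (rule run_mono)
      fix u s2 assume b: "(\<forall>j. j \<notin> set ss \<longrightarrow> snd s2 2 j = 0) \<and>
      (\<forall>j\<in>set ss. \<forall>Q. monotone_pred Q \<and> 4 * card {\<rho>\<in>{0..<r}. Q (?X \<rho> j)} \<le> r \<longrightarrow> \<not> Q (snd s2 2 j)) \<and>
      u \<le> length ss * (9640 * r + 180) + 20"
      have t: "t \<le> r * (10222000 * length ss + 70) + 10" using a by (elim conjE)
      have u: "u \<le> length ss * (9640 * r + 180) + 20" using b by (elim conjE)
      have time: "t + u \<le> 10240000 * (r * length ss)"
      proof -
        have "1 \<le> r" "1 \<le> length ss" using r ss(3) by (simp, cases ss) simp_all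
        then have rank_in: "r \<le> r * length ss" "length ss \<le> r * length ss" "1 \<le> r * length ss" by simp_all
        have "t + u \<le> (10222000 * (r * length ss) + 70 * r + 10) + (9640 * (r * length ss) + 180 * length ss + 20)"
          using t u by (simp add: algebra_simps)
        then show ?thesis using rank_in by linarith
      qed
      have "decoded (nth_default 0 (list_of_vec y)) (set ss) (snd s2 2)"
        unfolding decoded_def
      proof (rule exI[of _ ?X], rule conjI)
        show "\<forall>\<rho><r. \<exists>D. decodes (nth_default 0 (list_of_vec y)) (hash_row w \<rho> (h \<rho>)) (?X \<rho>) (set ss) D \<and>
            (peelable (hash_row w \<rho> (h \<rho>)) (set ss) \<longrightarrow> D = set ss)" using X by (intro allI impI)
        show "\<forall>j\<in>set ss. \<forall>Q. monotone_pred Q \<and> 4 * card {\<rho>\<in>{0..<r}. Q (?X \<rho> j)} \<le> r \<longrightarrow> \<not> Q (snd s2 2 j)"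
          using b by (elim conjE)
      qed
      with time conjunct1[OF b] show "t + u \<le> 10240000 * (r * length ss) \<and>
        (\<forall>j. j \<notin> set ss \<longrightarrow> snd s2 2 j = 0) \<and> decoded (nth_default 0 (list_of_vec y)) (set ss) (snd s2 2)"
        by (intro conjI)
    qed
  qed
qed

lemma measurement:
  assumes x: "x \<in> carrier_vec n" and \<nu>: "\<nu> \<in> carrier_vec (256 * r * (2 * w))" and i: "i < 256 * r * (2 * w)"
  shows "nth_default 0 (list_of_vec (hash_mat n w r h *\<^sub>v x + \<nu>)) i = measure_at n w h (\<lambda>j. x $ j) (\<lambda>i. \<nu> $ i) i"
proof -
  have "nth_default 0 (list_of_vec (hash_mat n w r h *\<^sub>v x + \<nu>)) i = (hash_mat n w r h *\<^sub>v x + \<nu>) $ i"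
    using i \<nu> by (simp add: nth_default_def list_of_vec_index)
  also have "\<dots> = (\<Sum>j<n. (if i mod (2 * w) = h (i div (2 * w) div 256) (j, i div (2 * w) mod 256) then 1 else 0) * x $ j) + \<nu> $ i"
    using i \<nu> x by (simp add: scalar_prod_def hash_mat_def atLeast0LessThan)
  also have "(\<Sum>j<n. (if i mod (2 * w) = h (i div (2 * w) div 256) (j, i div (2 * w) mod 256) then 1 else 0) * x $ j)
    = (\<Sum>j<n. if i mod (2 * w) = h (i div (2 * w) div 256) (j, i div (2 * w) mod 256) then x $ j else 0)"
    by (rule sum.cong) auto
  finally show ?thesis by (simp add: measure_at_def)
qed

end

context hashing
begin

lemma decoded_error:
  assumes p: "p = 1 \<or> p = 2" and x: "x \<in> carrier_vec n" and \<nu>: "\<nu> \<in> carrier_vec (256 * r * (2 * w))"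
    and S: "S \<subseteq> {..<n}" and r: "r > 0" and M: "M \<ge> 0"
    and M0: "\<And>\<rho>. \<rho> < r \<Longrightarrow> M = 0 \<Longrightarrow> (\<forall>j\<in>{..<n} - S. x $ j = 0) \<and> (\<forall>\<tau><256. \<forall>v<2 * w. gap w \<rho> (\<lambda>i. \<nu> $ i) \<tau> v = 0)"
    and z: "decoded (nth_default 0 (list_of_vec (hash_mat n w r h *\<^sub>v x + \<nu>))) S z"
    and nice: "8 * card {\<rho>\<in>{0..<r}. \<not> nice p (\<lambda>j. x $ j) (\<lambda>i. \<nu> $ i) {..<n} S w M \<rho> (h \<rho>)} \<le> r"
  shows "(\<Sum>j\<in>S. \<bar>z j - x $ j\<bar> ^ p) \<le> 8 * (48 * 2 ^ 60 * real (card S) * M)"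
proof -
  let ?y = "nth_default 0 (list_of_vec (hash_mat n w r h *\<^sub>v x + \<nu>))"
  let ?y' = "measure_at n w h (\<lambda>j. x $ j) (\<lambda>i. \<nu> $ i)"
  have finS: "finite S" using S finite_subset by blast
  obtain X where X: "\<forall>\<rho><r. \<exists>D. decodes ?y (hash_row w \<rho> (h \<rho>)) (X \<rho>) S D \<and> (peelable (hash_row w \<rho> (h \<rho>)) S \<longrightarrow> D = S)"
    and med: "\<forall>j\<in>S. \<forall>Q. monotone_pred Q \<and> 4 * card {\<rho>\<in>{0..<r}. Q (X \<rho> j)} \<le> r \<longrightarrow> \<not> Q (z j)"
    using z unfolding decoded_def by (elim exE conjE) (rule that)
  show ?thesis
  proof (rule median_amplification[OF r finS nice])
    show "p > 0" using p by auto
    show "\<not> Q (z j)" if "j \<in> S" "monotone_pred Q" "4 * card {\<rho>\<in>{0..<r}. Q (X \<rho> j)} \<le> r" for j Q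
      using med that by blast
    fix \<rho> assume \<rho>: "\<rho> < r" and nc: "nice p (\<lambda>j. x $ j) (\<lambda>i. \<nu> $ i) {..<n} S w M \<rho> (h \<rho>)"
    have "peelable (hash_row w \<rho> (h \<rho>)) S"
      by (rule peelable_of_excess[OF finS]) (use nc in \<open>simp add: nice_def\<close>)
    then have "decodes ?y (hash_row w \<rho> (h \<rho>)) (X \<rho>) S S" using X \<rho> by auto
    then have "decodes ?y' (hash_row w \<rho> (h \<rho>)) (X \<rho>) S S"
    proof (rule decodes_cong_y)
      fix j \<tau> assume j: "j \<in> S" "\<tau> < (256 :: nat)"
      have lt: "hash_row w \<rho> (h \<rho>) j \<tau> < 256 * r * (2 * w)" using hash_row_less[OF \<rho> _ j(2)] j S by auto
      moreover have "sib (hash_row w \<rho> (h \<rho>) j \<tau>) < 256 * r * (2 * w)"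
        using sib_lt[of "hash_row w \<rho> (h \<rho>) j \<tau>" "256 * r * w"] lt by (simp add: mult_ac)
      ultimately show "?y (hash_row w \<rho> (h \<rho>) j \<tau>) = ?y' (hash_row w \<rho> (h \<rho>) j \<tau>) \<and>
          ?y (sib (hash_row w \<rho> (h \<rho>) j \<tau>)) = ?y' (sib (hash_row w \<rho> (h \<rho>) j \<tau>))"
        by (intro conjI measurement[OF x \<nu>])
    qed
    then show "(\<Sum>j\<in>S. \<bar>X \<rho> j - x $ j\<bar> ^ p) \<le> 48 * 2 ^ 60 * real (card S) * M"
      using nice_copy_error[where h = h and \<rho> = \<rho>, OF p w S h[OF \<rho>] nc M M0[OF \<rho>]] by blast
  qed
qed

end

lemma sib_sib: "sib (sib v) = v"
proof -
  have "sib (sib v) div 2 = v div 2" "even (sib (sib v)) = even v"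
    unfolding sib_div2 by (cases "even v"; auto elim!: evenE oddE simp: sib_def)+
  then show ?thesis by (metis even_two_times_div_two odd_two_times_div_two_succ)
qed

text \<open>One factor 2 comes from the p-th power of a difference, the other from
  \<open>sib\<close> permuting the rows of a table, whereby every row is met twice.\<close>

lemma gap_energy:
  assumes p: "p = 1 \<or> p = 2" and \<rho>: "\<rho> < r" "\<tau> < 256"
  shows "(\<Sum>v<2 * w. \<bar>gap w \<rho> \<nu> \<tau> v\<bar> ^ p) \<le> 4 * (\<Sum>i<256 * r * (2 * w). \<bar>\<nu> i\<bar> ^ p)"
proof -
  let ?off = "(256 * \<rho> + \<tau>) * (2 * w)" and ?g = "\<lambda>v. \<bar>\<nu> v\<bar> ^ p"
  have two: "\<bar>a - b\<bar> ^ p \<le> 2 * (\<bar>a\<bar> ^ p + \<bar>b\<bar> ^ p)" for a b :: real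
    using p
  proof
    assume "p = 2"
    have "0 \<le> (a + b)\<^sup>2" by simp
    then have "(a - b)\<^sup>2 \<le> 2 * (a\<^sup>2 + b\<^sup>2)" by (simp add: power2_eq_square algebra_simps)
    then show ?thesis using \<open>p = 2\<close> by simp
  qed simp
  have "(\<Sum>v<2 * w. \<bar>gap w \<rho> \<nu> \<tau> v\<bar> ^ p) \<le> (\<Sum>v<2 * w. 2 * (?g (?off + v) + ?g (?off + sib v)))"
    unfolding gap_def by (rule sum_mono) (use two sib_add[of ?off] in simp)
  also have "\<dots> = 2 * ((\<Sum>v<2 * w. ?g (?off + v)) + (\<Sum>v<2 * w. ?g (?off + sib v)))"
    by (simp only: sum_distrib_left[symmetric] sum.distrib)
  also have "(\<Sum>v<2 * w. ?g (?off + sib v)) = (\<Sum>v<2 * w. ?g (?off + v))"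
    by (rule sum.reindex_bij_witness[of _ sib sib]) (auto simp: sib_sib sib_lt)
  also have "2 * ((\<Sum>v<2 * w. ?g (?off + v)) + (\<Sum>v<2 * w. ?g (?off + v))) = 4 * (\<Sum>v<2 * w. ?g (?off + v))"
    by simp
  also have "(\<Sum>v<2 * w. ?g (?off + v)) = (\<Sum>i\<in>(+) ?off ` {..<2 * w}. ?g i)"
    by (subst sum.reindex) auto
  also have "\<dots> \<le> (\<Sum>i<256 * r * (2 * w). ?g i)"
  proof (rule sum_mono2)
    show "(+) ?off ` {..<2 * w} \<subseteq> {..<256 * r * (2 * w)}"
    proof
      fix i assume "i \<in> (+) ?off ` {..<2 * w}"
      then have "i < (256 * \<rho> + \<tau> + 1) * (2 * w)" by auto
      also have "\<dots> \<le> 256 * r * (2 * w)" using \<rho> by (intro mult_le_mono1) simp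
      finally show "i \<in> {..<256 * r * (2 * w)}" by simp
    qed
  qed auto
  finally show ?thesis by simp
qed

section \<open>Amplification\<close>

text \<open>Some q of the 8 q copies fail together. The copies are independent, and the at most 2^(8
  q) = 256^q choices are absorbed by the factor 1/1024 in the failure probability of a single
  copy.\<close>

lemma prob_majority:
  assumes q: "\<And>\<rho>. \<rho> < 8 * q \<Longrightarrow> measure_pmf.prob (G \<rho>) {f. bad \<rho> f} \<le> \<delta>" and \<delta>: "0 \<le> \<delta>"
  shows "measure_pmf.prob (Pi_pmf {0..<8 * q} d G) {h. \<not> 8 * card {\<rho>\<in>{0..<8 * q}. bad \<rho> (h \<rho>)} \<le> 8 * q} \<le> (256 * \<delta>) ^ q"
proof -
  let ?H = "Pi_pmf {0..<8 * q} d G"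
  have "measure_pmf.prob ?H {h. \<not> 8 * card {\<rho>\<in>{0..<8 * q}. bad \<rho> (h \<rho>)} \<le> 8 * q}
    \<le> measure_pmf.prob ?H {h. \<exists>R\<subseteq>{0..<8 * q}. card R = q \<and> (\<forall>\<rho>\<in>R. bad \<rho> (h \<rho>))}"
  proof (rule prob_mono_supp)
    fix h assume "\<not> 8 * card {\<rho>\<in>{0..<8 * q}. bad \<rho> (h \<rho>)} \<le> 8 * q"
    then have "q \<le> card {\<rho>\<in>{0..<8 * q}. bad \<rho> (h \<rho>)}" by simp
    then obtain R where "R \<subseteq> {\<rho>\<in>{0..<8 * q}. bad \<rho> (h \<rho>)}" "card R = q"
      by (rule obtain_subset_with_card_n)
    then show "\<exists>R\<subseteq>{0..<8 * q}. card R = q \<and> (\<forall>\<rho>\<in>R. bad \<rho> (h \<rho>))" by (intro exI[of _ R]) auto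
  qed
  also have "\<dots> \<le> real (card {0..<8 * q} choose q) * \<delta> ^ q"
  proof (rule prob_Ex_subsets)
    fix R assume R: "R \<subseteq> {0..<8 * q}" "card R = q"
    have "{h. \<forall>\<rho>\<in>R. bad \<rho> (h \<rho>)} = Pi {0..<8 * q} (\<lambda>\<rho>. if \<rho> \<in> R then {f. bad \<rho> f} else UNIV)"
      using R by (fastforce simp: Pi_def)
    then have "measure_pmf.prob ?H {h. \<forall>\<rho>\<in>R. bad \<rho> (h \<rho>)} =
        (\<Prod>\<rho>\<in>{0..<8 * q}. measure_pmf.prob (G \<rho>) (if \<rho> \<in> R then {f. bad \<rho> f} else UNIV))"
      by (simp only: measure_Pi_pmf_Pi finite_atLeastLessThan)
    also have "\<dots> \<le> (\<Prod>\<rho>\<in>{0..<8 * q}. if \<rho> \<in> R then \<delta> else 1)"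
      by (rule prod_mono) (use q in auto)
    also have "\<dots> = \<delta> ^ q"
      using R by (simp add: prod.If_cases Int_absorb1)
    finally show "measure_pmf.prob ?H {h. \<forall>\<rho>\<in>R. bad \<rho> (h \<rho>)} \<le> \<delta> ^ q" .
  qed (use \<delta> in auto)
  also have "\<dots> \<le> 256 ^ q * \<delta> ^ q"
  proof (rule mult_right_mono)
    have "(8 * q) choose q \<le> 2 ^ (8 * q)" by (rule binomial_le_pow2)
    also have "\<dots> = 256 ^ q" by (simp add: power_mult)
    finally have "real ((8 * q) choose q) \<le> real (256 ^ q)" by (simp only: of_nat_le_iff)
    then show "real (card {0..<8 * q} choose q) \<le> 256 ^ q" by simp
  qed (use \<delta> in simp)
  finally show ?thesis by (simp add: power_mult_distrib)
qed

text \<open>The lower bound serves the exponent of the failure probability and the upper bound the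
  size of the matrix, while the selection requires a power of 8.\<close>

lemma pow8_between:
  fixes c :: real
  shows "\<exists>L. c \<le> 8 * 8 ^ L \<and> 8 ^ L \<le> max 1 c"
proof -
  obtain N where "c < (8::real) ^ N" using real_arch_pow[of 8 c] by auto
  then have ex: "\<exists>N. c \<le> (8::real) ^ N" by (intro exI less_imp_le)
  define L where "L = (LEAST N. c \<le> (8::real) ^ N)"
  have L: "c \<le> 8 ^ L" unfolding L_def by (rule LeastI_ex[OF ex])
  show ?thesis
  proof (cases L)
    case 0
    then show ?thesis using L by (intro exI[of _ 0]) auto
  next
    case (Suc l)
    then have "\<not> c \<le> 8 ^ l" unfolding L_def by (intro not_less_Least) simp
    then show ?thesis using L Suc by (intro exI[of _ l]) auto
  qed
qed

text \<open>Execution is deterministic, so the definite description in \<open>recovered\<close>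
  denotes the memory in which this run ends.\<close>

lemma recovered_run:
  assumes "run P (input c \<epsilon> A y ss \<omega>) (\<lambda>t s. Q (snd s 2))"
  shows "\<exists>z. Q z \<and> recovered P c \<epsilon> A y ss \<omega> = vec (dim_col A) z"
proof -
  obtain t s where e: "exec P (input c \<epsilon> A y ss \<omega>) t s" "Q (snd s 2)" using assms by (auto simp: run_def)
  have "(THE s. \<exists>t. exec P (input c \<epsilon> A y ss \<omega>) t s) = s"
    by (rule the_equality) (use e exec_deterministic in blast)+
  then show ?thesis using e by (auto simp: recovered_def)
qed

text \<open>The analysis bounds p-th powers; a^p + b^p \<le> (a + b)^p leads back to the sum of the
  two norms.\<close>

lemma error_norm:
  assumes p: "p = 1 \<or> p = 2" and nrm: "\<And>v. nrm v \<ge> 0 \<and> nrm v ^ p = (\<Sum>i<dim_vec v. \<bar>v $ i\<bar> ^ p)"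
    and x: "x \<in> carrier_vec n" and S: "S \<subseteq> {..<n}" and \<epsilon>: "\<epsilon> > 0" and z: "\<And>j. j \<notin> S \<Longrightarrow> z j = 0"
    and err: "(\<Sum>j\<in>S. \<bar>z j - x $ j\<bar> ^ p) \<le> \<epsilon> ^ p * ((\<Sum>j\<in>{..<n} - S. \<bar>x $ j\<bar> ^ p) + (\<Sum>i<dim_vec \<nu>. \<bar>\<nu> $ i\<bar> ^ p))"
  shows "supp_vec (vec n z) \<subseteq> S \<and> nrm (vec n z - restrict_vec x S) \<le> \<epsilon> * (nrm (x - restrict_vec x S) + nrm \<nu>)"
proof
  have "j \<in> S" if "z j \<noteq> 0" for j using z that by blast
  then show "supp_vec (vec n z) \<subseteq> S" by (auto simp: supp_vec_def)
  have p0: "p > 0" using p by auto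
  have "nrm (vec n z - restrict_vec x S) ^ p = (\<Sum>j<n. if j \<in> S then \<bar>z j - x $ j\<bar> ^ p else 0)"
    using x nrm[of "vec n z - restrict_vec x S"] z p0 by (auto simp: restrict_vec_def zero_power intro!: sum.cong)
  also have "\<dots> = (\<Sum>j\<in>S. \<bar>z j - x $ j\<bar> ^ p)"
    using S by (simp add: sum.inter_restrict[symmetric] Int_absorb1)
  also note err
  also have "(\<Sum>j\<in>{..<n} - S. \<bar>x $ j\<bar> ^ p) = nrm (x - restrict_vec x S) ^ p"
  proof -
    have "nrm (x - restrict_vec x S) ^ p = (\<Sum>j<n. if j \<in> {..<n} - S then \<bar>x $ j\<bar> ^ p else 0)"
      using x nrm[of "x - restrict_vec x S"] p0 by (auto simp: restrict_vec_def zero_power intro!: sum.cong)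
    also have "\<dots> = (\<Sum>j\<in>{..<n} - S. \<bar>x $ j\<bar> ^ p)"
      by (subst sum.inter_restrict[symmetric]) (auto intro: sum.cong)
    finally show ?thesis by simp
  qed
  also have "(\<Sum>i<dim_vec \<nu>. \<bar>\<nu> $ i\<bar> ^ p) = nrm \<nu> ^ p" using nrm by simp
  also have "\<epsilon> ^ p * (nrm (x - restrict_vec x S) ^ p + nrm \<nu> ^ p) \<le> (\<epsilon> * (nrm (x - restrict_vec x S) + nrm \<nu>)) ^ p"
  proof -
    have le: "a ^ p + b ^ p \<le> (a + b) ^ p" if "a \<ge> 0" "b \<ge> 0" for a b :: real
      using p that by (auto simp: power2_eq_square algebra_simps)
    show ?thesis unfolding power_mult_distrib by (rule mult_left_mono[OF le]) (use nrm \<epsilon> in auto)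
  qed
  finally show "nrm (vec n z - restrict_vec x S) \<le> \<epsilon> * (nrm (x - restrict_vec x S) + nrm \<nu>)"
    by (subst (asm) power_mono_iff) (use nrm \<epsilon> p0 in auto)
qed

definition scheme :: "nat \<Rightarrow> nat \<Rightarrow> nat \<Rightarrow> real mat pmf" where
  "scheme n w r = map_pmf (hash_mat n w r) (Pi_pmf {0..<r} (\<lambda>_. 0) (\<lambda>_. hash_pmf {..<n} w))"

lemma hashing_of_scheme:
  assumes "w > 0" "h \<in> set_pmf (Pi_pmf {0..<r} (\<lambda>_. 0) (\<lambda>_. hash_pmf {..<n} w))"
  shows "hashing n w r h"
proof
  show "w > 0" by (rule assms(1))
  fix \<rho> j \<tau> assume a: "\<rho> < r" "j < n" "\<tau> < (256 :: nat)"
  have "h \<rho> \<in> set_pmf (hash_pmf {..<n} w)" using assms(2) a(1) by (simp add: set_Pi_pmf PiE_dflt_def)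
  from set_hash[OF _ assms(1) this, of j \<tau>] show "h \<rho> (j, \<tau>) < 2 * w" using a by simp
qed

lemma scheme_cases:
  assumes "A \<in> set_pmf (scheme n w r)" "w > 0"
  obtains h where "A = hash_mat n w r h" "hashing n w r h"
  using assms(1) hashing_of_scheme[OF assms(2)] by (auto simp: scheme_def)

lemma scheme_error:
  assumes p: "p = 1 \<or> p = 2" and \<epsilon>: "\<epsilon> > 0" and wB: "2 ^ 700 * real k * max 1 (1 / \<epsilon> ^ p) \<le> real w"
    and r: "r = 64 * 8 ^ L" and k: "k > 0" and hash: "hashing n w r h"
    and nrm: "\<And>v. nrm v \<ge> 0 \<and> nrm v ^ p = (\<Sum>i<dim_vec v. \<bar>v $ i\<bar> ^ p)"
    and x: "x \<in> carrier_vec n" and \<nu>: "\<nu> \<in> carrier_vec (256 * r * (2 * w))"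
    and S: "S \<subseteq> {..<n}" "card S = k" "distinct ss" "set ss = S"
    and e: "e = (\<Sum>j\<in>{..<n} - S. \<bar>x $ j\<bar> ^ p) + (\<Sum>i<256 * r * (2 * w). \<bar>\<nu> $ i\<bar> ^ p)"
    and nice: "8 * card {\<rho>\<in>{0..<r}. \<not> nice p (\<lambda>j. x $ j) (\<lambda>i. \<nu> $ i) {..<n} S w (2 * e / w) \<rho> (h \<rho>)} \<le> r"
  shows "let x' = recovered recover_com c \<epsilon> (hash_mat n w r h) (hash_mat n w r h *\<^sub>v x + \<nu>) ss \<omega> in
    supp_vec x' \<subseteq> S \<and> nrm (x' - restrict_vec x S) \<le> \<epsilon> * (nrm (x - restrict_vec x S) + nrm \<nu>)"
proof -
  interpret hashing n w r h by (rule hash)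
  let ?A = "hash_mat n w r h"
  have p0: "p > 0" using p by auto
  have r0: "r > 0" using r by simp
  have e0: "e \<ge> 0" unfolding e by (intro add_nonneg_nonneg sum_nonneg) auto
  have ss: "distinct ss" "set ss \<subseteq> {..<n}" "ss \<noteq> []" using S k by auto
  have "run recover_com (input c \<epsilon> ?A (?A *\<^sub>v x + \<nu>) ss \<omega>)
     (\<lambda>t s. (\<forall>j. j \<notin> S \<longrightarrow> snd s 2 j = 0) \<and> decoded (nth_default 0 (list_of_vec (?A *\<^sub>v x + \<nu>))) S (snd s 2))"
    by (rule run_mono[OF run_recover[OF r ss]]) (use S in auto)
  from recovered_run[OF this] obtain z where z: "\<forall>j. j \<notin> S \<longrightarrow> z j = 0"
      "decoded (nth_default 0 (list_of_vec (?A *\<^sub>v x + \<nu>))) S z"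
      "recovered recover_com c \<epsilon> ?A (?A *\<^sub>v x + \<nu>) ss \<omega> = vec n z" by auto
  have "(\<Sum>j\<in>S. \<bar>z j - x $ j\<bar> ^ p) \<le> 8 * (48 * 2 ^ 60 * real (card S) * (2 * e / w))"
  proof (rule decoded_error[OF p x \<nu> S(1) r0 _ _ z(2) nice])
    show "0 \<le> 2 * e / real w" using e0 by simp
    fix \<rho> assume \<rho>: "\<rho> < r" and "2 * e / real w = 0"
    then have "e = 0" using hashing.w[OF hash] by simp
    then have "(\<Sum>j\<in>{..<n} - S. \<bar>x $ j\<bar> ^ p) = 0 \<and> (\<Sum>i<256 * r * (2 * w). \<bar>\<nu> $ i\<bar> ^ p) = 0"
      unfolding e by (subst (asm) add_nonneg_eq_0_iff) (auto intro: sum_nonneg)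
    then have x0: "\<forall>j\<in>{..<n} - S. x $ j = 0" and n0: "(\<Sum>i<256 * r * (2 * w). \<bar>\<nu> $ i\<bar> ^ p) = 0"
      using p0 by (auto simp: sum_nonneg_eq_0_iff)
    have "gap w \<rho> (\<lambda>i. \<nu> $ i) \<tau> v = 0" if "\<tau> < 256" "v < 2 * w" for \<tau> v
    proof -
      have "(\<Sum>v<2 * w. \<bar>gap w \<rho> (\<lambda>i. \<nu> $ i) \<tau> v\<bar> ^ p) \<le> 0"
        using gap_energy[OF p \<rho> that(1), of w "\<lambda>i. \<nu> $ i"] unfolding n0 by simp
      then have "(\<Sum>v<2 * w. \<bar>gap w \<rho> (\<lambda>i. \<nu> $ i) \<tau> v\<bar> ^ p) = 0" by (intro antisym sum_nonneg) auto
      then show ?thesis using that(2) p0 by (simp add: sum_nonneg_eq_0_iff)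
    qed
    then show "(\<forall>j\<in>{..<n} - S. x $ j = 0) \<and> (\<forall>\<tau><256. \<forall>v<2 * w. gap w \<rho> (\<lambda>i. \<nu> $ i) \<tau> v = 0)"
      using x0 by blast
  qed
  also have "\<dots> \<le> \<epsilon> ^ p * e"
  proof -
    have w0: "real w > 0" using hashing.w[OF hash] by simp
    have "1 \<le> max 1 (1 / \<epsilon> ^ p) * \<epsilon> ^ p"
    proof -
      have "1 / \<epsilon> ^ p * \<epsilon> ^ p \<le> max 1 (1 / \<epsilon> ^ p) * \<epsilon> ^ p" by (intro mult_right_mono) (use \<epsilon> in auto)
      then show ?thesis using \<epsilon> by simp
    qed
    then have "2 ^ 700 * real k * 1 \<le> 2 ^ 700 * real k * (max 1 (1 / \<epsilon> ^ p) * \<epsilon> ^ p)" by (intro mult_left_mono) auto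
    also have "\<dots> = 2 ^ 700 * real k * max 1 (1 / \<epsilon> ^ p) * \<epsilon> ^ p" by simp
    also have "\<dots> \<le> real w * \<epsilon> ^ p" by (rule mult_right_mono[OF wB]) (use \<epsilon> in auto)
    finally have "2 ^ 700 * real k \<le> real w * \<epsilon> ^ p" by simp
    \<comment> \<open>768 = 8 * 48 * 2: the amplification, the error of one copy, and the noise
      level 2 e / w. There is ample room, since the collision bounds dictate w.\<close>
    moreover have "768 * 2 ^ 60 * real k \<le> 2 ^ 700 * real k" by simp
    ultimately have "768 * 2 ^ 60 * real k \<le> real w * \<epsilon> ^ p" by linarith
    then have "768 * 2 ^ 60 * real k * e \<le> real w * \<epsilon> ^ p * e" by (rule mult_right_mono[OF _ e0])
    then have "768 * 2 ^ 60 * real k * e / real w \<le> \<epsilon> ^ p * e" using w0 by (simp add: field_simps)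
    then show ?thesis unfolding S(2) by simp
  qed
  finally have "(\<Sum>j\<in>S. \<bar>z j - x $ j\<bar> ^ p) \<le> \<epsilon> ^ p * ((\<Sum>j\<in>{..<n} - S. \<bar>x $ j\<bar> ^ p) + (\<Sum>i<dim_vec \<nu>. \<bar>\<nu> $ i\<bar> ^ p))"
    unfolding e using \<nu> by simp
  from error_norm[OF p nrm x S(1) \<epsilon> _ this] show ?thesis unfolding z(3) Let_def using z(1) by blast
qed

lemma solves_scheme:
  assumes p: "p = 1 \<or> p = 2" and \<epsilon>: "\<epsilon> > 0" and w: "2 ^ 700 * real k * max 1 (1 / \<epsilon> ^ p) \<le> real w"
    and r: "r = 64 * 8 ^ L" "c \<le> 8 * 8 ^ L" and k: "k > 0"
    and nrm: "\<And>v. nrm v \<ge> 0 \<and> nrm v ^ p = (\<Sum>i<dim_vec v. \<bar>v $ i\<bar> ^ p)"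
  shows "solves_set_query nrm recover_com c \<epsilon> k n (256 * r * (2 * w)) (scheme n w r) 0"
  unfolding solves_set_query_def
proof (intro ballI allI impI)
  fix x \<nu> :: "real vec" and S ss
  assume x: "x \<in> carrier_vec n" and \<nu>: "\<nu> \<in> carrier_vec (256 * r * (2 * w))"
    and "S \<subseteq> {..<n} \<and> card S = k \<and> distinct ss \<and> set ss = S"
  then have S: "S \<subseteq> {..<n}" "card S = k" "distinct ss" "set ss = S" by auto
  let ?H = "Pi_pmf {0..<r} (\<lambda>_. 0) (\<lambda>_. hash_pmf {..<n} w)"
  \<comment> \<open>q \<ge> c becomes the exponent of 1 / k in the failure probability, and r = 8
    q.\<close>
  define q :: nat where "q = 8 * 8 ^ L"
  define e where "e = (\<Sum>j\<in>{..<n} - S. \<bar>x $ j\<bar> ^ p) + (\<Sum>i<256 * r * (2 * w). \<bar>\<nu> $ i\<bar> ^ p)"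
  define ex where "ex = (\<Sum>j\<in>{..<n} - S. \<bar>x $ j\<bar> ^ p)"
  define en where "en = (\<Sum>i<256 * r * (2 * w). \<bar>\<nu> $ i\<bar> ^ p)"
  have en: "e = ex + en" "0 \<le> ex" "0 \<le> en" by (auto simp: e_def ex_def en_def intro: sum_nonneg)
  have rq: "r = 8 * q" using r by (simp add: q_def)
  have w700: "2 ^ 700 * real k \<le> real w"
  proof -
    have "2 ^ 700 * real k * 1 \<le> 2 ^ 700 * real k * max 1 (1 / \<epsilon> ^ p)" by (intro mult_left_mono) auto
    then show ?thesis using w by simp
  qed
  have w0: "w > 0"
  proof (rule ccontr)
    assume "\<not> w > 0"
    then show False using w700 k by simp
  qed
  let ?bad = "\<lambda>\<rho> f. \<not> nice p (\<lambda>j. x $ j) (\<lambda>i. \<nu> $ i) {..<n} S w (2 * e / w) \<rho> f"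
  let ?good = "\<lambda>A \<omega>. let x' = recovered recover_com c \<epsilon> A (A *\<^sub>v x + \<nu>) ss \<omega> in
             supp_vec x' \<subseteq> S \<and> nrm (x' - restrict_vec x S) \<le> \<epsilon> * (nrm (x - restrict_vec x S) + nrm \<nu>)"
  have bad: "measure_pmf.prob (hash_pmf {..<n} w) {f. ?bad \<rho> f} \<le> 1 / (1024 * real k)" if "\<rho> < 8 * q" for \<rho>
  proof (rule prob_not_nice[OF p _ w0 S(1,2) k w700])
    show "(\<Sum>j\<in>{..<n} - S. \<bar>x $ j\<bar> ^ p) \<le> 2 * e" unfolding ex_def[symmetric] using en by linarith
    fix \<tau> :: nat assume "\<tau> < 256"
    \<comment> \<open>The total over the 2 w rows of a table is at most 4 e, which averages to 2 e /
      w; hence 2 e as the noise parameter.\<close>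
    then have "(\<Sum>v<2 * w. \<bar>gap w \<rho> (\<lambda>i. \<nu> $ i) \<tau> v\<bar> ^ p) \<le> 4 * e"
      using gap_energy[OF p, of \<rho> r \<tau> w "\<lambda>i. \<nu> $ i"] that rq en unfolding en_def[symmetric] by linarith
    then show "(\<Sum>v<2 * w. \<bar>gap w \<rho> (\<lambda>i. \<nu> $ i) \<tau> v\<bar> ^ p) / (2 * real w) \<le> 2 * e / real w"
      using w0 by (simp add: field_simps)
  qed simp
  have "measure_pmf.prob ?H {h. \<not> 8 * card {\<rho>\<in>{0..<r}. ?bad \<rho> (h \<rho>)} \<le> r} \<le> (256 * (1 / (1024 * real k))) ^ q"
    unfolding rq by (rule prob_majority[OF bad]) auto
  also have "\<dots> \<le> (1 / real k) ^ q" by (rule power_mono) (use k in \<open>auto simp: field_simps\<close>)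
  also have "\<dots> \<le> 1 / real k powr c"
  proof -
    have "c \<le> real q" using r(2) by (simp add: q_def)
    then have "real k powr c \<le> real k powr real q" by (rule powr_mono) (use k in auto)
    also have "\<dots> = real k ^ q" using k by (intro powr_realpow) auto
    finally show ?thesis using k by (simp add: power_one_over divide_simps)
  qed
  finally have fail: "measure_pmf.prob ?H {h. \<not> 8 * card {\<rho>\<in>{0..<r}. ?bad \<rho> (h \<rho>)} \<le> r} \<le> 1 / real k powr c" .
  have "measure_pmf.prob ?H {h. 8 * card {\<rho>\<in>{0..<r}. ?bad \<rho> (h \<rho>)} \<le> r}
     = 1 - measure_pmf.prob ?H {h. \<not> 8 * card {\<rho>\<in>{0..<r}. ?bad \<rho> (h \<rho>)} \<le> r}"
    by (subst measure_pmf.prob_compl[symmetric]) (auto intro: arg_cong[where f = "measure_pmf.prob ?H"])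
  then have "1 - 1 / real k powr c \<le> measure_pmf.prob ?H {h. 8 * card {\<rho>\<in>{0..<r}. ?bad \<rho> (h \<rho>)} \<le> r}"
    using fail by linarith
  also have "\<dots> \<le> measure_pmf.prob ?H {h. ?good (hash_mat n w r h) []}"
  proof (rule prob_mono_supp)
    fix h assume "h \<in> set_pmf ?H" and a: "8 * card {\<rho>\<in>{0..<r}. ?bad \<rho> (h \<rho>)} \<le> r"
    then have "hashing n w r h" using hashing_of_scheme[OF w0] by blast
    from scheme_error[OF p \<epsilon> w r(1) k this nrm x \<nu> S e_def a] show "?good (hash_mat n w r h) []" .
  qed
  \<comment> \<open>The algorithm is deterministic: for R = 0 the tape is certainly empty.\<close>
  also have "\<dots> = measure_pmf.prob (pair_pmf (scheme n w r) (coins 0)) {(A, \<omega>). ?good A \<omega>}"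
    by (simp add: coins_def scheme_def pair_return_pmf2 vimage_def)
  finally show "1 - 1 / real k powr c \<le> measure_pmf.prob (pair_pmf (scheme n w r) (coins 0)) {(A, \<omega>). ?good A \<omega>}" .
qed

text \<open>Every matrix in the support satisfies \<open>hashing\<close>, and the time bound of
  \<open>run_recover\<close> makes no demand on collisions, as copies that cannot be peeled give up
  early.\<close>

lemma runs_scheme:
  assumes r: "r = 64 * 8 ^ L" and w: "w > 0" and k: "k > 0"
  shows "runs_in_time (10240000 * (real r * real k)) recover_com c \<epsilon> k n m (scheme n w r) 0"
  unfolding runs_in_time_def
proof (intro ballI allI impI)
  fix A \<omega> y and ss :: "nat list"
  assume A: "A \<in> set_pmf (scheme n w r)" and "distinct ss \<and> set ss \<subseteq> {..<n} \<and> length ss = k"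
  then have ss: "distinct ss" "set ss \<subseteq> {..<n}" "length ss = k" "ss \<noteq> []" using k by auto
  obtain h where h: "A = hash_mat n w r h" "hashing n w r h" by (rule scheme_cases[OF A w])
  obtain t s where "exec recover_com (input c \<epsilon> A y ss \<omega>) t s" "t \<le> 10240000 * (r * k)"
    using hashing.run_recover[OF h(2) r ss(1,2,4), of c \<epsilon> y \<omega>] unfolding run_def h(1) ss(3) by blast
  moreover from this(2) have "real t \<le> real (10240000 * (r * k))" by (simp only: of_nat_le_iff)
  ultimately show "halts_within (10240000 * (real r * real k)) recover_com c \<epsilon> A y ss \<omega>"
    unfolding halts_within_def by (intro exI[of _ t] exI[of _ s] conjI) simp_all
qed

lemma scheme_exists:
  assumes p: "p = 1 \<or> p = 2" and nrm: "\<And>v. nrm v \<ge> 0 \<and> nrm v ^ p = (\<Sum>i<dim_vec v. \<bar>v $ i\<bar> ^ p)"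
    and "c > 0" and \<epsilon>: "\<epsilon> > 0" and k: "1 \<le> k"
  shows "\<exists>m D R. set_pmf D \<subseteq> carrier_mat m n \<and>
           real m \<le> 2 ^ 716 * (max 1 c * max 1 (1 / \<epsilon> ^ p) * real k) \<and>
           (\<forall>A\<in>set_pmf D. sparse_binary (2 ^ 716 * max 1 c) A) \<and>
           runs_in_time (2 ^ 716 * (max 1 c * real k)) recover_com c \<epsilon> k n m D R \<and>
           solves_set_query nrm recover_com c \<epsilon> k n m D R"
proof -
  obtain L where L: "c \<le> 8 * 8 ^ L" "8 ^ L \<le> max 1 c" using pow8_between by blast
  define r :: nat where "r = 64 * 8 ^ L"
  define B where "B = 2 ^ 700 * real k * max 1 (1 / \<epsilon> ^ p)"
  define w where "w = nat \<lceil>B\<rceil>"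
  define m where "m = 256 * r * (2 * w)"
  have B1: "1 \<le> B"
  proof -
    have "1 * 1 * 1 \<le> B" unfolding B_def by (intro mult_mono) (use k in auto)
    then show ?thesis by simp
  qed
  have w: "B \<le> real w" "real w \<le> 2 * B" using B1 unfolding w_def by linarith+
  have w0: "w > 0" using w(1) B1 by (cases w) auto
  have rc: "real r \<le> 64 * max 1 c" using L(2) by (simp add: r_def)
  have "set_pmf (scheme n w r) \<subseteq> carrier_mat m n" by (auto simp: scheme_def hash_mat_def m_def)
  moreover have "real m \<le> 2 ^ 716 * (max 1 c * max 1 (1 / \<epsilon> ^ p) * real k)"
  proof -
    \<comment> \<open>The exponent 716: 2^9 for 256 tables with two rows per bucket, 2^6 from r, 2
      from rounding w up, and 2^700 from the collision bounds.\<close>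
    have "real m = 512 * (real r * real w)" by (simp add: m_def)
    also have "\<dots> \<le> 512 * ((64 * max 1 c) * (2 * B))" by (intro mult_left_mono mult_mono rc w) auto
    also have "\<dots> = 2 ^ 716 * (max 1 c * max 1 (1 / \<epsilon> ^ p) * real k)" by (simp add: B_def)
    finally show ?thesis .
  qed
  moreover have "sparse_binary (2 ^ 716 * max 1 c) A" if A: "A \<in> set_pmf (scheme n w r)" for A
  proof -
    obtain h where h: "A = hash_mat n w r h" "hashing n w r h" by (rule scheme_cases[OF A w0])
    have "256 * real r \<le> 2 ^ 716 * max 1 c" using rc by simp
    then show ?thesis using hashing.sparse_hash[OF h(2)] unfolding sparse_binary_def h(1) by (auto intro: order_trans)
  qed
  moreover have "runs_in_time (2 ^ 716 * (max 1 c * real k)) recover_com c \<epsilon> k n m (scheme n w r) 0"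
  proof -
    have "10240000 * (real r * real k) \<le> 10240000 * ((64 * max 1 c) * real k)"
      by (intro mult_left_mono mult_right_mono rc) auto
    also have "\<dots> \<le> 2 ^ 716 * (max 1 c * real k)" by (simp add: mult_right_mono)
    finally have le: "10240000 * (real r * real k) \<le> 2 ^ 716 * (max 1 c * real k)" .
    have "runs_in_time (10240000 * (real r * real k)) recover_com c \<epsilon> k n m (scheme n w r) 0"
      by (rule runs_scheme[OF r_def w0]) (use k in simp)
    then show ?thesis unfolding runs_in_time_def halts_within_def by (meson le order_trans)
  qed
  moreover have "solves_set_query nrm recover_com c \<epsilon> k n m (scheme n w r) 0"
    unfolding m_def by (rule solves_scheme[OF p \<epsilon> w(1)[unfolded B_def] r_def L(1) _ nrm]) (use k in simp)
  ultimately show ?thesis by blast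
qed

theorem theorem3p1:
  shows
    "(\<exists>P :: com. \<exists>C :: real. \<forall>c :: real. \<forall>\<epsilon> :: real. \<forall>k n :: nat.
        c > 0 \<and> \<epsilon> > 0 \<and> 1 \<le> k \<and> k \<le> n \<longrightarrow>
        (\<exists>(m :: nat) (D :: real mat pmf) (R :: nat).
           set_pmf D \<subseteq> carrier_mat m n \<and>
           real m \<le> C * (max 1 c * max 1 (1 / \<epsilon>\<^sup>2) * real k) \<and>
           (\<forall>A\<in>set_pmf D. sparse_binary (C * max 1 c) A) \<and>
           runs_in_time (C * (max 1 c * real k)) P c \<epsilon> k n m D R \<and>
           solves_set_query l2_norm P c \<epsilon> k n m D R))
   \<and> (\<exists>P :: com. \<exists>C :: real. \<forall>c :: real. \<forall>\<epsilon> :: real. \<forall>k n :: nat.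
        c > 0 \<and> \<epsilon> > 0 \<and> 1 \<le> k \<and> k \<le> n \<longrightarrow>
        (\<exists>(m :: nat) (D :: real mat pmf) (R :: nat).
           set_pmf D \<subseteq> carrier_mat m n \<and>
           real m \<le> C * (max 1 c * max 1 (1 / \<epsilon>) * real k) \<and>
           (\<forall>A\<in>set_pmf D. sparse_binary (C * max 1 c) A) \<and>
           runs_in_time (C * (max 1 c * real k)) P c \<epsilon> k n m D R \<and>
           solves_set_query l1_norm P c \<epsilon> k n m D R))"
\<comment> \<open>One program and one constant serve both norms; p enters the scheme only through
  the number w of buckets.\<close>
proof (intro conjI exI[of _ recover_com] exI[of _ "2 ^ 716 :: real"] allI impI)
  fix c \<epsilon> :: real and k n :: nat
  assume a: "c > 0 \<and> \<epsilon> > 0 \<and> 1 \<le> k \<and> k \<le> n"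
  have "l2_norm v \<ge> 0 \<and> l2_norm v ^ 2 = (\<Sum>i<dim_vec v. \<bar>v $ i\<bar> ^ 2)" for v
    by (simp add: l2_norm_def L2_set_def sum_nonneg)
  from scheme_exists[of 2, OF _ this] a
  show "\<exists>m D R. set_pmf D \<subseteq> carrier_mat m n \<and>
           real m \<le> 2 ^ 716 * (max 1 c * max 1 (1 / \<epsilon>\<^sup>2) * real k) \<and>
           (\<forall>A\<in>set_pmf D. sparse_binary (2 ^ 716 * max 1 c) A) \<and>
           runs_in_time (2 ^ 716 * (max 1 c * real k)) recover_com c \<epsilon> k n m D R \<and>
           solves_set_query l2_norm recover_com c \<epsilon> k n m D R" by blast
next
  fix c \<epsilon> :: real and k n :: nat
  assume a: "c > 0 \<and> \<epsilon> > 0 \<and> 1 \<le> k \<and> k \<le> n"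
  have "l1_norm v \<ge> 0 \<and> l1_norm v ^ 1 = (\<Sum>i<dim_vec v. \<bar>v $ i\<bar> ^ 1)" for v
    by (simp add: l1_norm_def sum_nonneg)
  from scheme_exists[of 1, OF _ this, of c \<epsilon> k n] a
  show "\<exists>m D R. set_pmf D \<subseteq> carrier_mat m n \<and>
           real m \<le> 2 ^ 716 * (max 1 c * max 1 (1 / \<epsilon>) * real k) \<and>
           (\<forall>A\<in>set_pmf D. sparse_binary (2 ^ 716 * max 1 c) A) \<and>
           runs_in_time (2 ^ 716 * (max 1 c * real k)) recover_com c \<epsilon> k n m D R \<and>
           solves_set_query l1_norm recover_com c \<epsilon> k n m D R" by simp
qed

end
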